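(* Let $R$ be a root system in $\mathbb{R}^d$ with positive root system $R_+$, fundamental Weyl chamber $\mathbb{W}$, multiplicity function $k$ and $\nu=k-1/2$. Suppose that $\min_{\alpha\in R_+}\nu(\alpha)\ge 3$ and that $b:[0,T]\times\mathbb{W}\to\mathbb{R}^d$ is bounded, Lipschitz continuous in space and $1/2$-Hölder continuous in time. Let $X$ be the radial Dunkl process with drift $b$ started at $x(0)\in\mathbb{W}$, and let $X^{(n)}$ be its semi-implicit Euler--Maruyama scheme with $n$ steps on $[0,T]$. Then for any $p\in[1,\min_{\alpha\in R_+}\nu(\alpha)/3)$ there exists $C=C(p,T)>0$ such that for any $n\in\mathbb{N}$, $$\mathbb{E}\Big[\sup_{\ell=1,\ldots,n}\big|X(t_\ell)-X^{(n)}(t_\ell)\big|^p\Big]^{1/p}\le\frac{C}{\sqrt n}.$$ If $b\equiv 0$, the statement holds also for $p=\min_{\alpha\in R_+}\nu(\alpha)/3$.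
   Context: A root system $R$ in $\mathbb{R}^d$ is a finite set of nonzero vectors such that (R1) $R\cap\{c\alpha: c\in\mathbb{R}\}=\{\alpha,-\alpha\}$ for every $\alpha\in R$, and (R2) $\sigma_\alpha(R)=R$ for every $\alpha\in R$, where $\sigma_\alpha(x)=x-\frac{2\langle\alpha,x\rangle}{|\alpha|^2}\alpha$. The Weyl group $W$ is the subgroup of the orthogonal group $O(d)$ generated by $\{\sigma_\alpha:\alpha\in R\}$. A positive root system $R_+$ is a subset with $R=R_+\sqcup(-R_+)$ such that $R_+$ and $-R_+$ are separated by a hyperplane through the origin containing no root. The fundamental Weyl chamber is $\mathbb{W}=\{x\in\mathbb{R}^d:\langle\alpha,x\rangle>0\ \forall\alpha\in R_+\}$. A multiplicity function is $k:R\to\mathbb{R}$ with $k(w\alpha)=k(\alpha)$ for all $w\in W$, $\alpha\in R$; $\nu(\alpha):=k(\alpha)-1/2$. Fix $T>0$, a filtered probability space $(\Omega,\mathscr{F},(\mathscr{F}_t)_{t\in[0,T]},\mathbb{P})$ satisfying the usual conditions, and a $d$-dimensional Brownian motion $B$ on it. The radial Dunkl process with drift $X$ is the (unique strong, $\mathbb{W}$-valued, continuous) solution of $$X(t)=x(0)+B(t)+\sum_{\alpha\in R_+}\int_0^t\frac{k(\alpha)}{\langle\alpha,X(s)\rangle}\alpha\,ds+\int_0^t b(s,X(s))\,ds,\quad t\in[0,T],\ x(0)\in\mathbb{W}.$$ Lipschitz in space and $1/2$-Hölder in time means $\sup_{x\ne y\in\mathbb{W},\,t\in[0,T]}\frac{|b(t,x)-b(t,y)|}{|x-y|}+\sup_{x\in\mathbb{W},\,t\ne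 s\in[0,T]}\frac{|b(t,x)-b(s,x)|}{|t-s|^{1/2}}<\infty$. Semi-implicit Euler--Maruyama scheme: $\Delta t=T/n$, $t_\ell=\ell T/n$, $\Delta B_\ell=B(t_{\ell+1})-B(t_\ell)$, $X^{(n)}(0)=x(0)$, and for $\ell=0,\ldots,n-1$, $X^{(n)}(t_{\ell+1})$ is the unique solution in $\mathbb{W}$ of $$X^{(n)}(t_{\ell+1})=X^{(n)}(t_\ell)+\Delta B_\ell+\Big\{\sum_{\alpha\in R_+}\frac{k(\alpha)}{\langle\alpha,X^{(n)}(t_{\ell+1})\rangle}\alpha+b(t_\ell,X^{(n)}(t_\ell))\Big\}\Delta t.$$ (For every $x\in\mathbb{R}^d$ and $c:R\to(0,\infty)$, the equation $y=x+\sum_{\alpha\in R_+}\frac{c(\alpha)}{\langle\alpha,y\rangle}\alpha$ has a unique solution $y\in\mathbb{W}$.) *)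

theory Defs
  imports "HOL-Probability.Probability" "HOL-Algebra.Generated_Groups"
begin

section \<open>Root systems\<close>

definition root_reflection :: "real ^ 'd \<Rightarrow> real ^ 'd \<Rightarrow> real ^ 'd" where
  "root_reflection \<alpha> x = x - (2 * (\<alpha> \<bullet> x) / (norm \<alpha>)\<^sup>2) *\<^sub>R \<alpha>"

definition root_system :: "(real ^ 'd) set \<Rightarrow> bool" where
  "root_system R \<longleftrightarrow>
     finite R \<and> 0 \<notin> R \<and>
     (\<forall>\<alpha>\<in>R. R \<inter> {c *\<^sub>R \<alpha> | c. True} = {\<alpha>, - \<alpha>}) \<and>
     (\<forall>\<alpha>\<in>R. root_reflection \<alpha> ` R = R)"

definition orthogonal_group :: "(real ^ 'd \<Rightarrow> real ^ 'd) monoid" where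
  "orthogonal_group =
     \<lparr>carrier = {f. orthogonal_transformation f}, mult = (\<circ>), one = id\<rparr>"

definition weyl_group :: "(real ^ 'd) set \<Rightarrow> (real ^ 'd \<Rightarrow> real ^ 'd) set" where
  "weyl_group R = generate orthogonal_group (root_reflection ` R)"

text \<open>The vector \<open>\<beta>\<close> is a normal of the separating hyperplane.\<close>

definition positive_root_system :: "(real ^ 'd) set \<Rightarrow> (real ^ 'd) set \<Rightarrow> bool" where
  "positive_root_system R Rp \<longleftrightarrow>
     R = Rp \<union> uminus ` Rp \<and> Rp \<inter> uminus ` Rp = {} \<and>
     (\<exists>\<beta>. \<beta> \<noteq> 0 \<and> (\<forall>\<alpha>\<in>R. \<beta> \<bullet> \<alpha> \<noteq> 0) \<and>
          (\<forall>\<alpha>\<in>Rp. \<beta> \<bullet> \<alpha> > 0) \<and> (\<forall>\<alpha>\<in>uminus ` Rp. \<beta> \<bullet> \<alpha> < 0))"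

definition weyl_chamber :: "(real ^ 'd) set \<Rightarrow> (real ^ 'd) set" where
  "weyl_chamber Rp = {x. \<forall>\<alpha>\<in>Rp. \<alpha> \<bullet> x > 0}"

definition multiplicity_function :: "(real ^ 'd) set \<Rightarrow> (real ^ 'd \<Rightarrow> real) \<Rightarrow> bool" where
  "multiplicity_function R k \<longleftrightarrow> (\<forall>w\<in>weyl_group R. \<forall>\<alpha>\<in>R. k (w \<alpha>) = k \<alpha>)"

definition mult_index :: "(real ^ 'd \<Rightarrow> real) \<Rightarrow> real ^ 'd \<Rightarrow> real" where
  "mult_index k \<alpha> = k \<alpha> - 1 / 2"

section \<open>Filtered probability spaces and Brownian motion on \<open>[0, T]\<close>\<close>

text \<open>The filtration is indexed by \<open>[0, T]\<close> only; \<open>F t\<close> is irrelevant for other \<open>t\<close>. The last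
  condition makes every subset of a null set belong to \<open>F 0\<close>, so in particular \<open>M\<close> is complete.\<close>

definition usual_filtration :: "'a measure \<Rightarrow> (real \<Rightarrow> 'a measure) \<Rightarrow> real \<Rightarrow> bool" where
  "usual_filtration M F T \<longleftrightarrow>
     prob_space M \<and>
     (\<forall>t\<in>{0..T}. subalgebra M (F t)) \<and>
     (\<forall>s\<in>{0..T}. \<forall>t\<in>{0..T}. s \<le> t \<longrightarrow> sets (F s) \<subseteq> sets (F t)) \<and>
     (\<forall>t\<in>{0..<T}. sets (F t) = (\<Inter>s\<in>{t<..T}. sets (F s))) \<and>
     (\<forall>N\<in>null_sets M. \<forall>A\<subseteq>N. A \<in> sets (F 0))"

definition adapted_process ::
    "(real \<Rightarrow> 'a measure) \<Rightarrow> real \<Rightarrow> (real \<Rightarrow> 'a \<Rightarrow> real ^ 'd) \<Rightarrow> bool" where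
  "adapted_process F T Y \<longleftrightarrow> (\<forall>t\<in>{0..T}. Y t \<in> borel_measurable (F t))"

text \<open>A standard \<open>d\<close>-dimensional Brownian motion relative to the filtration: the increments over
  \<open>[s, t]\<close> are independent of \<open>F s\<close> and have the law \<open>N(0, (t - s) I)\<close>, given by its density with
  respect to Lebesgue measure. (The second parameter of \<^const>\<open>normal_density\<close> is the standard
  deviation.)\<close>

definition brownian_motion ::
    "'a measure \<Rightarrow> (real \<Rightarrow> 'a measure) \<Rightarrow> real \<Rightarrow> (real \<Rightarrow> 'a \<Rightarrow> real ^ 'd) \<Rightarrow> bool" where
  "brownian_motion M F T B \<longleftrightarrow>
     adapted_process F T B \<and>
     (AE \<omega> in M. B 0 \<omega> = 0 \<and> continuous_on {0..T} (\<lambda>t. B t \<omega>)) \<and>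
     (\<forall>s\<in>{0..T}. \<forall>t\<in>{0..T}. s < t \<longrightarrow>
        prob_space.indep_set M
          {(\<lambda>\<omega>. B t \<omega> - B s \<omega>) -` A \<inter> space M | A. A \<in> sets borel} (sets (F s)) \<and>
        distributed M lborel (\<lambda>\<omega>. B t \<omega> - B s \<omega>)
          (\<lambda>x. ennreal (\<Prod>i\<in>UNIV. normal_density 0 (sqrt (t - s)) (x $ i))))"

section \<open>The equation and its discretization\<close>

text \<open>Only the values of \<open>b\<close> on \<open>[0, T] \<times> W\<close> matter. The two conditions say that the suprema of
  the difference quotients, over all times and all points of the chamber, are finite.\<close>

definition lipschitz_holder_drift ::
    "(real ^ 'd) set \<Rightarrow> real \<Rightarrow> (real \<Rightarrow> real ^ 'd \<Rightarrow> real ^ 'd) \<Rightarrow> bool" where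
  "lipschitz_holder_drift W T b \<longleftrightarrow>
     (\<exists>L. \<forall>t\<in>{0..T}. L-lipschitz_on W (b t)) \<and>
     (\<exists>H. \<forall>x\<in>W. \<forall>s\<in>{0..T}. \<forall>t\<in>{0..T}.
        norm (b t x - b s x) \<le> H * \<bar>t - s\<bar> powr (1 / 2))"

definition dunkl_drift ::
    "(real ^ 'd) set \<Rightarrow> (real ^ 'd \<Rightarrow> real) \<Rightarrow> real ^ 'd \<Rightarrow> real ^ 'd" where
  "dunkl_drift Rp k x = (\<Sum>\<alpha>\<in>Rp. (k \<alpha> / (\<alpha> \<bullet> x)) *\<^sub>R \<alpha>)"

text \<open>The noise is additive, so the equation is a pathwise integral equation. Along a continuous
  path in the chamber the singular integrands are continuous on \<open>[0, T]\<close>, and so is the last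
  one when \<open>b\<close> is continuous; hence the integrals exist.\<close>

definition radial_dunkl_process ::
    "'a measure \<Rightarrow> (real \<Rightarrow> 'a measure) \<Rightarrow> real \<Rightarrow> (real \<Rightarrow> 'a \<Rightarrow> real ^ 'd) \<Rightarrow>
     (real ^ 'd) set \<Rightarrow> (real ^ 'd \<Rightarrow> real) \<Rightarrow> (real \<Rightarrow> real ^ 'd \<Rightarrow> real ^ 'd) \<Rightarrow>
     real ^ 'd \<Rightarrow> (real \<Rightarrow> 'a \<Rightarrow> real ^ 'd) \<Rightarrow> bool" where
  "radial_dunkl_process M F T B Rp k b x0 X \<longleftrightarrow>
     adapted_process F T X \<and>
     (AE \<omega> in M.
        continuous_on {0..T} (\<lambda>t. X t \<omega>) \<and>
        (\<forall>t\<in>{0..T}. X t \<omega> \<in> weyl_chamber Rp) \<and>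
        (\<forall>t\<in>{0..T}.
           X t \<omega> = x0 + B t \<omega>
             + (\<Sum>\<alpha>\<in>Rp. integral {0..t} (\<lambda>s. (k \<alpha> / (\<alpha> \<bullet> X s \<omega>)) *\<^sub>R \<alpha>))
             + integral {0..t} (\<lambda>s. b s (X s \<omega>))))"

text \<open>\<open>semi_implicit_EM Rp k b T n x0 \<beta> l\<close> is the value of the scheme at time \<open>l T / n\<close> when the
  driving path is \<open>\<beta>\<close>. The implicit equation has exactly one solution in the chamber when \<open>k\<close> is
  positive on \<open>Rp\<close>.\<close>

primrec semi_implicit_EM ::
    "(real ^ 'd) set \<Rightarrow> (real ^ 'd \<Rightarrow> real) \<Rightarrow> (real \<Rightarrow> real ^ 'd \<Rightarrow> real ^ 'd) \<Rightarrow>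
     real \<Rightarrow> nat \<Rightarrow> real ^ 'd \<Rightarrow> (real \<Rightarrow> real ^ 'd) \<Rightarrow> nat \<Rightarrow> real ^ 'd" where
  "semi_implicit_EM Rp k b T n x0 \<beta> 0 = x0"
| "semi_implicit_EM Rp k b T n x0 \<beta> (Suc l) =
     (let x = semi_implicit_EM Rp k b T n x0 \<beta> l;
          t = real l * T / real n;
          t' = real (Suc l) * T / real n
      in THE y. y \<in> weyl_chamber Rp \<and>
           y = x + (\<beta> t' - \<beta> t) + (T / real n) *\<^sub>R (dunkl_drift Rp k y + b t x))"

end

theory Submission
  imports Defs
begin

text \<open>The implicit step is a resolvent of the monotone drift and hence a contraction, so the error
  is at most the accumulated local error, a sum of integrals of
  \<open>k(\<alpha>) |\<alpha>|\<^sup>2 |X(s) - X(t)| / (\<langle>\<alpha>, X(s)\<rangle> \<langle>\<alpha>, X(t)\<rangle>)\<close> and of increments of \<open>b\<close>. Splitting the \<open>p\<close>-th moment of this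
  product into three \<open>3p\<close>-th moments leaves one essential point: \<open>\<langle>\<alpha>, X(t)\<rangle>\<close> has uniformly bounded
  inverse moments of order \<open>3p \<le> min \<nu>\<close>.

  For this let \<open>P(x) = \<Prod>\<langle>\<alpha>, x\<rangle> ^ m\<close> with an even integer \<open>m\<close> strictly between \<open>min \<nu>\<close> and \<open>2 min \<nu>\<close>.
  By Weyl invariance the cross terms in the generator cancel, and \<open>g = 1 / (\<epsilon> + P)\<close>, which is smooth
  on the whole space, satisfies \<open>L g \<le> C g\<close> on the chamber with \<open>C\<close> independent of \<open>\<epsilon>\<close>; the gap
  \<open>2 \<nu> - m\<close> absorbs the bounded drift, so that the endpoint exponent needs no separate treatment.
  Since the noise is additive, the corresponding Dynkin inequality needs no stochastic integral: over
  a partition, the increments of the drift part are handled path by path and dominated by moments of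
  the running maximum of \<open>B\<close>, while the increments of the noise are averaged using their independence
  of the past.\<close>

section \<open>Roots\<close>

text \<open>Contractivity of the implicit step has a second effect: inverse moments are needed for
  \<open>X\<close> alone and never for the scheme. In bounding them the obstacle is that an
  increment of \<open>X\<close> mixes noise, which is to be averaged, with a singular drift, which
  is handled path by path. The increment is therefore performed in two moves. The noise comes first,
  starting from X(u), so that all coefficients are known before the increment is drawn. This is why
  a test function defined and bounded on the whole space is wanted, hence an even power and a
  positive \<epsilon>. Remainders may blow up as \<epsilon> tends to 0, since the partition is
  refined first and \<epsilon> is removed last. An even integer strictly between \<nu> and 2 \<nu>
  exists because the length \<nu> of this interval exceeds 2.\<close>

lemma weyl_reflection_mult:
  assumes "multiplicity_function R k" "\<gamma> \<in> R" "\<beta> \<in> R"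
  shows "k (root_reflection \<gamma> \<beta>) = k \<beta>"
proof -
  have "root_reflection \<gamma> \<in> weyl_group R"
    using assms(2) unfolding weyl_group_def by (auto intro: generate.incl)
  thus ?thesis using assms unfolding multiplicity_function_def by blast
qed

lemma root_reflection_self: "\<alpha> \<noteq> 0 \<Longrightarrow> root_reflection \<alpha> \<alpha> = - \<alpha>"
  by (simp add: root_reflection_def power2_norm_eq_inner scaleR_2)

lemma root_reflection_uminus: "root_reflection \<alpha> (- x) = - root_reflection \<alpha> x"
  by (simp add: root_reflection_def)

lemma root_reflection_invol:
  assumes "\<alpha> \<noteq> 0" shows "root_reflection \<alpha> (root_reflection \<alpha> x) = x"
  using assms
  by (simp add: root_reflection_def power2_norm_eq_inner inner_diff_right)

lemma inner_root_reflection: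
  assumes "\<alpha> \<noteq> 0" shows "root_reflection \<alpha> x \<bullet> \<alpha> = - (x \<bullet> \<alpha>)"
  using assms
  by (simp add: root_reflection_def power2_norm_eq_inner inner_diff_left inner_commute[of x])

lemma inner_root_reflection_fixed:
  assumes "\<alpha> \<bullet> y = 0" shows "root_reflection \<alpha> x \<bullet> y = x \<bullet> y"
  using assms by (simp add: root_reflection_def inner_diff_left)

lemma root_multiple:
  assumes "root_system R" "\<alpha> \<in> R" "c *\<^sub>R \<alpha> \<in> R"
  shows "c *\<^sub>R \<alpha> = \<alpha> \<or> c *\<^sub>R \<alpha> = - \<alpha>"
proof -
  have "R \<inter> {c *\<^sub>R \<alpha> | c. True} = {\<alpha>, - \<alpha>}"
    using assms unfolding root_system_def by blast
  with assms(3) show ?thesis by blast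
qed

lemma positive_rootsD:
  assumes "root_system R" "positive_root_system R Rp"
  shows "finite Rp" "Rp \<subseteq> R" "0 \<notin> Rp" "\<And>\<alpha>. \<alpha> \<in> Rp \<Longrightarrow> - \<alpha> \<notin> Rp"
    "R = Rp \<union> uminus ` Rp"
  using assms finite_subset unfolding root_system_def positive_root_system_def by auto

text \<open>Finitely many hyperplanes form a null set, so a generic direction misses them all. It
  supplies the line along which the partial fractions below have simple, distinct poles.\<close>

lemma avoid_hyperplanes:
  fixes S :: "(real ^ 'd) set"
  assumes "finite S" "0 \<notin> S"
  obtains v where "\<And>a. a \<in> S \<Longrightarrow> a \<bullet> v \<noteq> 0"
proof -
  have "negligible (\<Union>a\<in>S. {x. a \<bullet> x = 0})"
    using assms by (intro negligible_Union) (auto intro!: negligible_hyperplane)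
  hence "(\<Union>a\<in>S. {x. a \<bullet> x = 0}) \<noteq> UNIV"
    using non_negligible_UNIV by metis
  thus ?thesis using that by blast
qed

text \<open>A reflection need not preserve \<open>Rp\<close>, so the sum is passed to the whole of
  \<open>R\<close> without \<open>\<gamma>\<close> and \<open>- \<gamma>\<close>, which it does
  preserve. There evenness makes it twice the sum in question, and reindexing by the reflection
  turns it into its own negative.\<close>

lemma sum_positive_roots_reflection:
  fixes f :: "real ^ 'd \<Rightarrow> real"
  assumes R: "root_system R" "positive_root_system R Rp" and g: "\<gamma> \<in> Rp"
    and even: "\<And>\<beta>. \<beta> \<in> R \<Longrightarrow> f (- \<beta>) = f \<beta>"
    and anti: "\<And>\<beta>. \<beta> \<in> R \<Longrightarrow> f (root_reflection \<gamma> \<beta>) = - f \<beta>"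
  shows "(\<Sum>\<beta>\<in>Rp - {\<gamma>}. f \<beta>) = 0"
proof -
  note P = positive_rootsD[OF R]
  have gR: "\<gamma> \<in> R" "\<gamma> \<noteq> 0" using g P by auto
  have fin: "finite R" using R by (simp add: root_system_def)
  let ?A = "R - {\<gamma>, - \<gamma>}"
  have split: "?A = (Rp - {\<gamma>}) \<union> uminus ` (Rp - {\<gamma>})" using P g by auto
  have disj: "(Rp - {\<gamma>}) \<inter> uminus ` (Rp - {\<gamma>}) = {}" using P by auto
  have "(\<Sum>\<beta>\<in>?A. f \<beta>) = (\<Sum>\<beta>\<in>Rp - {\<gamma>}. f \<beta>) + (\<Sum>\<beta>\<in>uminus ` (Rp - {\<gamma>}). f \<beta>)"
    unfolding split using P disj by (intro sum.union_disjoint) auto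
  also have "(\<Sum>\<beta>\<in>uminus ` (Rp - {\<gamma>}). f \<beta>) = (\<Sum>\<beta>\<in>Rp - {\<gamma>}. f (- \<beta>))"
    by (subst sum.reindex) auto
  also have "\<dots> = (\<Sum>\<beta>\<in>Rp - {\<gamma>}. f \<beta>)" using even P by (intro sum.cong) auto
  finally have 1: "(\<Sum>\<beta>\<in>?A. f \<beta>) = 2 * (\<Sum>\<beta>\<in>Rp - {\<gamma>}. f \<beta>)" by simp
  have im: "root_reflection \<gamma> \<beta> \<in> ?A" if "\<beta> \<in> ?A" for \<beta>
  proof -
    have "root_reflection \<gamma> \<beta> \<in> R" using R gR that unfolding root_system_def by blast
    moreover have "root_reflection \<gamma> \<beta> \<noteq> \<gamma>" "root_reflection \<gamma> \<beta> \<noteq> - \<gamma>"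
      using that root_reflection_invol[OF gR(2), of \<beta>] root_reflection_self[OF gR(2)]
        root_reflection_uminus[of \<gamma> \<gamma>] by auto
    ultimately show ?thesis by blast
  qed
  have "(\<Sum>\<beta>\<in>?A. f \<beta>) = (\<Sum>\<beta>\<in>?A. f (root_reflection \<gamma> \<beta>))"
    by (rule sum.reindex_bij_witness[where i="root_reflection \<gamma>" and j="root_reflection \<gamma>"])
      (use im root_reflection_invol[OF gR(2)] in auto)
  also have "\<dots> = (\<Sum>\<beta>\<in>?A. - f \<beta>)" using anti by (intro sum.cong) auto
  finally have "(\<Sum>\<beta>\<in>?A. f \<beta>) = 0" by (simp add: sum_negf)
  with 1 show ?thesis by simp
qed

text \<open>This is the partial fraction decomposition of
  \<open>t / ((a + s * c) * (b + s * d))\<close> in the variable \<open>s\<close>, evaluated at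
  \<open>s = 0\<close>; the condition on \<open>a * d - b * c\<close> says that the two poles
  differ.\<close>

lemma two_pole_partial_fraction:
  fixes a b c d :: real
  assumes "a \<noteq> 0" "b \<noteq> 0" "a * d - b * c \<noteq> 0"
  shows "t / (a * b) = t * (d / ((a * d - b * c) * b)) - t * (c / ((a * d - b * c) * a))"
proof -
  have "1 / (a * b) = (a * d - b * c) / ((a * d - b * c) * (a * b))" using assms by simp
  also have "\<dots> = d / ((a * d - b * c) * b) - c / ((a * d - b * c) * a)"
    using assms(1,2) by (simp add: diff_divide_distrib)
  finally show ?thesis by (metis mult.right_neutral right_diff_distrib times_divide_eq_right)
qed

text \<open>On a generic line \<open>x + s v\<close> the sum is a rational function of \<open>s\<close> with simple poles. In the
  partial fraction expansion the residue at the hyperplane of \<open>\<gamma>\<close> vanishes, because the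
  reflection in \<open>\<gamma>\<close> fixes the pole and changes the sign of the summand.\<close>

lemma root_cross_terms:
  fixes R Rp :: "(real ^ 'd) set"
  assumes R: "root_system R" "positive_root_system R Rp"
    and k: "multiplicity_function R k" and x: "x \<in> weyl_chamber Rp"
  shows "(\<Sum>\<gamma>\<in>Rp. \<Sum>\<beta>\<in>Rp - {\<gamma>}. k \<gamma> * (\<beta> \<bullet> \<gamma>) / ((\<beta> \<bullet> x) * (\<gamma> \<bullet> x))) = 0"
proof -
  note P = positive_rootsD[OF R]
  have pos: "\<alpha> \<bullet> x > 0" if "\<alpha> \<in> Rp" for \<alpha> using x that by (auto simp: weyl_chamber_def)
  \<comment> \<open>The roots in this set keep each linear form nonconstant along \<open>v\<close>,
    so that it has a pole; the other vectors keep the poles of two different roots apart.\<close>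
  let ?S = "Rp \<union> {(\<beta> \<bullet> x) *\<^sub>R \<gamma> - (\<gamma> \<bullet> x) *\<^sub>R \<beta> | \<beta> \<gamma>. \<beta> \<in> Rp \<and> \<gamma> \<in> Rp \<and> \<beta> \<noteq> \<gamma>}"
  have "finite ?S"
  proof -
    have "?S \<subseteq> Rp \<union> (\<lambda>(\<beta>, \<gamma>). (\<beta> \<bullet> x) *\<^sub>R \<gamma> - (\<gamma> \<bullet> x) *\<^sub>R \<beta>) ` (Rp \<times> Rp)" by auto
    moreover have "finite (Rp \<union> (\<lambda>(\<beta>, \<gamma>). (\<beta> \<bullet> x) *\<^sub>R \<gamma> - (\<gamma> \<bullet> x) *\<^sub>R \<beta>) ` (Rp \<times> Rp))"
      using P(1) by blast
    ultimately show ?thesis by (rule finite_subset)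
  qed
  moreover have "0 \<notin> ?S"
  proof
    assume "0 \<in> ?S"
    then obtain \<beta> \<gamma> where bg: "\<beta> \<in> Rp" "\<gamma> \<in> Rp" "\<beta> \<noteq> \<gamma>"
      and "0 = (\<beta> \<bullet> x) *\<^sub>R \<gamma> - (\<gamma> \<bullet> x) *\<^sub>R \<beta>" using P(3) by blast
    hence bg4: "(\<beta> \<bullet> x) *\<^sub>R \<gamma> = (\<gamma> \<bullet> x) *\<^sub>R \<beta>" by simp
    have "\<gamma> = ((\<gamma> \<bullet> x) / (\<beta> \<bullet> x)) *\<^sub>R \<beta>"
    proof -
      have "\<gamma> = (1 / (\<beta> \<bullet> x)) *\<^sub>R ((\<beta> \<bullet> x) *\<^sub>R \<gamma>)" using pos[OF bg(1)] by simp
      thus ?thesis unfolding bg4 by simp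
    qed
    moreover have "\<gamma> \<in> R" "\<beta> \<in> R" using bg P(2) by auto
    ultimately have "\<gamma> = \<beta> \<or> \<gamma> = - \<beta>" using root_multiple[OF R(1)] by metis
    thus False using bg P(4) by auto
  qed
  ultimately obtain v where v: "\<And>a. a \<in> ?S \<Longrightarrow> a \<bullet> v \<noteq> 0" by (rule avoid_hyperplanes) blast
  have v1: "\<gamma> \<bullet> v \<noteq> 0" if "\<gamma> \<in> Rp" for \<gamma> using v that by auto
  define N where "N \<beta> \<gamma> = (\<beta> \<bullet> x) * (\<gamma> \<bullet> v) - (\<gamma> \<bullet> x) * (\<beta> \<bullet> v)" for \<beta> \<gamma>
  have N: "N \<beta> \<gamma> \<noteq> 0" if "\<beta> \<in> Rp" "\<gamma> \<in> Rp" "\<beta> \<noteq> \<gamma>" for \<beta> \<gamma>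
  proof -
    have "((\<beta> \<bullet> x) *\<^sub>R \<gamma> - (\<gamma> \<bullet> x) *\<^sub>R \<beta>) \<bullet> v \<noteq> 0" using that by (intro v) blast
    thus ?thesis by (simp add: N_def inner_diff_left)
  qed
  \<comment> \<open>\<open>y \<gamma>\<close> is the point where the line through \<open>x\<close>
    with direction \<open>v\<close> meets the wall of \<open>\<gamma>\<close>. Evaluating
    \<open>\<beta>\<close> there gives the determinant \<open>N \<beta> \<gamma>\<close> up to the
    factor \<open>\<gamma> \<bullet> v\<close>, so residues become values at a fixed point of the
    reflection in \<open>\<gamma>\<close>.\<close>
  define y where "y \<gamma> = x - ((\<gamma> \<bullet> x) / (\<gamma> \<bullet> v)) *\<^sub>R v" for \<gamma>
  have y0: "\<gamma> \<bullet> y \<gamma> = 0" if "\<gamma> \<in> Rp" for \<gamma>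
    using v1[OF that] by (simp add: y_def inner_diff_right)
  have yN: "\<beta> \<bullet> y \<gamma> = N \<beta> \<gamma> / (\<gamma> \<bullet> v)" if "\<gamma> \<in> Rp" for \<beta> \<gamma>
    using v1[OF that] by (simp add: y_def N_def inner_diff_right field_simps)
  have term_eq: "k \<gamma> * (\<beta> \<bullet> \<gamma>) / ((\<beta> \<bullet> x) * (\<gamma> \<bullet> x)) =
      k \<gamma> / (\<gamma> \<bullet> x) * ((\<beta> \<bullet> \<gamma>) / (\<beta> \<bullet> y \<gamma>)) + k \<gamma> * (\<beta> \<bullet> \<gamma>) / (\<gamma> \<bullet> y \<beta>) / (\<beta> \<bullet> x)"
    if "\<beta> \<in> Rp" "\<gamma> \<in> Rp" "\<beta> \<noteq> \<gamma>" for \<beta> \<gamma>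
  proof -
    have n: "N \<gamma> \<beta> = - N \<beta> \<gamma>" by (simp add: N_def)
    have "k \<gamma> * (\<beta> \<bullet> \<gamma>) / ((\<beta> \<bullet> x) * (\<gamma> \<bullet> x)) =
        k \<gamma> * (\<beta> \<bullet> \<gamma>) * ((\<gamma> \<bullet> v) / (N \<beta> \<gamma> * (\<gamma> \<bullet> x)))
        - k \<gamma> * (\<beta> \<bullet> \<gamma>) * ((\<beta> \<bullet> v) / (N \<beta> \<gamma> * (\<beta> \<bullet> x)))"
      unfolding N_def using N[OF that] pos[OF that(1)] pos[OF that(2)]
      by (intro two_pole_partial_fraction) (auto simp: N_def)
    also have "\<dots> = k \<gamma> / (\<gamma> \<bullet> x) * ((\<beta> \<bullet> \<gamma>) / (\<beta> \<bullet> y \<gamma>)) + k \<gamma> * (\<beta> \<bullet> \<gamma>) / (\<gamma> \<bullet> y \<beta>) / (\<beta> \<bullet> x)"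
      unfolding yN[OF that(1)] yN[OF that(2)] n by (simp add: mult_ac)
    finally show ?thesis .
  qed
  have z1: "(\<Sum>\<beta>\<in>Rp - {\<gamma>}. (\<beta> \<bullet> \<gamma>) / (\<beta> \<bullet> y \<gamma>)) = 0" if "\<gamma> \<in> Rp" for \<gamma>
  proof (rule sum_positive_roots_reflection[OF R that])
    have "\<gamma> \<noteq> 0" using that P by auto
    thus "root_reflection \<gamma> \<beta> \<bullet> \<gamma> / (root_reflection \<gamma> \<beta> \<bullet> y \<gamma>) = - (\<beta> \<bullet> \<gamma> / (\<beta> \<bullet> y \<gamma>))" for \<beta>
      by (simp add: inner_root_reflection inner_root_reflection_fixed[OF y0[OF that]])
  qed simp
  \<comment> \<open>In this family of residues the multiplicity varies with the summation index, and
    its Weyl invariance enters; in \<open>z1\<close> it is a constant factor outside the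
    sum.\<close>
  have z2: "(\<Sum>\<gamma>\<in>Rp - {\<beta>}. k \<gamma> * (\<beta> \<bullet> \<gamma>) / (\<gamma> \<bullet> y \<beta>)) = 0" if "\<beta> \<in> Rp" for \<beta>
  proof (rule sum_positive_roots_reflection[OF R that])
    have b: "\<beta> \<noteq> 0" "\<beta> \<in> R" using that P by auto
    show "k (root_reflection \<beta> \<gamma>) * (\<beta> \<bullet> root_reflection \<beta> \<gamma>) / (root_reflection \<beta> \<gamma> \<bullet> y \<beta>)
        = - (k \<gamma> * (\<beta> \<bullet> \<gamma>) / (\<gamma> \<bullet> y \<beta>))" if "\<gamma> \<in> R" for \<gamma>
      unfolding inner_root_reflection_fixed[OF y0[OF \<open>\<beta> \<in> Rp\<close>]]
        weyl_reflection_mult[OF k b(2) that]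
      using inner_root_reflection[OF b(1), of \<gamma>] by (simp add: inner_commute)
    show "k (- \<gamma>) * (\<beta> \<bullet> - \<gamma>) / (- \<gamma> \<bullet> y \<beta>) = k \<gamma> * (\<beta> \<bullet> \<gamma>) / (\<gamma> \<bullet> y \<beta>)" if "\<gamma> \<in> R" for \<gamma>
    proof -
      have "\<gamma> \<noteq> 0" using that R(1) by (auto simp: root_system_def)
      hence "k (- \<gamma>) = k \<gamma>"
        using weyl_reflection_mult[OF k that that] root_reflection_self by metis
      thus ?thesis by simp
    qed
  qed
  have "(\<Sum>\<gamma>\<in>Rp. \<Sum>\<beta>\<in>Rp - {\<gamma>}. k \<gamma> * (\<beta> \<bullet> \<gamma>) / ((\<beta> \<bullet> x) * (\<gamma> \<bullet> x))) =
      (\<Sum>\<gamma>\<in>Rp. \<Sum>\<beta>\<in>Rp - {\<gamma>}. k \<gamma> / (\<gamma> \<bullet> x) * ((\<beta> \<bullet> \<gamma>) / (\<beta> \<bullet> y \<gamma>))) +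
      (\<Sum>\<gamma>\<in>Rp. \<Sum>\<beta>\<in>Rp - {\<gamma>}. k \<gamma> * (\<beta> \<bullet> \<gamma>) / (\<gamma> \<bullet> y \<beta>) / (\<beta> \<bullet> x))"
    unfolding sum.distrib[symmetric] using term_eq by (intro sum.cong refl) auto
  also have "(\<Sum>\<gamma>\<in>Rp. \<Sum>\<beta>\<in>Rp - {\<gamma>}. k \<gamma> / (\<gamma> \<bullet> x) * ((\<beta> \<bullet> \<gamma>) / (\<beta> \<bullet> y \<gamma>))) = 0"
    unfolding sum_distrib_left[symmetric] using z1 by simp
  also have "(\<Sum>\<gamma>\<in>Rp. \<Sum>\<beta>\<in>Rp - {\<gamma>}. k \<gamma> * (\<beta> \<bullet> \<gamma>) / (\<gamma> \<bullet> y \<beta>) / (\<beta> \<bullet> x)) =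
      (\<Sum>\<beta>\<in>Rp. \<Sum>\<gamma>\<in>Rp - {\<beta>}. k \<gamma> * (\<beta> \<bullet> \<gamma>) / (\<gamma> \<bullet> y \<beta>) / (\<beta> \<bullet> x))"
  proof -
    have "(\<Sum>\<gamma>\<in>Rp. \<Sum>\<beta>\<in>Rp - {\<gamma>}. h \<gamma> \<beta>) = (\<Sum>\<beta>\<in>Rp. \<Sum>\<gamma>\<in>Rp - {\<beta>}. h \<gamma> \<beta>)" for h :: "_ \<Rightarrow> _ \<Rightarrow> real"
    proof -
      have "(\<Sum>\<gamma>\<in>Rp. \<Sum>\<beta>\<in>Rp - {\<gamma>}. h \<gamma> \<beta>) = (\<Sum>\<gamma>\<in>Rp. \<Sum>\<beta>\<in>Rp. h \<gamma> \<beta>) - (\<Sum>\<gamma>\<in>Rp. h \<gamma> \<gamma>)"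
        by (simp add: sum_diff1 P(1) sum_subtractf)
      also have "(\<Sum>\<gamma>\<in>Rp. \<Sum>\<beta>\<in>Rp. h \<gamma> \<beta>) = (\<Sum>\<beta>\<in>Rp. \<Sum>\<gamma>\<in>Rp. h \<gamma> \<beta>)" by (rule sum.swap)
      finally show ?thesis by (simp add: sum_diff1 P(1) sum_subtractf)
    qed
    thus ?thesis .
  qed
  also have "\<dots> = 0" unfolding sum_divide_distrib[symmetric] using z2 by simp
  finally show ?thesis by simp
qed

text \<open>The drift is the gradient of the concave function with terms
  \<open>k \<alpha> * ln (\<alpha> \<bullet> x)\<close>; termwise the inequality is the fact that
  \<open>1 / t\<close> decreases on the positive half-line.\<close>

lemma dunkl_drift_mono:
  assumes "\<And>\<alpha>. \<alpha> \<in> Rp \<Longrightarrow> k \<alpha> \<ge> 0" "x \<in> weyl_chamber Rp" "y \<in> weyl_chamber Rp"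
  shows "(x - y) \<bullet> (dunkl_drift Rp k x - dunkl_drift Rp k y) \<le> 0"
proof -
  have "(x - y) \<bullet> (dunkl_drift Rp k x - dunkl_drift Rp k y) =
      (\<Sum>\<alpha>\<in>Rp. k \<alpha> * (1 / (\<alpha> \<bullet> x) - 1 / (\<alpha> \<bullet> y)) * (\<alpha> \<bullet> x - \<alpha> \<bullet> y))"
    unfolding dunkl_drift_def sum_subtractf[symmetric] inner_sum_right
    by (intro sum.cong refl)
      (simp add: inner_diff_left inner_diff_right inner_commute algebra_simps diff_divide_distrib)
  also have "\<dots> \<le> 0"
  proof (intro sum_nonpos)
    fix \<alpha> assume a: "\<alpha> \<in> Rp"
    hence p: "\<alpha> \<bullet> x > 0" "\<alpha> \<bullet> y > 0" using assms by (auto simp: weyl_chamber_def)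
    have "(1 / (\<alpha> \<bullet> x) - 1 / (\<alpha> \<bullet> y)) * (\<alpha> \<bullet> x - \<alpha> \<bullet> y) = - ((\<alpha> \<bullet> x - \<alpha> \<bullet> y)\<^sup>2 / ((\<alpha> \<bullet> x) * (\<alpha> \<bullet> y)))"
      using p by (simp add: field_simps power2_eq_square)
    also have "\<dots> \<le> 0" using p by simp
    finally show "k \<alpha> * (1 / (\<alpha> \<bullet> x) - 1 / (\<alpha> \<bullet> y)) * (\<alpha> \<bullet> x - \<alpha> \<bullet> y) \<le> 0"
      using assms(1)[OF a] by (simp add: mult.assoc mult_nonneg_nonpos)
  qed
  finally show ?thesis .
qed

section \<open>The implicit step\<close>

lemma open_weyl_chamber: "finite Rp \<Longrightarrow> open (weyl_chamber Rp)"
proof -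
  assume "finite Rp"
  moreover have "weyl_chamber Rp = (\<Inter>\<alpha>\<in>Rp. {x. \<alpha> \<bullet> x > 0})" by (auto simp: weyl_chamber_def)
  ultimately show ?thesis by (auto intro!: open_INT open_halfspace_gt)
qed

text \<open>Pairing the identity with \<open>x - y\<close> discards the drift term by monotonicity,
  whatever the size of \<open>h\<close>, so no Lipschitz constant of the singular drift enters. The
  vector \<open>w\<close> may contain a consistency error, which is how the lemma serves the error
  recursion.\<close>

lemma dunkl_implicit_step_le:
  assumes "\<And>\<alpha>. \<alpha> \<in> Rp \<Longrightarrow> k \<alpha> \<ge> 0" "x \<in> weyl_chamber Rp" "y \<in> weyl_chamber Rp" "h \<ge> 0"
    and eq: "x - y = w + h *\<^sub>R (dunkl_drift Rp k x - dunkl_drift Rp k y)"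
  shows "norm (x - y) \<le> norm w"
proof -
  have "(norm (x - y))\<^sup>2 = (x - y) \<bullet> (x - y)" by (simp add: power2_norm_eq_inner)
  also have "\<dots> = (x - y) \<bullet> w + h * ((x - y) \<bullet> (dunkl_drift Rp k x - dunkl_drift Rp k y))"
    by (subst (2) eq) (simp add: inner_add_right)
  also have "\<dots> \<le> (x - y) \<bullet> w"
    using dunkl_drift_mono[of Rp k x y] assms by (simp add: mult_nonneg_nonpos)
  also have "\<dots> \<le> norm (x - y) * norm w" by (rule norm_cauchy_schwarz)
  finally have "norm (x - y) * norm (x - y) \<le> norm (x - y) * norm w" by (simp add: power2_eq_square)
  thus ?thesis by (cases "norm (x - y) = 0") (auto simp: mult_le_cancel_left)
qed

text \<open>The implicit equation is the critical point equation of the functional \<open>F\<close>,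
  a quadratic term plus a logarithmic barrier. A minimiser over the chamber exists because the
  sublevel set of the value \<open>F y0\<close> is contained in a compact subset \<open>K\<close> of
  the open chamber.\<close>

lemma dunkl_implicit_step_exists:
  fixes Rp :: "(real ^ 'd) set"
  assumes fin: "finite Rp" and k: "\<forall>\<alpha>\<in>Rp. k \<alpha> > 0" and y0: "y0 \<in> weyl_chamber Rp"
    and h: "h > 0"
  shows "\<exists>y \<in> weyl_chamber Rp. y = u + h *\<^sub>R dunkl_drift Rp k y"
proof -
  let ?W = "weyl_chamber Rp"
  define F where "F y = (norm (y - u))\<^sup>2 / 2 - h * (\<Sum>\<alpha>\<in>Rp. k \<alpha> * ln (\<alpha> \<bullet> y))" for y
  define c where "c = h * (\<Sum>\<alpha>\<in>Rp. k \<alpha> * norm \<alpha>)"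
  have c0: "c \<ge> 0" unfolding c_def using h k by (intro mult_nonneg_nonneg sum_nonneg) (auto simp: less_imp_le)
  have ln_le: "ln (\<alpha> \<bullet> y) \<le> norm \<alpha> * norm y" if "\<alpha> \<in> Rp" "y \<in> ?W" for \<alpha> y
  proof -
    have "\<alpha> \<bullet> y > 0" using that by (auto simp: weyl_chamber_def)
    hence "ln (\<alpha> \<bullet> y) \<le> \<alpha> \<bullet> y - 1" by (rule ln_le_minus_one)
    also have "\<dots> \<le> norm \<alpha> * norm y" using norm_cauchy_schwarz[of \<alpha> y] by simp
    finally show ?thesis .
  qed
  have sum_ln_le: "h * (\<Sum>\<alpha>\<in>A. k \<alpha> * ln (\<alpha> \<bullet> y)) \<le> c * norm y" if "y \<in> ?W" "A \<subseteq> Rp" for y A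
  proof -
    have "(\<Sum>\<alpha>\<in>A. k \<alpha> * ln (\<alpha> \<bullet> y)) \<le> (\<Sum>\<alpha>\<in>A. k \<alpha> * (norm \<alpha> * norm y))"
      using ln_le that k by (intro sum_mono mult_left_mono) (auto simp: less_imp_le subset_iff)
    also have "\<dots> \<le> (\<Sum>\<alpha>\<in>Rp. k \<alpha> * (norm \<alpha> * norm y))"
      using fin that k by (intro sum_mono2) (auto simp: less_imp_le)
    finally have "h * (\<Sum>\<alpha>\<in>A. k \<alpha> * ln (\<alpha> \<bullet> y)) \<le> h * (\<Sum>\<alpha>\<in>Rp. k \<alpha> * (norm \<alpha> * norm y))"
      using h by simp
    thus ?thesis by (simp add: c_def sum_distrib_right mult.assoc)
  qed
  \<comment> \<open>Beyond this radius \<open>t / 2 - c\<close> is at least 1, so the quadratic term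
    beats the linear bound on the logarithms and \<open>F\<close> exceeds
    \<open>F y0\<close>.\<close>
  define \<rho> where "\<rho> = 2 * c + 2 + \<bar>F y0\<bar> + c * norm u"
  have bnd: "norm (y - u) \<le> \<rho>" if "y \<in> ?W" "F y \<le> F y0" for y
  proof (rule ccontr)
    assume "\<not> norm (y - u) \<le> \<rho>"
    hence t: "norm (y - u) > \<rho>" by simp
    define t where "t = norm (y - u)"
    have tp: "t > 2 * c + 2" "t > \<bar>F y0\<bar> + c * norm u"
      using t c0 mult_nonneg_nonneg[OF c0 norm_ge_zero[of u]] unfolding t_def \<rho>_def by linarith+
    have ny: "norm y \<le> t + norm u" unfolding t_def by (metis add.commute norm_triangle_sub)
    have "t\<^sup>2 / 2 - c * norm y \<le> F y" using sum_ln_le[of y Rp] that by (simp add: F_def t_def)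
    moreover have "c * norm y \<le> c * (t + norm u)" using ny c0 by (intro mult_left_mono)
    ultimately have "t\<^sup>2 / 2 - c * t \<le> F y0 + c * norm u" using that by (simp add: algebra_simps)
    moreover have "t * 1 \<le> t * (t / 2 - c)" using tp c0 by (intro mult_left_mono) auto
    ultimately show False using tp by (simp add: algebra_simps power2_eq_square)
  qed
  \<comment> \<open>In the sublevel set all weighted logarithmic terms but one are together at most
    \<open>c * (\<rho> + norm u)\<close>; hence the remaining one is at least \<open>M\<close>,
    which keeps \<open>\<alpha> \<bullet> y\<close> away from zero.\<close>
  define M where "M = - F y0 - c * (\<rho> + norm u)"
  have low: "\<alpha> \<bullet> y \<ge> exp (M / (h * k \<alpha>))" if "y \<in> ?W" "F y \<le> F y0" "\<alpha> \<in> Rp" for y \<alpha>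
  proof -
    have p: "\<alpha> \<bullet> y > 0" using that by (auto simp: weyl_chamber_def)
    have "h * (\<Sum>\<alpha>\<in>Rp - {\<alpha>}. k \<alpha> * ln (\<alpha> \<bullet> y)) \<le> c * norm y" using that by (intro sum_ln_le) auto
    also have "\<dots> \<le> c * (\<rho> + norm u)"
    proof (intro mult_left_mono c0)
      have "norm y \<le> norm (y - u) + norm u" by (metis add.commute norm_triangle_sub)
      thus "norm y \<le> \<rho> + norm u" using bnd[OF that(1,2)] by simp
    qed
    finally have 1: "h * (\<Sum>\<alpha>\<in>Rp - {\<alpha>}. k \<alpha> * ln (\<alpha> \<bullet> y)) \<le> c * (\<rho> + norm u)" .
    have "(\<Sum>\<alpha>\<in>Rp. k \<alpha> * ln (\<alpha> \<bullet> y)) = k \<alpha> * ln (\<alpha> \<bullet> y) + (\<Sum>\<alpha>\<in>Rp - {\<alpha>}. k \<alpha> * ln (\<alpha> \<bullet> y))"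
      using fin that by (simp add: sum.remove)
    hence "F y = (norm (y - u))\<^sup>2 / 2 - h * (k \<alpha> * ln (\<alpha> \<bullet> y)) - h * (\<Sum>\<alpha>\<in>Rp - {\<alpha>}. k \<alpha> * ln (\<alpha> \<bullet> y))"
      unfolding F_def by (simp add: algebra_simps)
    hence "h * (k \<alpha> * ln (\<alpha> \<bullet> y)) \<ge> M"
      using 1 that(2) zero_le_power2[of "norm (y - u)"] unfolding M_def by linarith
    hence "M / (h * k \<alpha>) \<le> ln (\<alpha> \<bullet> y)"
      using h k that(3) by (simp add: pos_divide_le_eq mult_ac)
    thus ?thesis using p by (metis exp_le_cancel_iff exp_ln)
  qed
  define K where "K = cball u \<rho> \<inter> (\<Inter>\<alpha>\<in>Rp. {y. \<alpha> \<bullet> y \<ge> exp (M / (h * k \<alpha>))})"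
  have "compact K" unfolding K_def
    by (intro compact_Int_closed compact_cball closed_INT ballI closed_halfspace_ge)
  have KW: "K \<subseteq> ?W"
  proof
    fix y assume "y \<in> K"
    hence "\<alpha> \<bullet> y \<ge> exp (M / (h * k \<alpha>))" if "\<alpha> \<in> Rp" for \<alpha> using that by (auto simp: K_def)
    thus "y \<in> ?W" unfolding weyl_chamber_def using exp_gt_zero less_le_trans by blast
  qed
  have subK: "y \<in> K" if "y \<in> ?W" "F y \<le> F y0" for y
    using bnd[OF that] low[OF that] by (auto simp: K_def dist_norm norm_minus_commute)
  have "\<alpha> \<bullet> x \<noteq> 0" if "x \<in> K" "\<alpha> \<in> Rp" for x \<alpha>
  proof -
    have "\<alpha> \<bullet> x > 0" using KW that by (auto simp: weyl_chamber_def)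
    thus ?thesis by simp
  qed
  hence contF: "continuous_on K F"
    unfolding F_def by (intro continuous_intros) auto
  obtain y where y: "y \<in> K" "\<And>z. z \<in> K \<Longrightarrow> F y \<le> F z"
    using continuous_attains_inf[OF \<open>compact K\<close> _ contF] subK[OF y0] by blast
  have yW: "y \<in> ?W" using y KW by blast
  \<comment> \<open>Outside the sublevel set \<open>F\<close> is larger than \<open>F y0\<close>, so
    the minimum over \<open>K\<close> is a minimum over the whole open chamber, and the derivative
    vanishes there.\<close>
  have min: "F y \<le> F z" if "z \<in> ?W" for z
    using y(2)[of z] y(2)[OF subK[OF y0 order_refl]] subK[OF that] by linarith
  have pos: "\<alpha> \<bullet> y > 0" if "\<alpha> \<in> Rp" for \<alpha> using yW that by (auto simp: weyl_chamber_def)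
  have "(F has_derivative (\<lambda>d. (y - u) \<bullet> d - h * (\<Sum>\<alpha>\<in>Rp. k \<alpha> * ((\<alpha> \<bullet> d) / (\<alpha> \<bullet> y))))) (at y)"
  proof -
    have d1: "((\<lambda>z. k \<alpha> * ln (\<alpha> \<bullet> z)) has_derivative (\<lambda>d. k \<alpha> * ((\<alpha> \<bullet> d) / (\<alpha> \<bullet> y)))) (at y)"
      if "\<alpha> \<in> Rp" for \<alpha>
    proof -
      have "((\<lambda>z. \<alpha> \<bullet> z) has_derivative (\<lambda>d. \<alpha> \<bullet> d)) (at y)"
        by (intro bounded_linear.has_derivative[OF bounded_linear_inner_right] has_derivative_ident)
      from has_derivative_ln[where g="\<lambda>z. \<alpha> \<bullet> z", OF pos[OF that] this] show ?thesis
        unfolding divide_inverse by (intro has_derivative_mult_right)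
    qed
    have d2: "((\<lambda>z. (norm (z - u))\<^sup>2 / 2) has_derivative (\<lambda>d. (y - u) \<bullet> d)) (at y)"
      unfolding power2_norm_eq_inner
      by (rule has_derivative_eq_rhs, (rule derivative_intros)+, simp)
        (simp add: inner_commute fun_eq_iff)
    show ?thesis unfolding F_def
      by (rule has_derivative_diff[OF d2 has_derivative_mult_right[OF has_derivative_sum[OF d1]]])
  qed
  hence "(\<lambda>d. (y - u) \<bullet> d - h * (\<Sum>\<alpha>\<in>Rp. k \<alpha> * ((\<alpha> \<bullet> d) / (\<alpha> \<bullet> y)))) = (\<lambda>d. 0)"
    by (rule differential_zero_maxmin[OF yW open_weyl_chamber[OF fin]]) (use min in blast)
  moreover have "(y - u) \<bullet> d - h * (\<Sum>\<alpha>\<in>Rp. k \<alpha> * ((\<alpha> \<bullet> d) / (\<alpha> \<bullet> y))) =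
      (y - u - h *\<^sub>R dunkl_drift Rp k y) \<bullet> d" for d
    by (simp add: dunkl_drift_def inner_diff_left inner_sum_left)
  ultimately have "(y - u - h *\<^sub>R dunkl_drift Rp k y) \<bullet> (y - u - h *\<^sub>R dunkl_drift Rp k y) = 0"
    by metis
  hence "y - u - h *\<^sub>R dunkl_drift Rp k y = 0" unfolding inner_eq_zero_iff .
  hence "y = u + h *\<^sub>R dunkl_drift Rp k y" unfolding diff_diff_eq right_minus_eq .
  with yW show ?thesis by blast
qed

section \<open>The resolvent of the drift and the scheme as its iteration\<close>

lemma dunkl_implicit_step_lipschitz:
  assumes k: "\<forall>\<alpha>\<in>Rp. k \<alpha> > 0" and h: "h > 0"
    and x: "x \<in> weyl_chamber Rp" "x = u + h *\<^sub>R dunkl_drift Rp k x"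
    and y: "y \<in> weyl_chamber Rp" "y = v + h *\<^sub>R dunkl_drift Rp k y"
  shows "norm (x - y) \<le> norm (u - v)"
proof (rule dunkl_implicit_step_le)
  have "x - y = (u + h *\<^sub>R dunkl_drift Rp k x) - (v + h *\<^sub>R dunkl_drift Rp k y)"
    by (rule arg_cong2[where f="(-)", OF x(2) y(2)])
  also have "\<dots> = u - v + h *\<^sub>R (dunkl_drift Rp k x - dunkl_drift Rp k y)"
    by (simp add: scaleR_diff_right)
  finally show "x - y = u - v + h *\<^sub>R (dunkl_drift Rp k x - dunkl_drift Rp k y)" .
qed (use k h x(1) y(1) in \<open>auto simp: less_imp_le\<close>)

text \<open>This is the inverse of the map \<open>y - h *\<^sub>R dunkl_drift Rp k y\<close>. As a
  function of the explicit part \<open>u\<close> of a step it makes sense on the whole space, also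
  when the noise carries \<open>u\<close> out of the chamber.\<close>

definition dunkl_resolvent ::
    "(real ^ 'd) set \<Rightarrow> (real ^ 'd \<Rightarrow> real) \<Rightarrow> real \<Rightarrow> real ^ 'd \<Rightarrow> real ^ 'd" where
  "dunkl_resolvent Rp k h u = (THE y. y \<in> weyl_chamber Rp \<and> y = u + h *\<^sub>R dunkl_drift Rp k y)"

lemma dunkl_resolvent:
  fixes Rp :: "(real ^ 'd) set"
  assumes fin: "finite Rp" and k: "\<forall>\<alpha>\<in>Rp. k \<alpha> > 0" and y0: "y0 \<in> weyl_chamber Rp"
    and h: "h > 0"
  shows "dunkl_resolvent Rp k h u \<in> weyl_chamber Rp"
    "dunkl_resolvent Rp k h u = u + h *\<^sub>R dunkl_drift Rp k (dunkl_resolvent Rp k h u)"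
proof -
  have "\<exists>!y. y \<in> weyl_chamber Rp \<and> y = u + h *\<^sub>R dunkl_drift Rp k y"
  proof (rule ex_ex1I)
    show "\<exists>y. y \<in> weyl_chamber Rp \<and> y = u + h *\<^sub>R dunkl_drift Rp k y"
      using dunkl_implicit_step_exists[OF assms] by blast
    fix y z assume yz: "y \<in> weyl_chamber Rp \<and> y = u + h *\<^sub>R dunkl_drift Rp k y"
      "z \<in> weyl_chamber Rp \<and> z = u + h *\<^sub>R dunkl_drift Rp k z"
    have "norm (y - z) \<le> norm (u - u)"
      by (rule dunkl_implicit_step_lipschitz[OF k h conjunct1[OF yz(1)] conjunct2[OF yz(1)]
            conjunct1[OF yz(2)] conjunct2[OF yz(2)]])
    thus "y = z" by simp
  qed
  from theI'[OF this] show "dunkl_resolvent Rp k h u \<in> weyl_chamber Rp"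
    "dunkl_resolvent Rp k h u = u + h *\<^sub>R dunkl_drift Rp k (dunkl_resolvent Rp k h u)"
    unfolding dunkl_resolvent_def by auto
qed

lemma dunkl_resolvent_lipschitz:
  fixes Rp :: "(real ^ 'd) set"
  assumes fin: "finite Rp" and k: "\<forall>\<alpha>\<in>Rp. k \<alpha> > 0" and y0: "y0 \<in> weyl_chamber Rp"
    and h: "h > 0"
  shows "norm (dunkl_resolvent Rp k h u - dunkl_resolvent Rp k h v) \<le> norm (u - v)"
  by (rule dunkl_implicit_step_lipschitz[OF k h]) (rule dunkl_resolvent[OF assms])+

text \<open>Being 1-Lipschitz, the resolvent is continuous; no measurable selection is needed for
  the solution of the implicit equation.\<close>

lemma dunkl_resolvent_measurable:
  fixes Rp :: "(real ^ 'd) set"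
  assumes "finite Rp" "\<forall>\<alpha>\<in>Rp. k \<alpha> > 0" "y0 \<in> weyl_chamber Rp" "h > 0"
  shows "dunkl_resolvent Rp k h \<in> borel_measurable borel"
proof (rule borel_measurable_continuous_onI)
  have "1-lipschitz_on UNIV (dunkl_resolvent Rp k h)"
    using dunkl_resolvent_lipschitz[OF assms] by (intro lipschitz_onI) (auto simp: dist_norm)
  thus "continuous_on UNIV (dunkl_resolvent Rp k h)" by (rule lipschitz_on_continuous_on)
qed

text \<open>Moving the explicit drift \<open>b\<close> into the argument leaves only the singular
  drift implicit, so that one step is the resolvent applied to an explicit expression.\<close>

lemma semi_implicit_EM_Suc:
  fixes Rp :: "(real ^ 'd) set"
  shows "semi_implicit_EM Rp k b T n x0 \<beta> (Suc l) = dunkl_resolvent Rp k (T / real n)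
     (semi_implicit_EM Rp k b T n x0 \<beta> l + (\<beta> (real (Suc l) * T / real n) - \<beta> (real l * T / real n))
      + (T / real n) *\<^sub>R b (real l * T / real n) (semi_implicit_EM Rp k b T n x0 \<beta> l))"
proof -
  have eq: "x + d + h *\<^sub>R (D + c) = x + d + h *\<^sub>R c + h *\<^sub>R D" for x d c D :: "real ^ 'd" and h
    by (simp add: algebra_simps)
  show ?thesis unfolding dunkl_resolvent_def semi_implicit_EM.simps Let_def eq ..
qed

declare semi_implicit_EM.simps(2) [simp del]

lemma semi_implicit_EM_in_chamber:
  assumes "finite Rp" "\<forall>\<alpha>\<in>Rp. k \<alpha> > 0" "x0 \<in> weyl_chamber Rp" "T > 0" "n \<ge> 1"
  shows "semi_implicit_EM Rp k b T n x0 \<beta> l \<in> weyl_chamber Rp"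
proof (cases l)
  case (Suc m)
  have "T / real n > 0" using assms by simp
  thus ?thesis unfolding Suc semi_implicit_EM_Suc using dunkl_resolvent(1)[OF assms(1-3)] by blast
qed (use assms in simp)

lemma semi_implicit_EM_measurable:
  fixes Rp :: "(real ^ 'd) set"
  assumes "finite Rp" "\<forall>\<alpha>\<in>Rp. k \<alpha> > 0" "x0 \<in> weyl_chamber Rp" "T > 0" "n \<ge> 1"
    and B: "\<And>t. t \<in> {0..T} \<Longrightarrow> B t \<in> borel_measurable M"
    and b: "\<And>t. t \<in> {0..T} \<Longrightarrow> continuous_on (weyl_chamber Rp) (b t)"
    and l: "l \<le> n"
  shows "(\<lambda>\<omega>. semi_implicit_EM Rp k b T n x0 (\<lambda>t. B t \<omega>) l) \<in> borel_measurable M"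
  using l
proof (induction l)
  case (Suc l)
  let ?Y = "\<lambda>l \<omega>. semi_implicit_EM Rp k b T n x0 (\<lambda>t. B t \<omega>) l"
  have h: "T / real n > 0" using assms by simp
  have t: "real l * T / real n \<in> {0..T}" "real (Suc l) * T / real n \<in> {0..T}"
    using Suc.prems assms(4,5) by (auto simp: divide_le_eq mult_mono simp del: of_nat_Suc)
  have IH [measurable]: "?Y l \<in> borel_measurable M" using Suc by simp
  note [measurable] = B[OF t(1)] B[OF t(2)] dunkl_resolvent_measurable[OF assms(1-3) h]
  \<comment> \<open>\<open>b\<close> is controlled only on the chamber. Its extension by zero is
    Borel on the whole space and agrees with it along the scheme, which never leaves the
    chamber.\<close>
  let ?b = "\<lambda>x. indicator (weyl_chamber Rp) x *\<^sub>R b (real l * T / real n) x"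
  have "?b \<in> borel_measurable borel"
    using open_weyl_chamber[OF assms(1)]
    by (intro borel_measurable_continuous_on_indicator b[OF t(1)]) auto
  hence "(\<lambda>\<omega>. ?b (?Y l \<omega>)) \<in> borel_measurable M" by measurable
  moreover have "?b (?Y l \<omega>) = b (real l * T / real n) (?Y l \<omega>)" for \<omega>
    using semi_implicit_EM_in_chamber[OF assms(1-5)] by simp
  ultimately have [measurable]: "(\<lambda>\<omega>. b (real l * T / real n) (?Y l \<omega>)) \<in> borel_measurable M" by simp
  show ?case unfolding semi_implicit_EM_Suc by measurable
qed simp

text \<open>Each factor \<open>1 + L * h\<close> is at most \<open>exp (L * h)\<close>, so
  \<open>n\<close> steps with \<open>n * h = T\<close> cost only \<open>exp (L * T)\<close>,
  independently of the step size.\<close>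

lemma discrete_gronwall:
  fixes e r :: "nat \<Rightarrow> real"
  assumes "e 0 = 0" "L \<ge> 0" "h \<ge> 0" "\<And>l. r l \<ge> 0"
    and step: "\<And>l. l < n \<Longrightarrow> e (Suc l) \<le> (1 + L * h) * e l + r l"
    and "l \<le> n"
  shows "e l \<le> exp (L * h * real n) * (\<Sum>j<n. r j)"
proof -
  have "l \<le> n \<Longrightarrow> e l \<le> exp (L * h * real l) * (\<Sum>j<l. r j)" for l
  proof (induction l)
    case (Suc l)
    have "e (Suc l) \<le> (1 + L * h) * e l + r l" using Suc step by simp
    also have "\<dots> \<le> (1 + L * h) * (exp (L * h * real l) * (\<Sum>j<l. r j)) + 1 * r l"
      using Suc assms by (intro add_mono mult_left_mono) auto
    also have "\<dots> \<le> exp (L * h) * (exp (L * h * real l) * (\<Sum>j<l. r j)) + exp (L * h * real (Suc l)) * r l"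
      using assms exp_ge_add_one_self[of "L * h"]
      by (intro add_mono mult_right_mono mult_nonneg_nonneg sum_nonneg) auto
    also have "\<dots> = exp (L * h * real (Suc l)) * (\<Sum>j<Suc l. r j)"
      by (simp add: algebra_simps exp_add)
    finally show ?case .
  qed (use assms in simp)
  from this[OF \<open>l \<le> n\<close>] have "e l \<le> exp (L * h * real l) * (\<Sum>j<l. r j)" .
  also have "\<dots> \<le> exp (L * h * real n) * (\<Sum>j<n. r j)"
    using assms by (intro mult_mono sum_mono2 sum_nonneg) (auto intro!: mult_left_mono)
  finally show ?thesis .
qed

section \<open>Gaussian increments\<close>

text \<open>Lebesgue measure on \<open>real ^ 'd\<close> is an image of the product measure over
  \<open>Basis\<close>, where the product formula is available; the work is to reindex basis vectors
  by coordinates, which \<open>?ix\<close> does.\<close>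

lemma lborel_prod_vec:
  fixes g :: "'d::finite \<Rightarrow> real \<Rightarrow> real"
  assumes int: "\<And>i. integrable lborel (g i)"
  shows "integrable lborel (\<lambda>x::real^'d. \<Prod>i\<in>UNIV. g i (x $ i))"
    and "(\<integral>x. (\<Prod>i\<in>UNIV. g i ((x::real^'d) $ i)) \<partial>lborel) = (\<Prod>i\<in>UNIV. \<integral>x. g i x \<partial>lborel)"
proof -
  let ?ix = "inv_into UNIV (\<lambda>i. axis i (1::real) :: real^'d)"
  have inj: "inj (\<lambda>i. axis i (1::real) :: real^'d)" by (auto simp: inj_on_def axis_eq_axis)
  have Basis: "(Basis :: (real^'d) set) = range (\<lambda>i. axis i 1)" by (auto simp: Basis_vec_def)
  have re: "(\<Prod>b\<in>(Basis :: (real^'d) set). h (?ix b)) = (\<Prod>i\<in>UNIV. h i)" for h :: "'d \<Rightarrow> real"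
    unfolding Basis by (subst prod.reindex[OF inj]) (simp add: inv_f_f[OF inj] del: inv_f_f)
  have comp: "(\<Sum>b\<in>(Basis :: (real^'d) set). f b *\<^sub>R b) $ i = f (axis i 1)" for f :: "real^'d \<Rightarrow> real" and i
    unfolding Basis
    by (subst sum.reindex[OF inj]) (simp add: axis_def if_distrib sum.delta cong: if_cong)
  interpret product_sigma_finite "\<lambda>b::real^'d. lborel :: real measure" by standard
  have eq: "(\<Prod>i\<in>UNIV. g i ((\<Sum>b\<in>(Basis :: (real^'d) set). f b *\<^sub>R b) $ i)) =
      (\<Prod>b\<in>(Basis :: (real^'d) set). g (?ix b) (f b))" for f :: "real^'d \<Rightarrow> real"
  proof -
    have "(\<Prod>i\<in>UNIV. g i ((\<Sum>b\<in>(Basis :: (real^'d) set). f b *\<^sub>R b) $ i)) =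
        (\<Prod>b\<in>(Basis :: (real^'d) set). g (?ix b) (f (axis (?ix b) 1)))"
      unfolding comp by (rule re[symmetric])
    also have "\<dots> = (\<Prod>b\<in>(Basis :: (real^'d) set). g (?ix b) (f b))"
      unfolding Basis by (rule prod.cong) (auto simp: inv_f_f[OF inj])
    finally show ?thesis .
  qed
  have [measurable]: "g i \<in> borel_measurable borel" for i using int[of i] by auto
  have [measurable]: "(\<lambda>x::real^'d. x $ i) \<in> borel_measurable borel" for i
    by (intro borel_measurable_continuous_onI continuous_intros)
  have m: "(\<lambda>f. \<Sum>b\<in>(Basis :: (real^'d) set). f b *\<^sub>R b) \<in> (\<Pi>\<^sub>M b\<in>Basis. lborel) \<rightarrow>\<^sub>M borel"
    by measurable
  let ?P = "\<Pi>\<^sub>M b\<in>(Basis :: (real^'d) set). (lborel :: real measure)"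
  let ?G = "\<lambda>x::real^'d. \<Prod>i\<in>UNIV. g i (x $ i)"
  have G: "?G \<in> borel_measurable borel" by measurable
  have "integrable ?P (\<lambda>f. \<Prod>b\<in>(Basis :: (real^'d) set). g (?ix b) (f b))"
    by (rule product_integrable_prod) (auto intro: int)
  hence 1: "integrable ?P (\<lambda>f. ?G (\<Sum>b\<in>(Basis :: (real^'d) set). f b *\<^sub>R b))" unfolding eq .
  show "integrable lborel ?G"
    by (subst lborel_eq, rule iffD2[OF integrable_distr_eq[OF m G] 1])
  have "integral\<^sup>L lborel ?G = integral\<^sup>L ?P (\<lambda>f. ?G (\<Sum>b\<in>(Basis :: (real^'d) set). f b *\<^sub>R b))"
    by (subst lborel_eq, rule integral_distr[OF m G])
  also have "\<dots> = (\<Prod>b\<in>(Basis :: (real^'d) set). \<integral>x. g (?ix b) x \<partial>lborel)"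
    unfolding eq by (rule product_integral_prod) (auto intro: int)
  also have "\<dots> = (\<Prod>i\<in>UNIV. \<integral>x. g i x \<partial>lborel)" by (rule re)
  finally show "integral\<^sup>L lborel ?G = (\<Prod>i\<in>UNIV. \<integral>x. g i x \<partial>lborel)" .
qed

definition gaussian_vector :: "'a measure \<Rightarrow> real \<Rightarrow> ('a \<Rightarrow> real ^ 'd) \<Rightarrow> bool" where
  "gaussian_vector M \<sigma> Y \<longleftrightarrow> \<sigma> > 0 \<and>
     distributed M lborel Y (\<lambda>x. ennreal (\<Prod>i\<in>UNIV. normal_density 0 \<sigma> (x $ i)))"

context prob_space
begin

lemma gaussian_vector_prod:
  fixes Y :: "'a \<Rightarrow> real ^ 'd"
  assumes Y: "gaussian_vector M \<sigma> Y"
    and f: "\<And>i. f i \<in> borel_measurable borel"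
    and int: "\<And>i. integrable lborel (\<lambda>x. normal_density 0 \<sigma> x * f i x)"
  shows "integrable M (\<lambda>\<omega>. \<Prod>i\<in>UNIV. f i (Y \<omega> $ i))"
    and "expectation (\<lambda>\<omega>. \<Prod>i\<in>UNIV. f i (Y \<omega> $ i)) = (\<Prod>i\<in>UNIV. \<integral>x. normal_density 0 \<sigma> x * f i x \<partial>lborel)"
proof -
  have d: "distributed M lborel Y (\<lambda>x. ennreal (\<Prod>i\<in>UNIV. normal_density 0 \<sigma> (x $ i)))"
    using Y by (simp add: gaussian_vector_def)
  note [measurable] = f
  have [measurable]: "(\<lambda>x::real^'d. x $ i) \<in> borel_measurable borel" for i
    by (intro borel_measurable_continuous_onI continuous_intros)
  have m: "(\<lambda>x::real^'d. \<Prod>i\<in>UNIV. f i (x $ i)) \<in> borel_measurable lborel" by measurable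
  have nn: "\<And>x::real^'d. 0 \<le> (\<Prod>i\<in>UNIV. normal_density 0 \<sigma> (x $ i))" by (intro prod_nonneg) auto
  note L = lborel_prod_vec[of "\<lambda>i x. normal_density 0 \<sigma> x * f i x", OF int, unfolded prod.distrib]
  show "integrable M (\<lambda>\<omega>. \<Prod>i\<in>UNIV. f i (Y \<omega> $ i))"
    using distributed_integrable[OF d m nn] L(1) by simp
  show "expectation (\<lambda>\<omega>. \<Prod>i\<in>UNIV. f i (Y \<omega> $ i)) = (\<Prod>i\<in>UNIV. \<integral>x. normal_density 0 \<sigma> x * f i x \<partial>lborel)"
    using distributed_integral[OF d m nn] L(2) by simp
qed

lemma gaussian_vector_component:
  fixes Y :: "'a \<Rightarrow> real ^ 'd"
  assumes Y: "gaussian_vector M \<sigma> Y"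
  shows "integrable M (\<lambda>\<omega>. Y \<omega> $ i)" "expectation (\<lambda>\<omega>. Y \<omega> $ i) = 0"
    and "integrable M (\<lambda>\<omega>. Y \<omega> $ i * Y \<omega> $ j)"
    and "expectation (\<lambda>\<omega>. Y \<omega> $ i * Y \<omega> $ j) = (if i = j then \<sigma>\<^sup>2 else 0)"
    and "integrable M (\<lambda>\<omega>. (Y \<omega> $ i) ^ (2 * N))"
    and "expectation (\<lambda>\<omega>. (Y \<omega> $ i) ^ (2 * N)) = fact (2 * N) / (2 ^ N * fact N) * \<sigma> ^ (2 * N)"
proof -
  have s: "\<sigma> > 0" using Y by (simp add: gaussian_vector_def)
  have dens: "integrable lborel (\<lambda>x. normal_density 0 \<sigma> x * x ^ n)" for n
    using integrable_normal_moment[OF s, of 0 n] by simp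
  have m0: "(\<integral>x. normal_density 0 \<sigma> x * x ^ 0 \<partial>lborel) = 1"
    using integral_normal_density[OF s, of 0] by simp
  have m1: "(\<integral>x. normal_density 0 \<sigma> x * x ^ 1 \<partial>lborel) = 0"
    using integral_normal_moment_odd[OF s, of 0 0] by simp
  have me: "(\<integral>x. normal_density 0 \<sigma> x * x ^ (2 * n) \<partial>lborel) = fact (2 * n) / (2 ^ n * fact n) * \<sigma> ^ (2 * n)" for n
    using integral_normal_moment_even[OF s, of 0 n] by (simp add: power_divide power_mult)
  \<comment> \<open>All moments come from one family: monomials with an exponent vector
    \<open>e\<close>, whose expectation factors over the coordinates. Afterwards \<open>e\<close> is
    supported on one or two coordinates.\<close>
  note G = gaussian_vector_prod[OF Y, of "\<lambda>k x. x ^ e k" for e, OF _ dens, simplified]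
  have P1: "(\<Prod>k\<in>UNIV. a k ^ (if k = i then n else 0)) = a i ^ n" for a :: "'d \<Rightarrow> real" and n i
    by (subst prod.remove[of _ i]) auto
  have Q1: "(\<Prod>k\<in>(UNIV :: 'd set). \<integral>x. normal_density 0 \<sigma> x * x ^ (if k = i then n else 0) \<partial>lborel) =
     (\<integral>x. normal_density 0 \<sigma> x * x ^ n \<partial>lborel)" for n i
    using m0 by (subst prod.remove[of _ i]) auto
  have 1: "integrable M (\<lambda>\<omega>. Y \<omega> $ i ^ n)"
    "expectation (\<lambda>\<omega>. Y \<omega> $ i ^ n) = (\<integral>x. normal_density 0 \<sigma> x * x ^ n \<partial>lborel)" for n i
    using G[of "\<lambda>k. if k = i then n else 0"] unfolding P1 Q1 by auto
  show "integrable M (\<lambda>\<omega>. Y \<omega> $ i)" "expectation (\<lambda>\<omega>. Y \<omega> $ i) = 0"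
    using 1[of i 1] m1 by auto
  show "integrable M (\<lambda>\<omega>. (Y \<omega> $ i) ^ (2 * N))"
    "expectation (\<lambda>\<omega>. (Y \<omega> $ i) ^ (2 * N)) = fact (2 * N) / (2 ^ N * fact N) * \<sigma> ^ (2 * N)"
    using 1[of i "2 * N"] me[of N] by auto
  have "integrable M (\<lambda>\<omega>. Y \<omega> $ i * Y \<omega> $ j) \<and>
    expectation (\<lambda>\<omega>. Y \<omega> $ i * Y \<omega> $ j) = (if i = j then \<sigma>\<^sup>2 else 0)"
  proof (cases "i = j")
    case True
    thus ?thesis using 1[of j 2] me[of 1] by (auto simp: power2_eq_square)
  next
    case False
    have P: "(\<Prod>k\<in>UNIV. a k ^ (if k = i \<or> k = j then 1 else 0)) = a i * a j" for a :: "'d \<Rightarrow> real"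
    proof -
      have "(\<Prod>k\<in>UNIV. a k ^ (if k = i \<or> k = j then 1 else 0)) = (\<Prod>k\<in>{i, j}. a k ^ (if k = i \<or> k = j then 1 else 0))"
        by (rule prod.mono_neutral_right) auto
      thus ?thesis using False by simp
    qed
    have Q: "(\<Prod>k\<in>(UNIV :: 'd set). \<integral>x. normal_density 0 \<sigma> x * x ^ (if k = i \<or> k = j then 1 else 0) \<partial>lborel) = 0"
      using m1 by (intro prod_zero) (auto intro!: bexI[of _ i])
    show ?thesis
      using G[of "\<lambda>k. if k = i \<or> k = j then 1 else 0"] False unfolding P Q by auto
  qed
  thus "integrable M (\<lambda>\<omega>. Y \<omega> $ i * Y \<omega> $ j)"
    "expectation (\<lambda>\<omega>. Y \<omega> $ i * Y \<omega> $ j) = (if i = j then \<sigma>\<^sup>2 else 0)" by auto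
qed

lemma gaussian_vector_inner:
  fixes Y :: "'a \<Rightarrow> real ^ 'd"
  assumes Y: "gaussian_vector M \<sigma> Y"
  shows "integrable M (\<lambda>\<omega>. u \<bullet> Y \<omega>)" "expectation (\<lambda>\<omega>. u \<bullet> Y \<omega>) = 0"
    and "integrable M (\<lambda>\<omega>. (u \<bullet> Y \<omega>) * (v \<bullet> Y \<omega>))"
    and "expectation (\<lambda>\<omega>. (u \<bullet> Y \<omega>) * (v \<bullet> Y \<omega>)) = \<sigma>\<^sup>2 * (u \<bullet> v)"
proof -
  note c = gaussian_vector_component[OF Y]
  have i: "x \<bullet> y = (\<Sum>i\<in>UNIV. x $ i * y $ i)" for x y :: "real^'d" by (simp add: inner_vec_def)
  show "integrable M (\<lambda>\<omega>. u \<bullet> Y \<omega>)" "expectation (\<lambda>\<omega>. u \<bullet> Y \<omega>) = 0"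
    unfolding i using c by simp_all
  have e: "(u \<bullet> Y \<omega>) * (v \<bullet> Y \<omega>) = (\<Sum>i\<in>UNIV. \<Sum>j\<in>UNIV. (u $ i * v $ j) * (Y \<omega> $ i * Y \<omega> $ j))" for \<omega>
    unfolding i sum_product by (intro sum.cong refl) (simp add: mult_ac)
  show "integrable M (\<lambda>\<omega>. (u \<bullet> Y \<omega>) * (v \<bullet> Y \<omega>))" unfolding e using c by simp
  have "expectation (\<lambda>\<omega>. (u \<bullet> Y \<omega>) * (v \<bullet> Y \<omega>)) =
      (\<Sum>i\<in>UNIV. \<Sum>j\<in>UNIV. (u $ i * v $ j) * (if i = j then \<sigma>\<^sup>2 else 0))"
    unfolding e using c by simp
  thus "expectation (\<lambda>\<omega>. (u \<bullet> Y \<omega>) * (v \<bullet> Y \<omega>)) = \<sigma>\<^sup>2 * (u \<bullet> v)"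
    by (simp add: i if_distrib sum_distrib_left mult_ac cong: if_cong)
qed

text \<open>The squared norm is at most the dimension times the largest squared coordinate; its
  \<open>N\<close>-th power is then bounded by the sum over all coordinates. What matters later is
  the scaling \<open>\<sigma> ^ (2 * N)\<close>.\<close>

lemma gaussian_vector_norm_moment:
  fixes Y :: "'a \<Rightarrow> real ^ 'd"
  assumes Y: "gaussian_vector M \<sigma> Y"
  shows "integrable M (\<lambda>\<omega>. norm (Y \<omega>) ^ (2 * N))"
    and "expectation (\<lambda>\<omega>. norm (Y \<omega>) ^ (2 * N)) \<le>
      real CARD('d) ^ N * real CARD('d) * (fact (2 * N) / (2 ^ N * fact N)) * \<sigma> ^ (2 * N)"
proof -
  note c = gaussian_vector_component[OF Y]
  let ?S = "\<lambda>\<omega>. real CARD('d) ^ N * (\<Sum>i\<in>UNIV. (Y \<omega> $ i) ^ (2 * N))"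
  have bound: "norm (Y \<omega>) ^ (2 * N) \<le> ?S \<omega>" for \<omega>
  proof -
    let ?m = "Max (range (\<lambda>i. (Y \<omega> $ i)\<^sup>2))"
    have le: "(Y \<omega> $ i)\<^sup>2 \<le> ?m" for i by (intro Max_ge) auto
    have "?m \<in> range (\<lambda>i. (Y \<omega> $ i)\<^sup>2)" by (intro Max_in) auto
    then obtain i0 where i0: "?m = (Y \<omega> $ i0)\<^sup>2" by blast
    have "(norm (Y \<omega>))\<^sup>2 = (\<Sum>i\<in>UNIV. (Y \<omega> $ i)\<^sup>2)"
      unfolding power2_norm_eq_inner by (simp add: inner_vec_def power2_eq_square)
    also have "\<dots> \<le> (\<Sum>i\<in>(UNIV::'d set). ?m)" using le by (intro sum_mono)
    finally have "(norm (Y \<omega>))\<^sup>2 \<le> real CARD('d) * (Y \<omega> $ i0)\<^sup>2" using i0 by simp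
    hence "((norm (Y \<omega>))\<^sup>2) ^ N \<le> (real CARD('d) * (Y \<omega> $ i0)\<^sup>2) ^ N" by (intro power_mono) auto
    hence "norm (Y \<omega>) ^ (2 * N) \<le> real CARD('d) ^ N * (Y \<omega> $ i0) ^ (2 * N)"
      by (simp add: power_mult power_mult_distrib)
    also have "\<dots> \<le> ?S \<omega>"
      by (intro mult_left_mono member_le_sum) (auto simp: power_mult)
    finally show ?thesis .
  qed
  have int: "integrable M ?S" using c by simp
  have "Y \<in> borel_measurable M"
    using Y unfolding gaussian_vector_def distributed_def by simp
  thus i: "integrable M (\<lambda>\<omega>. norm (Y \<omega>) ^ (2 * N))"
    using bound by (intro Bochner_Integration.integrable_bound[OF int]) (auto intro!: order_trans[OF bound])
  have "expectation (\<lambda>\<omega>. norm (Y \<omega>) ^ (2 * N)) \<le> expectation ?S"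
    using bound by (intro integral_mono i int)
  also have "\<dots> = real CARD('d) ^ N * (\<Sum>i\<in>(UNIV::'d set). fact (2 * N) / (2 ^ N * fact N) * \<sigma> ^ (2 * N))"
    using c by simp
  finally show "expectation (\<lambda>\<omega>. norm (Y \<omega>) ^ (2 * N)) \<le>
      real CARD('d) ^ N * real CARD('d) * (fact (2 * N) / (2 ^ N * fact N)) * \<sigma> ^ (2 * N)"
    by (simp add: mult_ac)
qed

text \<open>Independence is assumed in the form in which Brownian motion provides it. Both
  \<open>f (Y \<omega>)\<close> and \<open>\<Phi>\<close> generate smaller sigma-algebras than the
  two that are independent, so expectations factor.\<close>

lemma indep_of_subalgebra:
  fixes Y :: "'a \<Rightarrow> 'b :: {second_countable_topology, real_normed_vector, banach}"
  assumes ind: "indep_set {Y -` A \<inter> space M | A. A \<in> sets borel} (sets G)" and G: "subalgebra M G"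
    and Y: "Y \<in> borel_measurable M" and f: "f \<in> borel_measurable borel"
    and \<Phi>: "\<Phi> \<in> borel_measurable G"
    and int: "integrable M (\<lambda>\<omega>. f (Y \<omega>) :: real)" "integrable M \<Phi>"
  shows "integrable M (\<lambda>\<omega>. f (Y \<omega>) * \<Phi> \<omega>)"
    and "expectation (\<lambda>\<omega>. f (Y \<omega>) * \<Phi> \<omega>) = expectation (\<lambda>\<omega>. f (Y \<omega>)) * expectation \<Phi>"
proof -
  have "indep_var borel (\<lambda>\<omega>. f (Y \<omega>)) borel \<Phi>"
    unfolding indep_var_eq
  proof (intro conjI)
    show "random_variable borel (\<lambda>\<omega>. f (Y \<omega>))" using Y f by measurable
    show "random_variable borel \<Phi>" using measurable_from_subalg[OF G \<Phi>] .
    have 1: "sigma_sets (space M) {(\<lambda>\<omega>. f (Y \<omega>)) -` A \<inter> space M | A. A \<in> sets borel}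
      \<subseteq> {Y -` A \<inter> space M | A. A \<in> sets borel}"
    proof -
      have eq: "sets (vimage_algebra (space M) Y borel) = {Y -` A \<inter> space M | A. A \<in> sets borel}"
        by (rule sets_vimage_algebra2) auto
      have sp: "space (vimage_algebra (space M) Y borel) = space M" by simp
      have "{(\<lambda>\<omega>. f (Y \<omega>)) -` A \<inter> space M | A. A \<in> sets borel} \<subseteq> sets (vimage_algebra (space M) Y borel)"
        unfolding eq
      proof safe
        fix A :: "real set" assume "A \<in> sets borel"
        hence "f -` A \<in> sets borel" using f by (simp add: measurable_sets_borel)
        thus "\<exists>Aa. (\<lambda>\<omega>. f (Y \<omega>)) -` A \<inter> space M = Y -` Aa \<inter> space M \<and> Aa \<in> sets borel"
          by (intro exI[of _ "f -` A"]) auto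
      qed
      from sets.sigma_sets_subset[OF this] show ?thesis unfolding sp eq .
    qed
    have 2: "sigma_sets (space M) {\<Phi> -` A \<inter> space M | A. A \<in> sets borel} \<subseteq> sets G"
    proof -
      have sp: "space G = space M" using G by (simp add: subalgebra_def)
      have "{\<Phi> -` A \<inter> space M | A. A \<in> sets borel} \<subseteq> sets G"
        using \<Phi> measurable_sets[OF \<Phi>] by (auto simp: sp)
      from sets.sigma_sets_subset[OF this] show ?thesis unfolding sp .
    qed
    show "indep_set (sigma_sets (space M) {(\<lambda>\<omega>. f (Y \<omega>)) -` A \<inter> space M | A. A \<in> sets borel})
      (sigma_sets (space M) {\<Phi> -` A \<inter> space M | A. A \<in> sets borel})"
      using ind unfolding indep_set_def
      by (rule indep_sets_mono_sets) (use 1 2 in \<open>auto split: bool.split\<close>)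
  qed
  from indep_var_integrable[OF this int] indep_var_lebesgue_integral[OF this int]
  show "integrable M (\<lambda>\<omega>. f (Y \<omega>) * \<Phi> \<omega>)"
    "expectation (\<lambda>\<omega>. f (Y \<omega>) * \<Phi> \<omega>) = expectation (\<lambda>\<omega>. f (Y \<omega>)) * expectation \<Phi>" by auto
qed

end

section \<open>The running maximum of Brownian motion\<close>

locale brownian_setup = prob_space M
  for M :: "'a measure" +
  fixes F :: "real \<Rightarrow> 'a measure" and T :: real and B :: "real \<Rightarrow> 'a \<Rightarrow> real ^ 'd"
  assumes T_pos: "T > 0"
    and usual: "usual_filtration M F T"
    and BM: "brownian_motion M F T B"
begin

lemma subalg: "t \<in> {0..T} \<Longrightarrow> subalgebra M (F t)"
  using usual by (simp add: usual_filtration_def)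

lemma B_measurable_F: "t \<in> {0..T} \<Longrightarrow> B t \<in> borel_measurable (F t)"
  using BM by (simp add: brownian_motion_def adapted_process_def)

lemma B_measurable [measurable]: "t \<in> {0..T} \<Longrightarrow> B t \<in> borel_measurable M"
  using measurable_from_subalg[OF subalg B_measurable_F] by blast

lemma AE_B: "AE \<omega> in M. B 0 \<omega> = 0 \<and> continuous_on {0..T} (\<lambda>t. B t \<omega>)"
  using BM by (simp add: brownian_motion_def)

lemma B_increment_gaussian:
  assumes "0 \<le> s" "s < t" "t \<le> T"
  shows "gaussian_vector M (sqrt (t - s)) (\<lambda>\<omega>. B t \<omega> - B s \<omega>)"
  using BM assms by (simp add: brownian_motion_def gaussian_vector_def)

lemma B_increment_indep:
  assumes "0 \<le> s" "s < t" "t \<le> T"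
  shows "indep_set {(\<lambda>\<omega>. B t \<omega> - B s \<omega>) -` A \<inter> space M | A. A \<in> sets borel} (sets (F s))"
  using BM assms by (simp add: brownian_motion_def)

lemma B_increment_moment:
  obtains C where "C \<ge> 0"
    and "\<And>s t. \<lbrakk>0 \<le> s; s < t; t \<le> T\<rbrakk> \<Longrightarrow> integrable M (\<lambda>\<omega>. norm (B t \<omega> - B s \<omega>) ^ (2 * N))"
    and "\<And>s t. \<lbrakk>0 \<le> s; s < t; t \<le> T\<rbrakk> \<Longrightarrow>
      expectation (\<lambda>\<omega>. norm (B t \<omega> - B s \<omega>) ^ (2 * N)) \<le> C * (t - s) ^ N"
proof
  let ?C = "real CARD('d) ^ N * real CARD('d) * (fact (2 * N) / (2 ^ N * fact N)) :: real"
  show "?C \<ge> 0" by simp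
  fix s t :: real assume st: "0 \<le> s" "s < t" "t \<le> T"
  note g = gaussian_vector_norm_moment[OF B_increment_gaussian[OF st], of N]
  show "integrable M (\<lambda>\<omega>. norm (B t \<omega> - B s \<omega>) ^ (2 * N))" by (rule g(1))
  have "sqrt (t - s) ^ (2 * N) = (t - s) ^ N" using st by (simp add: power_mult)
  thus "expectation (\<lambda>\<omega>. norm (B t \<omega> - B s \<omega>) ^ (2 * N)) \<le> ?C * (t - s) ^ N"
    using g(2) by simp
qed

text \<open>Dyadic chaining: a point of level \<open>J\<close> differs from one of the next coarser
  level by at most one increment of level \<open>J\<close>, so \<open>f\<close> at dyadic points is
  bounded by a geometric series. Continuity carries the bound to all times.\<close>

lemma chaining_bound:
  fixes f :: "real \<Rightarrow> real ^ 'd" and v q :: real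
  assumes f0: "f 0 = 0" and cont: "continuous_on {0..T} f" and q: "0 < q" "q < 1" and v: "v \<ge> 0"
    and inc: "\<And>j i. i < 2 ^ j \<Longrightarrow>
      norm (f (real (Suc i) * T / 2 ^ j) - f (real i * T / 2 ^ j)) \<le> v * q ^ j"
    and t: "t \<in> {0..T}"
  shows "norm (f t) \<le> v / (1 - q)"
proof -
  have dy: "i \<le> 2 ^ J \<Longrightarrow> norm (f (real i * T / 2 ^ J)) \<le> v * (\<Sum>j\<le>J. q ^ j)" for J i
  proof (induction J arbitrary: i)
    case 0
    hence "i = 0 \<or> i = 1" by auto
    thus ?case using inc[of 0 0] f0 v by auto
  next
    case (Suc J)
    have e: "f (real (2 * i') * T / 2 ^ Suc J) = f (real i' * T / 2 ^ J)" for i'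
      by simp
    have sm: "v * (\<Sum>j\<le>J. q ^ j) \<le> v * (\<Sum>j\<le>Suc J. q ^ j)"
      using v q by (intro mult_left_mono) auto
    \<comment> \<open>Even indices already belong to the coarser grid; an odd one lies one increment
      to the right of an even one.\<close>
    obtain i' where "i = 2 * i' \<or> i = Suc (2 * i')" by (metis oddE evenE Suc_eq_plus1)
    thus ?case
    proof
      assume i: "i = 2 * i'"
      hence "i' \<le> 2 ^ J" using Suc.prems by simp
      from Suc.IH[OF this] show ?thesis unfolding i e using sm by linarith
    next
      assume i: "i = Suc (2 * i')"
      hence "i' \<le> 2 ^ J" "2 * i' < 2 ^ Suc J" using Suc.prems by simp_all
      note IH = Suc.IH[OF this(1)] and d = inc[OF this(2)]
      have "norm (f (real i * T / 2 ^ Suc J)) \<le> norm (f (real i' * T / 2 ^ J)) + v * q ^ Suc J"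
        using norm_triangle_le_diff d norm_triangle_sub[of "f (real i * T / 2 ^ Suc J)" "f (real (2 * i') * T / 2 ^ Suc J)"]
        unfolding i e by linarith
      also have "\<dots> \<le> v * (\<Sum>j\<le>J. q ^ j) + v * q ^ Suc J" using IH by simp
      finally show ?thesis by (simp add: algebra_simps)
    qed
  qed
  have geo: "v * (\<Sum>j\<le>J. q ^ j) \<le> v / (1 - q)" for J
  proof -
    have "(\<Sum>j\<le>J. q ^ j) \<le> (\<Sum>j. q ^ j)"
      using q by (intro sum_le_suminf summable_geometric) auto
    also have "\<dots> = 1 / (1 - q)" using q by (intro suminf_geometric) auto
    finally show ?thesis using v by (metis mult_left_mono times_divide_eq_right mult.right_neutral)
  qed
  \<comment> \<open>Rounding down to the dyadic grid keeps the approximating times inside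
    \<open>{0..T}\<close>.\<close>
  define i where "i J = nat \<lfloor>2 ^ J * t / T\<rfloor>" for J :: nat
  define x where "x J = real (i J) * T / 2 ^ J" for J
  have i: "real (i J) \<le> 2 ^ J * t / T" "2 ^ J * t / T < real (i J) + 1" "i J \<le> 2 ^ J" for J
  proof -
    have p: "0 \<le> 2 ^ J * t / T" using t T_pos by simp
    hence r: "real (i J) = of_int \<lfloor>2 ^ J * t / T\<rfloor>" by (simp add: i_def)
    show 1: "real (i J) \<le> 2 ^ J * t / T" "2 ^ J * t / T < real (i J) + 1" unfolding r by linarith+
    have "2 ^ J * t / T \<le> 2 ^ J" using t T_pos by (simp add: divide_le_eq mult_left_mono)
    hence "real (i J) \<le> real (2 ^ J)" using 1 unfolding of_nat_power of_nat_numeral by linarith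
    thus "i J \<le> 2 ^ J" unfolding of_nat_le_iff .
  qed
  have xt: "x J \<le> t" "t - x J \<le> T * (1 / 2) ^ J" "0 \<le> x J" for J
  proof -
    show "x J \<le> t" using i(1)[of J] T_pos by (simp add: x_def field_simps)
    have "t * 2 ^ J - real (i J) * T \<le> T" using i(2)[of J] T_pos by (simp add: field_simps)
    hence "(t * 2 ^ J - real (i J) * T) / 2 ^ J \<le> T / 2 ^ J" by (rule divide_right_mono) simp
    thus "t - x J \<le> T * (1 / 2) ^ J" by (simp add: x_def power_one_over diff_divide_distrib)
    show "0 \<le> x J" using T_pos by (simp add: x_def)
  qed
  have lim: "x \<longlonglongrightarrow> t"
  proof (rule tendsto_sandwich)
    show "\<forall>\<^sub>F J in sequentially. t - T * (1 / 2) ^ J \<le> x J" using xt(2) by (auto simp: algebra_simps)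
    show "\<forall>\<^sub>F J in sequentially. x J \<le> t" using xt(1) by auto
    have "(\<lambda>J. t - T * (1 / 2) ^ J) \<longlonglongrightarrow> t - T * 0"
      by (intro tendsto_intros LIMSEQ_power_zero) auto
    thus "(\<lambda>J. t - T * (1 / 2) ^ J) \<longlonglongrightarrow> t" by simp
  qed simp
  have "x J \<in> {0..T}" for J using xt(1,3)[of J] t by auto
  hence "(\<lambda>J. f (x J)) \<longlonglongrightarrow> f t"
    using continuous_on_tendsto_compose[OF cont lim t] by auto
  moreover have "norm (f (x J)) \<le> v / (1 - q)" for J
    using dy[OF i(3)] geo[of J] unfolding x_def by (rule order_trans)
  ultimately show ?thesis by (intro LIMSEQ_le_const2[OF tendsto_norm]) auto
qed

text \<open>Outside a null set the increments over dyadic intervals of level \<open>j\<close> are at most a random multiple of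
  \<open>2 powr (- j / 4)\<close>; the moments of order \<open>4 K\<close> of the increments make the sum over all levels and
  intervals converge as soon as \<open>K \<ge> 2\<close>.\<close>

lemma B_sup_moments:
  obtains V where "V \<in> borel_measurable M" "\<And>\<omega>. V \<omega> \<ge> 1" "integrable M (\<lambda>\<omega>. V \<omega> ^ N)"
    "AE \<omega> in M. \<forall>t\<in>{0..T}. norm (B t \<omega>) \<le> V \<omega>"
proof -
  \<comment> \<open>\<open>K \<ge> 2\<close> gives summability over the levels, and
    \<open>4 * K \<ge> N\<close> lets the moment of order \<open>4 * K\<close> control the one of
    order \<open>N\<close>.\<close>
  define K where "K = N + 2"
  define D where "D j i \<omega> = B (real (Suc i) * T / 2 ^ j) \<omega> - B (real i * T / 2 ^ j) \<omega>" for j i :: nat and \<omega>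
  \<comment> \<open>The weight \<open>2 ^ (j * K)\<close> is the \<open>4 * K\<close>-th power of
    \<open>2 powr (j / 4)\<close>. The moments of order \<open>4 * K\<close> scale like
    \<open>2 powr (- 2 * K * j)\<close> and there are \<open>2 ^ j\<close> intervals, so the
    expectation of \<open>a j\<close> is of order \<open>2 powr ((1 - K) * j)\<close>.\<close>
  define a where "a j \<omega> = (\<Sum>i<2^j. 2 ^ (j * K) * norm (D j i \<omega>) ^ (4 * K))" for j :: nat and \<omega>
  obtain C where C: "C \<ge> 0"
    "\<And>s t. \<lbrakk>0 \<le> s; s < t; t \<le> T\<rbrakk> \<Longrightarrow> integrable M (\<lambda>\<omega>. norm (B t \<omega> - B s \<omega>) ^ (2 * (2 * K)))"
    "\<And>s t. \<lbrakk>0 \<le> s; s < t; t \<le> T\<rbrakk> \<Longrightarrow>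
      expectation (\<lambda>\<omega>. norm (B t \<omega> - B s \<omega>) ^ (2 * (2 * K))) \<le> C * (t - s) ^ (2 * K)"
    by (rule B_increment_moment[of "2 * K"]) blast
  have grid: "0 \<le> real i * T / 2 ^ j" "real i * T / 2 ^ j < real (Suc i) * T / 2 ^ j"
    "real (Suc i) * T / 2 ^ j \<le> T" if "i < 2 ^ j" for i j :: nat
  proof -
    show "0 \<le> real i * T / 2 ^ j" using T_pos by simp
    show "real i * T / 2 ^ j < real (Suc i) * T / 2 ^ j" using T_pos by (simp add: divide_strict_right_mono)
    have "real (Suc i) \<le> real (2 ^ j)" using that by (intro of_nat_mono) simp
    hence "real (Suc i) * T \<le> 2 ^ j * T" using T_pos by (intro mult_right_mono) auto
    thus "real (Suc i) * T / 2 ^ j \<le> T" by (simp add: divide_le_eq mult.commute del: of_nat_Suc)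
  qed
  have D_int: "integrable M (\<lambda>\<omega>. norm (D j i \<omega>) ^ (4 * K))"
    and D_le: "expectation (\<lambda>\<omega>. norm (D j i \<omega>) ^ (4 * K)) \<le> C * (T / 2 ^ j) ^ (2 * K)"
    if "i < 2 ^ j" for i j :: nat
  proof -
    have k: "2 * (2 * K) = 4 * K" by simp
    show "integrable M (\<lambda>\<omega>. norm (D j i \<omega>) ^ (4 * K))"
      using C(2)[OF grid[OF that]] unfolding D_def k .
    have "real (Suc i) * T / 2 ^ j - real i * T / 2 ^ j = T / 2 ^ j"
      by (simp add: field_simps)
    thus "expectation (\<lambda>\<omega>. norm (D j i \<omega>) ^ (4 * K)) \<le> C * (T / 2 ^ j) ^ (2 * K)"
      using C(3)[OF grid[OF that]] unfolding D_def k by simp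
  qed
  have a0: "a j \<omega> \<ge> 0" for j \<omega> unfolding a_def by (intro sum_nonneg) auto
  have a_int: "integrable M (a j)" for j unfolding a_def
    by (intro Bochner_Integration.integrable_sum integrable_mult_right D_int) simp
  have a_le: "expectation (a j) \<le> C * T ^ (2 * K) * (1 / 2) ^ j" for j
  proof -
    have "expectation (a j) = (\<Sum>i<2^j. 2 ^ (j * K) * expectation (\<lambda>\<omega>. norm (D j i \<omega>) ^ (4 * K)))"
      unfolding a_def
      by (subst Bochner_Integration.integral_sum)
        (auto intro!: integrable_mult_right D_int)
    also have "\<dots> \<le> (\<Sum>i<(2::nat)^j. 2 ^ (j * K) * (C * (T / 2 ^ j) ^ (2 * K)))"
      using D_le by (intro sum_mono mult_left_mono) auto
    also have "\<dots> = C * T ^ (2 * K) * (2 ^ j * 2 ^ (j * K) / 2 ^ (j * (2 * K)))"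
      by (simp add: power_divide power_mult[symmetric])
    also have "\<dots> \<le> C * T ^ (2 * K) * (1 / 2) ^ j"
    proof (intro mult_left_mono)
      have "(2::real) ^ j * 2 ^ (j * K) * 2 ^ j \<le> 2 ^ (j * (2 * K))"
        unfolding power_add[symmetric] by (intro power_increasing) (auto simp: K_def algebra_simps)
      thus "(2::real) ^ j * 2 ^ (j * K) / 2 ^ (j * (2 * K)) \<le> (1 / 2) ^ j"
        by (simp add: power_one_over field_simps)
    qed (use C T_pos in auto)
    finally show ?thesis .
  qed
  define U where "U \<omega> = (\<Sum>j. ennreal (a j \<omega>))" for \<omega>
  have [measurable]: "a j \<in> borel_measurable M" for j using a_int by blast
  have "(\<integral>\<^sup>+\<omega>. U \<omega> \<partial>M) = (\<Sum>j. \<integral>\<^sup>+\<omega>. ennreal (a j \<omega>) \<partial>M)"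
    unfolding U_def by (rule nn_integral_suminf) measurable
  also have "\<dots> \<le> (\<Sum>j. ennreal (C * T ^ (2 * K) * (1 / 2) ^ j))"
  proof (intro suminf_le summableI allI)
    show "(\<integral>\<^sup>+\<omega>. ennreal (a j \<omega>) \<partial>M) \<le> ennreal (C * T ^ (2 * K) * (1 / 2) ^ j)" for j
      using nn_integral_eq_integral[OF a_int] a0 a_le by (simp add: ennreal_leI)
  qed
  also have "\<dots> < \<infinity>"
  proof -
    have "summable (\<lambda>j. C * T ^ (2 * K) * (1 / 2) ^ j)"
      by (intro summable_mult summable_geometric) auto
    hence "(\<Sum>j. ennreal (C * T ^ (2 * K) * (1 / 2) ^ j)) = ennreal (\<Sum>j. C * T ^ (2 * K) * (1 / 2) ^ j)"
      using C T_pos by (intro suminf_ennreal2) auto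
    thus ?thesis by simp
  qed
  finally have U_fin: "(\<integral>\<^sup>+\<omega>. U \<omega> \<partial>M) < \<infinity>" .
  have [measurable]: "U \<in> borel_measurable M" unfolding U_def by measurable
  \<comment> \<open>Passing to reals replaces the value infinity by 0; this affects only the null
    set excluded by \<open>AE_U\<close>.\<close>
  define V0 where "V0 \<omega> = enn2real (U \<omega>)" for \<omega>
  have V0: "V0 \<omega> \<ge> 0" for \<omega> by (simp add: V0_def)
  have V0m [measurable]: "V0 \<in> borel_measurable M" unfolding V0_def by measurable
  have AE_U: "AE \<omega> in M. U \<omega> < \<infinity>"
    using nn_integral_PInf_AE[of U M] U_fin by (auto simp: less_top)
  have V0_int: "integrable M V0"
  proof (rule integrableI_nonneg)
    have "(\<integral>\<^sup>+\<omega>. ennreal (V0 \<omega>) \<partial>M) \<le> (\<integral>\<^sup>+\<omega>. U \<omega> \<partial>M)"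
      unfolding V0_def by (intro nn_integral_mono) (simp add: ennreal_enn2real_if)
    thus "(\<integral>\<^sup>+\<omega>. ennreal (V0 \<omega>) \<partial>M) < \<infinity>" using U_fin by (rule le_less_trans)
  qed (use V0 in auto)
  \<comment> \<open>\<open>p\<close> is the growth of the admissible bound per level; its inverse
    \<open>q\<close> is the ratio of the geometric series in the chaining bound.\<close>
  define p where "p = root 4 (2::real)"
  have p: "p > 1" "p ^ 4 = 2" by (simp_all add: p_def)
  define q where "q = 1 / p"
  have q: "0 < q" "q < 1" using p by (auto simp: q_def)
  \<comment> \<open>Adding 1 before taking the root makes \<open>v\<close>, and with it
    \<open>V\<close>, at least 1, so that powers of \<open>V\<close> increase with the
    exponent.\<close>
  define v where "v \<omega> = root (4 * K) (1 + V0 \<omega>)" for \<omega>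
  have v: "v \<omega> \<ge> 1" "v \<omega> ^ (4 * K) = 1 + V0 \<omega>" for \<omega>
    using V0[of \<omega>] by (auto simp: v_def K_def)
  define V where "V \<omega> = v \<omega> / (1 - q)" for \<omega>
  have Vv: "V \<omega> \<ge> v \<omega>" for \<omega>
    unfolding V_def using q v(1)[of \<omega>] mult_left_mono[of "1 - q" 1 "v \<omega>"] by (simp add: pos_le_divide_eq)
  have Vm: "V \<in> borel_measurable M" unfolding V_def v_def by measurable
  show ?thesis
  proof
    show "V \<in> borel_measurable M" by (rule Vm)
    show V1: "V \<omega> \<ge> 1" for \<omega> using Vv[of \<omega>] v(1)[of \<omega>] by linarith
    show "integrable M (\<lambda>\<omega>. V \<omega> ^ N)"
    proof (rule Bochner_Integration.integrable_bound)
      show "integrable M (\<lambda>\<omega>. (1 + V0 \<omega>) * (1 / (1 - q) ^ (4 * K)))" using V0_int by simp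
      show "(\<lambda>\<omega>. V \<omega> ^ N) \<in> borel_measurable M" using Vm by measurable
      have "V \<omega> ^ N \<le> V \<omega> ^ (4 * K)" for \<omega> using V1 by (intro power_increasing) (auto simp: K_def)
      also have "V \<omega> ^ (4 * K) = (1 + V0 \<omega>) * (1 / (1 - q) ^ (4 * K))" for \<omega>
        by (simp add: V_def power_divide v(2))
      finally have le: "V \<omega> ^ N \<le> (1 + V0 \<omega>) * (1 / (1 - q) ^ (4 * K))" for \<omega> .
      have "norm (V \<omega> ^ N) = V \<omega> ^ N" for \<omega> using V1[of \<omega>] by simp
      thus "AE \<omega> in M. norm (V \<omega> ^ N) \<le> norm ((1 + V0 \<omega>) * (1 / (1 - q) ^ (4 * K)))"
        using order_trans[OF le abs_ge_self] by simp
    qed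
    show "AE \<omega> in M. \<forall>t\<in>{0..T}. norm (B t \<omega>) \<le> V \<omega>"
      using AE_U AE_B
    proof eventually_elim
      fix \<omega> assume U: "U \<omega> < \<infinity>" and c: "B 0 \<omega> = 0 \<and> continuous_on {0..T} (\<lambda>t. B t \<omega>)"
      have inc: "norm (D j i \<omega>) \<le> v \<omega> * q ^ j" if "i < 2 ^ j" for i j :: nat
      proof -
        have "2 ^ (j * K) * norm (D j i \<omega>) ^ (4 * K) \<le> a j \<omega>"
          unfolding a_def using that by (intro member_le_sum) auto
        also have "\<dots> \<le> V0 \<omega>"
        proof -
          have "ennreal (a j \<omega>) \<le> U \<omega>"
            unfolding U_def using sum_le_suminf[of "\<lambda>j. ennreal (a j \<omega>)" "{j}"] by simp
          also have "\<dots> = ennreal (V0 \<omega>)" using U by (simp add: V0_def less_top)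
          finally show ?thesis using V0 by simp
        qed
        also have "\<dots> \<le> v \<omega> ^ (4 * K)" unfolding v(2) by simp
        finally have "2 ^ (j * K) * norm (D j i \<omega>) ^ (4 * K) \<le> v \<omega> ^ (4 * K)" .
        moreover have "(2::real) ^ (j * K) = (p ^ j) ^ (4 * K)"
          unfolding p(2)[symmetric] by (simp add: power_mult[symmetric] mult_ac)
        ultimately have "(p ^ j * norm (D j i \<omega>)) ^ (4 * K) \<le> v \<omega> ^ (4 * K)"
          by (simp add: power_mult_distrib)
        hence "p ^ j * norm (D j i \<omega>) \<le> v \<omega>"
          using p v(1)[of \<omega>] by (subst (asm) power_mono_iff) (auto simp: K_def)
        thus ?thesis using p by (simp add: q_def power_one_over field_simps)
      qed
      show "\<forall>t\<in>{0..T}. norm (B t \<omega>) \<le> V \<omega>"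
        unfolding V_def using c q v(1)[of \<omega>] inc
        by (intro ballI chaining_bound[where f="\<lambda>t. B t \<omega>"]) (auto simp: D_def)
    qed
  qed
qed

end

section \<open>A priori bounds along a path\<close>

text \<open>The equation for a single path and driving function, with all drift terms under one
  integral; the a priori bounds below thereby become deterministic.\<close>

definition dunkl_path ::
    "(real ^ 'd) set \<Rightarrow> (real ^ 'd \<Rightarrow> real) \<Rightarrow> (real \<Rightarrow> real ^ 'd \<Rightarrow> real ^ 'd) \<Rightarrow> real \<Rightarrow>
     real ^ 'd \<Rightarrow> (real \<Rightarrow> real ^ 'd) \<Rightarrow> (real \<Rightarrow> real ^ 'd) \<Rightarrow> bool" where
  "dunkl_path Rp k b T x0 \<beta> x \<longleftrightarrow>
     continuous_on {0..T} x \<and> (\<forall>t\<in>{0..T}. x t \<in> weyl_chamber Rp) \<and>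
     (\<forall>t\<in>{0..T}. x t = x0 + \<beta> t + integral {0..t} (\<lambda>r. dunkl_drift Rp k (x r) + b r (x r)))"

lemma continuous_on_dunkl_drift:
  assumes "continuous_on A x" "\<forall>t\<in>A. x t \<in> weyl_chamber Rp"
  shows "continuous_on A (\<lambda>t. dunkl_drift Rp k (x t))"
proof -
  have "\<alpha> \<bullet> x t \<noteq> 0" if "t \<in> A" "\<alpha> \<in> Rp" for t \<alpha>
    using assms that by (fastforce simp: weyl_chamber_def)
  thus ?thesis unfolding dunkl_drift_def using assms(1)
    by (intro continuous_intros) auto
qed

lemma lipschitz_holder_driftE:
  assumes "lipschitz_holder_drift W T b" "T \<ge> 0"
  obtains L where "L > 0"
    "\<And>s t x y. \<lbrakk>s \<in> {0..T}; t \<in> {0..T}; x \<in> W; y \<in> W\<rbrakk> \<Longrightarrow>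
       norm (b t x - b s y) \<le> L * (sqrt \<bar>t - s\<bar> + norm (x - y))"
proof -
  obtain L H where L: "\<And>t. t \<in> {0..T} \<Longrightarrow> L-lipschitz_on W (b t)"
    and H: "\<And>x s t. \<lbrakk>x \<in> W; s \<in> {0..T}; t \<in> {0..T}\<rbrakk> \<Longrightarrow> norm (b t x - b s x) \<le> H * \<bar>t - s\<bar> powr (1 / 2)"
    using assms(1) unfolding lipschitz_holder_drift_def by blast
  show ?thesis
  proof
    show "\<bar>H\<bar> + \<bar>L\<bar> + 1 > 0" by simp
    fix s t x y assume A: "s \<in> {0..T}" "t \<in> {0..T}" "x \<in> W" "y \<in> W"
    have "b t x - b s y = (b t x - b s x) + (b s x - b s y)" by simp
    hence "norm (b t x - b s y) \<le> norm (b t x - b s x) + norm (b s x - b s y)"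
      by (metis norm_triangle_ineq)
    also have "norm (b s x - b s y) \<le> L * norm (x - y)"
      using lipschitz_onD[OF L[OF A(1)] A(3,4)] by (simp add: dist_norm)
    also have "norm (b t x - b s x) \<le> H * sqrt \<bar>t - s\<bar>"
      using H[OF A(3,1,2)] by (simp add: powr_half_sqrt)
    also have "H * sqrt \<bar>t - s\<bar> + L * norm (x - y) \<le>
        (\<bar>H\<bar> + \<bar>L\<bar> + 1) * sqrt \<bar>t - s\<bar> + (\<bar>H\<bar> + \<bar>L\<bar> + 1) * norm (x - y)"
      by (intro add_mono mult_right_mono) auto
    finally show "norm (b t x - b s y) \<le> (\<bar>H\<bar> + \<bar>L\<bar> + 1) * (sqrt \<bar>t - s\<bar> + norm (x - y))"
      by (simp add: algebra_simps)
  qed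
qed

lemma continuous_on_drift_path:
  fixes b :: "real \<Rightarrow> 'v::real_normed_vector \<Rightarrow> 'v"
  assumes L: "L > 0" "\<And>s t x y. \<lbrakk>s \<in> {0..T}; t \<in> {0..T}; x \<in> W; y \<in> W\<rbrakk> \<Longrightarrow>
       norm (b t x - b s y) \<le> L * (sqrt \<bar>t - s\<bar> + norm (x - y))"
    and x: "continuous_on {0..T} x" "\<And>t. t \<in> {0..T} \<Longrightarrow> x t \<in> W"
  shows "continuous_on {0..T} (\<lambda>t. b t (x t))"
  unfolding continuous_on_def
proof
  fix s assume s: "s \<in> {0..T}"
  have "(x \<longlongrightarrow> x s) (at s within {0..T})" using x(1) s by (auto simp: continuous_on_def)
  hence "((\<lambda>t. L * (sqrt \<bar>t - s\<bar> + norm (x t - x s))) \<longlongrightarrow> L * (sqrt \<bar>s - s\<bar> + norm (x s - x s))) (at s within {0..T})"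
    by (intro tendsto_intros) auto
  hence 0: "((\<lambda>t. L * (sqrt \<bar>t - s\<bar> + norm (x t - x s))) \<longlongrightarrow> 0) (at s within {0..T})" by simp
  have "((\<lambda>t. b t (x t) - b s (x s)) \<longlongrightarrow> 0) (at s within {0..T})"
  proof (rule Lim_null_comparison[OF _ 0])
    show "\<forall>\<^sub>F t in at s within {0..T}. norm (b t (x t) - b s (x s)) \<le> L * (sqrt \<bar>t - s\<bar> + norm (x t - x s))"
      unfolding eventually_at_filter using L(2) s x(2) by auto
  qed
  thus "((\<lambda>t. b t (x t)) \<longlongrightarrow> b s (x s)) (at s within {0..T})" by (rule LIM_zero_cancel)
qed

text \<open>The part \<open>Z\<close> of the path without the driving term is compared with a point
  \<open>v\<close> deep in the chamber: by monotonicity the singular drift at \<open>x t\<close> may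
  be replaced by that at \<open>v + \<beta> t\<close>, which is bounded, so the distance from
  \<open>Z\<close> to \<open>v\<close> grows at most linearly. For the integral of the norm,
  \<open>\<rho>\<close> has positive inner product with each positive root, so the norm of the
  singular drift is at most a multiple of its \<open>\<rho>\<close>-component, whose integral is a
  displacement already bounded. Both bounds are linear in \<open>K\<close>, so moments of the
  maximum of the driving path carry over.\<close>

lemma dunkl_path_bound:
  fixes Rp :: "(real ^ 'd) set"
  assumes fin: "finite Rp" and k: "\<forall>\<alpha>\<in>Rp. k \<alpha> > 0" and \<rho>: "\<forall>\<alpha>\<in>Rp. \<rho> \<bullet> \<alpha> > 0" and T: "T > 0"
    and Kb: "\<And>t x. \<lbrakk>t \<in> {0..T}; x \<in> weyl_chamber Rp\<rbrakk> \<Longrightarrow> norm (b t x) \<le> Kb"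
  shows "\<exists>C\<ge>1. \<forall>\<beta> x K. dunkl_path Rp k b T x0 \<beta> x \<and> K \<ge> 1 \<and> (\<forall>t\<in>{0..T}. norm (\<beta> t) \<le> K) \<and>
      continuous_on {0..T} (\<lambda>t. b t (x t)) \<longrightarrow>
      (\<forall>t\<in>{0..T}. norm (x t) \<le> C * K) \<and>
      integral {0..T} (\<lambda>r. norm (dunkl_drift Rp k (x r) + b r (x r))) \<le> C * K"
proof -
  let ?D = "dunkl_drift Rp k"
  have "\<exists>m>0. \<forall>\<alpha>\<in>Rp. m \<le> \<rho> \<bullet> \<alpha>"
  proof (cases "Rp = {}")
    case True
    thus ?thesis by (intro exI[of _ 1]) auto
  next
    case False
    hence "Min ((\<lambda>\<alpha>. \<rho> \<bullet> \<alpha>) ` Rp) \<in> (\<lambda>\<alpha>. \<rho> \<bullet> \<alpha>) ` Rp" using fin by (intro Min_in) auto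
    hence "Min ((\<lambda>\<alpha>. \<rho> \<bullet> \<alpha>) ` Rp) > 0" using \<rho> by auto
    thus ?thesis using fin by (intro exI[of _ "Min ((\<lambda>\<alpha>. \<rho> \<bullet> \<alpha>) ` Rp)"]) auto
  qed
  then obtain m where m: "m > 0" "\<And>\<alpha>. \<alpha> \<in> Rp \<Longrightarrow> m \<le> \<rho> \<bullet> \<alpha>" by blast
  define r where "r = (\<Sum>\<alpha>\<in>Rp. norm \<alpha>) + 1"
  have r: "r > 0" "\<And>\<alpha>. \<alpha> \<in> Rp \<Longrightarrow> norm \<alpha> \<le> r"
  proof -
    show "r > 0" unfolding r_def by (intro add_nonneg_pos sum_nonneg) auto
    fix \<alpha> assume "\<alpha> \<in> Rp"
    hence "norm \<alpha> \<le> (\<Sum>\<alpha>\<in>Rp. norm \<alpha>)" using fin by (intro member_le_sum) auto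
    thus "norm \<alpha> \<le> r" by (simp add: r_def)
  qed
  define \<kappa> where "\<kappa> = (\<Sum>\<alpha>\<in>Rp. k \<alpha> * norm \<alpha>)"
  define c where "c = \<kappa> + \<bar>Kb\<bar>"
  have \<kappa>0: "\<kappa> \<ge> 0" unfolding \<kappa>_def using k by (intro sum_nonneg mult_nonneg_nonneg) (auto simp: less_imp_le)
  have c0: "c \<ge> 0" using \<kappa>0 by (simp add: c_def)
  define C1 where "C1 = 2 * ((1 + r) / m * norm \<rho>) + 1 + norm x0 + c * T + 1"
  define C2 where "C2 = r / m * (norm \<rho> * (C1 + 1 + norm x0 + T * \<bar>Kb\<bar>)) + T * \<bar>Kb\<bar>"
  have C1: "C1 \<ge> 1" unfolding C1_def using r m c0 T by (simp add: add_nonneg_nonneg)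
  have C2: "C2 \<ge> 0" unfolding C2_def using r m C1 T by (intro add_nonneg_nonneg mult_nonneg_nonneg) auto
  show ?thesis
  proof (rule exI[of _ "C1 + C2"], rule conjI, goal_cases)
    case 1
    show ?case using C1 C2 by simp
  next
    case 2
    show ?case
    proof (intro allI impI, elim conjE)
    fix \<beta> x K
    assume path: "dunkl_path Rp k b T x0 \<beta> x" and K: "K \<ge> 1"
      and \<beta>': "\<forall>t\<in>{0..T}. norm (\<beta> t) \<le> K" and cb: "continuous_on {0..T} (\<lambda>t. b t (x t))"
    have \<beta>: "norm (\<beta> t) \<le> K" if "t \<in> {0..T}" for t using \<beta>' that by blast
    define a where "a t = ?D (x t) + b t (x t)" for t
    have xc: "continuous_on {0..T} x" and xW: "\<And>t. t \<in> {0..T} \<Longrightarrow> x t \<in> weyl_chamber Rp"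
      and xe: "\<And>t. t \<in> {0..T} \<Longrightarrow> x t = x0 + \<beta> t + integral {0..t} a"
      using path unfolding dunkl_path_def a_def[abs_def] by auto
    have cD: "continuous_on {0..T} (\<lambda>t. ?D (x t))" using xc xW by (intro continuous_on_dunkl_drift) auto
    have ac: "continuous_on {0..T} a" unfolding a_def by (intro continuous_intros cD cb)
    \<comment> \<open>Far enough in the direction \<open>\<rho>\<close> that each
      \<open>\<alpha> \<bullet> (v + \<beta> t)\<close> stays at least 1 although
      \<open>\<beta> t\<close> may have norm up to \<open>K\<close>; the norm of \<open>v\<close> is
      of order \<open>K\<close>.\<close>
    define v where "v = ((1 + r * K) / m) *\<^sub>R \<rho>"
    have v1: "\<alpha> \<bullet> (v + \<beta> t) \<ge> 1" if "\<alpha> \<in> Rp" "t \<in> {0..T}" for \<alpha> t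
    proof -
      have "(1 + r * K) / m * m \<le> (1 + r * K) / m * (\<rho> \<bullet> \<alpha>)"
        using m(1) m(2)[OF that(1)] r K by (intro mult_left_mono) auto
      hence "1 + r * K \<le> \<alpha> \<bullet> v" using m by (simp add: v_def inner_commute)
      moreover have "- (norm \<alpha> * norm (\<beta> t)) \<le> \<alpha> \<bullet> \<beta> t"
        using Cauchy_Schwarz_ineq2[of \<alpha> "\<beta> t"] by linarith
      moreover have "norm \<alpha> * norm (\<beta> t) \<le> r * K" using r \<beta> that by (intro mult_mono) auto
      ultimately show ?thesis by (simp add: inner_add_right)
    qed
    have vW: "v + \<beta> t \<in> weyl_chamber Rp" if "t \<in> {0..T}" for t
      using v1[OF _ that] unfolding weyl_chamber_def by force
    have Dv: "norm (?D (v + \<beta> t)) \<le> \<kappa>" if "t \<in> {0..T}" for t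
      unfolding dunkl_drift_def \<kappa>_def
    proof (rule sum_norm_le)
      fix \<alpha> assume a: "\<alpha> \<in> Rp"
      have kp: "k \<alpha> > 0" using k a by auto
      have "k \<alpha> / (\<alpha> \<bullet> (v + \<beta> t)) \<le> k \<alpha> / 1" "k \<alpha> / (\<alpha> \<bullet> (v + \<beta> t)) \<ge> 0"
        using v1[OF a that] kp frac_le[of "k \<alpha>" "k \<alpha>" 1 "\<alpha> \<bullet> (v + \<beta> t)"]
        by (auto simp del: inner_add_right)
      thus "norm ((k \<alpha> / (\<alpha> \<bullet> (v + \<beta> t))) *\<^sub>R \<alpha>) \<le> k \<alpha> * norm \<alpha>"
        unfolding norm_scaleR by (intro mult_right_mono) (simp_all only: real_norm_def abs_of_nonneg norm_ge_zero)
    qed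
    define Z where "Z t = x0 + integral {0..t} a" for t
    have Zx: "x t = Z t + \<beta> t" if "t \<in> {0..T}" for t using xe[OF that] by (simp add: Z_def)
    \<comment> \<open>A smoothed distance to \<open>v\<close>: the added 1 makes the square root
      differentiable also where \<open>Z t = v\<close>.\<close>
    define \<phi> where "\<phi> t = sqrt (1 + (Z t - v) \<bullet> (Z t - v))" for t
    have \<phi>_ge: "norm (Z t - v) \<le> \<phi> t" for t
      unfolding \<phi>_def norm_eq_sqrt_inner by (intro real_sqrt_le_mono) simp
    have \<phi>_pos: "\<phi> t > 0" for t
      unfolding \<phi>_def using inner_ge_zero[of "Z t - v"] by (intro real_sqrt_gt_zero) linarith
    define \<phi>' where "\<phi>' t = (Z t - v) \<bullet> a t / \<phi> t" for t
    have der: "(\<phi> has_real_derivative \<phi>' t) (at t within {0..T})" if t: "t \<in> {0..T}" for t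
    proof -
      have "((\<lambda>u. integral {0..u} a) has_vector_derivative a t) (at t within {0..T})"
        by (rule integral_has_vector_derivative[OF ac t])
      hence "((\<lambda>u. integral {0..u} a) has_derivative (\<lambda>h. h *\<^sub>R a t)) (at t within {0..T})"
        by (simp add: has_vector_derivative_def)
      hence w: "((\<lambda>u. Z u - v) has_derivative (\<lambda>h. h *\<^sub>R a t)) (at t within {0..T})"
        unfolding Z_def
        using has_derivative_diff[OF has_derivative_add[OF has_derivative_const[of x0]] has_derivative_const[of v]]
        by fastforce
      have "((\<lambda>u. 1 + (Z u - v) \<bullet> (Z u - v)) has_derivative (\<lambda>h. (Z t - v) \<bullet> (h *\<^sub>R a t) + (h *\<^sub>R a t) \<bullet> (Z t - v))) (at t within {0..T})"
        by (rule has_derivative_eq_rhs[OF has_derivative_add[OF has_derivative_const has_derivative_inner[OF w w]]]) simp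
      hence i: "((\<lambda>u. 1 + (Z u - v) \<bullet> (Z u - v)) has_real_derivative 2 * ((Z t - v) \<bullet> a t)) (at t within {0..T})"
        unfolding has_field_derivative_def
        by (rule has_derivative_eq_rhs) (simp add: fun_eq_iff inner_commute)
      have p: "1 + (Z t - v) \<bullet> (Z t - v) > 0" using inner_ge_zero[of "Z t - v"] by linarith
      have eq: "(inverse w / 2) * (2 * q) = q / w" for w q :: real
        unfolding divide_inverse by simp
      show ?thesis unfolding \<phi>'_def
        unfolding \<phi>_def by (rule DERIV_cong[OF DERIV_chain2[OF DERIV_real_sqrt[OF p] i] eq])
    qed
    have \<phi>'_le: "\<phi>' t \<le> c" if t: "t \<in> {0..T}" for t
    proof -
      \<comment> \<open>The splitting works because \<open>Z t - v\<close> equals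
        \<open>x t - (v + \<beta> t)\<close>, so the first pairing is one of the monotone
        drift.\<close>
      have "(Z t - v) \<bullet> a t = (x t - (v + \<beta> t)) \<bullet> (?D (x t) - ?D (v + \<beta> t)) + (Z t - v) \<bullet> (?D (v + \<beta> t) + b t (x t))"
        unfolding a_def Zx[OF t] by (simp add: algebra_simps inner_add_right inner_diff_right inner_add_left)
      also have "(x t - (v + \<beta> t)) \<bullet> (?D (x t) - ?D (v + \<beta> t)) \<le> 0"
        using k by (intro dunkl_drift_mono xW[OF t] vW[OF t]) (auto simp: less_imp_le)
      also have "(Z t - v) \<bullet> (?D (v + \<beta> t) + b t (x t)) \<le> norm (Z t - v) * norm (?D (v + \<beta> t) + b t (x t))"
        by (rule norm_cauchy_schwarz)
      also have "\<dots> \<le> \<phi> t * c"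
      proof (intro mult_mono \<phi>_ge)
        have "norm (b t (x t)) \<le> \<bar>Kb\<bar>" using Kb[OF t xW[OF t]] by linarith
        thus "norm (?D (v + \<beta> t) + b t (x t)) \<le> c"
          using Dv[OF t] norm_triangle_ineq[of "?D (v + \<beta> t)" "b t (x t)"] unfolding c_def by linarith
      qed (use \<phi>_pos[of t] in auto)
      finally show ?thesis using \<phi>_pos[of t] by (simp add: \<phi>'_def divide_le_eq mult.commute)
    qed
    have \<phi>_le: "\<phi> t \<le> \<phi> 0 + c * T" if t: "t \<in> {0..T}" for t
    proof -
      have "\<exists>s\<in>{0..t}. \<phi> t - \<phi> 0 = (t - 0) * \<phi>' s"
      proof (rule mvt_very_simple[where f'="\<lambda>s h. h * \<phi>' s"])
        fix s assume "0 \<le> s" "s \<le> t"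
        hence "(\<phi> has_real_derivative \<phi>' s) (at s within {0..t})"
          using t by (intro DERIV_subset[OF der]) auto
        thus "(\<phi> has_derivative (\<lambda>h. h * \<phi>' s)) (at s within {0..t})"
          unfolding has_field_derivative_def by (rule has_derivative_eq_rhs) (simp add: fun_eq_iff)
      qed (use t in auto)
      then obtain s where s: "s \<in> {0..t}" "\<phi> t - \<phi> 0 = t * \<phi>' s" by auto
      have "t * \<phi>' s \<le> t * c" using s t by (intro mult_left_mono \<phi>'_le) auto
      also have "\<dots> \<le> T * c" using t c0 by (intro mult_right_mono) auto
      finally show ?thesis using s by (simp add: mult.commute)
    qed
    have \<phi>0: "\<phi> 0 \<le> 1 + norm x0 + norm v"
    proof -
      have "\<phi> 0 = sqrt (1 + (norm (x0 - v))\<^sup>2)" by (simp add: \<phi>_def Z_def power2_norm_eq_inner)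
      also have "\<dots> \<le> 1 + norm (x0 - v)" by (intro real_le_lsqrt) (auto simp: power2_eq_square algebra_simps)
      also have "\<dots> \<le> 1 + (norm x0 + norm v)" using norm_triangle_ineq4 by simp
      finally show ?thesis by simp
    qed
    have nv: "norm v \<le> (1 + r) / m * norm \<rho> * K"
    proof -
      have "norm v = (1 + r * K) / m * norm \<rho>" using r m K by (simp add: v_def)
      also have "\<dots> \<le> ((1 + r) * K) / m * norm \<rho>"
        using r m K by (intro mult_right_mono divide_right_mono) (auto simp: algebra_simps)
      finally show ?thesis by (simp add: mult_ac)
    qed
    have Zb: "norm (Z t) \<le> (C1 - 1) * K" if t: "t \<in> {0..T}" for t
    proof -
      have "norm (Z t) \<le> norm v + norm (Z t - v)" using norm_triangle_sub[of "Z t" v] by simp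
      also have "\<dots> \<le> 2 * norm v + (1 + norm x0 + c * T)" using \<phi>_ge[of t] \<phi>_le[OF t] \<phi>0 by linarith
      also have "\<dots> \<le> 2 * ((1 + r) / m * norm \<rho> * K) + (1 + norm x0 + c * T) * K"
        using nv K c0 T mult_left_mono[OF K, of "1 + norm x0 + c * T"] by simp
      finally show ?thesis by (simp add: C1_def algebra_simps)
    qed
    have x_le: "norm (x t) \<le> C1 * K" if t: "t \<in> {0..T}" for t
      using norm_triangle_ineq[of "Z t" "\<beta> t"] Zb[OF t] \<beta>[OF t] unfolding Zx[OF t]
      by (simp add: algebra_simps)
    have cK: "C1 * K \<le> (C1 + C2) * K" using C2 K by (intro mult_right_mono) auto
    have int: "(\<lambda>t. ?D (x t)) integrable_on {0..T}" "(\<lambda>t. b t (x t)) integrable_on {0..T}"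
      "(\<lambda>t. norm (?D (x t))) integrable_on {0..T}" "(\<lambda>t. norm (b t (x t))) integrable_on {0..T}"
      "(\<lambda>t. norm (a t)) integrable_on {0..T}"
      by (intro integrable_continuous_real continuous_intros cD cb ac)+
    have Dle: "norm (?D (x t)) \<le> r / m * (\<rho> \<bullet> ?D (x t))" if t: "t \<in> {0..T}" for t
    proof -
      have "norm (?D (x t)) \<le> (\<Sum>\<alpha>\<in>Rp. r / m * (\<rho> \<bullet> ((k \<alpha> / (\<alpha> \<bullet> x t)) *\<^sub>R \<alpha>)))"
        unfolding dunkl_drift_def
      proof (rule sum_norm_le)
        fix \<alpha> assume a: "\<alpha> \<in> Rp"
        have p: "k \<alpha> / (\<alpha> \<bullet> x t) > 0" using k a xW[OF t] by (auto simp: weyl_chamber_def)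
        have "norm \<alpha> \<le> r / m * m" using m r(2)[OF a] by simp
        also have "\<dots> \<le> r / m * (\<rho> \<bullet> \<alpha>)" using r m(1) m(2)[OF a] by (intro mult_left_mono) auto
        finally have "k \<alpha> / (\<alpha> \<bullet> x t) * norm \<alpha> \<le> k \<alpha> / (\<alpha> \<bullet> x t) * (r / m * (\<rho> \<bullet> \<alpha>))"
          using p by (intro mult_left_mono) auto
        thus "norm ((k \<alpha> / (\<alpha> \<bullet> x t)) *\<^sub>R \<alpha>) \<le> r / m * (\<rho> \<bullet> ((k \<alpha> / (\<alpha> \<bullet> x t)) *\<^sub>R \<alpha>))"
          using abs_of_pos[OF p] unfolding norm_scaleR inner_scaleR_right real_norm_def
          by (metis mult.left_commute)
      qed
      thus ?thesis by (simp add: dunkl_drift_def inner_sum_right sum_distrib_left)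
    qed
    have bint: "integral {0..T} (\<lambda>t. norm (b t (x t))) \<le> T * \<bar>Kb\<bar>"
    proof -
      have "integral {0..T} (\<lambda>t. norm (b t (x t))) \<le> integral {0..T} (\<lambda>t. \<bar>Kb\<bar>)"
        using Kb xW by (intro integral_le int) (auto intro: order_trans[OF _ abs_ge_self])
      thus ?thesis using T by simp
    qed
    have "integral {0..T} (\<lambda>t. norm (?D (x t))) \<le> integral {0..T} (\<lambda>t. r / m * (\<rho> \<bullet> ?D (x t)))"
      using Dle by (intro integral_le int integrable_continuous_real continuous_intros cD)
    also have "\<dots> = r / m * (\<rho> \<bullet> integral {0..T} (\<lambda>t. ?D (x t)))"
      using integral_linear[OF int(1) bounded_linear_inner_right, of \<rho>] by (simp add: o_def)
    also have "integral {0..T} (\<lambda>t. ?D (x t)) = Z T - x0 - integral {0..T} (\<lambda>t. b t (x t))"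
      using Henstock_Kurzweil_Integration.integral_add[OF int(1,2)] by (simp add: Z_def a_def[abs_def])
    also have "r / m * (\<rho> \<bullet> (Z T - x0 - integral {0..T} (\<lambda>t. b t (x t)))) \<le>
        r / m * (norm \<rho> * ((C1 + 1 + norm x0 + T * \<bar>Kb\<bar>) * K))"
    proof (intro mult_left_mono order_trans[OF norm_cauchy_schwarz])
      have "norm (integral {0..T} (\<lambda>t. b t (x t))) \<le> T * \<bar>Kb\<bar>"
        using integral_norm_bound_integral[OF int(2) int(4)] bint by simp
      moreover have "norm (Z T - x0 - integral {0..T} (\<lambda>t. b t (x t))) \<le>
          norm (Z T) + norm x0 + norm (integral {0..T} (\<lambda>t. b t (x t)))"
        by (meson add_mono_thms_linordered_semiring(3) norm_triangle_ineq4 order_trans)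
      ultimately have "norm (Z T - x0 - integral {0..T} (\<lambda>t. b t (x t))) \<le> (C1 - 1) * K + (norm x0 + T * \<bar>Kb\<bar>)"
        using Zb[of T] T by simp
      also have "(norm x0 + T * \<bar>Kb\<bar>) \<le> (norm x0 + T * \<bar>Kb\<bar>) * K"
        using mult_left_mono[OF K, of "norm x0 + T * \<bar>Kb\<bar>"] T by simp
      finally show "norm (Z T - x0 - integral {0..T} (\<lambda>t. b t (x t))) \<le> (C1 + 1 + norm x0 + T * \<bar>Kb\<bar>) * K"
        using K by (simp add: algebra_simps)
    qed (use r m in auto)
    finally have Dint: "integral {0..T} (\<lambda>t. norm (?D (x t))) \<le> r / m * (norm \<rho> * (C1 + 1 + norm x0 + T * \<bar>Kb\<bar>)) * K"
      by (simp add: mult_ac)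
    have "integral {0..T} (\<lambda>t. norm (a t)) \<le> integral {0..T} (\<lambda>t. norm (?D (x t)) + norm (b t (x t)))"
      by (intro integral_le int integrable_add) (auto simp: a_def norm_triangle_ineq)
    also have "\<dots> = integral {0..T} (\<lambda>t. norm (?D (x t))) + integral {0..T} (\<lambda>t. norm (b t (x t)))"
      by (rule Henstock_Kurzweil_Integration.integral_add[OF int(3,4)])
    also have "\<dots> \<le> r / m * (norm \<rho> * (C1 + 1 + norm x0 + T * \<bar>Kb\<bar>)) * K + T * \<bar>Kb\<bar> * K"
    proof (rule add_mono[OF Dint])
      have "T * \<bar>Kb\<bar> * 1 \<le> T * \<bar>Kb\<bar> * K" using T K by (intro mult_left_mono) auto
      thus "integral {0..T} (\<lambda>t. norm (b t (x t))) \<le> T * \<bar>Kb\<bar> * K" using bint by linarith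
    qed
    also have "\<dots> = C2 * K" by (simp add: C2_def algebra_simps)
    also have "\<dots> \<le> (C1 + C2) * K" using C1 K by (intro mult_right_mono) auto
    finally have "integral {0..T} (\<lambda>r. norm (?D (x r) + b r (x r))) \<le> (C1 + C2) * K"
      by (simp add: a_def)
    thus "(\<forall>t\<in>{0..T}. norm (x t) \<le> (C1 + C2) * K) \<and>
      integral {0..T} (\<lambda>r. norm (?D (x r) + b r (x r))) \<le> (C1 + C2) * K"
      using order_trans[OF x_le cK] by blast
    qed
  qed
qed

section \<open>Expansion of the test function\<close>

text \<open>Multiplying by one more factor \<open>x + y\<close> sends value, linear and quadratic
  terms to \<open>x * A\<close>, \<open>x * L + y * A\<close> and \<open>x * Q + y * L\<close>. Each
  new remainder is \<open>x\<close> times the old remainder of the same order plus \<open>y\<close>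
  times the one an order lower, so the same six bounds survive with \<open>K\<close> multiplied by
  \<open>4 * p\<close>.\<close>

lemma prod_shift_expansion_step:
  fixes x y A L Q E p d K :: real
  assumes x: "\<bar>x\<bar> \<le> p" and y: "\<bar>y\<bar> \<le> d" and p: "1 \<le> p" "d \<le> p" "0 \<le> d" and K: "0 \<le> K"
    and A: "\<bar>A\<bar> \<le> K" and L: "\<bar>L\<bar> \<le> d * K" and Q: "\<bar>Q\<bar> \<le> d\<^sup>2 * K"
    and E: "\<bar>E - A\<bar> \<le> d * K" "\<bar>E - A - L\<bar> \<le> d\<^sup>2 * K" "\<bar>E - A - L - Q\<bar> \<le> d ^ 3 * K"
  shows "\<bar>x * A\<bar> \<le> 4 * p * K" "\<bar>x * L + y * A\<bar> \<le> d * (4 * p * K)" "\<bar>x * Q + y * L\<bar> \<le> d\<^sup>2 * (4 * p * K)"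
    "\<bar>(x + y) * E - x * A\<bar> \<le> d * (4 * p * K)"
    "\<bar>(x + y) * E - x * A - (x * L + y * A)\<bar> \<le> d\<^sup>2 * (4 * p * K)"
    "\<bar>(x + y) * E - x * A - (x * L + y * A) - (x * Q + y * L)\<bar> \<le> d ^ 3 * (4 * p * K)"
proof -
  \<comment> \<open>All two-term bounds are instances of this one; \<open>e\<close> counts the
    powers of \<open>d\<close> already gained, and \<open>p + (1 + d) \<le> 4 * p\<close> produces
    the constant.\<close>
  have step: "\<bar>x * u + y * v\<bar> \<le> d * e * (4 * p * K)"
    if "\<bar>u\<bar> \<le> d * e * K" "\<bar>v\<bar> \<le> e * ((1 + d) * K)" "0 \<le> e" for u v e
  proof -
    have "\<bar>x * u + y * v\<bar> \<le> \<bar>x\<bar> * \<bar>u\<bar> + \<bar>y\<bar> * \<bar>v\<bar>"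
      by (metis abs_mult abs_triangle_ineq)
    also have "\<dots> \<le> p * (d * e * K) + d * (e * ((1 + d) * K))"
      using that x y p K by (intro add_mono mult_mono) auto
    also have "\<dots> = d * e * K * (p + (1 + d))" by (simp add: algebra_simps)
    also have "\<dots> \<le> d * e * K * (4 * p)"
      using that p K by (intro mult_left_mono mult_nonneg_nonneg) auto
    finally show ?thesis by (simp add: mult_ac)
  qed
  have dK: "e * K \<le> e * ((1 + d) * K)" if "e \<ge> 0" for e
    using p K that by (intro mult_left_mono) (auto simp: algebra_simps)
  have "\<bar>x\<bar> * \<bar>A\<bar> \<le> p * K" using x A p K by (intro mult_mono) auto
  thus "\<bar>x * A\<bar> \<le> 4 * p * K" using p K mult_nonneg_nonneg[of p K] unfolding abs_mult by linarith
  show "\<bar>x * L + y * A\<bar> \<le> d * (4 * p * K)"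
    using step[of L 1 A] L A dK[of 1] by simp
  show "\<bar>x * Q + y * L\<bar> \<le> d\<^sup>2 * (4 * p * K)"
    using step[of Q d L] Q L dK[of d] p by (simp add: power2_eq_square)
  have b: "\<bar>A + (E - A)\<bar> \<le> 1 * ((1 + d) * K)" "\<bar>L + (E - A - L)\<bar> \<le> d * ((1 + d) * K)"
    "\<bar>Q + (E - A - L - Q)\<bar> \<le> d\<^sup>2 * ((1 + d) * K)"
    using abs_triangle_ineq[of A "E - A"] abs_triangle_ineq[of L "E - A - L"] abs_triangle_ineq[of Q "E - A - L - Q"]
      A L Q E by (simp_all add: algebra_simps power2_eq_square power3_eq_cube)
  have "(x + y) * E - x * A = x * (E - A) + y * (A + (E - A))" by (simp add: algebra_simps)
  thus "\<bar>(x + y) * E - x * A\<bar> \<le> d * (4 * p * K)" using step[OF _ b(1)] E by simp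
  have "(x + y) * E - x * A - (x * L + y * A) = x * (E - A - L) + y * (L + (E - A - L))"
    by (simp add: algebra_simps)
  thus "\<bar>(x + y) * E - x * A - (x * L + y * A)\<bar> \<le> d\<^sup>2 * (4 * p * K)"
    using step[OF _ b(2)] E p by (simp add: power2_eq_square)
  have "(x + y) * E - x * A - (x * L + y * A) - (x * Q + y * L) = x * (E - A - L - Q) + y * (Q + (E - A - L - Q))"
    by (simp add: algebra_simps)
  moreover have "\<bar>x * (E - A - L - Q) + y * (Q + (E - A - L - Q))\<bar> \<le> d * d\<^sup>2 * (4 * p * K)"
    using E p by (intro step b(3)) (auto simp: power2_eq_square power3_eq_cube)
  ultimately show "\<bar>(x + y) * E - x * A - (x * L + y * A) - (x * Q + y * L)\<bar> \<le> d ^ 3 * (4 * p * K)"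
    by (simp add: power2_eq_square power3_eq_cube)
qed

text \<open>Second-order expansion of a product of shifted factors, without differentiation: all three
  remainders satisfy the recursion obtained by adding one factor.\<close>

lemma prod_shift_expansion:
  fixes a c :: "'i \<Rightarrow> real" and \<rho> \<delta> :: real
  assumes fin: "finite I" and a0: "\<And>i. i \<in> I \<Longrightarrow> a i \<noteq> 0"
    and a: "\<And>i. i \<in> I \<Longrightarrow> \<bar>a i\<bar> \<le> \<rho>" and c: "\<And>i. i \<in> I \<Longrightarrow> \<bar>c i\<bar> \<le> \<delta>"
    and \<rho>: "\<rho> \<ge> 1" "\<delta> \<le> \<rho>" "\<delta> \<ge> 0"
  defines "A \<equiv> \<Prod>i\<in>I. a i" and "E \<equiv> \<Prod>i\<in>I. (a i + c i)"
    and "L \<equiv> (\<Prod>i\<in>I. a i) * (\<Sum>i\<in>I. c i / a i)"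
    and "Q \<equiv> (\<Prod>i\<in>I. a i) * (((\<Sum>i\<in>I. c i / a i)\<^sup>2 - (\<Sum>i\<in>I. (c i / a i)\<^sup>2)) / 2)"
  shows "\<bar>A\<bar> \<le> (4 * \<rho>) ^ card I" "\<bar>L\<bar> \<le> \<delta> * (4 * \<rho>) ^ card I" "\<bar>Q\<bar> \<le> \<delta>\<^sup>2 * (4 * \<rho>) ^ card I"
    "\<bar>E - A\<bar> \<le> \<delta> * (4 * \<rho>) ^ card I" "\<bar>E - A - L\<bar> \<le> \<delta>\<^sup>2 * (4 * \<rho>) ^ card I"
    "\<bar>E - A - L - Q\<bar> \<le> \<delta> ^ 3 * (4 * \<rho>) ^ card I"
proof -
  let ?A = "\<lambda>I. \<Prod>i\<in>I. a i" and ?E = "\<lambda>I. \<Prod>i\<in>I. (a i + c i)"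
    and ?z = "\<lambda>I. \<Sum>i\<in>I. c i / a i" and ?w = "\<lambda>I. \<Sum>i\<in>I. (c i / a i)\<^sup>2"
  let ?L = "\<lambda>I. ?A I * ?z I" and ?Q = "\<lambda>I. ?A I * (((?z I)\<^sup>2 - ?w I) / 2)"
  have "(\<forall>i\<in>I. a i \<noteq> 0 \<and> \<bar>a i\<bar> \<le> \<rho> \<and> \<bar>c i\<bar> \<le> \<delta>) \<Longrightarrow>
    \<bar>?A I\<bar> \<le> (4 * \<rho>) ^ card I \<and> \<bar>?L I\<bar> \<le> \<delta> * (4 * \<rho>) ^ card I \<and> \<bar>?Q I\<bar> \<le> \<delta>\<^sup>2 * (4 * \<rho>) ^ card I \<and>
    \<bar>?E I - ?A I\<bar> \<le> \<delta> * (4 * \<rho>) ^ card I \<and> \<bar>?E I - ?A I - ?L I\<bar> \<le> \<delta>\<^sup>2 * (4 * \<rho>) ^ card I \<and>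
    \<bar>?E I - ?A I - ?L I - ?Q I\<bar> \<le> \<delta> ^ 3 * (4 * \<rho>) ^ card I"
    using fin
  proof (induction I rule: finite_induct)
    case empty
    thus ?case using \<rho> by simp
  next
    case (insert i I)
    have i: "a i \<noteq> 0" "\<bar>a i\<bar> \<le> \<rho>" "\<bar>c i\<bar> \<le> \<delta>" using insert.prems by auto
    define n where "n = card I"
    have card: "card (insert i I) = Suc n" using insert by (simp add: n_def)
    define A L Q E z w where A: "A = ?A I" and L: "L = ?L I" and Q: "Q = ?Q I" and E: "E = ?E I"
      and z: "z = ?z I" and w: "w = ?w I"
    have IH: "\<bar>A\<bar> \<le> (4 * \<rho>) ^ n" "\<bar>L\<bar> \<le> \<delta> * (4 * \<rho>) ^ n" "\<bar>Q\<bar> \<le> \<delta>\<^sup>2 * (4 * \<rho>) ^ n"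
      "\<bar>E - A\<bar> \<le> \<delta> * (4 * \<rho>) ^ n" "\<bar>E - A - L\<bar> \<le> \<delta>\<^sup>2 * (4 * \<rho>) ^ n"
      "\<bar>E - A - L - Q\<bar> \<le> \<delta> ^ 3 * (4 * \<rho>) ^ n"
      using insert.IH insert.prems unfolding n_def A L Q E by auto
    have rA: "?A (insert i I) = a i * A" and rE: "?E (insert i I) = (a i + c i) * E"
      using insert by (simp_all add: A E)
    have rL: "?L (insert i I) = a i * L + c i * A"
      using insert i(1) by (simp add: A L field_simps)
    \<comment> \<open>\<open>Q\<close> is the product times the second elementary symmetric
      polynomial of the ratios \<open>c i / a i\<close>; a new factor adds to that polynomial its
      own ratio times the sum \<open>z\<close> of the old ones.\<close>
    have rQ: "?Q (insert i I) = a i * Q + c i * L"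
    proof -
      have "?Q (insert i I) = a i * A * (((c i / a i + z)\<^sup>2 - ((c i / a i)\<^sup>2 + w)) / 2)"
        using insert by (simp add: A z w)
      also have "((c i / a i + z)\<^sup>2 - ((c i / a i)\<^sup>2 + w)) = (z\<^sup>2 - w) + 2 * (c i / a i * z)"
        by (simp add: power2_eq_square algebra_simps)
      also have "a i * A * ((z\<^sup>2 - w + 2 * (c i / a i * z)) / 2) = a i * (A * ((z\<^sup>2 - w) / 2)) + a i * (c i / a i) * (A * z)"
      proof -
        have "x * A * ((s + 2 * (y * z)) / 2) = x * (A * (s / 2)) + x * y * (A * z)" for x y s :: real
          by (simp add: field_simps)
        thus ?thesis .
      qed
      also have "a i * (c i / a i) = c i" using i by simp
      finally show ?thesis by (simp add: A L Q z w)
    qed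
    have "(4 * \<rho>) ^ n \<ge> 0" using \<rho> by simp
    note S = prod_shift_expansion_step[OF i(2,3) \<rho> this IH]
    show ?case unfolding rQ unfolding rL unfolding rA rE card power_Suc using S by blast
  qed
  thus "\<bar>A\<bar> \<le> (4 * \<rho>) ^ card I" "\<bar>L\<bar> \<le> \<delta> * (4 * \<rho>) ^ card I" "\<bar>Q\<bar> \<le> \<delta>\<^sup>2 * (4 * \<rho>) ^ card I"
    "\<bar>E - A\<bar> \<le> \<delta> * (4 * \<rho>) ^ card I" "\<bar>E - A - L\<bar> \<le> \<delta>\<^sup>2 * (4 * \<rho>) ^ card I"
    "\<bar>E - A - L - Q\<bar> \<le> \<delta> ^ 3 * (4 * \<rho>) ^ card I"
    using a0 a c unfolding A_def E_def L_def Q_def by auto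
qed

text \<open>The remainders in the expansion of a reciprocal are exact rational expressions: up to
  sign, a power of \<open>v - u\<close> over a power of \<open>u\<close> times \<open>v\<close>.
  Bounding the denominators below by powers of \<open>\<epsilon>\<close> takes the place of Taylor's
  theorem.\<close>

lemma inverse_shift_expansion:
  fixes \<epsilon> P P' :: real
  assumes "\<epsilon> > 0" "P \<ge> 0" "P' \<ge> 0"
  shows "\<bar>1 / (\<epsilon> + P') - 1 / (\<epsilon> + P)\<bar> \<le> \<bar>P' - P\<bar> / \<epsilon>\<^sup>2"
    and "\<bar>1 / (\<epsilon> + P') - 1 / (\<epsilon> + P) + (P' - P) / (\<epsilon> + P)\<^sup>2\<bar> \<le> (P' - P)\<^sup>2 / \<epsilon> ^ 3"
    and "\<bar>1 / (\<epsilon> + P') - 1 / (\<epsilon> + P) + (P' - P) / (\<epsilon> + P)\<^sup>2 - (P' - P)\<^sup>2 / (\<epsilon> + P) ^ 3\<bar> \<le> \<bar>P' - P\<bar> ^ 3 / \<epsilon> ^ 4"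
proof -
  define u v where "u = \<epsilon> + P" and "v = \<epsilon> + P'"
  have uv: "u \<ge> \<epsilon>" "v \<ge> \<epsilon>" "u > 0" "v > 0" "P' - P = v - u" using assms by (auto simp: u_def v_def)
  have e1: "1 / v - 1 / u = - ((v - u) / (u * v))" using uv by (simp add: field_simps)
  have e2: "1 / v - 1 / u + (v - u) / u\<^sup>2 = (v - u)\<^sup>2 / (u\<^sup>2 * v)"
    using uv by (simp add: field_simps power2_eq_square)
  have e3: "1 / v - 1 / u + (v - u) / u\<^sup>2 - (v - u)\<^sup>2 / u ^ 3 = - ((v - u) ^ 3 / (u ^ 3 * v))"
    using uv by (simp add: field_simps power2_eq_square power3_eq_cube)
  have b: "\<epsilon>\<^sup>2 \<le> u * v" "\<epsilon> ^ 3 \<le> u\<^sup>2 * v" "\<epsilon> ^ 4 \<le> u ^ 3 * v"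
  proof -
    show "\<epsilon>\<^sup>2 \<le> u * v" unfolding power2_eq_square using uv assms by (intro mult_mono) auto
    have "\<epsilon>\<^sup>2 * \<epsilon> \<le> u\<^sup>2 * v" using uv assms by (intro mult_mono power_mono) auto
    thus "\<epsilon> ^ 3 \<le> u\<^sup>2 * v" by (simp add: power2_eq_square power3_eq_cube)
    have "\<epsilon> ^ 3 * \<epsilon> \<le> u ^ 3 * v" using uv assms by (intro mult_mono power_mono) auto
    thus "\<epsilon> ^ 4 \<le> u ^ 3 * v" by (simp add: power_numeral_reduce)
  qed
  show "\<bar>1 / (\<epsilon> + P') - 1 / (\<epsilon> + P)\<bar> \<le> \<bar>P' - P\<bar> / \<epsilon>\<^sup>2"
    unfolding uv(5) u_def[symmetric] v_def[symmetric] e1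
    using b assms uv by (simp add: abs_mult frac_le)
  show "\<bar>1 / (\<epsilon> + P') - 1 / (\<epsilon> + P) + (P' - P) / (\<epsilon> + P)\<^sup>2\<bar> \<le> (P' - P)\<^sup>2 / \<epsilon> ^ 3"
    unfolding uv(5) u_def[symmetric] v_def[symmetric] e2
    using b assms uv by (simp add: abs_mult frac_le)
  show "\<bar>1 / (\<epsilon> + P') - 1 / (\<epsilon> + P) + (P' - P) / (\<epsilon> + P)\<^sup>2 - (P' - P)\<^sup>2 / (\<epsilon> + P) ^ 3\<bar> \<le> \<bar>P' - P\<bar> ^ 3 / \<epsilon> ^ 4"
    unfolding uv(5) u_def[symmetric] v_def[symmetric] e3
    using b assms uv by (simp add: abs_mult frac_le power_abs)
qed

section \<open>The wall product, its regularised inverse and their expansions\<close>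

definition wall_prod :: "(real ^ 'd) set \<Rightarrow> nat \<Rightarrow> real ^ 'd \<Rightarrow> real" where
  "wall_prod Rp m x = (\<Prod>\<alpha>\<in>Rp. (\<alpha> \<bullet> x) ^ m)"

definition test_fun :: "(real ^ 'd) set \<Rightarrow> nat \<Rightarrow> real \<Rightarrow> real ^ 'd \<Rightarrow> real" where
  "test_fun Rp m \<epsilon> x = 1 / (\<epsilon> + wall_prod Rp m x)"

text \<open>On the chamber this is the directional derivative along \<open>y\<close> of the
  logarithm of the product of all \<open>\<alpha> \<bullet> x\<close>, taken without the exponent
  \<open>m\<close>.\<close>

definition log_der :: "(real ^ 'd) set \<Rightarrow> real ^ 'd \<Rightarrow> real ^ 'd \<Rightarrow> real" where
  "log_der Rp x y = (\<Sum>\<alpha>\<in>Rp. (\<alpha> \<bullet> y) / (\<alpha> \<bullet> x))"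

text \<open>On the chamber this is minus the second directional derivative along \<open>y\<close> of
  the same logarithm.\<close>

definition log_der2 :: "(real ^ 'd) set \<Rightarrow> real ^ 'd \<Rightarrow> real ^ 'd \<Rightarrow> real" where
  "log_der2 Rp x y = (\<Sum>\<alpha>\<in>Rp. ((\<alpha> \<bullet> y) / (\<alpha> \<bullet> x))\<^sup>2)"

text \<open>On the chamber this is minus the Laplacian of that logarithm; by the cancellation of the
  cross terms it is also the squared norm of its gradient.\<close>

definition wall_sum :: "(real ^ 'd) set \<Rightarrow> real ^ 'd \<Rightarrow> real" where
  "wall_sum Rp x = (\<Sum>\<alpha>\<in>Rp. (norm \<alpha> / (\<alpha> \<bullet> x))\<^sup>2)"

text \<open>The Laplacian of \<^term>\<open>test_fun Rp m \<epsilon>\<close> on the chamber, where the cross terms between different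
  roots cancel.\<close>

definition test_fun_laplacian :: "(real ^ 'd) set \<Rightarrow> nat \<Rightarrow> real \<Rightarrow> real ^ 'd \<Rightarrow> real" where
  "test_fun_laplacian Rp m \<epsilon> x = (let P = wall_prod Rp m x; S = wall_sum Rp x in
     2 * (real m * P)\<^sup>2 * S / (\<epsilon> + P) ^ 3 - real m * (real m - 1) * P * S / (\<epsilon> + P)\<^sup>2)"

lemma wall_prod_nonneg: "even m \<Longrightarrow> wall_prod Rp m x \<ge> 0"
  unfolding wall_prod_def by (intro prod_nonneg) (auto simp: zero_le_even_power)

lemma wall_prod_pos: "x \<in> weyl_chamber Rp \<Longrightarrow> wall_prod Rp m x > 0"
  unfolding wall_prod_def weyl_chamber_def by (intro prod_pos) auto

lemma roots_norm_bound:
  fixes Rp :: "(real ^ 'd) set"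
  assumes "finite Rp"
  obtains r where "r \<ge> 1" "\<forall>\<alpha>\<in>Rp. norm \<alpha> \<le> r"
proof
  show "1 + (\<Sum>\<alpha>\<in>Rp. norm \<alpha>) \<ge> 1" by (simp add: sum_nonneg)
  show "\<forall>\<alpha>\<in>Rp. norm \<alpha> \<le> 1 + (\<Sum>\<alpha>\<in>Rp. norm \<alpha>)"
  proof
    fix \<alpha> assume "\<alpha> \<in> Rp"
    hence "norm \<alpha> \<le> (\<Sum>\<alpha>\<in>Rp. norm \<alpha>)" using assms by (intro member_le_sum) auto
    thus "norm \<alpha> \<le> 1 + (\<Sum>\<alpha>\<in>Rp. norm \<alpha>)" by simp
  qed
qed

text \<open>The factors are the linear forms, each repeated \<open>m\<close> times: the index set
  \<open>Rp \<times> {..<m}\<close> brings the product into the form of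
  \<open>prod_shift_expansion\<close>, and the exponent becomes a multiplicity in the sums.\<close>

lemma wall_prod_expansion:
  fixes Rp :: "(real ^ 'd) set" and m :: nat and y :: "real ^ 'd"
  assumes fin: "finite Rp" and r: "r \<ge> 1" "\<forall>\<alpha>\<in>Rp. norm \<alpha> \<le> r" and x: "x \<in> weyl_chamber Rp"
  defines "P \<equiv> wall_prod Rp m x" and "P' \<equiv> wall_prod Rp m (x + y)"
    and "L \<equiv> real m * wall_prod Rp m x * log_der Rp x y"
    and "Q \<equiv> wall_prod Rp m x * ((real m * log_der Rp x y)\<^sup>2 - real m * log_der2 Rp x y) / 2"
    and "K \<equiv> (4 * (1 + r * (norm x + norm y))) ^ (m * card Rp)" and "\<delta> \<equiv> r * norm y"
  shows "\<bar>P\<bar> \<le> K" "\<bar>L\<bar> \<le> \<delta> * K" "\<bar>Q\<bar> \<le> \<delta>\<^sup>2 * K"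
    "\<bar>P' - P\<bar> \<le> \<delta> * K" "\<bar>P' - P - L\<bar> \<le> \<delta>\<^sup>2 * K" "\<bar>P' - P - L - Q\<bar> \<le> \<delta> ^ 3 * K"
proof -
  let ?I = "Rp \<times> {..<m}" and ?a = "\<lambda>p. fst p \<bullet> x" and ?c = "\<lambda>p. fst p \<bullet> y"
  have pr: "(\<Prod>p\<in>?I. f (fst p)) = (\<Prod>\<alpha>\<in>Rp. f \<alpha> ^ m)" for f :: "real ^ 'd \<Rightarrow> real"
    by (simp add: prod.cartesian_product' prod_constant)
  have su: "(\<Sum>p\<in>?I. f (fst p)) = real m * (\<Sum>\<alpha>\<in>Rp. f \<alpha>)" for f :: "real ^ 'd \<Rightarrow> real"
    by (simp add: sum.cartesian_product' sum_distrib_left)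
  have p1: "(\<Prod>p\<in>?I. ?a p) = P" unfolding P_def wall_prod_def by (rule pr)
  have p2: "(\<Prod>p\<in>?I. ?a p + ?c p) = P'"
    using pr[of "\<lambda>\<alpha>. \<alpha> \<bullet> x + \<alpha> \<bullet> y"] by (simp add: P'_def wall_prod_def inner_add_right)
  have s1: "(\<Sum>p\<in>?I. ?c p / ?a p) = real m * log_der Rp x y" unfolding log_der_def by (rule su)
  have s2: "(\<Sum>p\<in>?I. (?c p / ?a p)\<^sup>2) = real m * log_der2 Rp x y" unfolding log_der2_def by (rule su)
  have L: "P * (real m * log_der Rp x y) = L" by (simp add: L_def P_def)
  have Q: "P * (((real m * log_der Rp x y)\<^sup>2 - real m * log_der2 Rp x y) / 2) = Q" by (simp add: Q_def P_def)
  have inner: "\<bar>\<alpha> \<bullet> z\<bar> \<le> r * norm z" if "\<alpha> \<in> Rp" for \<alpha> z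
    using Cauchy_Schwarz_ineq2[of \<alpha> z] mult_right_mono[OF bspec[OF r(2) that], of "norm z"] by simp
  have nn: "r * norm x \<ge> 0" "r * norm y \<ge> 0" using r by auto
  have rho: "1 + r * (norm x + norm y) \<ge> 1" "r * norm y \<le> 1 + r * (norm x + norm y)" "r * norm y \<ge> 0"
    using nn by (auto simp: algebra_simps)
  have a0: "?a p \<noteq> 0" if "p \<in> ?I" for p using x that by (fastforce simp: weyl_chamber_def)
  have aa: "\<bar>?a p\<bar> \<le> 1 + r * (norm x + norm y)" if "p \<in> ?I" for p
    using inner[of "fst p" x] nn that by (auto simp: algebra_simps)
  have cc: "\<bar>?c p\<bar> \<le> r * norm y" if "p \<in> ?I" for p using inner[of "fst p" y] that by auto
  have card: "card ?I = m * card Rp" by (simp add: card_cartesian_product)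
  have "finite ?I" using fin by simp
  note E = prod_shift_expansion[where a="?a" and c="?c" and \<rho>="1 + r * (norm x + norm y)" and \<delta>="r * norm y",
      OF this a0 aa cc rho, unfolded p1 p2 s1 s2 card L Q, folded K_def \<delta>_def]
  show "\<bar>P\<bar> \<le> K" "\<bar>L\<bar> \<le> \<delta> * K" "\<bar>Q\<bar> \<le> \<delta>\<^sup>2 * K"
    "\<bar>P' - P\<bar> \<le> \<delta> * K" "\<bar>P' - P - L\<bar> \<le> \<delta>\<^sup>2 * K" "\<bar>P' - P - L - Q\<bar> \<le> \<delta> ^ 3 * K"
    using E by blast+
qed

text \<open>Composition of the two expansions. The second-order form serves the drift increments;
  the third-order form serves the noise, whose square is of the order of the time step. The constant
  \<open>C\<close> degenerates as \<open>\<epsilon>\<close> tends to 0, which is harmless because it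
  multiplies only remainders that vanish under refinement at fixed
  \<open>\<epsilon>\<close>.\<close>

lemma test_fun_expansion:
  fixes Rp :: "(real ^ 'd) set" and y :: "real ^ 'd"
  assumes fin: "finite Rp" and r: "r \<ge> 1" "\<forall>\<alpha>\<in>Rp. norm \<alpha> \<le> r" and x: "x \<in> weyl_chamber Rp"
    and m: "even m" and \<epsilon>: "\<epsilon> > 0"
  defines "P \<equiv> wall_prod Rp m x"
    and "L \<equiv> real m * wall_prod Rp m x * log_der Rp x y"
    and "Q \<equiv> wall_prod Rp m x * ((real m * log_der Rp x y)\<^sup>2 - real m * log_der2 Rp x y) / 2"
    and "K \<equiv> (4 * (1 + r * (norm x + norm y))) ^ (3 * (m * card Rp))" and "\<delta> \<equiv> r * norm y"
    and "C \<equiv> 1 / \<epsilon>\<^sup>2 + 2 / \<epsilon> ^ 3 + 1 / \<epsilon> ^ 4"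
  shows "\<bar>test_fun Rp m \<epsilon> (x + y) - test_fun Rp m \<epsilon> x\<bar> \<le> C * (\<delta> * K)"
    and "\<bar>test_fun Rp m \<epsilon> (x + y) - test_fun Rp m \<epsilon> x + L / (\<epsilon> + P)\<^sup>2\<bar> \<le> C * (\<delta>\<^sup>2 * K)"
    and "\<bar>test_fun Rp m \<epsilon> (x + y) - test_fun Rp m \<epsilon> x + (L + Q) / (\<epsilon> + P)\<^sup>2 - L\<^sup>2 / (\<epsilon> + P) ^ 3\<bar> \<le> C * (\<delta> ^ 3 * K)"
    and "\<bar>L / (\<epsilon> + P)\<^sup>2\<bar> \<le> C * (\<delta> * K)"
proof -
  define P' where "P' = wall_prod Rp m (x + y)"
  define k where "k = (4 * (1 + r * (norm x + norm y))) ^ (m * card Rp)"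
  note E = wall_prod_expansion[OF fin r x, of m y, folded P_def P'_def L_def Q_def k_def \<delta>_def]
  have k1: "k \<ge> 1"
  proof -
    have "1 \<le> 4 * (1 + r * (norm x + norm y))" using r by (simp add: add_increasing2)
    thus ?thesis unfolding k_def by (rule one_le_power)
  qed
  \<comment> \<open>The cube lets a single \<open>K\<close> absorb \<open>k\<close>,
    \<open>k\<^sup>2\<close> and \<open>k ^ 3\<close>, which come with the first three powers of
    \<open>P' - P\<close>.\<close>
  have K: "K = k ^ 3" unfolding K_def k_def by (simp add: power_mult[symmetric] mult.commute)
  have kK: "k \<le> K" "k\<^sup>2 \<le> K" "1 \<le> K"
    using power_increasing[of 1 3 k] power_increasing[of 2 3 k] one_le_power[of k 3] k1 unfolding K by auto
  have d0: "\<delta> \<ge> 0" using r by (simp add: \<delta>_def)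
  have P0: "P \<ge> 0" "P' \<ge> 0" using wall_prod_nonneg[OF m] by (simp_all add: P_def P'_def)
  have e: "1 / \<epsilon>\<^sup>2 \<ge> 0" "2 / \<epsilon> ^ 3 \<ge> 0" "1 / \<epsilon> ^ 4 \<ge> 0" "1 / \<epsilon> ^ 3 \<ge> 0" using \<epsilon> by auto
  have sq: "1 / (\<epsilon> + P)\<^sup>2 \<le> 1 / \<epsilon>\<^sup>2" "1 / (\<epsilon> + P) ^ 3 \<le> 1 / \<epsilon> ^ 3"
    using \<epsilon> P0 by (intro divide_left_mono power_mono mult_pos_pos zero_less_power; simp)+
  let ?g = "test_fun Rp m \<epsilon> (x + y) - test_fun Rp m \<epsilon> x"
  have g: "?g = 1 / (\<epsilon> + P') - 1 / (\<epsilon> + P)" by (simp add: test_fun_def P_def P'_def)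
  note I = inverse_shift_expansion[OF \<epsilon> P0, folded g]
  have D1: "\<bar>P' - P\<bar> \<le> \<delta> * K"
    using E(4) mult_left_mono[OF kK(1) d0] by linarith
  have "\<bar>?g\<bar> \<le> (\<delta> * K) / \<epsilon>\<^sup>2" using I(1) divide_right_mono[OF D1, of "\<epsilon>\<^sup>2"] by simp
  also have "\<dots> = 1 / \<epsilon>\<^sup>2 * (\<delta> * K)" by simp
  also have "\<dots> \<le> C * (\<delta> * K)" unfolding C_def using e d0 kK by (intro mult_right_mono) auto
  finally show "\<bar>?g\<bar> \<le> C * (\<delta> * K)" .
  have quad: "\<bar>P' - P\<bar>\<^sup>2 \<le> \<delta>\<^sup>2 * K"
  proof -
    have "\<bar>P' - P\<bar>\<^sup>2 \<le> (\<delta> * k)\<^sup>2" using E(4) by (intro power_mono) auto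
    also have "\<dots> = \<delta>\<^sup>2 * k\<^sup>2" by (simp add: power_mult_distrib)
    also have "\<dots> \<le> \<delta>\<^sup>2 * K" using kK by (intro mult_left_mono) auto
    finally show ?thesis .
  qed
  have D2: "\<bar>P' - P - L\<bar> \<le> \<delta>\<^sup>2 * K"
    using E(5) mult_left_mono[OF kK(1), of "\<delta>\<^sup>2"] by simp
  have scale: "\<bar>a / (\<epsilon> + P)\<^sup>2\<bar> \<le> 1 / \<epsilon>\<^sup>2 * c" "\<bar>a / (\<epsilon> + P) ^ 3\<bar> \<le> 1 / \<epsilon> ^ 3 * c" if "\<bar>a\<bar> \<le> c" for a c
  proof -
    have pp: "(\<epsilon> + P)\<^sup>2 > 0" "(\<epsilon> + P) ^ 3 > 0" using \<epsilon> P0 by (auto intro!: zero_less_power)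
    have "\<bar>a / (\<epsilon> + P)\<^sup>2\<bar> = 1 / (\<epsilon> + P)\<^sup>2 * \<bar>a\<bar>" by (simp add: abs_divide)
    also have "\<dots> \<le> 1 / \<epsilon>\<^sup>2 * c" using that sq e by (intro mult_mono) auto
    finally show "\<bar>a / (\<epsilon> + P)\<^sup>2\<bar> \<le> 1 / \<epsilon>\<^sup>2 * c" .
    have "\<bar>a / (\<epsilon> + P) ^ 3\<bar> = 1 / (\<epsilon> + P) ^ 3 * \<bar>a\<bar>" using pp(2) by (simp only: abs_divide abs_of_pos) simp
    also have "\<dots> \<le> 1 / \<epsilon> ^ 3 * c" using that sq e by (intro mult_mono) auto
    finally show "\<bar>a / (\<epsilon> + P) ^ 3\<bar> \<le> 1 / \<epsilon> ^ 3 * c" .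
  qed
  have "?g + L / (\<epsilon> + P)\<^sup>2 = (?g + (P' - P) / (\<epsilon> + P)\<^sup>2) - (P' - P - L) / (\<epsilon> + P)\<^sup>2"
    by (simp add: diff_divide_distrib)
  hence "\<bar>?g + L / (\<epsilon> + P)\<^sup>2\<bar> \<le> (P' - P)\<^sup>2 / \<epsilon> ^ 3 + 1 / \<epsilon>\<^sup>2 * (\<delta>\<^sup>2 * K)"
    using I(2) scale(1)[OF D2] by linarith
  also have "(P' - P)\<^sup>2 / \<epsilon> ^ 3 \<le> 1 / \<epsilon> ^ 3 * (\<delta>\<^sup>2 * K)"
    using quad \<epsilon> by (simp add: divide_right_mono)
  finally have "\<bar>?g + L / (\<epsilon> + P)\<^sup>2\<bar> \<le> (1 / \<epsilon>\<^sup>2 + 1 / \<epsilon> ^ 3) * (\<delta>\<^sup>2 * K)" by (simp add: algebra_simps)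
  also have "\<dots> \<le> C * (\<delta>\<^sup>2 * K)"
  proof (rule mult_right_mono)
    have "2 / \<epsilon> ^ 3 = 2 * (1 / \<epsilon> ^ 3)" by simp
    thus "1 / \<epsilon>\<^sup>2 + 1 / \<epsilon> ^ 3 \<le> C" unfolding C_def using e by linarith
    show "0 \<le> \<delta>\<^sup>2 * K" using kK by simp
  qed
  finally show "\<bar>?g + L / (\<epsilon> + P)\<^sup>2\<bar> \<le> C * (\<delta>\<^sup>2 * K)" .
  have D3: "\<bar>P' - P - L - Q\<bar> \<le> \<delta> ^ 3 * K"
    using E(6) mult_left_mono[OF kK(1), of "\<delta> ^ 3"] d0 by simp
  \<comment> \<open>The difference of squares factors into the second-order error times a
    first-order quantity, so replacing \<open>P' - P\<close> by \<open>L\<close> costs only third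
    order.\<close>
  have D4: "\<bar>(P' - P)\<^sup>2 - L\<^sup>2\<bar> \<le> 2 * (\<delta> ^ 3 * K)"
  proof -
    have "\<bar>(P' - P)\<^sup>2 - L\<^sup>2\<bar> = \<bar>P' - P - L\<bar> * \<bar>P' - P + L\<bar>"
      unfolding abs_mult[symmetric] by (rule arg_cong[where f=abs]) (simp add: power2_eq_square algebra_simps)
    also have "\<dots> \<le> (\<delta>\<^sup>2 * k) * (2 * (\<delta> * k))"
      using E(2,4,5) d0 k1 by (intro mult_mono) auto
    also have "\<dots> = 2 * (\<delta> ^ 3 * k\<^sup>2)" by (simp add: power2_eq_square power3_eq_cube)
    also have "\<dots> \<le> 2 * (\<delta> ^ 3 * K)" using kK d0 by (intro mult_left_mono) auto
    finally show ?thesis .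
  qed
  have cub: "\<bar>P' - P\<bar> ^ 3 \<le> \<delta> ^ 3 * K"
  proof -
    have "\<bar>P' - P\<bar> ^ 3 \<le> (\<delta> * k) ^ 3" using E(4) by (intro power_mono) auto
    thus ?thesis by (simp add: power_mult_distrib K)
  qed
  have "?g + (L + Q) / (\<epsilon> + P)\<^sup>2 - L\<^sup>2 / (\<epsilon> + P) ^ 3 =
      (?g + (P' - P) / (\<epsilon> + P)\<^sup>2 - (P' - P)\<^sup>2 / (\<epsilon> + P) ^ 3)
      - (P' - P - L - Q) / (\<epsilon> + P)\<^sup>2 + ((P' - P)\<^sup>2 - L\<^sup>2) / (\<epsilon> + P) ^ 3"
    by (simp add: diff_divide_distrib add_divide_distrib)
  hence "\<bar>?g + (L + Q) / (\<epsilon> + P)\<^sup>2 - L\<^sup>2 / (\<epsilon> + P) ^ 3\<bar> \<le>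
      \<bar>P' - P\<bar> ^ 3 / \<epsilon> ^ 4 + 1 / \<epsilon>\<^sup>2 * (\<delta> ^ 3 * K) + 1 / \<epsilon> ^ 3 * (2 * (\<delta> ^ 3 * K))"
    using I(3) scale(1)[OF D3] scale(2)[OF D4] by linarith
  also have "\<bar>P' - P\<bar> ^ 3 / \<epsilon> ^ 4 \<le> (\<delta> ^ 3 * K) / \<epsilon> ^ 4" by (rule divide_right_mono[OF cub]) simp
  finally show "\<bar>?g + (L + Q) / (\<epsilon> + P)\<^sup>2 - L\<^sup>2 / (\<epsilon> + P) ^ 3\<bar> \<le> C * (\<delta> ^ 3 * K)"
    by (simp add: C_def algebra_simps)
  have "\<bar>L\<bar> \<le> \<delta> * K" using E(2) mult_left_mono[OF kK(1) d0] by linarith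
  from scale(1)[OF this] have "\<bar>L / (\<epsilon> + P)\<^sup>2\<bar> \<le> 1 / \<epsilon>\<^sup>2 * (\<delta> * K)" .
  also have "\<dots> \<le> C * (\<delta> * K)" unfolding C_def using e d0 kK by (intro mult_right_mono) auto
  finally show "\<bar>L / (\<epsilon> + P)\<^sup>2\<bar> \<le> C * (\<delta> * K)" .
qed

text \<open>Since \<open>m \<ge> 2\<close>, two of the factors \<open>\<alpha> \<bullet> x\<close>
  cancel the double pole; what remains is a product of linear forms and grows polynomially.\<close>

lemma wall_prod_div_le:
  fixes Rp :: "(real ^ 'd) set"
  assumes fin: "finite Rp" and r: "r \<ge> 1" "\<forall>\<alpha>\<in>Rp. norm \<alpha> \<le> r" and x: "x \<in> weyl_chamber Rp"
    and m: "m \<ge> 2" and \<alpha>: "\<alpha> \<in> Rp"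
  shows "wall_prod Rp m x / (\<alpha> \<bullet> x)\<^sup>2 \<le> (1 + r * norm x) ^ (m * card Rp)"
proof -
  let ?\<rho> = "1 + r * norm x"
  have \<rho>: "?\<rho> \<ge> 1" using r by simp
  have pos: "\<beta> \<bullet> x > 0" if "\<beta> \<in> Rp" for \<beta> using x that by (auto simp: weyl_chamber_def)
  have le: "\<beta> \<bullet> x \<le> ?\<rho>" if "\<beta> \<in> Rp" for \<beta>
    using norm_cauchy_schwarz[of \<beta> x] mult_right_mono[OF bspec[OF r(2) that], of "norm x"] by simp
  have "wall_prod Rp m x = (\<alpha> \<bullet> x) ^ m * (\<Prod>\<beta>\<in>Rp - {\<alpha>}. (\<beta> \<bullet> x) ^ m)"
    unfolding wall_prod_def using fin \<alpha> by (rule prod.remove)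
  hence "wall_prod Rp m x / (\<alpha> \<bullet> x)\<^sup>2 = (\<alpha> \<bullet> x) ^ (m - 2) * (\<Prod>\<beta>\<in>Rp - {\<alpha>}. (\<beta> \<bullet> x) ^ m)"
    using pos[OF \<alpha>] m by (simp add: power_diff)
  also have "\<dots> \<le> ?\<rho> ^ m * (\<Prod>\<beta>\<in>Rp - {\<alpha>}. ?\<rho> ^ m)"
  proof (intro mult_mono prod_mono conjI prod_nonneg)
    have "(\<alpha> \<bullet> x) ^ (m - 2) \<le> ?\<rho> ^ (m - 2)" using pos[OF \<alpha>] le[OF \<alpha>] by (intro power_mono) auto
    also have "\<dots> \<le> ?\<rho> ^ m" using \<rho> by (intro power_increasing) auto
    finally show "(\<alpha> \<bullet> x) ^ (m - 2) \<le> ?\<rho> ^ m" .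
  qed (use pos le \<rho> in \<open>auto intro!: power_mono simp: less_imp_le\<close>)
  also have "\<dots> = (\<Prod>\<beta>\<in>Rp. ?\<rho> ^ m)" by (rule prod.remove[OF fin \<alpha>, symmetric])
  also have "\<dots> = ?\<rho> ^ (m * card Rp)" by (simp add: power_mult)
  finally show ?thesis .
qed

lemma wall_prod_sum_le:
  fixes Rp :: "(real ^ 'd) set"
  assumes fin: "finite Rp" and r: "r \<ge> 1" "\<forall>\<alpha>\<in>Rp. norm \<alpha> \<le> r" and x: "x \<in> weyl_chamber Rp"
    and m: "m \<ge> 2"
  shows "wall_prod Rp m x * wall_sum Rp x \<le> real (card Rp) * r\<^sup>2 * (1 + r * norm x) ^ (m * card Rp)"
proof -
  have "wall_prod Rp m x * wall_sum Rp x = (\<Sum>\<alpha>\<in>Rp. (norm \<alpha>)\<^sup>2 * (wall_prod Rp m x / (\<alpha> \<bullet> x)\<^sup>2))"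
    unfolding wall_sum_def sum_distrib_left by (intro sum.cong refl) (simp add: power_divide)
  also have "\<dots> \<le> (\<Sum>\<alpha>\<in>Rp. r\<^sup>2 * (1 + r * norm x) ^ (m * card Rp))"
    using r wall_prod_div_le[OF fin r x m] wall_prod_pos[OF x, of m]
    by (intro sum_mono mult_mono power_mono) (auto intro!: divide_nonneg_nonneg simp: less_imp_le)
  finally show ?thesis by (simp add: mult.assoc)
qed

section \<open>Cancellation of the cross terms and the generator inequality\<close>

lemma sum_split_diag:
  fixes f :: "'b \<Rightarrow> 'b \<Rightarrow> real"
  assumes "finite A"
  shows "(\<Sum>\<gamma>\<in>A. \<Sum>\<beta>\<in>A. f \<gamma> \<beta>) = (\<Sum>\<gamma>\<in>A. f \<gamma> \<gamma>) + (\<Sum>\<gamma>\<in>A. \<Sum>\<beta>\<in>A - {\<gamma>}. f \<gamma> \<beta>)"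
  using assms by (simp add: sum.remove sum.distrib)

text \<open>Only the diagonal survives. The identity is used with the given \<open>k\<close> for the
  drift and with constant multiplicity 1 for the gradient term of the Laplacian.\<close>

lemma root_double_sum:
  fixes R Rp :: "(real ^ 'd) set"
  assumes R: "root_system R" "positive_root_system R Rp"
    and k: "multiplicity_function R k" and x: "x \<in> weyl_chamber Rp"
  shows "(\<Sum>\<gamma>\<in>Rp. \<Sum>\<beta>\<in>Rp. k \<gamma> * (\<beta> \<bullet> \<gamma>) / ((\<beta> \<bullet> x) * (\<gamma> \<bullet> x))) = (\<Sum>\<gamma>\<in>Rp. k \<gamma> * (norm \<gamma> / (\<gamma> \<bullet> x))\<^sup>2)"
  unfolding sum_split_diag[OF positive_rootsD(1)[OF R]] root_cross_terms[OF R k x]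
  by (simp add: power_divide power2_norm_eq_inner) (simp add: power2_eq_square)

lemma log_der_dunkl_drift:
  fixes R Rp :: "(real ^ 'd) set"
  assumes R: "root_system R" "positive_root_system R Rp"
    and k: "multiplicity_function R k" and x: "x \<in> weyl_chamber Rp"
  shows "log_der Rp x (dunkl_drift Rp k x) = (\<Sum>\<gamma>\<in>Rp. k \<gamma> * (norm \<gamma> / (\<gamma> \<bullet> x))\<^sup>2)"
proof -
  have "log_der Rp x (dunkl_drift Rp k x) = (\<Sum>\<beta>\<in>Rp. \<Sum>\<gamma>\<in>Rp. k \<gamma> * (\<beta> \<bullet> \<gamma>) / ((\<beta> \<bullet> x) * (\<gamma> \<bullet> x)))"
    unfolding log_der_def dunkl_drift_def inner_sum_right sum_divide_distrib
    by (intro sum.cong refl) (simp add: mult.commute)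
  also have "\<dots> = (\<Sum>\<gamma>\<in>Rp. \<Sum>\<beta>\<in>Rp. k \<gamma> * (\<beta> \<bullet> \<gamma>) / ((\<beta> \<bullet> x) * (\<gamma> \<bullet> x)))" by (rule sum.swap)
  finally show ?thesis using root_double_sum[OF assms] by simp
qed

lemma half_laplacian:
  "(2 * a * S / d - j * (j - 1) * P * S / e) / 2 = a * S / d - j * P / e * ((j - 1) / 2 * S)"
  for a S d j P e :: real
proof -
  define u where "u = (j - 1) / 2"
  have j: "j - 1 = 2 * u" by (simp add: u_def)
  have "j * (2 * u) * P * S / e = 2 * (j * P / e * (u * S))" by simp
  moreover have "2 * a * S / d = 2 * (a * S / d)" by simp
  moreover have "(v - w) / 2 = v' - w'" if "w = 2 * w'" "v = 2 * v'" for v v' w w' :: real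
    using that by simp
  ultimately show ?thesis unfolding u_def[symmetric] unfolding j by blast
qed

text \<open>The cross terms vanish, so the drift contributes at least \<open>(\<nu> + 1/2) S\<close> against the
  \<open>(m + 1) S / 2\<close> of the second-order part; the bounded drift is absorbed by completing the square.\<close>

lemma test_fun_generator_le:
  fixes R Rp :: "(real ^ 'd) set"
  assumes R: "root_system R" "positive_root_system R Rp"
    and k: "multiplicity_function R k" and k\<nu>: "\<forall>\<alpha>\<in>Rp. k \<alpha> \<ge> \<nu> + 1 / 2"
    and m: "even m" "real m < 2 * \<nu>" and \<epsilon>: "\<epsilon> > 0"
    and x: "x \<in> weyl_chamber Rp" and c: "norm c \<le> Kb"
  shows "- (real m * wall_prod Rp m x * log_der Rp x (dunkl_drift Rp k x + c) / (\<epsilon> + wall_prod Rp m x)\<^sup>2)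
    \<le> real m * real (card Rp) * (Kb\<^sup>2 / (4 * \<nu> - 2 * real m)) * test_fun Rp m \<epsilon> x - test_fun_laplacian Rp m \<epsilon> x / 2"
proof -
  \<comment> \<open>\<open>\<theta>\<close> is half the gap between \<open>2 * \<nu>\<close> and
    \<open>m\<close>: the part of the wall repulsion left over after it has balanced the
    second-order terms, and available against the bounded drift.\<close>
  define P S \<theta> where "P = wall_prod Rp m x" and "S = wall_sum Rp x" and "\<theta> = \<nu> - real m / 2"
  have P: "P > 0" using wall_prod_pos[OF x] by (simp add: P_def)
  have \<theta>: "\<theta> > 0" using m by (simp add: \<theta>_def)
  have S: "S \<ge> 0" unfolding S_def wall_sum_def by (intro sum_nonneg) auto
  define A where "A = (\<Sum>\<alpha>\<in>Rp. norm \<alpha> / (\<alpha> \<bullet> x))"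
  have pos: "\<alpha> \<bullet> x > 0" if "\<alpha> \<in> Rp" for \<alpha> using x that by (auto simp: weyl_chamber_def)
  have th: "(\<nu> + 1 / 2) * S = \<theta> * S + (real m + 1) / 2 * S" by (simp add: \<theta>_def field_simps)
  have "log_der Rp x (dunkl_drift Rp k x + c) = log_der Rp x (dunkl_drift Rp k x) + log_der Rp x c"
    by (simp add: log_der_def inner_add_right add_divide_distrib sum.distrib)
  moreover have "log_der Rp x (dunkl_drift Rp k x) \<ge> (\<nu> + 1 / 2) * S"
    unfolding log_der_dunkl_drift[OF R k x] S_def wall_sum_def sum_distrib_left
    using k\<nu> by (intro sum_mono mult_right_mono) auto
  moreover have "log_der Rp x c \<ge> - (Kb * A)"
    unfolding log_der_def A_def sum_distrib_left sum_negf[symmetric]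
  proof (rule sum_mono)
    fix \<alpha> assume a: "\<alpha> \<in> Rp"
    have "- (norm \<alpha> * norm c) \<le> \<alpha> \<bullet> c" using Cauchy_Schwarz_ineq2[of \<alpha> c] by linarith
    moreover have "norm \<alpha> * norm c \<le> Kb * norm \<alpha>"
      using mult_left_mono[OF c norm_ge_zero[of \<alpha>]] by (simp add: mult.commute)
    ultimately have "- (Kb * norm \<alpha>) / (\<alpha> \<bullet> x) \<le> (\<alpha> \<bullet> c) / (\<alpha> \<bullet> x)"
      using pos[OF a] by (intro divide_right_mono) auto
    thus "- (Kb * (norm \<alpha> / (\<alpha> \<bullet> x))) \<le> (\<alpha> \<bullet> c) / (\<alpha> \<bullet> x)" by simp
  qed
  moreover have "Kb * A - \<theta> * S \<le> real (card Rp) * (Kb\<^sup>2 / (4 * \<theta>))"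
  proof -
    have "Kb * A - \<theta> * S = (\<Sum>\<alpha>\<in>Rp. Kb * (norm \<alpha> / (\<alpha> \<bullet> x)) - \<theta> * (norm \<alpha> / (\<alpha> \<bullet> x))\<^sup>2)"
      by (simp add: A_def S_def wall_sum_def sum_distrib_left sum_subtractf)
    also have "\<dots> \<le> (\<Sum>\<alpha>\<in>Rp. Kb\<^sup>2 / (4 * \<theta>))"
    proof (rule sum_mono)
      fix \<alpha>
      have "0 \<le> (2 * \<theta> * u - Kb)\<^sup>2 / (4 * \<theta>)" for u using \<theta> by simp
      moreover have "(2 * \<theta> * u - Kb)\<^sup>2 / (4 * \<theta>) = Kb\<^sup>2 / (4 * \<theta>) - (Kb * u - \<theta> * u\<^sup>2)" for u
        using \<theta> by (simp add: field_simps power2_eq_square)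
      ultimately have "0 \<le> Kb\<^sup>2 / (4 * \<theta>) - (Kb * u - \<theta> * u\<^sup>2)" for u by metis
      from this[of "norm \<alpha> / (\<alpha> \<bullet> x)"]
      show "Kb * (norm \<alpha> / (\<alpha> \<bullet> x)) - \<theta> * (norm \<alpha> / (\<alpha> \<bullet> x))\<^sup>2 \<le> Kb\<^sup>2 / (4 * \<theta>)" by linarith
    qed
    finally show ?thesis by simp
  qed
  ultimately have main: "- log_der Rp x (dunkl_drift Rp k x + c) + (real m + 1) / 2 * S \<le> real (card Rp) * (Kb\<^sup>2 / (4 * \<theta>))"
    using th by linarith
  define q where "q = real m * P / (\<epsilon> + P)\<^sup>2"
  have q0: "q \<ge> 0" using P \<epsilon> by (simp add: q_def)
  have qle: "q \<le> real m * (1 / (\<epsilon> + P))"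
  proof -
    have "P / (\<epsilon> + P)\<^sup>2 \<le> (\<epsilon> + P) / (\<epsilon> + P)\<^sup>2" using \<epsilon> P by (intro divide_right_mono) auto
    also have "\<dots> = 1 / (\<epsilon> + P)" by (simp add: power2_eq_square)
    finally have "real m * (P / (\<epsilon> + P)\<^sup>2) \<le> real m * (1 / (\<epsilon> + P))" by (intro mult_left_mono) auto
    thus ?thesis by (simp add: q_def)
  qed
  \<comment> \<open>Bounding one factor \<open>P / (\<epsilon> + P)\<close> by 1 in the squared
    gradient term brings it to the common prefactor \<open>q\<close>; then
    \<open>m - (m - 1) / 2 = (m + 1) / 2\<close> gives the weight that the drift has to
    beat.\<close>
  have lap: "test_fun_laplacian Rp m \<epsilon> x / 2 \<le> q * ((real m + 1) / 2 * S)"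
  proof -
    have "(real m * P)\<^sup>2 * S / (\<epsilon> + P) ^ 3 \<le> (real m)\<^sup>2 * P * S / (\<epsilon> + P)\<^sup>2"
    proof -
      have "(real m * P)\<^sup>2 * S / (\<epsilon> + P) ^ 3 = (real m)\<^sup>2 * P * S / (\<epsilon> + P)\<^sup>2 * (P / (\<epsilon> + P))"
        by (simp add: power2_eq_square power3_eq_cube)
      also have "\<dots> \<le> (real m)\<^sup>2 * P * S / (\<epsilon> + P)\<^sup>2"
        using P \<epsilon> S by (intro mult_left_le divide_nonneg_nonneg mult_nonneg_nonneg) auto
      finally show ?thesis .
    qed
    moreover have "test_fun_laplacian Rp m \<epsilon> x / 2 =
      (real m * P)\<^sup>2 * S / (\<epsilon> + P) ^ 3 - q * ((real m - 1) / 2 * S)"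
      unfolding test_fun_laplacian_def Let_def q_def P_def[symmetric] S_def[symmetric]
      by (rule half_laplacian)
    moreover have "(real m)\<^sup>2 * P * S / (\<epsilon> + P)\<^sup>2 = q * (real m * S)"
      by (simp add: q_def power2_eq_square)
    ultimately have "test_fun_laplacian Rp m \<epsilon> x / 2 \<le> q * (real m * S) - q * ((real m - 1) / 2 * S)" by linarith
    also have "\<dots> = q * ((real m + 1) / 2 * S)" by (simp add: field_simps)
    finally show ?thesis .
  qed
  have "q * (- log_der Rp x (dunkl_drift Rp k x + c) + (real m + 1) / 2 * S) \<le> q * (real (card Rp) * (Kb\<^sup>2 / (4 * \<theta>)))"
    using main q0 by (rule mult_left_mono)
  also have "\<dots> \<le> real m * (1 / (\<epsilon> + P)) * (real (card Rp) * (Kb\<^sup>2 / (4 * \<theta>)))"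
    using qle \<theta> by (intro mult_right_mono) auto
  also have "\<dots> = real m * real (card Rp) * (Kb\<^sup>2 / (4 * \<nu> - 2 * real m)) * test_fun Rp m \<epsilon> x"
    by (simp add: test_fun_def P_def \<theta>_def algebra_simps)
  finally have "q * - log_der Rp x (dunkl_drift Rp k x + c) + q * ((real m + 1) / 2 * S) \<le>
      real m * real (card Rp) * (Kb\<^sup>2 / (4 * \<nu> - 2 * real m)) * test_fun Rp m \<epsilon> x"
    by (simp only: distrib_left)
  moreover have "q * - log_der Rp x (dunkl_drift Rp k x + c) =
      - (real m * wall_prod Rp m x * log_der Rp x (dunkl_drift Rp k x + c) / (\<epsilon> + wall_prod Rp m x)\<^sup>2)"
    by (simp add: q_def P_def)
  ultimately show ?thesis using lap by linarith
qed

section \<open>The process\<close>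

lemma integral_grid_sum:
  fixes f :: "real \<Rightarrow> 'b :: banach"
  assumes f: "continuous_on {s..t} f" and h: "h \<ge> 0" and n: "s + real n * h \<le> t"
  shows "integral {s..s + real n * h} f = (\<Sum>i<n. integral {s + real i * h..s + real (Suc i) * h} f)"
  using n
proof (induction n)
  case (Suc n)
  have le: "s + real n * h \<le> s + real (Suc n) * h" using h by (simp add: algebra_simps)
  have "integral {s..s + real (Suc n) * h} f =
      integral {s..s + real n * h} f + integral {s + real n * h..s + real (Suc n) * h} f"
  proof (rule Henstock_Kurzweil_Integration.integral_combine[symmetric])
    show "f integrable_on {s..s + real (Suc n) * h}"
      using Suc.prems by (intro integrable_continuous_real continuous_on_subset[OF f]) auto
    show "s \<le> s + real n * h" using h by simp
    show "s + real n * h \<le> s + real (Suc n) * h" by (rule le)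
  qed
  moreover have "integral {s..s + real n * h} f = (\<Sum>i<n. integral {s + real i * h..s + real (Suc i) * h} f)"
    using Suc.prems le by (intro Suc.IH) linarith
  ultimately show ?case unfolding sum.lessThan_Suc by simp
qed simp

lemma integral_deviation_le:
  fixes f :: "real \<Rightarrow> 'b :: euclidean_space"
  assumes f: "continuous_on {s..t} f" and st: "s \<le> t"
    and \<eta>: "\<And>u. u \<in> {s..t} \<Longrightarrow> norm (f u - c) \<le> \<eta>"
  shows "norm (integral {s..t} f - (t - s) *\<^sub>R c) \<le> (t - s) * \<eta>"
proof -
  have "f integrable_on {s..t}" by (rule integrable_continuous_real[OF f])
  hence "integral {s..t} f - (t - s) *\<^sub>R c = integral {s..t} (\<lambda>u. f u - c)"
    using st by (subst Henstock_Kurzweil_Integration.integral_diff) auto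
  also have "norm \<dots> \<le> \<eta> * (t - s)"
    using \<eta> st by (intro integral_bound continuous_intros f) auto
  finally show ?thesis by (simp add: mult.commute)
qed

locale dunkl_setup = brownian_setup M F T B
  for M :: "'a measure" and F T and B :: "real \<Rightarrow> 'a \<Rightarrow> real ^ 'd" +
  fixes R Rp :: "(real ^ 'd) set" and k :: "real ^ 'd \<Rightarrow> real"
    and b :: "real \<Rightarrow> real ^ 'd \<Rightarrow> real ^ 'd" and x0 :: "real ^ 'd" and X :: "real \<Rightarrow> 'a \<Rightarrow> real ^ 'd"
    and \<nu> Kb :: real
  assumes root_sys: "root_system R" "positive_root_system R Rp"
    and mult: "multiplicity_function R k"
    and k_ge: "\<forall>\<alpha>\<in>Rp. k \<alpha> \<ge> \<nu> + 1 / 2" and \<nu>_pos: "\<nu> > 0"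
    and b_bound: "\<And>t x. \<lbrakk>t \<in> {0..T}; x \<in> weyl_chamber Rp\<rbrakk> \<Longrightarrow> norm (b t x) \<le> Kb"
    and drift: "lipschitz_holder_drift (weyl_chamber Rp) T b"
    and x0: "x0 \<in> weyl_chamber Rp"
    and rdp: "radial_dunkl_process M F T B Rp k b x0 X"
begin

abbreviation "W \<equiv> weyl_chamber Rp"
abbreviation "D \<equiv> dunkl_drift Rp k"

lemma fin: "finite Rp" using positive_rootsD[OF root_sys] by blast

lemma k_pos: "\<forall>\<alpha>\<in>Rp. k \<alpha> > 0" using k_ge \<nu>_pos by (force intro: less_le_trans[of 0 "\<nu> + 1 / 2"])

lemma X_measurable_F: "t \<in> {0..T} \<Longrightarrow> X t \<in> borel_measurable (F t)"
  using rdp by (simp add: radial_dunkl_process_def adapted_process_def)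

lemma X_measurable [measurable]: "t \<in> {0..T} \<Longrightarrow> X t \<in> borel_measurable M"
  using measurable_from_subalg[OF subalg X_measurable_F] by blast

lemma b_modulus:
  obtains L where "L > 0"
    "\<And>s t x y. \<lbrakk>s \<in> {0..T}; t \<in> {0..T}; x \<in> W; y \<in> W\<rbrakk> \<Longrightarrow>
       norm (b t x - b s y) \<le> L * (sqrt \<bar>t - s\<bar> + norm (x - y))"
  using lipschitz_holder_driftE[OF drift] T_pos by (metis less_imp_le)

text \<open>Splitting and recombining the integrals requires each singular integrand to be
  integrable; it is continuous because a path in the open chamber keeps all
  \<open>\<alpha> \<bullet> X s\<close> nonzero.\<close>

lemma AE_path:
  "AE \<omega> in M. dunkl_path Rp k b T x0 (\<lambda>t. B t \<omega>) (\<lambda>t. X t \<omega>) \<and> continuous_on {0..T} (\<lambda>t. b t (X t \<omega>))"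
proof -
  obtain L where L: "L > 0"
    "\<And>s t x y. \<lbrakk>s \<in> {0..T}; t \<in> {0..T}; x \<in> W; y \<in> W\<rbrakk> \<Longrightarrow>
       norm (b t x - b s y) \<le> L * (sqrt \<bar>t - s\<bar> + norm (x - y))"
    by (rule b_modulus) blast
  have "AE \<omega> in M.
        continuous_on {0..T} (\<lambda>t. X t \<omega>) \<and>
        (\<forall>t\<in>{0..T}. X t \<omega> \<in> W) \<and>
        (\<forall>t\<in>{0..T}.
           X t \<omega> = x0 + B t \<omega>
             + (\<Sum>\<alpha>\<in>Rp. integral {0..t} (\<lambda>s. (k \<alpha> / (\<alpha> \<bullet> X s \<omega>)) *\<^sub>R \<alpha>))
             + integral {0..t} (\<lambda>s. b s (X s \<omega>)))"
    using rdp by (simp add: radial_dunkl_process_def)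
  thus ?thesis
  proof eventually_elim
    case (elim \<omega>)
    hence c: "continuous_on {0..T} (\<lambda>t. X t \<omega>)" and w: "\<And>t. t \<in> {0..T} \<Longrightarrow> X t \<omega> \<in> W"
      and e: "\<And>t. t \<in> {0..T} \<Longrightarrow> X t \<omega> = x0 + B t \<omega>
             + (\<Sum>\<alpha>\<in>Rp. integral {0..t} (\<lambda>s. (k \<alpha> / (\<alpha> \<bullet> X s \<omega>)) *\<^sub>R \<alpha>))
             + integral {0..t} (\<lambda>s. b s (X s \<omega>))" by auto
    have bc: "continuous_on {0..T} (\<lambda>t. b t (X t \<omega>))" by (rule continuous_on_drift_path[OF L c w])
    have Dc: "continuous_on {0..T} (\<lambda>t. D (X t \<omega>))" by (rule continuous_on_dunkl_drift[OF c]) (use w in auto)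
    have "X t \<omega> = x0 + B t \<omega> + integral {0..t} (\<lambda>r. D (X r \<omega>) + b r (X r \<omega>))" if t: "t \<in> {0..T}" for t
    proof -
      have sub: "{0..t} \<subseteq> {0..T}" using t by auto
      have "(\<lambda>s. (k \<alpha> / (\<alpha> \<bullet> X s \<omega>)) *\<^sub>R \<alpha>) integrable_on {0..t}" if a: "\<alpha> \<in> Rp" for \<alpha>
      proof (intro integrable_continuous_real continuous_intros)
        show "continuous_on {0..t} (\<lambda>s. X s \<omega>)" by (rule continuous_on_subset[OF c sub])
        show "\<forall>s\<in>{0..t}. \<alpha> \<bullet> X s \<omega> \<noteq> 0"
        proof
          fix s assume "s \<in> {0..t}"
          hence "X s \<omega> \<in> W" using w sub by blast
          hence "\<alpha> \<bullet> X s \<omega> > 0" using a by (simp add: weyl_chamber_def)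
          thus "\<alpha> \<bullet> X s \<omega> \<noteq> 0" by simp
        qed
      qed
      hence "(\<Sum>\<alpha>\<in>Rp. integral {0..t} (\<lambda>s. (k \<alpha> / (\<alpha> \<bullet> X s \<omega>)) *\<^sub>R \<alpha>)) = integral {0..t} (\<lambda>s. D (X s \<omega>))"
        unfolding dunkl_drift_def by (intro Henstock_Kurzweil_Integration.integral_sum[symmetric] fin)
      moreover have "integral {0..t} (\<lambda>r. D (X r \<omega>) + b r (X r \<omega>)) =
          integral {0..t} (\<lambda>r. D (X r \<omega>)) + integral {0..t} (\<lambda>r. b r (X r \<omega>))"
        by (intro Henstock_Kurzweil_Integration.integral_add integrable_continuous_real
            continuous_on_subset[OF bc sub] continuous_on_subset[OF Dc sub])
      ultimately show ?thesis using e[OF t] by simp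
    qed
    thus ?case unfolding dunkl_path_def using c w bc by blast
  qed
qed

text \<open>One random number \<open>V\<close> bounds the noise, the solution and the total
  variation of the drift part at once, so the suprema over time and the time integral need not
  themselves be random variables.\<close>

definition controlled :: "('a \<Rightarrow> real) \<Rightarrow> 'a \<Rightarrow> bool" where
  "controlled V \<omega> \<longleftrightarrow> dunkl_path Rp k b T x0 (\<lambda>t. B t \<omega>) (\<lambda>t. X t \<omega>) \<and>
     continuous_on {0..T} (\<lambda>t. b t (X t \<omega>)) \<and>
     (\<forall>t\<in>{0..T}. norm (B t \<omega>) \<le> V \<omega> \<and> norm (X t \<omega>) \<le> V \<omega>) \<and>
     integral {0..T} (\<lambda>r. norm (D (X r \<omega>) + b r (X r \<omega>))) \<le> V \<omega>"

text \<open>The a priori bound is linear in the maximum of the noise, so a multiple of the variable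
  from \<open>B_sup_moments\<close> works; as it is at least 1, its top moment dominates the lower
  ones.\<close>

lemma controlled_moments:
  obtains V where "V \<in> borel_measurable M" "\<And>\<omega>. V \<omega> \<ge> 1"
    "\<And>j. j \<le> N \<Longrightarrow> integrable M (\<lambda>\<omega>. V \<omega> ^ j)" "AE \<omega> in M. controlled V \<omega>"
proof -
  obtain \<rho> where "\<forall>\<alpha>\<in>Rp. \<rho> \<bullet> \<alpha> > 0" using root_sys(2) unfolding positive_root_system_def by blast
  have "\<exists>C\<ge>1. \<forall>\<beta> x K. dunkl_path Rp k b T x0 \<beta> x \<and> K \<ge> 1 \<and> (\<forall>t\<in>{0..T}. norm (\<beta> t) \<le> K) \<and>
      continuous_on {0..T} (\<lambda>t. b t (x t)) \<longrightarrow>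
      (\<forall>t\<in>{0..T}. norm (x t) \<le> C * K) \<and>
      integral {0..T} (\<lambda>r. norm (D (x r) + b r (x r))) \<le> C * K"
    by (rule dunkl_path_bound[OF fin k_pos \<open>\<forall>\<alpha>\<in>Rp. \<rho> \<bullet> \<alpha> > 0\<close> T_pos]) (rule b_bound)
  then obtain C where C: "C \<ge> 1"
    "\<forall>\<beta> x K. dunkl_path Rp k b T x0 \<beta> x \<and> K \<ge> 1 \<and> (\<forall>t\<in>{0..T}. norm (\<beta> t) \<le> K) \<and>
      continuous_on {0..T} (\<lambda>t. b t (x t)) \<longrightarrow>
      (\<forall>t\<in>{0..T}. norm (x t) \<le> C * K) \<and>
      integral {0..T} (\<lambda>r. norm (D (x r) + b r (x r))) \<le> C * K"
    by (elim exE conjE) (rule that)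
  obtain V where V: "V \<in> borel_measurable M" "\<And>\<omega>. V \<omega> \<ge> 1" "integrable M (\<lambda>\<omega>. V \<omega> ^ N)"
    "AE \<omega> in M. \<forall>t\<in>{0..T}. norm (B t \<omega>) \<le> V \<omega>" by (rule B_sup_moments[of N]) blast
  define U where "U \<omega> = C * V \<omega>" for \<omega>
  have CV: "U \<omega> \<ge> V \<omega>" for \<omega> using C(1) V(2)[of \<omega>] mult_right_mono[of 1 C "V \<omega>"] by (simp add: U_def)
  have U1: "U \<omega> \<ge> 1" for \<omega> using CV[of \<omega>] V(2)[of \<omega>] by linarith
  have Um: "U \<in> borel_measurable M" unfolding U_def using V(1) by measurable
  show ?thesis
  proof
    show "U \<in> borel_measurable M" by (rule Um)
    show "U \<omega> \<ge> 1" for \<omega> by (rule U1)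
    have int: "integrable M (\<lambda>\<omega>. U \<omega> ^ N)" unfolding U_def power_mult_distrib using V(3) by simp
    show "integrable M (\<lambda>\<omega>. U \<omega> ^ j)" if "j \<le> N" for j
    proof (rule Bochner_Integration.integrable_bound[OF int])
      show "(\<lambda>\<omega>. U \<omega> ^ j) \<in> borel_measurable M" using Um by measurable
      have "U \<omega> ^ j \<le> U \<omega> ^ N" "U \<omega> ^ j \<ge> 0" for \<omega>
        using U1[of \<omega>] that by (auto intro: power_increasing)
      hence "norm (U \<omega> ^ j) \<le> norm (U \<omega> ^ N)" for \<omega>
        unfolding real_norm_def by (smt (verit))
      thus "AE \<omega> in M. norm (U \<omega> ^ j) \<le> norm (U \<omega> ^ N)" by simp
    qed
    show "AE \<omega> in M. controlled U \<omega>"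
      using AE_path V(4)
    proof eventually_elim
      case (elim \<omega>)
      have "(\<forall>t\<in>{0..T}. norm (X t \<omega>) \<le> C * V \<omega>) \<and>
        integral {0..T} (\<lambda>r. norm (D (X r \<omega>) + b r (X r \<omega>))) \<le> C * V \<omega>"
        using elim V(2) by (intro C(2)[rule_format, where \<beta>="\<lambda>t. B t \<omega>"]) auto
      moreover have "\<forall>t\<in>{0..T}. norm (B t \<omega>) \<le> U \<omega>"
        using elim CV[of \<omega>] by (meson order_trans)
      ultimately show ?case using elim unfolding controlled_def U_def by blast
    qed
  qed
qed

lemma AE_X_W: "t \<in> {0..T} \<Longrightarrow> AE \<omega> in M. X t \<omega> \<in> W"
  using AE_path by (auto simp: dunkl_path_def)

text \<open>The growth bound is asked for only inside the chamber, so a function built from terms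
  with poles at the walls qualifies as soon as these poles cancel.\<close>

lemma poly_integrable:
  assumes u: "u \<in> {0..T}" and m: "\<phi> \<in> borel_measurable borel"
    and le: "\<And>x. x \<in> W \<Longrightarrow> \<bar>\<phi> x\<bar> \<le> c * (1 + norm x) ^ N"
  shows "integrable M (\<lambda>\<omega>. \<phi> (X u \<omega>) :: real)"
proof -
  obtain V where V: "V \<in> borel_measurable M" "\<And>\<omega>. V \<omega> \<ge> 1"
    "\<And>j. j \<le> N \<Longrightarrow> integrable M (\<lambda>\<omega>. V \<omega> ^ j)" "AE \<omega> in M. controlled V \<omega>"
    by (rule controlled_moments[of N]) blast
  have int: "integrable M (\<lambda>\<omega>. \<bar>c\<bar> * 2 ^ N * V \<omega> ^ N)" using V(3)[of N] by simp
  show ?thesis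
  proof (rule Bochner_Integration.integrable_bound[OF int])
    show "(\<lambda>\<omega>. \<phi> (X u \<omega>)) \<in> borel_measurable M" using m X_measurable[OF u] by measurable
    show "AE \<omega> in M. norm (\<phi> (X u \<omega>)) \<le> norm (\<bar>c\<bar> * 2 ^ N * V \<omega> ^ N)"
      using V(4)
    proof eventually_elim
      case (elim \<omega>)
      hence x: "X u \<omega> \<in> W" "norm (X u \<omega>) \<le> V \<omega>" using u unfolding controlled_def dunkl_path_def by auto
      have "\<bar>\<phi> (X u \<omega>)\<bar> \<le> c * (1 + norm (X u \<omega>)) ^ N" by (rule le[OF x(1)])
      also have "\<dots> \<le> \<bar>c\<bar> * (2 * V \<omega>) ^ N"
        using x V(2)[of \<omega>] by (intro mult_mono power_mono) auto
      finally show ?case using V(2)[of \<omega>] by (simp add: power_mult_distrib abs_mult)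
    qed
  qed
qed

end

section \<open>Measurability and growth of the test function and its Laplacian\<close>

lemma wall_prod_measurable [measurable]: "wall_prod Rp m \<in> borel_measurable borel"
  unfolding wall_prod_def[abs_def] by measurable

lemma wall_sum_measurable [measurable]: "wall_sum Rp \<in> borel_measurable borel"
  unfolding wall_sum_def[abs_def] by measurable

lemma test_fun_measurable [measurable]: "test_fun Rp m \<epsilon> \<in> borel_measurable borel"
  unfolding test_fun_def[abs_def] by measurable

lemma test_fun_laplacian_measurable [measurable]: "test_fun_laplacian Rp m \<epsilon> \<in> borel_measurable borel"
  unfolding test_fun_laplacian_def[abs_def] Let_def by measurable

lemma test_fun_bounds:
  assumes "even m" "\<epsilon> > 0"
  shows "test_fun Rp m \<epsilon> x \<ge> 0" "test_fun Rp m \<epsilon> x \<le> 1 / \<epsilon>"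
  using wall_prod_nonneg[OF assms(1), of Rp x] assms(2)
  by (auto simp: test_fun_def intro!: divide_left_mono mult_pos_pos)

lemma poly_bound_weaken:
  fixes a r :: real
  assumes "r \<ge> 1" "a \<ge> 0"
  shows "(1 + r * a) ^ N \<le> r ^ N * (1 + a) ^ N"
  unfolding power_mult_distrib[symmetric] using assms
  by (intro power_mono) (auto simp: algebra_simps)

lemma half_le_self: "0 \<le> z \<Longrightarrow> z / 2 \<le> z" for z :: real
  by simp

lemma quotient_power_bounds:
  fixes P :: real
  assumes "\<epsilon> > 0" "P \<ge> 0"
  shows "P / (\<epsilon> + P)\<^sup>2 \<le> P / \<epsilon>\<^sup>2" "P\<^sup>2 / (\<epsilon> + P) ^ 3 \<le> P / \<epsilon>\<^sup>2"
proof -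
  show 1: "P / (\<epsilon> + P)\<^sup>2 \<le> P / \<epsilon>\<^sup>2"
    using assms by (intro divide_left_mono power_mono mult_pos_pos zero_less_power) auto
  have "P\<^sup>2 / (\<epsilon> + P) ^ 3 = P / (\<epsilon> + P)\<^sup>2 * (P / (\<epsilon> + P))"
    by (simp add: power2_eq_square power3_eq_cube)
  also have "\<dots> \<le> P / (\<epsilon> + P)\<^sup>2" using assms by (intro mult_left_le) auto
  finally show "P\<^sup>2 / (\<epsilon> + P) ^ 3 \<le> P / \<epsilon>\<^sup>2" using 1 by linarith
qed

text \<open>The poles of \<open>wall_sum\<close> are double, and each term of the Laplacian carries
  at least one factor \<open>P\<close>, which cancels them for \<open>m \<ge> 2\<close>.\<close>

lemma test_fun_laplacian_bound:
  fixes Rp :: "(real ^ 'd) set"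
  assumes fin: "finite Rp" and m: "even m" "m \<ge> 2" and \<epsilon>: "\<epsilon> > 0"
  obtains C where "C \<ge> 0"
    "\<And>x. x \<in> weyl_chamber Rp \<Longrightarrow> \<bar>test_fun_laplacian Rp m \<epsilon> x\<bar> \<le> C * (1 + norm x) ^ (m * card Rp)"
proof -
  obtain r where r: "r \<ge> 1" "\<forall>\<alpha>\<in>Rp. norm \<alpha> \<le> r" by (rule roots_norm_bound[OF fin])
  let ?C = "3 * (real m)\<^sup>2 / \<epsilon>\<^sup>2 * (real (card Rp) * r\<^sup>2 * r ^ (m * card Rp))"
  show ?thesis
  proof
    show "?C \<ge> 0" using r by simp
    fix x assume x: "x \<in> weyl_chamber Rp"
    define P S where "P = wall_prod Rp m x" and "S = wall_sum Rp x"
    have P: "P \<ge> 0" using wall_prod_nonneg[OF m(1)] by (simp add: P_def)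
    have S: "S \<ge> 0" unfolding S_def wall_sum_def by (intro sum_nonneg) auto
    define A B where "A = 2 * (real m * P)\<^sup>2 * S / (\<epsilon> + P) ^ 3" and "B = real m * (real m - 1) * P * S / (\<epsilon> + P)\<^sup>2"
    have "A = 2 * (real m)\<^sup>2 * S * (P\<^sup>2 / (\<epsilon> + P) ^ 3)" by (simp add: A_def power_mult_distrib)
    also have "\<dots> \<le> 2 * (real m)\<^sup>2 * S * (P / \<epsilon>\<^sup>2)"
      using S quotient_power_bounds[OF \<epsilon> P] by (intro mult_left_mono) auto
    finally have A: "A \<le> 2 * ((real m)\<^sup>2 / \<epsilon>\<^sup>2 * (P * S))" by (simp add: mult_ac)
    have "B = real m * (real m - 1) * S * (P / (\<epsilon> + P)\<^sup>2)" by (simp add: B_def)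
    also have "\<dots> \<le> (real m)\<^sup>2 * S * (P / \<epsilon>\<^sup>2)"
      using S m P quotient_power_bounds[OF \<epsilon> P] \<epsilon>
      by (intro mult_mono mult_right_mono) (auto simp: power2_eq_square)
    finally have B: "B \<le> (real m)\<^sup>2 / \<epsilon>\<^sup>2 * (P * S)" by (simp add: mult_ac)
    have "A \<ge> 0" "B \<ge> 0" using P S \<epsilon> m by (auto simp: A_def B_def)
    moreover have "test_fun_laplacian Rp m \<epsilon> x = A - B"
      by (simp add: test_fun_laplacian_def Let_def A_def B_def P_def S_def)
    ultimately have "\<bar>test_fun_laplacian Rp m \<epsilon> x\<bar> \<le> 3 * (real m)\<^sup>2 / \<epsilon>\<^sup>2 * (P * S)" using A B by simp
    also have "\<dots> \<le> 3 * (real m)\<^sup>2 / \<epsilon>\<^sup>2 * (real (card Rp) * r\<^sup>2 * (r ^ (m * card Rp) * (1 + norm x) ^ (m * card Rp)))"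
    proof (intro mult_left_mono)
      have "P * S \<le> real (card Rp) * r\<^sup>2 * (1 + r * norm x) ^ (m * card Rp)"
        unfolding P_def S_def by (rule wall_prod_sum_le[OF fin r x m(2)])
      also have "\<dots> \<le> real (card Rp) * r\<^sup>2 * (r ^ (m * card Rp) * (1 + norm x) ^ (m * card Rp))"
        by (intro mult_left_mono poly_bound_weaken r) auto
      finally show "P * S \<le> real (card Rp) * r\<^sup>2 * (r ^ (m * card Rp) * (1 + norm x) ^ (m * card Rp))" .
    qed simp
    finally show "\<bar>test_fun_laplacian Rp m \<epsilon> x\<bar> \<le> ?C * (1 + norm x) ^ (m * card Rp)" by (simp only: mult.assoc)
  qed
qed

context dunkl_setup
begin

text \<open>The one-step expansion over a Brownian increment: the coefficients are measurable with respect
  to the past, so the linear term has mean zero and the quadratic one gives half the Laplacian.\<close>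

lemma test_fun_noise_step:
  assumes m: "even m" "m \<ge> 2" and \<epsilon>: "\<epsilon> > 0"
  obtains C where "C \<ge> 0"
    "\<And>u v. \<lbrakk>0 \<le> u; u < v; v \<le> T\<rbrakk> \<Longrightarrow>
      expectation (\<lambda>\<omega>. test_fun Rp m \<epsilon> (X u \<omega> + (B v \<omega> - B u \<omega>)) - test_fun Rp m \<epsilon> (X u \<omega>))
      \<le> (v - u) * (expectation (\<lambda>\<omega>. test_fun_laplacian Rp m \<epsilon> (X u \<omega>)) / 2) + C * ((v - u) * sqrt (v - u))"
proof -
  obtain r where r: "r \<ge> 1" "\<forall>\<alpha>\<in>Rp. norm \<alpha> \<le> r" by (rule roots_norm_bound[OF fin])
  define N where "N = m * card Rp"
  define C\<epsilon> where "C\<epsilon> = 1 / \<epsilon>\<^sup>2 + 2 / \<epsilon> ^ 3 + 1 / \<epsilon> ^ 4"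
  have C\<epsilon>: "C\<epsilon> \<ge> 0" using \<epsilon> by (simp add: C\<epsilon>_def)
  obtain V where V: "V \<in> borel_measurable M" "\<And>\<omega>. V \<omega> \<ge> 1"
    "\<And>j. j \<le> 6 * N \<Longrightarrow> integrable M (\<lambda>\<omega>. V \<omega> ^ j)" "AE \<omega> in M. controlled V \<omega>"
    by (rule controlled_moments[of "6 * N"]) blast
  obtain C6 where C6: "C6 \<ge> 0"
    "\<And>s t. \<lbrakk>0 \<le> s; s < t; t \<le> T\<rbrakk> \<Longrightarrow> integrable M (\<lambda>\<omega>. norm (B t \<omega> - B s \<omega>) ^ (2 * 3))"
    "\<And>s t. \<lbrakk>0 \<le> s; s < t; t \<le> T\<rbrakk> \<Longrightarrow>
      expectation (\<lambda>\<omega>. norm (B t \<omega> - B s \<omega>) ^ (2 * 3)) \<le> C6 * (t - s) ^ 3"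
    by (rule B_increment_moment[of 3]) blast
  define EV where "EV = expectation (\<lambda>\<omega>. (16 * r) ^ (6 * N) * V \<omega> ^ (6 * N))"
  have EV: "EV \<ge> 0" unfolding EV_def using r V(2)
    by (intro Bochner_Integration.integral_nonneg mult_nonneg_nonneg zero_le_power) (auto intro: order_trans[of 0 1])
  define P where "P = wall_prod Rp m"
  have Pm [measurable]: "P \<in> borel_measurable borel" unfolding P_def by measurable
  \<comment> \<open>As a polynomial in the increment, the second-order expansion has coefficients
    \<open>c\<close> (linear), \<open>d\<close> (products over two roots) and \<open>e\<close>
    (squares for one root), all functions of \<open>X u\<close> alone. Independence is applied to
    each term, so each coefficient has to be integrable by itself in spite of its poles.\<close>
  define c where "c \<alpha> x = - (real m * P x / (\<epsilon> + P x)\<^sup>2 / (\<alpha> \<bullet> x))" for \<alpha> x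
  define G where "G x = (real m * P x)\<^sup>2 / (\<epsilon> + P x) ^ 3 - (real m)\<^sup>2 * P x / (\<epsilon> + P x)\<^sup>2 / 2" for x
  define d where "d \<alpha> \<beta> x = G x / ((\<alpha> \<bullet> x) * (\<beta> \<bullet> x))" for \<alpha> \<beta> x
  define e where "e \<alpha> x = real m * P x / (\<epsilon> + P x)\<^sup>2 / 2 / (\<alpha> \<bullet> x)\<^sup>2" for \<alpha> x
  have meas [measurable]: "c \<alpha> \<in> borel_measurable borel" "d \<alpha> \<beta> \<in> borel_measurable borel" "e \<alpha> \<in> borel_measurable borel" for \<alpha> \<beta>
    unfolding c_def[abs_def] d_def[abs_def] e_def[abs_def] G_def[abs_def] by measurable
  have P0: "P x \<ge> 0" for x using wall_prod_nonneg[OF m(1)] by (simp add: P_def)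
  have pos: "\<alpha> \<bullet> x > 0" if "x \<in> W" "\<alpha> \<in> Rp" for \<alpha> x using that by (auto simp: weyl_chamber_def)
  define w where "w x = (4 * r) ^ N * (1 + norm x) ^ N" for x :: "real ^ 'd"
  have w1: "P x / (\<alpha> \<bullet> x)\<^sup>2 \<le> w x" if "x \<in> W" "\<alpha> \<in> Rp" for \<alpha> x
  proof -
    have "P x / (\<alpha> \<bullet> x)\<^sup>2 \<le> (1 + r * norm x) ^ N"
      unfolding P_def N_def by (rule wall_prod_div_le[OF fin r that(1) m(2) that(2)])
    also have "\<dots> \<le> r ^ N * (1 + norm x) ^ N" by (intro poly_bound_weaken r) auto
    also have "\<dots> \<le> w x" unfolding w_def using r by (intro mult_right_mono power_mono) auto
    finally show ?thesis .
  qed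
  have w2: "P x \<le> w x" if "x \<in> W" for x
  proof -
    have "P x \<le> (4 * (1 + r * norm x)) ^ N"
      using wall_prod_expansion(1)[OF fin r that, of m 0] P0[of x] by (simp add: P_def N_def)
    also have "\<dots> = 4 ^ N * (1 + r * norm x) ^ N" by (rule power_mult_distrib)
    also have "\<dots> \<le> 4 ^ N * (r ^ N * (1 + norm x) ^ N)" by (intro mult_left_mono poly_bound_weaken r) auto
    finally show ?thesis by (simp add: w_def power_mult_distrib mult_ac)
  qed
  have G_le: "\<bar>G x\<bar> \<le> (real m)\<^sup>2 / \<epsilon>\<^sup>2 * P x" for x
  proof -
    have "(real m * P x)\<^sup>2 / (\<epsilon> + P x) ^ 3 \<le> (real m)\<^sup>2 * (P x / \<epsilon>\<^sup>2)"
      using mult_left_mono[OF quotient_power_bounds(2)[OF \<epsilon> P0[of x]], of "(real m)\<^sup>2"]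
      by (simp add: power_mult_distrib)
    moreover have "(real m)\<^sup>2 * P x / (\<epsilon> + P x)\<^sup>2 / 2 \<le> (real m)\<^sup>2 * (P x / \<epsilon>\<^sup>2)"
    proof -
      have "0 \<le> (real m)\<^sup>2 * P x / (\<epsilon> + P x)\<^sup>2" using P0[of x] by simp
      hence "(real m)\<^sup>2 * P x / (\<epsilon> + P x)\<^sup>2 / 2 \<le> (real m)\<^sup>2 * P x / (\<epsilon> + P x)\<^sup>2"
        by (rule half_le_self)
      also have "\<dots> \<le> (real m)\<^sup>2 * (P x / \<epsilon>\<^sup>2)"
        using mult_left_mono[OF quotient_power_bounds(1)[OF \<epsilon> P0[of x]], of "(real m)\<^sup>2"] by simp
      finally show ?thesis .
    qed
    moreover have "(real m * P x)\<^sup>2 / (\<epsilon> + P x) ^ 3 \<ge> 0" "(real m)\<^sup>2 * P x / (\<epsilon> + P x)\<^sup>2 / 2 \<ge> 0"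
      using P0[of x] \<epsilon> by auto
    ultimately show ?thesis unfolding G_def by simp
  qed
  \<comment> \<open>Simple and mixed poles are reduced to double poles, which \<open>w1\<close>
    shows to be cancelled by \<open>P\<close>.\<close>
  have inv_le: "1 / a \<le> 1 + 1 / a\<^sup>2" "1 / (a * b') \<le> 1 / a\<^sup>2 + 1 / b'\<^sup>2" if "a > 0" "b' > 0" for a b' :: real
  proof -
    have sq: "y * z \<le> y\<^sup>2 + z\<^sup>2" for y z :: real
    proof -
      have "2 * (y * z) \<le> y\<^sup>2 + z\<^sup>2" using sum_squares_bound[of y z] by (simp add: mult.assoc)
      moreover have "0 \<le> y\<^sup>2 + z\<^sup>2" by simp
      ultimately show ?thesis by linarith
    qed
    show "1 / a \<le> 1 + 1 / a\<^sup>2" using sq[of 1 "1 / a"] by (simp add: power_one_over)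
    show "1 / (a * b') \<le> 1 / a\<^sup>2 + 1 / b'\<^sup>2" using sq[of "1 / a" "1 / b'"] by (simp add: power_one_over)
  qed
  have bc: "\<bar>c \<alpha> x\<bar> \<le> (2 * real m / \<epsilon>\<^sup>2 * (4 * r) ^ N) * (1 + norm x) ^ N" if "x \<in> W" "\<alpha> \<in> Rp" for \<alpha> x
  proof -
    have a: "\<alpha> \<bullet> x > 0" by (rule pos[OF that])
    have "\<bar>c \<alpha> x\<bar> = real m * (P x / (\<epsilon> + P x)\<^sup>2) * (1 / (\<alpha> \<bullet> x))"
      using a P0[of x] by (simp add: c_def abs_mult)
    also have "\<dots> \<le> real m * (P x / \<epsilon>\<^sup>2) * (1 + 1 / (\<alpha> \<bullet> x)\<^sup>2)"
      using quotient_power_bounds(1)[OF \<epsilon> P0[of x]] inv_le(1)[OF a a] a P0[of x] \<epsilon>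
      by (intro mult_mono mult_left_mono) auto
    also have "\<dots> = real m / \<epsilon>\<^sup>2 * (P x + P x / (\<alpha> \<bullet> x)\<^sup>2)" by (simp add: algebra_simps add_divide_distrib)
    also have "\<dots> \<le> real m / \<epsilon>\<^sup>2 * (w x + w x)"
      using w1[OF that] w2[OF that(1)] by (intro mult_left_mono add_mono) auto
    finally show ?thesis by (simp add: w_def power_mult_distrib mult_ac)
  qed
  have bd: "\<bar>d \<alpha> \<beta> x\<bar> \<le> (2 * (real m)\<^sup>2 / \<epsilon>\<^sup>2 * (4 * r) ^ N) * (1 + norm x) ^ N" if "x \<in> W" "\<alpha> \<in> Rp" "\<beta> \<in> Rp" for \<alpha> \<beta> x
  proof -
    have a: "\<alpha> \<bullet> x > 0" "\<beta> \<bullet> x > 0" using pos that by auto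
    have "\<bar>d \<alpha> \<beta> x\<bar> = \<bar>G x\<bar> * (1 / ((\<alpha> \<bullet> x) * (\<beta> \<bullet> x)))" using a by (simp add: d_def abs_mult)
    also have "\<dots> \<le> ((real m)\<^sup>2 / \<epsilon>\<^sup>2 * P x) * (1 / (\<alpha> \<bullet> x)\<^sup>2 + 1 / (\<beta> \<bullet> x)\<^sup>2)"
      using G_le inv_le(2)[OF a] a P0[of x] by (intro mult_mono) auto
    also have "\<dots> = (real m)\<^sup>2 / \<epsilon>\<^sup>2 * (P x / (\<alpha> \<bullet> x)\<^sup>2 + P x / (\<beta> \<bullet> x)\<^sup>2)" by (simp add: algebra_simps)
    also have "\<dots> \<le> (real m)\<^sup>2 / \<epsilon>\<^sup>2 * (w x + w x)"
      using w1[OF that(1,2)] w1[OF that(1,3)] by (intro mult_left_mono add_mono) auto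
    finally show ?thesis by (simp add: w_def power_mult_distrib mult_ac)
  qed
  have be: "\<bar>e \<alpha> x\<bar> \<le> (real m / \<epsilon>\<^sup>2 * (4 * r) ^ N) * (1 + norm x) ^ N" if "x \<in> W" "\<alpha> \<in> Rp" for \<alpha> x
  proof -
    have "\<bar>e \<alpha> x\<bar> = real m / 2 * (P x / (\<epsilon> + P x)\<^sup>2) * (1 / (\<alpha> \<bullet> x)\<^sup>2)"
      using P0[of x] by (simp add: e_def abs_mult)
    also have "\<dots> \<le> real m * (P x / \<epsilon>\<^sup>2) * (1 / (\<alpha> \<bullet> x)\<^sup>2)"
      using quotient_power_bounds(1)[OF \<epsilon> P0[of x]] P0[of x] \<epsilon>
      by (intro mult_right_mono mult_mono) auto
    also have "\<dots> = real m / \<epsilon>\<^sup>2 * (P x / (\<alpha> \<bullet> x)\<^sup>2)" by simp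
    also have "\<dots> \<le> real m / \<epsilon>\<^sup>2 * w x" using w1[OF that] by (intro mult_left_mono) auto
    finally show ?thesis by (simp add: w_def)
  qed
  have expand: "- (L + Q) / (\<epsilon> + P x)\<^sup>2 + L\<^sup>2 / (\<epsilon> + P x) ^ 3 =
      (\<Sum>\<alpha>\<in>Rp. (\<alpha> \<bullet> y) * c \<alpha> x) + (\<Sum>\<alpha>\<in>Rp. \<Sum>\<beta>\<in>Rp. ((\<alpha> \<bullet> y) * (\<beta> \<bullet> y)) * d \<alpha> \<beta> x)
      + (\<Sum>\<alpha>\<in>Rp. ((\<alpha> \<bullet> y) * (\<alpha> \<bullet> y)) * e \<alpha> x)"
    if "L = real m * P x * log_der Rp x y"
      "Q = P x * ((real m * log_der Rp x y)\<^sup>2 - real m * log_der2 Rp x y) / 2" for L Q x y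
  proof -
    define \<Lambda> \<Lambda>2 where "\<Lambda> = log_der Rp x y" and "\<Lambda>2 = log_der2 Rp x y"
    have 1: "(\<Sum>\<alpha>\<in>Rp. (\<alpha> \<bullet> y) * c \<alpha> x) = - (real m * P x / (\<epsilon> + P x)\<^sup>2) * \<Lambda>"
      unfolding \<Lambda>_def log_der_def sum_distrib_left by (intro sum.cong refl) (simp add: c_def)
    have 2: "(\<Sum>\<alpha>\<in>Rp. \<Sum>\<beta>\<in>Rp. ((\<alpha> \<bullet> y) * (\<beta> \<bullet> y)) * d \<alpha> \<beta> x) = G x * \<Lambda>\<^sup>2"
      unfolding \<Lambda>_def log_der_def power2_eq_square sum_product unfolding sum_distrib_left
      by (intro sum.cong refl) (simp add: d_def)
    have 3: "(\<Sum>\<alpha>\<in>Rp. ((\<alpha> \<bullet> y) * (\<alpha> \<bullet> y)) * e \<alpha> x) = (real m * P x / (\<epsilon> + P x)\<^sup>2 / 2) * \<Lambda>2"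
      unfolding \<Lambda>2_def log_der2_def sum_distrib_left
      by (intro sum.cong refl) (simp add: e_def power2_eq_square)
    have "- (j * p * l + p * ((j * l)\<^sup>2 - j * l2) / 2) / a + (j * p * l)\<^sup>2 / b' =
       - (j * p / a) * l + ((j * p)\<^sup>2 / b' - j\<^sup>2 * p / a / 2) * l\<^sup>2 + (j * p / a / 2) * l2" for j p l l2 a b' :: real
      by (simp add: algebra_simps add_divide_distrib diff_divide_distrib power_mult_distrib)
    from this[of "real m" "P x" \<Lambda> \<Lambda>2 "(\<epsilon> + P x)\<^sup>2" "(\<epsilon> + P x) ^ 3"] show ?thesis
      unfolding 1 2 3 G_def that \<Lambda>_def[symmetric] \<Lambda>2_def[symmetric] by simp
  qed
  \<comment> \<open>Averaging replaces \<open>(\<alpha> \<bullet> y) * (\<beta> \<bullet> y)\<close>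
    by a multiple of \<open>\<alpha> \<bullet> \<beta>\<close>; the resulting double sum collapses
    by \<open>root_double_sum\<close> with multiplicity 1.\<close>
  have lap: "(\<Sum>\<alpha>\<in>Rp. \<Sum>\<beta>\<in>Rp. (\<alpha> \<bullet> \<beta>) * d \<alpha> \<beta> x) + (\<Sum>\<alpha>\<in>Rp. (\<alpha> \<bullet> \<alpha>) * e \<alpha> x) = test_fun_laplacian Rp m \<epsilon> x / 2"
    if "x \<in> W" for x
  proof -
    have "multiplicity_function R (\<lambda>_. 1)" by (simp add: multiplicity_function_def)
    from root_double_sum[OF root_sys this that]
    have ds: "(\<Sum>\<alpha>\<in>Rp. \<Sum>\<beta>\<in>Rp. (\<alpha> \<bullet> \<beta>) / ((\<alpha> \<bullet> x) * (\<beta> \<bullet> x))) = wall_sum Rp x"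
      by (simp add: wall_sum_def inner_commute mult.commute)
    have 2: "(\<Sum>\<alpha>\<in>Rp. \<Sum>\<beta>\<in>Rp. (\<alpha> \<bullet> \<beta>) * d \<alpha> \<beta> x) = G x * wall_sum Rp x"
      unfolding ds[symmetric] sum_distrib_left by (intro sum.cong refl) (simp add: d_def)
    have 3: "(\<Sum>\<alpha>\<in>Rp. (\<alpha> \<bullet> \<alpha>) * e \<alpha> x) = (real m * P x / (\<epsilon> + P x)\<^sup>2 / 2) * wall_sum Rp x"
      unfolding wall_sum_def sum_distrib_left
      by (intro sum.cong refl) (simp add: e_def power_divide power2_norm_eq_inner)
    have "((j * p)\<^sup>2 / b' - j\<^sup>2 * p / a / 2) * s + (j * p / a / 2) * s =
       (2 * (j * p)\<^sup>2 * s / b' - j * (j - 1) * p * s / a) / 2" for j p s a b' :: real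
      by (simp add: algebra_simps add_divide_distrib diff_divide_distrib power2_eq_square)
    thus ?thesis unfolding 2 3 G_def test_fun_laplacian_def Let_def P_def by simp
  qed
  show ?thesis
  proof
    let ?C = "C\<epsilon> * (r ^ 6 * C6 + EV)"
    show "?C \<ge> 0" using C\<epsilon> C6(1) EV r by simp
    fix u v :: real assume uv: "0 \<le> u" "u < v" "v \<le> T"
    define h where "h = v - u"
    have h: "h > 0" using uv by (simp add: h_def)
    have u: "u \<in> {0..T}" and v: "v \<in> {0..T}" using uv by auto
    define Y where "Y \<omega> = B v \<omega> - B u \<omega>" for \<omega>
    have Ym [measurable]: "Y \<in> borel_measurable M" unfolding Y_def using u v by measurable
    have Xm [measurable]: "X u \<in> borel_measurable M" by (rule X_measurable[OF u])
    have gauss: "gaussian_vector M (sqrt h) Y"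
      using B_increment_gaussian[OF uv] by (simp add: Y_def[abs_def] h_def)
    have ind: "indep_set {Y -` A \<inter> space M | A. A \<in> sets borel} (sets (F u))"
      using B_increment_indep[OF uv] by (simp add: Y_def[abs_def])
    note gi = gaussian_vector_inner[OF gauss]
    have past: "(\<lambda>\<omega>. \<phi> (X u \<omega>)) \<in> borel_measurable (F u)" if "\<phi> \<in> borel_measurable borel" for \<phi> :: "real ^ 'd \<Rightarrow> real"
      using measurable_compose[OF X_measurable_F[OF u] that] .
    note IND = indep_of_subalgebra[OF ind subalg[OF u] Ym]
    have c1: "integrable M (\<lambda>\<omega>. (\<alpha> \<bullet> Y \<omega>) * c \<alpha> (X u \<omega>))" "expectation (\<lambda>\<omega>. (\<alpha> \<bullet> Y \<omega>) * c \<alpha> (X u \<omega>)) = 0"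
      if "\<alpha> \<in> Rp" for \<alpha>
      using IND[of "\<lambda>y. \<alpha> \<bullet> y" "\<lambda>\<omega>. c \<alpha> (X u \<omega>)"] gi(1,2)[of \<alpha>] past[OF meas(1)]
        poly_integrable[OF u meas(1) bc[OF _ that]] by auto
    have d0: "integrable M (\<lambda>\<omega>. d \<alpha> \<beta> (X u \<omega>))" if "\<alpha> \<in> Rp" "\<beta> \<in> Rp" for \<alpha> \<beta>
      by (rule poly_integrable[OF u meas(2) bd[OF _ that]])
    have e0: "integrable M (\<lambda>\<omega>. e \<alpha> (X u \<omega>))" if "\<alpha> \<in> Rp" for \<alpha>
      by (rule poly_integrable[OF u meas(3) be[OF _ that]])
    have d1: "integrable M (\<lambda>\<omega>. ((\<alpha> \<bullet> Y \<omega>) * (\<beta> \<bullet> Y \<omega>)) * d \<alpha> \<beta> (X u \<omega>))"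
      "expectation (\<lambda>\<omega>. ((\<alpha> \<bullet> Y \<omega>) * (\<beta> \<bullet> Y \<omega>)) * d \<alpha> \<beta> (X u \<omega>)) = h * (\<alpha> \<bullet> \<beta>) * expectation (\<lambda>\<omega>. d \<alpha> \<beta> (X u \<omega>))"
      if "\<alpha> \<in> Rp" "\<beta> \<in> Rp" for \<alpha> \<beta>
      using IND[of "\<lambda>y. (\<alpha> \<bullet> y) * (\<beta> \<bullet> y)" "\<lambda>\<omega>. d \<alpha> \<beta> (X u \<omega>)"] gi(3,4)[of \<alpha> \<beta>] past[OF meas(2)]
        d0[OF that] h by auto
    have e1: "integrable M (\<lambda>\<omega>. ((\<alpha> \<bullet> Y \<omega>) * (\<alpha> \<bullet> Y \<omega>)) * e \<alpha> (X u \<omega>))"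
      "expectation (\<lambda>\<omega>. ((\<alpha> \<bullet> Y \<omega>) * (\<alpha> \<bullet> Y \<omega>)) * e \<alpha> (X u \<omega>)) = h * (\<alpha> \<bullet> \<alpha>) * expectation (\<lambda>\<omega>. e \<alpha> (X u \<omega>))"
      if "\<alpha> \<in> Rp" for \<alpha>
      using IND[of "\<lambda>y. (\<alpha> \<bullet> y) * (\<alpha> \<bullet> y)" "\<lambda>\<omega>. e \<alpha> (X u \<omega>)"] gi(3,4)[of \<alpha> \<alpha>] past[OF meas(3)]
        e0[OF that] h by auto
    define \<Xi> where "\<Xi> \<omega> = (\<Sum>\<alpha>\<in>Rp. (\<alpha> \<bullet> Y \<omega>) * c \<alpha> (X u \<omega>)) + (\<Sum>\<alpha>\<in>Rp. \<Sum>\<beta>\<in>Rp. ((\<alpha> \<bullet> Y \<omega>) * (\<beta> \<bullet> Y \<omega>)) * d \<alpha> \<beta> (X u \<omega>))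
      + (\<Sum>\<alpha>\<in>Rp. ((\<alpha> \<bullet> Y \<omega>) * (\<alpha> \<bullet> Y \<omega>)) * e \<alpha> (X u \<omega>))" for \<omega>
    have \<Xi>_int: "integrable M \<Xi>" unfolding \<Xi>_def[abs_def] using c1(1) d1(1) e1(1)
      by (intro Bochner_Integration.integrable_add Bochner_Integration.integrable_sum) auto
    have \<Xi>_exp: "expectation \<Xi> = h * (expectation (\<lambda>\<omega>. test_fun_laplacian Rp m \<epsilon> (X u \<omega>)) / 2)"
    proof -
      have "expectation \<Xi> = (\<Sum>\<alpha>\<in>Rp. \<Sum>\<beta>\<in>Rp. h * (\<alpha> \<bullet> \<beta>) * expectation (\<lambda>\<omega>. d \<alpha> \<beta> (X u \<omega>)))
          + (\<Sum>\<alpha>\<in>Rp. h * (\<alpha> \<bullet> \<alpha>) * expectation (\<lambda>\<omega>. e \<alpha> (X u \<omega>)))"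
        unfolding \<Xi>_def[abs_def] using c1 d1 e1
        by (simp add: Bochner_Integration.integral_add Bochner_Integration.integral_sum Bochner_Integration.integrable_add Bochner_Integration.integrable_sum)
      also have "\<dots> = h * ((\<Sum>\<alpha>\<in>Rp. \<Sum>\<beta>\<in>Rp. (\<alpha> \<bullet> \<beta>) * expectation (\<lambda>\<omega>. d \<alpha> \<beta> (X u \<omega>))) + (\<Sum>\<alpha>\<in>Rp. (\<alpha> \<bullet> \<alpha>) * expectation (\<lambda>\<omega>. e \<alpha> (X u \<omega>))))"
        by (simp add: distrib_left sum_distrib_left mult.assoc)
      also have "(\<Sum>\<alpha>\<in>Rp. \<Sum>\<beta>\<in>Rp. (\<alpha> \<bullet> \<beta>) * expectation (\<lambda>\<omega>. d \<alpha> \<beta> (X u \<omega>))) + (\<Sum>\<alpha>\<in>Rp. (\<alpha> \<bullet> \<alpha>) * expectation (\<lambda>\<omega>. e \<alpha> (X u \<omega>))) =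
        expectation (\<lambda>\<omega>. (\<Sum>\<alpha>\<in>Rp. \<Sum>\<beta>\<in>Rp. (\<alpha> \<bullet> \<beta>) * d \<alpha> \<beta> (X u \<omega>)) + (\<Sum>\<alpha>\<in>Rp. (\<alpha> \<bullet> \<alpha>) * e \<alpha> (X u \<omega>)))"
        using d0 e0 by (simp add: Bochner_Integration.integral_add Bochner_Integration.integral_sum Bochner_Integration.integrable_sum)
      also have "\<dots> = expectation (\<lambda>\<omega>. test_fun_laplacian Rp m \<epsilon> (X u \<omega>) / 2)"
      proof (rule integral_cong_AE)
        show "AE \<omega> in M. (\<Sum>\<alpha>\<in>Rp. \<Sum>\<beta>\<in>Rp. (\<alpha> \<bullet> \<beta>) * d \<alpha> \<beta> (X u \<omega>)) + (\<Sum>\<alpha>\<in>Rp. (\<alpha> \<bullet> \<alpha>) * e \<alpha> (X u \<omega>)) =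
          test_fun_laplacian Rp m \<epsilon> (X u \<omega>) / 2"
          using AE_X_W[OF u] by eventually_elim (rule lap)
      qed measurable
      finally show ?thesis by simp
    qed
    \<comment> \<open>The cubic remainder is a power of the increment times a random factor of
      polynomial growth. With the increment normalised by \<open>sqrt h\<close>, the inequality
      \<open>a * b \<le> a\<^sup>2 + b\<^sup>2\<close> separates the two into integrable terms and
      leaves the prefactor \<open>h * sqrt h\<close>.\<close>
    define Z where "Z \<omega> = C\<epsilon> * (h * sqrt h) * (r ^ 6 * (norm (Y \<omega>) ^ (2 * 3) / h ^ 3) + (16 * r) ^ (6 * N) * V \<omega> ^ (6 * N))" for \<omega>
    have Y6: "integrable M (\<lambda>\<omega>. norm (Y \<omega>) ^ (2 * 3))" "expectation (\<lambda>\<omega>. norm (Y \<omega>) ^ (2 * 3)) \<le> C6 * h ^ 3"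
      using C6(2,3)[OF uv] by (simp_all add: Y_def h_def)
    have V6: "integrable M (\<lambda>\<omega>. (16 * r) ^ (6 * N) * V \<omega> ^ (6 * N))" using V(3)[of "6 * N"] by simp
    have Z_int: "integrable M Z" unfolding Z_def[abs_def] using Y6(1) V6
      by (intro integrable_mult_right Bochner_Integration.integrable_add integrable_divide) auto
    have Z_exp: "expectation Z \<le> ?C * (h * sqrt h)"
    proof -
      have "expectation Z = C\<epsilon> * (h * sqrt h) * (r ^ 6 * (expectation (\<lambda>\<omega>. norm (Y \<omega>) ^ (2 * 3)) / h ^ 3) + EV)"
        unfolding Z_def[abs_def] EV_def using Y6(1) V6
        by (subst integral_mult_right_zero, subst Bochner_Integration.integral_add) auto
      also have "\<dots> \<le> C\<epsilon> * (h * sqrt h) * (r ^ 6 * C6 + EV)"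
        using C\<epsilon> h Y6(2) r by (intro mult_left_mono add_right_mono) (auto simp: divide_le_eq)
      finally show ?thesis by (simp add: mult_ac)
    qed
    have AE_le: "AE \<omega> in M. test_fun Rp m \<epsilon> (X u \<omega> + Y \<omega>) - test_fun Rp m \<epsilon> (X u \<omega>) \<le> \<Xi> \<omega> + Z \<omega>"
      using V(4)
    proof eventually_elim
      case (elim \<omega>)
      have x: "X u \<omega> \<in> W" "norm (X u \<omega>) \<le> V \<omega>" "norm (B u \<omega>) \<le> V \<omega>" "norm (B v \<omega>) \<le> V \<omega>"
        using elim u v unfolding controlled_def dunkl_path_def by auto
      have y: "norm (Y \<omega>) \<le> 2 * V \<omega>" using x(3,4) norm_triangle_ineq4[of "B v \<omega>" "B u \<omega>"] by (simp add: Y_def)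
      define K where "K = (4 * (1 + r * (norm (X u \<omega>) + norm (Y \<omega>)))) ^ (3 * N)"
      have Kle: "K\<^sup>2 \<le> (16 * r) ^ (6 * N) * V \<omega> ^ (6 * N)"
      proof -
        have "r * (norm (X u \<omega>) + norm (Y \<omega>)) \<le> r * (3 * V \<omega>)" using x y r by (intro mult_left_mono) auto
        moreover have "1 \<le> r * V \<omega>" using r V(2)[of \<omega>] mult_mono[of 1 r 1 "V \<omega>"] by simp
        moreover have "4 * (1 + s) \<le> 16 * r * V \<omega>" if "s \<le> r * (3 * V \<omega>)" "1 \<le> r * V \<omega>" for s
          using that by (simp add: mult.assoc)
        ultimately have "4 * (1 + r * (norm (X u \<omega>) + norm (Y \<omega>))) \<le> 16 * r * V \<omega>" by blast
        hence "(4 * (1 + r * (norm (X u \<omega>) + norm (Y \<omega>)))) ^ (6 * N) \<le> (16 * r * V \<omega>) ^ (6 * N)"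
          using r by (intro power_mono) auto
        moreover have "K\<^sup>2 = (4 * (1 + r * (norm (X u \<omega>) + norm (Y \<omega>)))) ^ (6 * N)"
          unfolding K_def power_mult[symmetric] by (simp add: mult.commute)
        ultimately show ?thesis by (simp add: power_mult_distrib)
      qed
      define \<delta> where "\<delta> = r * norm (Y \<omega>)"
      define q where "q = \<delta> / sqrt h"
      have q: "\<delta> = sqrt h * q" using h by (simp add: q_def)
      have q0: "q \<ge> 0" using r h by (simp add: q_def \<delta>_def)
      have "q ^ 3 * K \<le> (q ^ 3)\<^sup>2 + K\<^sup>2"
        using sum_squares_bound[of "q ^ 3" K] zero_le_power2[of "q ^ 3"] zero_le_power2[of K] by linarith
      moreover have "(q ^ 3)\<^sup>2 = r ^ 6 * (norm (Y \<omega>) ^ (2 * 3) / h ^ 3)"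
      proof -
        have "(sqrt h) ^ 6 = ((sqrt h)\<^sup>2) ^ 3" unfolding power_mult[symmetric] by simp
        hence "(sqrt h) ^ 6 = h ^ 3" using h by simp
        thus ?thesis by (simp add: q_def \<delta>_def power_mult[symmetric] power_divide power_mult_distrib)
      qed
      moreover have "\<delta> ^ 3 = (h * sqrt h) * q ^ 3"
        unfolding q power_mult_distrib using h by (simp add: power3_eq_cube)
      ultimately have d3: "\<delta> ^ 3 = (h * sqrt h) * q ^ 3"
        and qK: "q ^ 3 * K \<le> r ^ 6 * (norm (Y \<omega>) ^ (2 * 3) / h ^ 3) + (16 * r) ^ (6 * N) * V \<omega> ^ (6 * N)"
        using Kle by linarith+
      have "(h * sqrt h) * (q ^ 3 * K) \<le> (h * sqrt h) * (r ^ 6 * (norm (Y \<omega>) ^ (2 * 3) / h ^ 3) + (16 * r) ^ (6 * N) * V \<omega> ^ (6 * N))"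
        using h by (intro mult_left_mono qK) auto
      hence dK: "\<delta> ^ 3 * K \<le> (h * sqrt h) * (r ^ 6 * (norm (Y \<omega>) ^ (2 * 3) / h ^ 3) + (16 * r) ^ (6 * N) * V \<omega> ^ (6 * N))"
        unfolding d3 mult.assoc .
      define L where "L = real m * P (X u \<omega>) * log_der Rp (X u \<omega>) (Y \<omega>)"
      define Q where "Q = P (X u \<omega>) * ((real m * log_der Rp (X u \<omega>) (Y \<omega>))\<^sup>2 - real m * log_der2 Rp (X u \<omega>) (Y \<omega>)) / 2"
      have "\<bar>test_fun Rp m \<epsilon> (X u \<omega> + Y \<omega>) - test_fun Rp m \<epsilon> (X u \<omega>) + (L + Q) / (\<epsilon> + P (X u \<omega>))\<^sup>2 - L\<^sup>2 / (\<epsilon> + P (X u \<omega>)) ^ 3\<bar> \<le> C\<epsilon> * (\<delta> ^ 3 * K)"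
        using test_fun_expansion(3)[OF fin r x(1) m(1) \<epsilon>, of "Y \<omega>"]
        unfolding L_def Q_def P_def C\<epsilon>_def \<delta>_def K_def N_def .
      moreover have "C\<epsilon> * (\<delta> ^ 3 * K) \<le> Z \<omega>" unfolding Z_def mult.assoc[of C\<epsilon>] by (rule mult_left_mono[OF dK C\<epsilon>])
      moreover have "- ((L + Q) / (\<epsilon> + P (X u \<omega>))\<^sup>2) + L\<^sup>2 / (\<epsilon> + P (X u \<omega>)) ^ 3 = \<Xi> \<omega>"
        unfolding \<Xi>_def minus_divide_left by (rule expand[OF L_def Q_def])
      ultimately show ?case by linarith
    qed
    have "expectation (\<lambda>\<omega>. test_fun Rp m \<epsilon> (X u \<omega> + Y \<omega>) - test_fun Rp m \<epsilon> (X u \<omega>)) \<le> expectation (\<lambda>\<omega>. \<Xi> \<omega> + Z \<omega>)"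
    proof (rule integral_mono_AE[OF _ _ AE_le])
      have "integrable M (\<lambda>\<omega>. test_fun Rp m \<epsilon> (U \<omega>))" if [measurable]: "U \<in> borel_measurable M" for U
      proof -
        have "\<bar>test_fun Rp m \<epsilon> z\<bar> \<le> 1 / \<epsilon>" for z using test_fun_bounds[OF m(1) \<epsilon>, of Rp z] by linarith
        thus ?thesis by (intro integrable_const_bound[where B="1 / \<epsilon>"] AE_I2) simp_all
      qed
      thus "integrable M (\<lambda>\<omega>. test_fun Rp m \<epsilon> (X u \<omega> + Y \<omega>) - test_fun Rp m \<epsilon> (X u \<omega>))" by simp
    qed (use \<Xi>_int Z_int in simp)
    also have "\<dots> \<le> h * (expectation (\<lambda>\<omega>. test_fun_laplacian Rp m \<epsilon> (X u \<omega>)) / 2) + ?C * (h * sqrt h)"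
      using \<Xi>_int Z_int \<Xi>_exp Z_exp by simp
    finally show "expectation (\<lambda>\<omega>. test_fun Rp m \<epsilon> (X u \<omega> + (B v \<omega> - B u \<omega>)) - test_fun Rp m \<epsilon> (X u \<omega>))
      \<le> (v - u) * (expectation (\<lambda>\<omega>. test_fun_laplacian Rp m \<epsilon> (X u \<omega>)) / 2) + ?C * ((v - u) * sqrt (v - u))"
      by (simp add: Y_def h_def)
  qed
qed

end

section \<open>Dynkin inequality for the test function\<close>

context dunkl_setup
begin

abbreviation "speed \<omega> r \<equiv> D (X r \<omega>) + b r (X r \<omega>)"

lemma controlledD:
  assumes "controlled V \<omega>"
  shows "continuous_on {0..T} (\<lambda>t. X t \<omega>)" "\<And>t. t \<in> {0..T} \<Longrightarrow> X t \<omega> \<in> W"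
    "\<And>t. t \<in> {0..T} \<Longrightarrow> norm (X t \<omega>) \<le> V \<omega>" "\<And>t. t \<in> {0..T} \<Longrightarrow> norm (B t \<omega>) \<le> V \<omega>"
    "continuous_on {0..T} (speed \<omega>)" "integral {0..T} (\<lambda>r. norm (speed \<omega> r)) \<le> V \<omega>"
    "continuous_on {0..T} (\<lambda>t. b t (X t \<omega>))"
proof -
  show c: "continuous_on {0..T} (\<lambda>t. X t \<omega>)" and w: "\<And>t. t \<in> {0..T} \<Longrightarrow> X t \<omega> \<in> W"
    and "\<And>t. t \<in> {0..T} \<Longrightarrow> norm (X t \<omega>) \<le> V \<omega>" "\<And>t. t \<in> {0..T} \<Longrightarrow> norm (B t \<omega>) \<le> V \<omega>"
    and "integral {0..T} (\<lambda>r. norm (speed \<omega> r)) \<le> V \<omega>"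
    and bc: "continuous_on {0..T} (\<lambda>t. b t (X t \<omega>))"
    using assms unfolding controlled_def dunkl_path_def by auto
  have "continuous_on {0..T} (\<lambda>t. D (X t \<omega>))" by (rule continuous_on_dunkl_drift[OF c]) (use w in auto)
  thus "continuous_on {0..T} (speed \<omega>)" using bc by (intro continuous_intros)
qed

lemma controlled_increment:
  assumes g: "controlled V \<omega>" and uv: "0 \<le> u" "u \<le> v" "v \<le> T"
  shows "X v \<omega> - X u \<omega> = B v \<omega> - B u \<omega> + integral {u..v} (speed \<omega>)"
    and "norm (integral {u..v} (speed \<omega>)) \<le> integral {u..v} (\<lambda>r. norm (speed \<omega> r))"
proof -
  have c: "continuous_on {0..v} (speed \<omega>)" by (rule continuous_on_subset[OF controlledD(5)[OF g]]) (use uv in auto)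
  have "integral {0..v} (speed \<omega>) = integral {0..u} (speed \<omega>) + integral {u..v} (speed \<omega>)"
    using uv by (intro Henstock_Kurzweil_Integration.integral_combine[symmetric] integrable_continuous_real c) auto
  moreover have "X t \<omega> = x0 + B t \<omega> + integral {0..t} (speed \<omega>)" if "t \<in> {0..T}" for t
    using g that unfolding controlled_def dunkl_path_def by auto
  from this[of u] this[of v] have "X v \<omega> - X u \<omega> = (B v \<omega> + integral {0..v} (speed \<omega>)) - (B u \<omega> + integral {0..u} (speed \<omega>))"
    using uv by simp
  ultimately show "X v \<omega> - X u \<omega> = B v \<omega> - B u \<omega> + integral {u..v} (speed \<omega>)" by simp
  have "continuous_on {u..v} (speed \<omega>)" by (rule continuous_on_subset[OF c]) (use uv in auto)
  thus "norm (integral {u..v} (speed \<omega>)) \<le> integral {u..v} (\<lambda>r. norm (speed \<omega> r))"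
    by (intro integral_norm_bound_integral integrable_continuous_real continuous_on_norm) auto
qed

text \<open>The point reached after the noise is written as \<open>X v \<omega> - J\<close> and the
  expansion is made at \<open>X v \<omega>\<close>, which lies in the chamber. The first estimate
  holds for arbitrarily coarse partitions and gives domination; the second uses the oscillation
  \<open>\<eta>\<close> of the speed and is sharp enough for the limit.\<close>

lemma test_fun_drift_step:
  assumes g: "controlled V \<omega>" and V1: "V \<omega> \<ge> 1" and uv: "0 \<le> u" "u \<le> v" "v \<le> T"
    and m: "even m" "real m < 2 * \<nu>" and \<epsilon>: "\<epsilon> > 0"
    and r: "r \<ge> 1" "\<forall>\<alpha>\<in>Rp. norm \<alpha> \<le> r"
  defines "J \<equiv> integral {u..v} (speed \<omega>)" and "K \<equiv> (24 * r * V \<omega>) ^ (3 * (m * card Rp))"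
    and "C \<equiv> 1 / \<epsilon>\<^sup>2 + 2 / \<epsilon> ^ 3 + 1 / \<epsilon> ^ 4"
    and "Cg \<equiv> real m * real (card Rp) * (Kb\<^sup>2 / (4 * \<nu> - 2 * real m))"
    and "I \<equiv> test_fun Rp m \<epsilon> (X v \<omega>) - test_fun Rp m \<epsilon> (X u \<omega> + (B v \<omega> - B u \<omega>))"
  shows "\<bar>I\<bar> \<le> C * (r * norm J * K)"
    and "\<And>\<eta>. \<lbrakk>norm (J - (v - u) *\<^sub>R speed \<omega> v) \<le> (v - u) * \<eta>; (v - u) * \<eta> \<le> 1\<rbrakk> \<Longrightarrow>
      I - (v - u) * (Cg * test_fun Rp m \<epsilon> (X v \<omega>) - test_fun_laplacian Rp m \<epsilon> (X v \<omega>) / 2)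
      \<le> C * K * (r * ((v - u) * \<eta>) + (r * norm J)\<^sup>2)"
proof -
  have t: "u \<in> {0..T}" "v \<in> {0..T}" using uv by auto
  note G = controlledD[OF g]
  have x: "X v \<omega> \<in> W" by (rule G(2)[OF t(2)])
  have start: "X u \<omega> + (B v \<omega> - B u \<omega>) = X v \<omega> + (- J)"
    using controlled_increment(1)[OF g uv] by (simp add: J_def algebra_simps)
  have C0: "C \<ge> 0" using \<epsilon> by (simp add: C_def)
  \<comment> \<open>\<open>J\<close> need not be small on a coarse partition; it is a combination of
    four vectors of norm at most \<open>V \<omega>\<close>. Together with
    \<open>X v \<omega>\<close> this gives the 5 behind the constant 24.\<close>
  have nJ: "norm (- J) \<le> 4 * V \<omega>"
  proof -
    have "- J = X u \<omega> + (B v \<omega> - B u \<omega>) - X v \<omega>" using start by simp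
    also have "norm \<dots> \<le> norm (X u \<omega> + (B v \<omega> - B u \<omega>)) + norm (X v \<omega>)" by (rule norm_triangle_ineq4)
    also have "norm (X u \<omega> + (B v \<omega> - B u \<omega>)) \<le> norm (X u \<omega>) + norm (B v \<omega> - B u \<omega>)" by (rule norm_triangle_ineq)
    also have "norm (B v \<omega> - B u \<omega>) \<le> norm (B v \<omega>) + norm (B u \<omega>)" by (rule norm_triangle_ineq4)
    finally show ?thesis using G(3,4)[OF t(1)] G(3,4)[OF t(2)] by linarith
  qed
  have K_le: "(4 * (1 + r * (norm (X v \<omega>) + norm y))) ^ (3 * (m * card Rp)) \<le> K" if "norm y \<le> 4 * V \<omega>" for y :: "real ^ 'd"
    unfolding K_def
  proof (rule power_mono)
    have "r * (norm (X v \<omega>) + norm y) \<le> r * (5 * V \<omega>)" using G(3)[OF t(2)] that r by (intro mult_left_mono) auto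
    moreover have "1 \<le> r * V \<omega>" using mult_mono[OF r(1) V1] r by simp
    moreover have "4 * (1 + s) \<le> 24 * r * V \<omega>" if "s \<le> r * (5 * V \<omega>)" "1 \<le> r * V \<omega>" for s
      using that by (simp add: mult.assoc)
    ultimately show "4 * (1 + r * (norm (X v \<omega>) + norm y)) \<le> 24 * r * V \<omega>" by blast
    show "0 \<le> 4 * (1 + r * (norm (X v \<omega>) + norm y))" using r by simp
  qed
  note E = test_fun_expansion[OF fin r x m(1) \<epsilon>, folded C_def]
  have Ie: "I = - (test_fun Rp m \<epsilon> (X v \<omega> + - J) - test_fun Rp m \<epsilon> (X v \<omega>))" by (simp add: I_def start)
  have "\<bar>I\<bar> \<le> C * (r * norm (- J) * (4 * (1 + r * (norm (X v \<omega>) + norm (- J)))) ^ (3 * (m * card Rp)))"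
    unfolding Ie abs_minus_cancel by (rule E(1))
  also have "\<dots> \<le> C * (r * norm (- J) * K)" using C0 r K_le[OF nJ] by (intro mult_left_mono) auto
  finally show "\<bar>I\<bar> \<le> C * (r * norm J * K)" by simp
  fix \<eta> assume \<eta>: "norm (J - (v - u) *\<^sub>R speed \<omega> v) \<le> (v - u) * \<eta>" "(v - u) * \<eta> \<le> 1"
  define z where "z = J - (v - u) *\<^sub>R speed \<omega> v"
  have nz: "norm z \<le> 4 * V \<omega>" using \<eta> V1 by (simp add: z_def)
  define P where "P = wall_prod Rp m (X v \<omega>)"
  define \<Gamma> where "\<Gamma> y = real m * P * log_der Rp (X v \<omega>) y / (\<epsilon> + P)\<^sup>2" for y
  \<comment> \<open>Linearity splits \<open>- J\<close> into the exact Euler part, to which the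
    generator inequality applies, and the deviation \<open>z\<close>, of norm at most
    \<open>(v - u) * \<eta>\<close>.\<close>
  have lin: "\<Gamma> (- J) = - (v - u) * \<Gamma> (speed \<omega> v) - \<Gamma> z"
  proof -
    have "log_der Rp (X v \<omega>) (- J) = - (v - u) * log_der Rp (X v \<omega>) (speed \<omega> v) - log_der Rp (X v \<omega>) z"
    proof -
      have "- J = - ((v - u) *\<^sub>R speed \<omega> v) - z" by (simp add: z_def)
      thus ?thesis unfolding log_der_def sum_distrib_left sum_subtractf[symmetric]
        by (intro sum.cong refl) (simp only: inner_diff_right inner_minus_right inner_scaleR_right diff_divide_distrib
            times_divide_eq_right minus_divide_left mult_minus_left)
    qed
    moreover have "q * (- d * l - l') / E = - d * (q * l / E) - q * l' / E" for q d l l' E :: real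
      by (simp add: right_diff_distrib diff_divide_distrib)
    ultimately show ?thesis unfolding \<Gamma>_def by metis
  qed
  have e2: "\<bar>test_fun Rp m \<epsilon> (X v \<omega> + - J) - test_fun Rp m \<epsilon> (X v \<omega>) + \<Gamma> (- J)\<bar> \<le> C * ((r * norm J)\<^sup>2 * K)"
  proof -
    have "\<bar>test_fun Rp m \<epsilon> (X v \<omega> + - J) - test_fun Rp m \<epsilon> (X v \<omega>) + \<Gamma> (- J)\<bar> \<le>
        C * ((r * norm (- J))\<^sup>2 * (4 * (1 + r * (norm (X v \<omega>) + norm (- J)))) ^ (3 * (m * card Rp)))"
      unfolding \<Gamma>_def P_def by (rule E(2))
    also have "\<dots> \<le> C * ((r * norm (- J))\<^sup>2 * K)" using C0 K_le[OF nJ] by (intro mult_left_mono) auto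
    finally show ?thesis by simp
  qed
  have e4: "\<bar>\<Gamma> z\<bar> \<le> C * (r * ((v - u) * \<eta>) * K)"
  proof -
    have K0: "K \<ge> 0" using r V1 by (simp add: K_def)
    have "\<bar>\<Gamma> z\<bar> \<le> C * (r * norm z * (4 * (1 + r * (norm (X v \<omega>) + norm z))) ^ (3 * (m * card Rp)))"
      unfolding \<Gamma>_def P_def by (rule E(4))
    also have "\<dots> \<le> C * (r * norm z * K)" using C0 r K_le[OF nz] by (intro mult_left_mono) auto
    also have "\<dots> \<le> C * (r * ((v - u) * \<eta>) * K)"
      using C0 r K0 \<eta>(1) by (intro mult_left_mono mult_right_mono) (auto simp: z_def)
    finally show ?thesis .
  qed
  have gen: "- \<Gamma> (speed \<omega> v) \<le> Cg * test_fun Rp m \<epsilon> (X v \<omega>) - test_fun_laplacian Rp m \<epsilon> (X v \<omega>) / 2"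
    unfolding \<Gamma>_def P_def Cg_def
    by (rule test_fun_generator_le[OF root_sys mult k_ge m \<epsilon> x b_bound[OF t(2) x]])
  have "(v - u) * (- \<Gamma> (speed \<omega> v)) \<le> (v - u) * (Cg * test_fun Rp m \<epsilon> (X v \<omega>) - test_fun_laplacian Rp m \<epsilon> (X v \<omega>) / 2)"
    using uv by (intro mult_left_mono gen) auto
  moreover have "I \<le> \<Gamma> (- J) + C * ((r * norm J)\<^sup>2 * K)" using e2 unfolding Ie by linarith
  moreover have "C * ((r * norm J)\<^sup>2 * K) + C * (r * ((v - u) * \<eta>) * K) = C * K * (r * ((v - u) * \<eta>) + (r * norm J)\<^sup>2)"
    by (simp add: algebra_simps)
  ultimately show "I - (v - u) * (Cg * test_fun Rp m \<epsilon> (X v \<omega>) - test_fun_laplacian Rp m \<epsilon> (X v \<omega>) / 2)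
      \<le> C * K * (r * ((v - u) * \<eta>) + (r * norm J)\<^sup>2)"
    using lin e4 by linarith
qed

text \<open>Along uniform partitions the drift increments exceed their generator bound by
  \<open>\<Psi> n\<close>, whose positive part tends to 0 in mean. The drift bound contains the
  Laplacian at the right end of each interval and the noise bound the Laplacian at the left end,
  with opposite signs. They telescope, which spares any continuity in time of the mean
  Laplacian.\<close>

lemma test_fun_ito_step:
  assumes m: "even m" "m \<ge> 2" "real m < 2 * \<nu>" and \<epsilon>: "\<epsilon> > 0"
    and st: "0 \<le> s" "s < t" "t \<le> T"
    and Mx: "\<And>u. u \<in> {s..t} \<Longrightarrow> expectation (\<lambda>\<omega>. test_fun Rp m \<epsilon> (X u \<omega>)) \<le> Mx"
  defines "Cg \<equiv> real m * real (card Rp) * (Kb\<^sup>2 / (4 * \<nu> - 2 * real m))"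
  shows "expectation (\<lambda>\<omega>. test_fun Rp m \<epsilon> (X t \<omega>)) \<le> expectation (\<lambda>\<omega>. test_fun Rp m \<epsilon> (X s \<omega>)) + (t - s) * (Cg * Mx)"
proof -
  obtain r where r: "r \<ge> 1" "\<forall>\<alpha>\<in>Rp. norm \<alpha> \<le> r" by (rule roots_norm_bound[OF fin])
  define N where "N = m * card Rp"
  define C where "C = 1 / \<epsilon>\<^sup>2 + 2 / \<epsilon> ^ 3 + 1 / \<epsilon> ^ 4"
  have C0: "C \<ge> 0" using \<epsilon> by (simp add: C_def)
  have Cg0: "Cg \<ge> 0" using m by (simp add: Cg_def)
  obtain V where V: "V \<in> borel_measurable M" "\<And>\<omega>. V \<omega> \<ge> 1"
    "\<And>j. j \<le> 3 * N + 1 \<Longrightarrow> integrable M (\<lambda>\<omega>. V \<omega> ^ j)" "AE \<omega> in M. controlled V \<omega>"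
    by (rule controlled_moments[of "3 * N + 1"]) blast
  obtain CL where CL: "CL \<ge> 0" "\<And>x. x \<in> W \<Longrightarrow> \<bar>test_fun_laplacian Rp m \<epsilon> x\<bar> \<le> CL * (1 + norm x) ^ N"
    unfolding N_def by (rule test_fun_laplacian_bound[OF fin m(1,2) \<epsilon>]) blast
  obtain C2 where C2: "C2 \<ge> 0"
    "\<And>u v. \<lbrakk>0 \<le> u; u < v; v \<le> T\<rbrakk> \<Longrightarrow>
      expectation (\<lambda>\<omega>. test_fun Rp m \<epsilon> (X u \<omega> + (B v \<omega> - B u \<omega>)) - test_fun Rp m \<epsilon> (X u \<omega>))
      \<le> (v - u) * (expectation (\<lambda>\<omega>. test_fun_laplacian Rp m \<epsilon> (X u \<omega>)) / 2) + C2 * ((v - u) * sqrt (v - u))"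
    by (rule test_fun_noise_step[OF m(1,2) \<epsilon>]) blast
  let ?g = "test_fun Rp m \<epsilon>" and ?\<Theta> = "test_fun_laplacian Rp m \<epsilon>"
  define h where "h n = (t - s) / real (Suc n)" for n
  define u where "u n i = s + real i * h n" for n i
  have h: "h n > 0" "real (Suc n) * h n = t - s" for n using st by (auto simp: h_def)
  have u_end: "u n 0 = s" "u n (Suc n) = t" for n using h(2)[of n] by (auto simp: u_def)
  have u_step: "u n (Suc i) - u n i = h n" for n i by (simp add: u_def algebra_simps)
  have u_lt: "u n i < u n (Suc i)" for n i using u_step[of n i] h(1)[of n] by linarith
  have u_in: "u n i \<in> {s..t}" if "i \<le> Suc n" for n i
  proof -
    have "real i * h n \<le> real (Suc n) * h n" using that h(1)[of n] by (intro mult_right_mono) auto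
    hence "real i * h n \<le> t - s" unfolding h(2) .
    thus ?thesis using h(1)[of n] by (auto simp: u_def)
  qed
  have u_T: "u n i \<in> {0..T}" if "i \<le> Suc n" for n i using u_in[OF that] st by auto
  have u3: "0 \<le> u n i" "u n i < u n (Suc i)" "u n i \<le> u n (Suc i)" "u n (Suc i) \<le> T" if "i < Suc n" for n i
    using u_T[of i n] u_T[of "Suc i" n] u_lt[of n i] that by auto
  have Xm [measurable]: "X (u n i) \<in> borel_measurable M" "B (u n i) \<in> borel_measurable M" if "i \<le> Suc n" for n i
    using X_measurable[OF u_T[OF that]] B_measurable[OF u_T[OF that]] by auto
  define I where "I n i \<omega> = ?g (X (u n (Suc i)) \<omega>) - ?g (X (u n i) \<omega> + (B (u n (Suc i)) \<omega> - B (u n i) \<omega>))" for n i \<omega>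
  define II where "II n i \<omega> = ?g (X (u n i) \<omega> + (B (u n (Suc i)) \<omega> - B (u n i) \<omega>)) - ?g (X (u n i) \<omega>)" for n i \<omega>
  define A where "A n i \<omega> = Cg * ?g (X (u n (Suc i)) \<omega>) - ?\<Theta> (X (u n (Suc i)) \<omega>) / 2" for n i \<omega>
  \<comment> \<open>Only an upper bound is wanted, so it is the positive part of this excess that is
    dominated and shown to vanish.\<close>
  define \<Psi> where "\<Psi> n \<omega> = (\<Sum>i<Suc n. I n i \<omega> - h n * A n i \<omega>)" for n \<omega>
  have g_int: "integrable M (\<lambda>\<omega>. ?g (U \<omega>))" if [measurable]: "U \<in> borel_measurable M" for U
  proof -
    have "\<bar>?g z\<bar> \<le> 1 / \<epsilon>" for z using test_fun_bounds[OF m(1) \<epsilon>, of Rp z] by linarith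
    thus ?thesis by (intro integrable_const_bound[where B="1 / \<epsilon>"] AE_I2) simp_all
  qed
  have \<Theta>_int: "integrable M (\<lambda>\<omega>. ?\<Theta> (X w \<omega>))" if "w \<in> {0..T}" for w
    by (rule poly_integrable[OF that _ CL(2)]) auto
  have I_int: "integrable M (I n i)" and II_int: "integrable M (II n i)" and A_int: "integrable M (A n i)"
    if "i < Suc n" for n i
  proof -
    have [measurable]: "X (u n i) \<in> borel_measurable M" "B (u n i) \<in> borel_measurable M"
      "X (u n (Suc i)) \<in> borel_measurable M" "B (u n (Suc i)) \<in> borel_measurable M" using Xm that by auto
    show "integrable M (I n i)" "integrable M (II n i)"
      unfolding I_def[abs_def] II_def[abs_def] by (intro Bochner_Integration.integrable_diff g_int; measurable)+
    show "integrable M (A n i)" unfolding A_def[abs_def]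
      using that by (intro Bochner_Integration.integrable_diff integrable_mult_right integrable_divide g_int \<Theta>_int u_T) auto
  qed
  have \<Psi>_int: "integrable M (\<Psi> n)" for n unfolding \<Psi>_def[abs_def]
    by (intro Bochner_Integration.integrable_sum Bochner_Integration.integrable_diff integrable_mult_right I_int A_int) auto
  \<comment> \<open>The integrals of the norm of the speed over the intervals of a partition add up
    to the integral over \<open>{s..t}\<close>, hence a bound independent of \<open>n\<close>; this
    is why \<open>controlled\<close> includes that integral.\<close>
  define w where "w \<omega> = C * r * (24 * r) ^ (3 * N) * V \<omega> ^ (3 * N + 1) + T * (Cg / \<epsilon> + CL * 2 ^ N * V \<omega> ^ N)" for \<omega>
  have w_int: "integrable M w" unfolding w_def[abs_def] using V(3)[of "3 * N + 1"] V(3)[of N]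
    by (intro Bochner_Integration.integrable_add integrable_mult_right) auto
  have dom: "max 0 (\<Psi> n \<omega>) \<le> w \<omega>" if g: "controlled V \<omega>" for n \<omega>
  proof -
    note G = controlledD[OF g]
    define K where "K = (24 * r * V \<omega>) ^ (3 * N)"
    have K0: "K \<ge> 0" using r V(2)[of \<omega>] by (simp add: K_def)
    have c0T: "continuous_on {0..T} (\<lambda>r. norm (speed \<omega> r))" by (intro continuous_intros G(5))
    have c: "continuous_on {s..t} (\<lambda>r. norm (speed \<omega> r))"
      by (rule continuous_on_subset[OF c0T]) (use st in auto)
    have I_le: "\<bar>I n i \<omega>\<bar> \<le> C * r * K * integral {u n i..u n (Suc i)} (\<lambda>r. norm (speed \<omega> r))" if i: "i < Suc n" for i
    proof -
      have "\<bar>I n i \<omega>\<bar> \<le> C * (r * norm (integral {u n i..u n (Suc i)} (speed \<omega>)) * K)"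
        unfolding I_def C_def K_def N_def
        by (rule test_fun_drift_step(1)[OF g V(2) u3(1,3,4)[OF i] m(1,3) \<epsilon> r])
      also have "\<dots> \<le> C * (r * integral {u n i..u n (Suc i)} (\<lambda>r. norm (speed \<omega> r)) * K)"
        using C0 r K0 controlled_increment(2)[OF g u3(1,3,4)[OF i]] by (intro mult_left_mono mult_right_mono) auto
      finally show ?thesis by (simp add: mult_ac)
    qed
    have A_le: "- A n i \<omega> \<le> Cg / \<epsilon> + CL * 2 ^ N * V \<omega> ^ N" if i: "i < Suc n" for i
    proof -
      have w: "u n (Suc i) \<in> {0..T}" using u_T[of "Suc i" n] i by simp
      have "\<bar>?\<Theta> (X (u n (Suc i)) \<omega>)\<bar> \<le> CL * (1 + norm (X (u n (Suc i)) \<omega>)) ^ N" by (rule CL(2)[OF G(2)[OF w]])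
      also have "\<dots> \<le> CL * (2 * V \<omega>) ^ N"
        using G(3)[OF w] V(2)[of \<omega>] CL(1) by (intro mult_left_mono power_mono) auto
      finally have 1: "\<bar>?\<Theta> (X (u n (Suc i)) \<omega>)\<bar> \<le> CL * 2 ^ N * V \<omega> ^ N" by (simp add: power_mult_distrib)
      have "0 \<le> Cg * ?g (X (u n (Suc i)) \<omega>)" using Cg0 test_fun_bounds[OF m(1) \<epsilon>] by (intro mult_nonneg_nonneg)
      moreover have "Cg / \<epsilon> \<ge> 0" using Cg0 \<epsilon> by simp
      ultimately show ?thesis using 1 unfolding A_def by linarith
    qed
    have "\<Psi> n \<omega> \<le> (\<Sum>i<Suc n. C * r * K * integral {u n i..u n (Suc i)} (\<lambda>r. norm (speed \<omega> r)) + h n * (Cg / \<epsilon> + CL * 2 ^ N * V \<omega> ^ N))"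
      unfolding \<Psi>_def
    proof (rule sum_mono)
      fix i assume "i \<in> {..<Suc n}"
      hence i: "i < Suc n" by simp
      have "h n * (- A n i \<omega>) \<le> h n * (Cg / \<epsilon> + CL * 2 ^ N * V \<omega> ^ N)"
        using h(1)[of n] by (intro mult_left_mono A_le[OF i]) auto
      thus "I n i \<omega> - h n * A n i \<omega> \<le> C * r * K * integral {u n i..u n (Suc i)} (\<lambda>r. norm (speed \<omega> r)) + h n * (Cg / \<epsilon> + CL * 2 ^ N * V \<omega> ^ N)"
        using I_le[OF i] by simp
    qed
    also have "\<dots> = C * r * K * (\<Sum>i<Suc n. integral {u n i..u n (Suc i)} (\<lambda>r. norm (speed \<omega> r))) + real (Suc n) * h n * (Cg / \<epsilon> + CL * 2 ^ N * V \<omega> ^ N)"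
    proof -
      have gen: "(\<Sum>i<l. c * f i + d) = c * (\<Sum>i<l. f i) + real l * d" for c d f and l :: nat
        by (simp add: sum.distrib sum_distrib_left)
      show ?thesis unfolding gen mult.assoc[of "real (Suc n)"] ..
    qed
    also have "(\<Sum>i<Suc n. integral {u n i..u n (Suc i)} (\<lambda>r. norm (speed \<omega> r))) = integral {s..t} (\<lambda>r. norm (speed \<omega> r))"
      using integral_grid_sum[OF c, of "h n" "Suc n"] h[of n] unfolding u_def by simp
    also have "C * r * K * integral {s..t} (\<lambda>r. norm (speed \<omega> r)) \<le> C * r * K * V \<omega>"
    proof (intro mult_left_mono)
      have "integral {s..t} (\<lambda>r. norm (speed \<omega> r)) \<le> integral {0..T} (\<lambda>r. norm (speed \<omega> r))"
        using st by (intro integral_subset_le integrable_continuous_real c c0T) auto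
      thus "integral {s..t} (\<lambda>r. norm (speed \<omega> r)) \<le> V \<omega>" using G(6) by linarith
    qed (use C0 r K0 in auto)
    also have "real (Suc n) * h n * (Cg / \<epsilon> + CL * 2 ^ N * V \<omega> ^ N) \<le> T * (Cg / \<epsilon> + CL * 2 ^ N * V \<omega> ^ N)"
      unfolding h(2) using st Cg0 \<epsilon> CL(1) V(2)[of \<omega>]
      by (intro mult_right_mono add_nonneg_nonneg mult_nonneg_nonneg divide_nonneg_nonneg) auto
    finally have "\<Psi> n \<omega> \<le> w \<omega>" by (simp add: w_def K_def power_mult_distrib mult_ac)
    moreover have "w \<omega> \<ge> 0" unfolding w_def using C0 r V(2)[of \<omega>] Cg0 \<epsilon> CL(1) T_pos
      by (intro add_nonneg_nonneg mult_nonneg_nonneg divide_nonneg_nonneg) auto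
    ultimately show ?thesis by simp
  qed
  have conv: "(\<lambda>n. max 0 (\<Psi> n \<omega>)) \<longlonglongrightarrow> 0" if g: "controlled V \<omega>" for \<omega>
  proof (rule LIMSEQ_I)
    fix e :: real assume e: "e > 0"
    note G = controlledD[OF g]
    define K where "K = (24 * r * V \<omega>) ^ (3 * N)"
    have K0: "K \<ge> 0" using r V(2)[of \<omega>] by (simp add: K_def)
    have c: "continuous_on {s..t} (speed \<omega>)" by (rule continuous_on_subset[OF G(5)]) (use st in auto)
    obtain a where a: "a > 0" "\<And>v. v \<in> {s..t} \<Longrightarrow> norm (speed \<omega> v) \<le> a"
      using compact_imp_bounded[OF compact_continuous_image[OF c compact_Icc]] unfolding bounded_pos by (auto simp: image_iff)
    \<comment> \<open>\<open>\<kappa>\<close> and, below, \<open>\<kappa>2\<close> collect over all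
      intervals the coefficients of \<open>\<eta>\<close> (oscillation of the speed) and of
      \<open>h n\<close> (quadratic error); each error is made at most \<open>e / 4\<close>. The
      added 1 keeps the denominators positive.\<close>
    define \<kappa> where "\<kappa> = C * K * r * (t - s) + 1"
    have \<kappa>: "\<kappa> > 0" using C0 K0 r st by (simp add: \<kappa>_def add_nonneg_pos)
    define \<eta> where "\<eta> = e / (4 * \<kappa>)"
    have \<eta>: "\<eta> > 0" using e \<kappa> by (simp add: \<eta>_def)
    have "uniformly_continuous_on {s..t} (speed \<omega>)" by (rule compact_uniformly_continuous[OF c compact_Icc])
    then obtain \<delta> where \<delta>: "\<delta> > 0" "\<And>x y. \<lbrakk>x \<in> {s..t}; y \<in> {s..t}; dist y x < \<delta>\<rbrakk> \<Longrightarrow> dist (speed \<omega> y) (speed \<omega> x) < \<eta>"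
      unfolding uniformly_continuous_on_def using \<eta> by metis
    have hlim: "h \<longlonglongrightarrow> 0" unfolding h_def
      by (rule tendsto_divide_0[OF tendsto_const]) (intro filterlim_at_top_imp_at_infinity filterlim_compose[OF filterlim_real_sequentially filterlim_Suc])
    define \<kappa>2 where "\<kappa>2 = C * K * (r * a)\<^sup>2 * (t - s) + 1"
    have \<kappa>2: "\<kappa>2 > 0" using C0 K0 st by (simp add: \<kappa>2_def add_nonneg_pos)
    have "eventually (\<lambda>n. h n < min \<delta> (min (1 / \<eta>) (e / (4 * \<kappa>2)))) sequentially"
      using order_tendstoD(2)[OF hlim, of "min \<delta> (min (1 / \<eta>) (e / (4 * \<kappa>2)))"] \<delta>(1) \<eta> e \<kappa>2 by simp
    then obtain n0 where n0: "\<And>n. n \<ge> n0 \<Longrightarrow> h n < \<delta> \<and> h n < 1 / \<eta> \<and> h n < e / (4 * \<kappa>2)"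
      unfolding eventually_sequentially by auto
    show "\<exists>n0. \<forall>n\<ge>n0. norm (max 0 (\<Psi> n \<omega>) - 0) < e"
    proof (intro exI allI impI)
      fix n assume "n \<ge> n0"
      hence hn: "h n < \<delta>" "h n < 1 / \<eta>" "h n < e / (4 * \<kappa>2)" using n0 by auto
      have step: "I n i \<omega> - h n * A n i \<omega> \<le> C * K * (r * (h n * \<eta>) + (r * (h n * a))\<^sup>2)" if i: "i < Suc n" for i
      proof -
        have sub: "{u n i..u n (Suc i)} \<subseteq> {s..t}" using u_in[of i n] u_in[of "Suc i" n] i by auto
        have ci: "continuous_on {u n i..u n (Suc i)} (speed \<omega>)" by (rule continuous_on_subset[OF c sub])
        have "norm (integral {u n i..u n (Suc i)} (speed \<omega>) - (u n (Suc i) - u n i) *\<^sub>R speed \<omega> (u n (Suc i))) \<le> (u n (Suc i) - u n i) * \<eta>"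
        proof (rule integral_deviation_le[OF ci])
          fix v assume v: "v \<in> {u n i..u n (Suc i)}"
          hence "dist v (u n (Suc i)) < \<delta>" using hn(1) u_step[of n i] by (auto simp: dist_real_def)
          thus "norm (speed \<omega> v - speed \<omega> (u n (Suc i))) \<le> \<eta>"
            using \<delta>(2)[of "u n (Suc i)" v] v sub u3(3)[OF i] by (force simp: dist_norm)
        qed (use u3(3)[OF i] in auto)
        moreover have "(u n (Suc i) - u n i) * \<eta> \<le> 1"
          unfolding u_step using hn(2) \<eta> by (simp add: field_simps)
        ultimately have "I n i \<omega> - h n * A n i \<omega> \<le> C * K * (r * (h n * \<eta>) + (r * norm (integral {u n i..u n (Suc i)} (speed \<omega>)))\<^sup>2)"
          using test_fun_drift_step(2)[OF g V(2) u3(1,3,4)[OF i] m(1,3) \<epsilon> r]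
          unfolding I_def A_def C_def K_def N_def Cg_def u_step by blast
        also have "\<dots> \<le> C * K * (r * (h n * \<eta>) + (r * (h n * a))\<^sup>2)"
        proof (intro mult_left_mono add_left_mono power_mono)
          have "norm (integral {u n i..u n (Suc i)} (speed \<omega>)) \<le> a * (u n (Suc i) - u n i)"
            using sub a(2) u3(3)[OF i] by (intro integral_bound ci) auto
          thus "norm (integral {u n i..u n (Suc i)} (speed \<omega>)) \<le> h n * a" unfolding u_step by (simp add: mult.commute)
        qed (use C0 K0 r in auto)
        finally show ?thesis .
      qed
      have "\<Psi> n \<omega> \<le> (\<Sum>i<Suc n. C * K * (r * (h n * \<eta>) + (r * (h n * a))\<^sup>2))"
        unfolding \<Psi>_def by (intro sum_mono step) auto
      also have "\<dots> = (real (Suc n) * h n) * (C * K * r) * \<eta> + (real (Suc n) * h n) * (C * K * (r * a)\<^sup>2) * h n"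
        by (simp only: sum_constant card_lessThan) (simp add: algebra_simps power2_eq_square)
      also have "\<dots> \<le> \<kappa> * \<eta> + \<kappa>2 * h n"
        unfolding h(2) using \<eta> h(1)[of n] by (intro add_mono mult_right_mono) (auto simp: \<kappa>_def \<kappa>2_def mult_ac)
      also have "\<kappa> * \<eta> = e / 4" using \<kappa> by (simp add: \<eta>_def)
      also have "\<kappa>2 * h n \<le> e / 4" using hn(3) \<kappa>2 by (simp add: field_simps)
      finally show "norm (max 0 (\<Psi> n \<omega>) - 0) < e" using e by simp
    qed
  qed
  have lim0: "(\<lambda>n. expectation (\<lambda>\<omega>. max 0 (\<Psi> n \<omega>))) \<longlonglongrightarrow> expectation (\<lambda>\<omega>. 0)"
  proof (rule integral_dominated_convergence[where w=w])
    show "(\<lambda>\<omega>. max 0 (\<Psi> n \<omega>)) \<in> borel_measurable M" for n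
      using borel_measurable_integrable[OF \<Psi>_int[of n]] by measurable
    show "AE \<omega> in M. (\<lambda>n. max 0 (\<Psi> n \<omega>)) \<longlonglongrightarrow> 0" using V(4) by eventually_elim (rule conv)
    show "AE \<omega> in M. norm (max 0 (\<Psi> n \<omega>)) \<le> w \<omega>" for n using V(4) by eventually_elim (use dom in auto)
  qed (use w_int in auto)
  define \<theta> where "\<theta> w = expectation (\<lambda>\<omega>. ?\<Theta> (X w \<omega>))" for w
  have est: "expectation (\<lambda>\<omega>. ?g (X t \<omega>)) - expectation (\<lambda>\<omega>. ?g (X s \<omega>)) \<le>
      expectation (\<lambda>\<omega>. max 0 (\<Psi> n \<omega>)) + (t - s) * (Cg * Mx) + h n / 2 * (\<theta> s - \<theta> t) + (t - s) * C2 * sqrt (h n)" for n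
  proof -
    have "?g (X t \<omega>) - ?g (X s \<omega>) = (\<Sum>i<Suc n. ?g (X (u n (Suc i)) \<omega>) - ?g (X (u n i) \<omega>))" for \<omega>
      unfolding sum_lessThan_telescope[of "\<lambda>i. ?g (X (u n i) \<omega>)"] u_end ..
    also have "\<dots> \<omega> = \<Psi> n \<omega> + (\<Sum>i<Suc n. h n * A n i \<omega> + II n i \<omega>)" for \<omega>
      unfolding \<Psi>_def sum.distrib[symmetric] by (intro sum.cong refl) (simp add: I_def II_def)
    finally have eq: "?g (X t \<omega>) - ?g (X s \<omega>) = \<Psi> n \<omega> + (\<Sum>i<Suc n. h n * A n i \<omega> + II n i \<omega>)" for \<omega> .
    have gs: "integrable M (\<lambda>\<omega>. ?g (X t \<omega>))" "integrable M (\<lambda>\<omega>. ?g (X s \<omega>))" using st by (auto intro!: g_int X_measurable)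
    have "expectation (\<lambda>\<omega>. ?g (X t \<omega>)) - expectation (\<lambda>\<omega>. ?g (X s \<omega>)) = expectation (\<lambda>\<omega>. \<Psi> n \<omega> + (\<Sum>i<Suc n. h n * A n i \<omega> + II n i \<omega>))"
      unfolding Bochner_Integration.integral_diff[OF gs, symmetric] eq ..
    also have "\<dots> = expectation (\<Psi> n) + (\<Sum>i<Suc n. h n * expectation (A n i) + expectation (II n i))"
    proof -
      have i: "integrable M (\<lambda>\<omega>. h n * A n i \<omega> + II n i \<omega>)" if "i \<in> {..<Suc n}" for i
        using that by (intro Bochner_Integration.integrable_add integrable_mult_right A_int II_int) auto
      have "expectation (\<lambda>\<omega>. \<Psi> n \<omega> + (\<Sum>i<Suc n. h n * A n i \<omega> + II n i \<omega>)) =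
          expectation (\<Psi> n) + expectation (\<lambda>\<omega>. \<Sum>i<Suc n. h n * A n i \<omega> + II n i \<omega>)"
        by (rule Bochner_Integration.integral_add[OF \<Psi>_int Bochner_Integration.integrable_sum[OF i]])
      also have "expectation (\<lambda>\<omega>. \<Sum>i<Suc n. h n * A n i \<omega> + II n i \<omega>) = (\<Sum>i<Suc n. expectation (\<lambda>\<omega>. h n * A n i \<omega> + II n i \<omega>))"
        by (rule Bochner_Integration.integral_sum[OF i])
      also have "(\<Sum>i<Suc n. expectation (\<lambda>\<omega>. h n * A n i \<omega> + II n i \<omega>)) = (\<Sum>i<Suc n. h n * expectation (A n i) + expectation (II n i))"
      proof (intro sum.cong refl)
        fix i assume "i \<in> {..<Suc n}"
        hence "i < Suc n" by simp
        from A_int[OF this] II_int[OF this]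
        show "expectation (\<lambda>\<omega>. h n * A n i \<omega> + II n i \<omega>) = h n * expectation (A n i) + expectation (II n i)"
          by (subst Bochner_Integration.integral_add) auto
      qed
      finally show ?thesis .
    qed
    also have "\<dots> \<le> expectation (\<lambda>\<omega>. max 0 (\<Psi> n \<omega>)) +
        (\<Sum>i<Suc n. h n * (Cg * Mx) + (h n / 2 * \<theta> (u n i) - h n / 2 * \<theta> (u n (Suc i))) + C2 * (h n * sqrt (h n)))"
    proof (rule add_mono[OF _ sum_mono])
      show "expectation (\<Psi> n) \<le> expectation (\<lambda>\<omega>. max 0 (\<Psi> n \<omega>))"
        using \<Psi>_int by (intro integral_mono) auto
      fix i assume "i \<in> {..<Suc n}"
      hence i: "i < Suc n" by simp
      have X': "X (u n (Suc i)) \<in> borel_measurable M" using Xm(1)[of "Suc i" n] i by simp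
      have uT: "u n (Suc i) \<in> {0..T}" using u_T[of "Suc i" n] i by simp
      have "expectation (A n i) = Cg * expectation (\<lambda>\<omega>. ?g (X (u n (Suc i)) \<omega>)) - \<theta> (u n (Suc i)) / 2"
        unfolding A_def[abs_def] \<theta>_def using g_int[OF X'] \<Theta>_int[OF uT] by simp
      also have "\<dots> \<le> Cg * Mx - \<theta> (u n (Suc i)) / 2"
        using Mx[OF u_in[of "Suc i" n]] Cg0 i by (intro diff_right_mono mult_left_mono) auto
      finally have "h n * expectation (A n i) \<le> h n * (Cg * Mx - \<theta> (u n (Suc i)) / 2)"
        using h(1)[of n] by (intro mult_left_mono) auto
      moreover have "expectation (II n i) \<le> h n * (\<theta> (u n i) / 2) + C2 * (h n * sqrt (h n))"
        using C2(2)[OF u3(1,2,4)[OF i]] unfolding II_def[abs_def] u_step \<theta>_def .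
      ultimately show "h n * expectation (A n i) + expectation (II n i) \<le>
          h n * (Cg * Mx) + (h n / 2 * \<theta> (u n i) - h n / 2 * \<theta> (u n (Suc i))) + C2 * (h n * sqrt (h n))"
        by (simp add: algebra_simps)
    qed
    \<comment> \<open>The mean Laplacians telescope to their two end values, multiplied by
      \<open>h n\<close>, and so disappear in the limit.\<close>
    also have "(\<Sum>i<Suc n. h n * (Cg * Mx) + (h n / 2 * \<theta> (u n i) - h n / 2 * \<theta> (u n (Suc i))) + C2 * (h n * sqrt (h n))) =
        (real (Suc n) * h n) * (Cg * Mx) + (h n / 2 * \<theta> s - h n / 2 * \<theta> t) + (real (Suc n) * h n) * (C2 * sqrt (h n))"
      unfolding sum.distrib sum_lessThan_telescope'[of "\<lambda>i. h n / 2 * \<theta> (u n i)"] u_end by simp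
    finally have "expectation (\<lambda>\<omega>. ?g (X t \<omega>)) - expectation (\<lambda>\<omega>. ?g (X s \<omega>)) \<le> expectation (\<lambda>\<omega>. max 0 (\<Psi> n \<omega>)) +
        ((t - s) * (Cg * Mx) + (h n / 2 * \<theta> s - h n / 2 * \<theta> t) + (t - s) * (C2 * sqrt (h n)))" unfolding h(2) .
    thus ?thesis unfolding right_diff_distrib[of "h n / 2"] mult.assoc[of "t - s" C2] by linarith
  qed
  have hlim: "h \<longlonglongrightarrow> 0" unfolding h_def
    by (rule tendsto_divide_0[OF tendsto_const]) (intro filterlim_at_top_imp_at_infinity filterlim_compose[OF filterlim_real_sequentially filterlim_Suc])
  have "(\<lambda>n. expectation (\<lambda>\<omega>. max 0 (\<Psi> n \<omega>)) + (t - s) * (Cg * Mx) + h n / 2 * (\<theta> s - \<theta> t) + (t - s) * C2 * sqrt (h n))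
      \<longlonglongrightarrow> expectation (\<lambda>\<omega>. 0) + (t - s) * (Cg * Mx) + 0 / 2 * (\<theta> s - \<theta> t) + (t - s) * C2 * sqrt 0"
    by (intro tendsto_intros lim0 hlim) simp
  hence "(\<lambda>n. expectation (\<lambda>\<omega>. max 0 (\<Psi> n \<omega>)) + (t - s) * (Cg * Mx) + h n / 2 * (\<theta> s - \<theta> t) + (t - s) * C2 * sqrt (h n))
      \<longlonglongrightarrow> (t - s) * (Cg * Mx)" by simp
  from LIMSEQ_le_const[OF this] est
  have "expectation (\<lambda>\<omega>. ?g (X t \<omega>)) - expectation (\<lambda>\<omega>. ?g (X s \<omega>)) \<le> (t - s) * (Cg * Mx)" by blast
  thus ?thesis by simp
qed

end

section \<open>Inverse moments\<close>

text \<open>With \<open>a = \<alpha> \<bullet> x\<close>, the product is at most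
  \<open>a ^ m\<close> times a polynomial in \<open>norm x\<close>. If \<open>a powr (m - q)\<close>
  is small enough to absorb the polynomial, the inverse product dominates; otherwise
  \<open>a\<close> is bounded below by a negative power of \<open>1 + r * norm x\<close>, which
  gives the last term with its exponent rounded up. The strict inequality \<open>q < m\<close> makes
  this dichotomy possible.\<close>

lemma powr_le_wall_prod:
  fixes Rp :: "(real ^ 'd) set"
  assumes fin: "finite Rp" and r: "r \<ge> 1" "\<forall>\<alpha>\<in>Rp. norm \<alpha> \<le> r" and x: "x \<in> weyl_chamber Rp"
    and \<alpha>: "\<alpha> \<in> Rp" and q: "0 < q" "q < real m"
  shows "(\<alpha> \<bullet> x) powr (- q) \<le> 1 / wall_prod Rp m x
    + (1 + r * norm x) ^ nat \<lceil>real (m * card Rp) * q / (real m - q)\<rceil>"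
proof -
  let ?\<rho> = "1 + r * norm x" and ?N = "m * card Rp"
  define a where "a = \<alpha> \<bullet> x"
  have \<rho>: "?\<rho> \<ge> 1" using r by simp
  have pos: "\<beta> \<bullet> x > 0" if "\<beta> \<in> Rp" for \<beta> using x that by (auto simp: weyl_chamber_def)
  have le: "\<beta> \<bullet> x \<le> ?\<rho>" if "\<beta> \<in> Rp" for \<beta>
    using norm_cauchy_schwarz[of \<beta> x] mult_right_mono[OF bspec[OF r(2) that], of "norm x"] by simp
  have a: "a > 0" using pos[OF \<alpha>] by (simp add: a_def)
  have P: "wall_prod Rp m x > 0" by (rule wall_prod_pos[OF x])
  have "wall_prod Rp m x = a ^ m * (\<Prod>\<beta>\<in>Rp - {\<alpha>}. (\<beta> \<bullet> x) ^ m)"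
    unfolding wall_prod_def a_def using fin \<alpha> by (rule prod.remove)
  also have "\<dots> \<le> a ^ m * (\<Prod>\<beta>\<in>Rp - {\<alpha>}. ?\<rho> ^ m)"
    using a pos le by (intro mult_left_mono prod_mono conjI power_mono) (auto simp: less_imp_le)
  also have "(\<Prod>\<beta>\<in>Rp - {\<alpha>}. ?\<rho> ^ m) = ?\<rho> ^ (m * (card Rp - 1))"
    using fin \<alpha> by (simp add: power_mult)
  also have "a ^ m * \<dots> \<le> a ^ m * ?\<rho> ^ ?N" using a \<rho> by (intro mult_left_mono power_increasing) auto
  finally have Pl: "wall_prod Rp m x \<le> a ^ m * ?\<rho> ^ ?N" .
  have "a powr m = a ^ m" "?\<rho> powr ?N = ?\<rho> ^ ?N" using a \<rho> by (intro powr_realpow; linarith)+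
  with Pl have Ple: "wall_prod Rp m x \<le> a powr m * ?\<rho> powr ?N" by (simp only:)
  show ?thesis
  proof (cases "a powr (real m - q) * ?\<rho> powr ?N \<le> 1")
    case True
    have "wall_prod Rp m x * a powr (- q) \<le> (a powr m * ?\<rho> powr ?N) * a powr (- q)"
      using Ple by (intro mult_right_mono) auto
    also have "\<dots> = a powr (real m - q) * ?\<rho> powr ?N" by (simp add: powr_diff powr_minus_divide)
    also have "\<dots> \<le> 1" by (rule True)
    finally have "a powr (- q) \<le> 1 / wall_prod Rp m x" using P by (simp add: field_simps)
    thus ?thesis unfolding a_def using \<rho> by (intro add_increasing2) auto
  next
    case False
    define c where "c = real m - q"
    have c: "c > 0" using q by (simp add: c_def)
    have "a powr (- c) < ?\<rho> powr ?N" using False a by (simp add: c_def[symmetric] powr_minus field_simps)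
    hence "(a powr (- c)) powr (q / c) \<le> (?\<rho> powr ?N) powr (q / c)"
      using c q by (intro powr_mono2) auto
    hence "a powr (- q) \<le> ?\<rho> powr (real ?N * q / c)" using c by (simp add: powr_powr)
    also have "\<dots> \<le> ?\<rho> powr (real (nat \<lceil>real ?N * q / c\<rceil>))"
      using \<rho> by (intro powr_mono) linarith+
    also have "\<dots> = ?\<rho> ^ nat \<lceil>real ?N * q / c\<rceil>" using \<rho> by (intro powr_realpow) linarith
    finally show ?thesis unfolding a_def c_def using P by (intro add_increasing) auto
  qed
qed

context dunkl_setup
begin

lemma AE_X0: "AE \<omega> in M. X 0 \<omega> = x0"
  using AE_path AE_B
proof eventually_elim
  case (elim \<omega>)
  thus ?case using T_pos unfolding dunkl_path_def by (auto dest!: bspec[of _ _ 0])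
qed

text \<open>On intervals of length \<open>\<tau>\<close> with \<open>C \<tau> \<le> 1/2\<close> the estimate bounds the supremum of the
  expectations by twice the initial one.\<close>

lemma test_fun_expectation_bound:
  assumes m: "even m" "m \<ge> 2" "real m < 2 * \<nu>"
  obtains C where "C \<ge> 0" "\<And>\<epsilon> t. \<lbrakk>\<epsilon> > 0; t \<in> {0..T}\<rbrakk> \<Longrightarrow> expectation (\<lambda>\<omega>. test_fun Rp m \<epsilon> (X t \<omega>)) \<le> C"
proof -
  define Cg where "Cg = real m * real (card Rp) * (Kb\<^sup>2 / (4 * \<nu> - 2 * real m))"
  have Cg0: "Cg \<ge> 0" using m by (simp add: Cg_def)
  \<comment> \<open>\<open>J\<close> intervals of length \<open>\<tau>\<close> fill
    \<open>{0..T}\<close>, with \<open>\<tau> * Cg \<le> 1 / 2\<close>. Since \<open>J\<close> does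
    not depend on \<open>\<epsilon>\<close>, neither does the final factor
    \<open>2 ^ J\<close>.\<close>
  define J where "J = Suc (nat \<lceil>2 * T * Cg\<rceil>)"
  define \<tau> where "\<tau> = T / real J"
  have J: "real J > 0" "2 * T * Cg \<le> real J" unfolding J_def by linarith+
  have \<tau>: "\<tau> > 0" "\<tau> * Cg \<le> 1 / 2" "real J * \<tau> = T"
    using J T_pos by (auto simp: \<tau>_def field_simps)
  let ?C = "2 ^ J * (1 / wall_prod Rp m x0)"
  have P0: "wall_prod Rp m x0 > 0" by (rule wall_prod_pos[OF x0])
  show ?thesis
  proof
    show "?C \<ge> 0" using P0 by simp
    fix \<epsilon> t :: real assume \<epsilon>: "\<epsilon> > 0" and t: "t \<in> {0..T}"
    define G where "G u = expectation (\<lambda>\<omega>. test_fun Rp m \<epsilon> (X u \<omega>))" for u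
    have bnd: "\<bar>test_fun Rp m \<epsilon> z\<bar> \<le> 1 / \<epsilon>" for z using test_fun_bounds[OF m(1) \<epsilon>, of Rp z] by linarith
    have int: "integrable M (\<lambda>\<omega>. test_fun Rp m \<epsilon> (X u \<omega>))" if "u \<in> {0..T}" for u
      using bnd X_measurable[OF that] by (intro integrable_const_bound[where B="1 / \<epsilon>"] AE_I2) simp_all
    have G_le: "G u \<le> 1 / \<epsilon>" if "u \<in> {0..T}" for u
    proof -
      have "G u \<le> expectation (\<lambda>\<omega>. 1 / \<epsilon>)" unfolding G_def
        using test_fun_bounds[OF m(1) \<epsilon>] by (intro integral_mono int[OF that]) auto
      thus ?thesis by (simp add: prob_space)
    qed
    have G0: "G u \<ge> 0" for u unfolding G_def
      using test_fun_bounds[OF m(1) \<epsilon>] by (intro Bochner_Integration.integral_nonneg)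
    \<comment> \<open>The supremum \<open>S\<close> is finite because the test function is at most
      \<open>1 / \<epsilon>\<close>; once half of it is absorbed on the left, the bound no longer
      involves \<open>\<epsilon>\<close>.\<close>
    have dbl: "G v \<le> 2 * G s" if sv: "0 \<le> s" "s \<le> v" "v \<le> s + \<tau>" "v \<le> T" for s v
    proof -
      define S where "S = (SUP u\<in>{s..v}. G u)"
      have bdd: "bdd_above (G ` {s..v})" using sv by (intro bdd_aboveI2[where M="1 / \<epsilon>"] G_le) auto
      have up: "G u \<le> S" if "u \<in> {s..v}" for u unfolding S_def by (rule cSUP_upper[OF that bdd])
      have S0: "S \<ge> 0" using up[of s] G0[of s] sv by simp
      have "S \<le> G s + \<tau> * (Cg * S)"
        unfolding S_def
      proof (rule cSUP_least)
        show "{s..v} \<noteq> {}" using sv by simp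
        fix u assume u: "u \<in> {s..v}"
        show "G u \<le> G s + \<tau> * (Cg * (SUP u\<in>{s..v}. G u))" unfolding S_def[symmetric]
        proof (cases "u = s")
          case True
          thus "G u \<le> G s + \<tau> * (Cg * S)" using \<tau> Cg0 S0 by simp
        next
          case False
          hence "s < u" using u by simp
          hence "G u \<le> G s + (u - s) * (Cg * S)" unfolding G_def Cg_def
            using u sv by (intro test_fun_ito_step[OF m \<epsilon>] up[unfolded G_def]) auto
          also have "\<dots> \<le> G s + \<tau> * (Cg * S)" using u sv Cg0 S0 by (intro add_left_mono mult_right_mono) auto
          finally show "G u \<le> G s + \<tau> * (Cg * S)" .
        qed
      qed
      also have "\<tau> * (Cg * S) \<le> 1 / 2 * S" unfolding mult.assoc[symmetric] using \<tau>(2) S0 by (rule mult_right_mono)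
      finally show ?thesis using up[of v] sv by simp
    qed
    have it: "j \<le> J \<Longrightarrow> \<forall>u\<in>{0..real j * \<tau>}. G u \<le> 2 ^ j * G 0" for j
    proof (induction j)
      case (Suc j)
      have jT: "real (Suc j) * \<tau> \<le> T"
        using Suc.prems \<tau>(1) mult_right_mono[of "real (Suc j)" "real J" \<tau>] unfolding \<tau>(3) by simp
      show ?case
      proof
        fix u assume u: "u \<in> {0..real (Suc j) * \<tau>}"
        show "G u \<le> 2 ^ Suc j * G 0"
        proof (cases "u \<le> real j * \<tau>")
          case True
          hence "G u \<le> 2 ^ j * G 0" using Suc u by auto
          also have "\<dots> \<le> 2 ^ Suc j * G 0" using G0 by (intro mult_right_mono) auto
          finally show ?thesis .
        next
          case False
          have "G u \<le> 2 * G (real j * \<tau>)"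
            using False u jT \<tau>(1) by (intro dbl) (auto simp: algebra_simps)
          moreover have "G (real j * \<tau>) \<le> 2 ^ j * G 0" using Suc \<tau>(1) by auto
          ultimately show ?thesis by simp
        qed
      qed
    qed simp
    have "G t \<le> 2 ^ J * G 0" using it[of J] t \<tau>(3) by auto
    also have "G 0 = expectation (\<lambda>\<omega>. test_fun Rp m \<epsilon> x0)"
      unfolding G_def using T_pos X_measurable[of 0] AE_X0 by (intro integral_cong_AE) auto
    also have "\<dots> = test_fun Rp m \<epsilon> x0" by (simp add: prob_space)
    also have "2 ^ J * test_fun Rp m \<epsilon> x0 \<le> ?C"
      unfolding test_fun_def using P0 \<epsilon> by (intro mult_left_mono divide_left_mono mult_pos_pos) auto
    finally show "expectation (\<lambda>\<omega>. test_fun Rp m \<epsilon> (X t \<omega>)) \<le> ?C" unfolding G_def .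
  qed
qed

text \<open>The previous bound is uniform in \<open>\<epsilon>\<close>, so Fatou's lemma along
  \<open>\<epsilon> = 1 / (n + 1)\<close> removes the regularisation.\<close>

lemma inverse_wall_prod_moment:
  assumes m: "even m" "m \<ge> 2" "real m < 2 * \<nu>"
  obtains C where "C \<ge> 0"
    "\<And>t. t \<in> {0..T} \<Longrightarrow> (\<integral>\<^sup>+\<omega>. ennreal (1 / wall_prod Rp m (X t \<omega>)) \<partial>M) \<le> ennreal C"
proof -
  obtain C where C: "C \<ge> 0"
    "\<And>\<epsilon> t. \<lbrakk>\<epsilon> > 0; t \<in> {0..T}\<rbrakk> \<Longrightarrow> expectation (\<lambda>\<omega>. test_fun Rp m \<epsilon> (X t \<omega>)) \<le> C"
    by (rule test_fun_expectation_bound[OF m]) blast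
  show ?thesis
  proof
    show "C \<ge> 0" by (rule C(1))
    fix t assume t: "t \<in> {0..T}"
    note [measurable] = X_measurable[OF t]
    let ?e = "\<lambda>n. inverse (real (Suc n))"
    have "(\<integral>\<^sup>+\<omega>. ennreal (1 / wall_prod Rp m (X t \<omega>)) \<partial>M) =
        (\<integral>\<^sup>+\<omega>. liminf (\<lambda>n. ennreal (test_fun Rp m (?e n) (X t \<omega>))) \<partial>M)"
    proof (rule nn_integral_cong_AE)
      show "AE \<omega> in M. ennreal (1 / wall_prod Rp m (X t \<omega>)) = liminf (\<lambda>n. ennreal (test_fun Rp m (?e n) (X t \<omega>)))"
        using AE_X_W[OF t]
      proof eventually_elim
        case (elim \<omega>)
        have P: "wall_prod Rp m (X t \<omega>) > 0" by (rule wall_prod_pos[OF elim])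
        have "(\<lambda>n. 1 / (?e n + wall_prod Rp m (X t \<omega>))) \<longlonglongrightarrow> 1 / (0 + wall_prod Rp m (X t \<omega>))"
          using P by (intro tendsto_intros LIMSEQ_inverse_real_of_nat) auto
        hence "(\<lambda>n. ennreal (test_fun Rp m (?e n) (X t \<omega>))) \<longlonglongrightarrow> ennreal (1 / wall_prod Rp m (X t \<omega>))"
          unfolding test_fun_def by (intro tendsto_ennrealI) simp
        from lim_imp_Liminf[OF _ this] show ?case by simp
      qed
    qed
    also have "\<dots> \<le> liminf (\<lambda>n. \<integral>\<^sup>+\<omega>. ennreal (test_fun Rp m (?e n) (X t \<omega>)) \<partial>M)"
      by (rule nn_integral_liminf) measurable
    also have "\<dots> \<le> ennreal C"
    proof -
      have le: "(\<integral>\<^sup>+\<omega>. ennreal (test_fun Rp m (?e n) (X t \<omega>)) \<partial>M) \<le> ennreal C" for n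
      proof -
        have e: "?e n > 0" by simp
        have "\<bar>test_fun Rp m (?e n) z\<bar> \<le> 1 / ?e n" for z using test_fun_bounds[OF m(1) e, of Rp z] by linarith
        hence "integrable M (\<lambda>\<omega>. test_fun Rp m (?e n) (X t \<omega>))"
          by (intro integrable_const_bound[where B="1 / ?e n"] AE_I2) simp_all
        hence "(\<integral>\<^sup>+\<omega>. ennreal (test_fun Rp m (?e n) (X t \<omega>)) \<partial>M) = ennreal (expectation (\<lambda>\<omega>. test_fun Rp m (?e n) (X t \<omega>)))"
          using test_fun_bounds[OF m(1) e] by (intro nn_integral_eq_integral) auto
        thus ?thesis using C(2)[OF e t] by (simp add: ennreal_leI)
      qed
      have "liminf (\<lambda>n. \<integral>\<^sup>+\<omega>. ennreal (test_fun Rp m (?e n) (X t \<omega>)) \<partial>M) \<le> liminf (\<lambda>n. ennreal C)"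
        using le by (intro Liminf_mono always_eventually) auto
      thus ?thesis by (simp add: Liminf_const)
    qed
    finally show "(\<integral>\<^sup>+\<omega>. ennreal (1 / wall_prod Rp m (X t \<omega>)) \<partial>M) \<le> ennreal C" .
  qed
qed

lemma inverse_root_moment:
  assumes \<nu>2: "\<nu> > 2" and q: "0 < q" "q \<le> \<nu>"
  obtains C where "C \<ge> 0"
    "\<And>t \<alpha>. \<lbrakk>t \<in> {0..T}; \<alpha> \<in> Rp\<rbrakk> \<Longrightarrow> (\<integral>\<^sup>+\<omega>. ennreal ((\<alpha> \<bullet> X t \<omega>) powr (- q)) \<partial>M) \<le> ennreal C"
proof -
  \<comment> \<open>The least even integer above \<open>\<nu>\<close>: it is at most
    \<open>\<nu> + 2\<close>, hence below \<open>2 * \<nu>\<close> because \<open>\<nu> > 2\<close>,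
    and it exceeds \<open>q\<close> because \<open>q \<le> \<nu>\<close>.\<close>
  define m where "m = 2 * (nat \<lfloor>\<nu> / 2\<rfloor> + 1)"
  have fl: "real (nat \<lfloor>\<nu> / 2\<rfloor>) \<le> \<nu> / 2" "\<nu> / 2 < real (nat \<lfloor>\<nu> / 2\<rfloor>) + 1"
    using \<nu>2 by linarith+
  have rm: "real m = 2 * real (nat \<lfloor>\<nu> / 2\<rfloor>) + 2" unfolding m_def of_nat_mult of_nat_add by simp
  have m: "even m" "m \<ge> 2" "real m < 2 * \<nu>" and qm: "q < real m"
    using fl \<nu>2 q unfolding rm by (simp_all add: m_def) linarith+
  obtain r where r: "r \<ge> 1" "\<forall>\<alpha>\<in>Rp. norm \<alpha> \<le> r" by (rule roots_norm_bound[OF fin])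
  obtain C where C: "C \<ge> 0"
    "\<And>t. t \<in> {0..T} \<Longrightarrow> (\<integral>\<^sup>+\<omega>. ennreal (1 / wall_prod Rp m (X t \<omega>)) \<partial>M) \<le> ennreal C"
    by (rule inverse_wall_prod_moment[OF m]) blast
  define \<kappa> where "\<kappa> = nat \<lceil>real (m * card Rp) * q / (real m - q)\<rceil>"
  obtain V where V: "V \<in> borel_measurable M" "\<And>\<omega>. V \<omega> \<ge> 1"
    "\<And>j. j \<le> \<kappa> \<Longrightarrow> integrable M (\<lambda>\<omega>. V \<omega> ^ j)" "AE \<omega> in M. controlled V \<omega>"
    by (rule controlled_moments[of \<kappa>]) blast
  define U where "U \<omega> = (2 * r) ^ \<kappa> * V \<omega> ^ \<kappa>" for \<omega>
  have U0: "U \<omega> \<ge> 0" for \<omega> using r V(2)[of \<omega>] by (simp add: U_def)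
  have U_int: "integrable M U" unfolding U_def[abs_def] using V(3)[of \<kappa>] by simp
  have [measurable]: "U \<in> borel_measurable M" using U_int by blast
  show ?thesis
  proof
    show "C + expectation U \<ge> 0" using C(1) U0 by (intro add_nonneg_nonneg Bochner_Integration.integral_nonneg)
    fix t \<alpha> assume t: "t \<in> {0..T}" and \<alpha>: "\<alpha> \<in> Rp"
    note [measurable] = X_measurable[OF t]
    have "(\<integral>\<^sup>+\<omega>. ennreal ((\<alpha> \<bullet> X t \<omega>) powr (- q)) \<partial>M) \<le> (\<integral>\<^sup>+\<omega>. ennreal (1 / wall_prod Rp m (X t \<omega>)) + ennreal (U \<omega>) \<partial>M)"
    proof (rule nn_integral_mono_AE)
      show "AE \<omega> in M. ennreal ((\<alpha> \<bullet> X t \<omega>) powr (- q)) \<le> ennreal (1 / wall_prod Rp m (X t \<omega>)) + ennreal (U \<omega>)"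
        using V(4)
      proof eventually_elim
        case (elim \<omega>)
        note G = controlledD[OF elim]
        have "(\<alpha> \<bullet> X t \<omega>) powr (- q) \<le> 1 / wall_prod Rp m (X t \<omega>) + (1 + r * norm (X t \<omega>)) ^ \<kappa>"
          unfolding \<kappa>_def by (rule powr_le_wall_prod[OF fin r G(2)[OF t] \<alpha> q(1) qm])
        also have "(1 + r * norm (X t \<omega>)) ^ \<kappa> \<le> (2 * r * V \<omega>) ^ \<kappa>"
        proof (rule power_mono)
          have "r * norm (X t \<omega>) \<le> r * V \<omega>" using r G(3)[OF t] by (intro mult_left_mono) auto
          moreover have "1 \<le> r * V \<omega>" using mult_mono[OF r(1) V(2)[of \<omega>]] r by simp
          ultimately show "1 + r * norm (X t \<omega>) \<le> 2 * r * V \<omega>" by simp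
        qed (use r in auto)
        also have "(2 * r * V \<omega>) ^ \<kappa> = U \<omega>" by (simp add: U_def power_mult_distrib)
        finally have "ennreal ((\<alpha> \<bullet> X t \<omega>) powr (- q)) \<le> ennreal (1 / wall_prod Rp m (X t \<omega>) + U \<omega>)"
          by (simp add: ennreal_leI)
        also have "\<dots> = ennreal (1 / wall_prod Rp m (X t \<omega>)) + ennreal (U \<omega>)"
          using U0 wall_prod_pos[OF G(2)[OF t], of m] by (intro ennreal_plus) (auto simp: less_imp_le)
        finally show ?case .
      qed
    qed
    also have "\<dots> = (\<integral>\<^sup>+\<omega>. ennreal (1 / wall_prod Rp m (X t \<omega>)) \<partial>M) + (\<integral>\<^sup>+\<omega>. ennreal (U \<omega>) \<partial>M)"
      by (intro nn_integral_add) measurable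
    also have "\<dots> \<le> ennreal C + ennreal (expectation U)"
      using C(2)[OF t] nn_integral_eq_integral[OF U_int] U0 by (intro add_mono) auto
    also have "\<dots> = ennreal (C + expectation U)"
      using C(1) U0 by (intro ennreal_plus[symmetric] Bochner_Integration.integral_nonneg)
    finally show "(\<integral>\<^sup>+\<omega>. ennreal ((\<alpha> \<bullet> X t \<omega>) powr (- q)) \<partial>M) \<le> ennreal (C + expectation U)" .
  qed
qed

end

section \<open>Moments of integrals of paths\<close>

text \<open>Jensen's inequality. Convexity is applied on the positive numbers, so zero entries are
  dropped first; changing the number of entries costs the factor \<open>(a' / a) powr p\<close>, and
  \<open>(a' / a) powr p \<le> a' / a\<close> restores the right normalisation.\<close>

lemma powr_mean_le:
  fixes y :: "'i \<Rightarrow> real"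
  assumes fin: "finite A" "A \<noteq> {}" and y: "\<And>i. i \<in> A \<Longrightarrow> y i \<ge> 0" and p: "p \<ge> 1"
  shows "((\<Sum>i\<in>A. y i) / real (card A)) powr p \<le> (\<Sum>i\<in>A. y i powr p) / real (card A)"
proof -
  define A' where "A' = {i \<in> A. y i > 0}"
  have fA': "finite A'" "A' \<subseteq> A" using fin by (auto simp: A'_def)
  have z: "y i = 0" if "i \<in> A - A'" for i using y[of i] that by (auto simp: A'_def not_less)
  have s: "(\<Sum>i\<in>A. y i) = (\<Sum>i\<in>A'. y i)" "(\<Sum>i\<in>A. y i powr p) = (\<Sum>i\<in>A'. y i powr p)"
    using fin fA' z by (intro sum.mono_neutral_right; simp)+
  show ?thesis
  proof (cases "A' = {}")
    case True
    thus ?thesis using s by simp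
  next
    case False
    define a a' where "a = real (card A)" and "a' = real (card A')"
    have a: "0 < a'" "a' \<le> a"
      using False fA' fin by (auto simp: a_def a'_def card_gt_0_iff intro: card_mono)
    have "(\<Sum>i\<in>A'. (1 / a') *\<^sub>R y i) powr p \<le> (\<Sum>i\<in>A'. (1 / a') * (y i powr p))"
      using a by (intro convex_on_sum[OF fA'(1) False powr_convex[OF p]]) (auto simp: A'_def a'_def)
    hence J: "((\<Sum>i\<in>A'. y i) / a') powr p \<le> (\<Sum>i\<in>A'. y i powr p) / a'"
      by (simp add: sum_divide_distrib)
    have nn: "(\<Sum>i\<in>A'. y i) \<ge> 0" "(\<Sum>i\<in>A'. y i powr p) \<ge> 0" using y fA' by (auto intro!: sum_nonneg)
    have "(\<Sum>i\<in>A'. y i) / a = (a' / a) * ((\<Sum>i\<in>A'. y i) / a')" using a by simp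
    hence "((\<Sum>i\<in>A'. y i) / a) powr p = ((a' / a) * ((\<Sum>i\<in>A'. y i) / a')) powr p" by (rule arg_cong)
    also have "\<dots> = (a' / a) powr p * ((\<Sum>i\<in>A'. y i) / a') powr p"
      by (rule powr_mult)
    also have "\<dots> \<le> (a' / a) * ((\<Sum>i\<in>A'. y i powr p) / a')"
    proof (intro mult_mono J)
      have "(a' / a) powr p \<le> (a' / a) powr 1" using a p by (intro powr_mono') auto
      thus "(a' / a) powr p \<le> a' / a" using a by simp
    qed (use a in auto)
    also have "\<dots> = (\<Sum>i\<in>A'. y i powr p) / a" using a by simp
    finally show ?thesis unfolding s a_def .
  qed
qed

lemma powr_sum_le:
  fixes y :: "'i \<Rightarrow> real"
  assumes fin: "finite A" and y: "\<And>i. i \<in> A \<Longrightarrow> y i \<ge> 0" and q: "q \<ge> 1"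
  shows "(\<Sum>i\<in>A. y i) powr q \<le> real (card A) powr (q - 1) * (\<Sum>i\<in>A. y i powr q)"
proof (cases "A = {}")
  case False
  define a where "a = real (card A)"
  have a: "a > 0" using fin False by (simp add: a_def card_gt_0_iff)
  have S: "(\<Sum>i\<in>A. y i) \<ge> 0" using y by (rule sum_nonneg)
  have "(\<Sum>i\<in>A. y i) powr q = a powr q * ((\<Sum>i\<in>A. y i) / a) powr q"
    using a S by (simp add: powr_mult[symmetric])
  also have "\<dots> \<le> a powr q * ((\<Sum>i\<in>A. y i powr q) / a)"
    unfolding a_def by (intro mult_left_mono powr_mean_le[OF fin False y q]) auto
  also have "\<dots> = a powr (q - 1) * (\<Sum>i\<in>A. y i powr q)" using a by (simp add: powr_diff)
  finally show ?thesis unfolding a_def .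
qed simp

text \<open>A crude substitute for Hoelder's inequality: the product is at most the cube of its
  largest factor. This is where the exponent \<open>3 * p\<close> arises.\<close>

lemma powr_prod3_le:
  fixes x y z :: real
  assumes "x \<ge> 0" "y \<ge> 0" "z \<ge> 0" "p \<ge> 0"
  shows "(x * y * z) powr p \<le> x powr (3 * p) + y powr (3 * p) + z powr (3 * p)"
proof -
  define w where "w = max x (max y z)"
  have w: "x \<le> w" "y \<le> w" "z \<le> w" "w = x \<or> w = y \<or> w = z" "w \<ge> 0" using assms by (auto simp: w_def)
  have "(x * y * z) powr p \<le> (w * w * w) powr p"
    using assms w by (intro powr_mono2 mult_mono mult_nonneg_nonneg) auto
  also have "\<dots> = w powr (3 * p)"
  proof -
    have "(w * w * w) powr p = w powr p * w powr p * w powr p" using w by (simp add: powr_mult)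
    also have "\<dots> = w powr (p + p + p)" by (simp only: powr_add)
    also have "p + p + p = 3 * p" by simp
    finally show ?thesis .
  qed
  also have "\<dots> \<le> x powr (3 * p) + y powr (3 * p) + z powr (3 * p)" using w(4) by auto
  finally show ?thesis .
qed

lemma riemann_sums_tendsto:
  fixes f :: "real \<Rightarrow> real"
  assumes f: "continuous_on {s..t} f" and st: "s < t"
  shows "(\<lambda>n. (t - s) * ((\<Sum>i<Suc n. f (s + real i * ((t - s) / real (Suc n)))) / real (Suc n))) \<longlonglongrightarrow> integral {s..t} f"
proof (rule LIMSEQ_I)
  fix e :: real assume e: "e > 0"
  define \<eta> where "\<eta> = e / (2 * (t - s))"
  have \<eta>: "\<eta> > 0" using e st by (simp add: \<eta>_def)
  have "uniformly_continuous_on {s..t} f" by (rule compact_uniformly_continuous[OF f compact_Icc])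
  then obtain \<delta> where \<delta>: "\<delta> > 0" "\<And>x y. \<lbrakk>x \<in> {s..t}; y \<in> {s..t}; dist y x < \<delta>\<rbrakk> \<Longrightarrow> dist (f y) (f x) < \<eta>"
    unfolding uniformly_continuous_on_def using \<eta> by metis
  define h where "h n = (t - s) / real (Suc n)" for n
  have hlim: "h \<longlonglongrightarrow> 0" unfolding h_def
    by (rule tendsto_divide_0[OF tendsto_const]) (intro filterlim_at_top_imp_at_infinity filterlim_compose[OF filterlim_real_sequentially filterlim_Suc])
  obtain n0 where n0: "\<And>n. n \<ge> n0 \<Longrightarrow> h n < \<delta>"
    using order_tendstoD(2)[OF hlim \<delta>(1)] unfolding eventually_sequentially by auto
  have h: "h n > 0" "real (Suc n) * h n = t - s" for n using st by (auto simp: h_def)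
  show "\<exists>n0. \<forall>n\<ge>n0. norm ((t - s) * ((\<Sum>i<Suc n. f (s + real i * ((t - s) / real (Suc n)))) / real (Suc n)) - integral {s..t} f) < e"
  proof (intro exI allI impI)
    fix n assume n: "n \<ge> n0"
    have u: "s + real i * h n \<in> {s..t}" if "i \<le> Suc n" for i
    proof -
      have "real i * h n \<le> real (Suc n) * h n" using that h(1)[of n] by (intro mult_right_mono) auto
      hence "real i * h n \<le> t - s" unfolding h(2) .
      thus ?thesis using h(1)[of n] by auto
    qed
    have st': "s + real (Suc n) * h n = t" unfolding h(2) by simp
    have int: "integral {s..t} f = (\<Sum>i<Suc n. integral {s + real i * h n..s + real (Suc i) * h n} f)"
      using integral_grid_sum[OF f, of "h n" "Suc n"] h(1)[of n] unfolding st' by simp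
    have R: "(t - s) * ((\<Sum>i<Suc n. f (s + real i * ((t - s) / real (Suc n)))) / real (Suc n)) = (\<Sum>i<Suc n. h n * f (s + real i * h n))"
      unfolding sum_distrib_left[symmetric] h_def by simp
    have "norm ((\<Sum>i<Suc n. h n * f (s + real i * h n)) - integral {s..t} f) \<le> (\<Sum>i<Suc n. h n * \<eta>)"
      unfolding int sum_subtractf[symmetric]
    proof (rule sum_norm_le)
      fix i assume "i \<in> {..<Suc n}"
      hence i: "i \<le> Suc n" "Suc i \<le> Suc n" by auto
      have st: "s + real (Suc i) * h n - (s + real i * h n) = h n" by (simp add: algebra_simps)
      have sub: "{s + real i * h n..s + real (Suc i) * h n} \<subseteq> {s..t}" using u[OF i(1)] u[OF i(2)] by auto
      have "norm (integral {s + real i * h n..s + real (Suc i) * h n} f - (s + real (Suc i) * h n - (s + real i * h n)) *\<^sub>R f (s + real i * h n))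
        \<le> (s + real (Suc i) * h n - (s + real i * h n)) * \<eta>"
      proof (rule integral_deviation_le[OF continuous_on_subset[OF f sub]])
        show "s + real i * h n \<le> s + real (Suc i) * h n" using st h(1)[of n] by linarith
        fix v assume v: "v \<in> {s + real i * h n..s + real (Suc i) * h n}"
        hence "dist v (s + real i * h n) < \<delta>" using n0[OF n] st by (auto simp: dist_real_def)
        thus "norm (f v - f (s + real i * h n)) \<le> \<eta>"
          using \<delta>(2)[OF u[OF i(1)], of v] v sub by (force simp: dist_norm)
      qed
      thus "norm (h n * f (s + real i * h n) - integral {s + real i * h n..s + real (Suc i) * h n} f) \<le> h n * \<eta>"
        unfolding st by (simp add: abs_minus_commute)
    qed
    also have "\<dots> = real (Suc n) * h n * \<eta>" by simp
    also have "\<dots> = e / 2"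
    proof -
      have "d * (e / (2 * d)) = e / 2" if "d \<noteq> 0" for d using that by simp
      from this[of "t - s"] show ?thesis unfolding h(2) \<eta>_def using st by simp
    qed
    finally show "norm ((t - s) * ((\<Sum>i<Suc n. f (s + real i * ((t - s) / real (Suc n)))) / real (Suc n)) - integral {s..t} f) < e"
      unfolding R using e by simp
  qed
qed

text \<open>Minkowski's integral inequality for continuous paths: Jensen for Riemann sums, then Fatou. No
  joint measurability is needed.\<close>

lemma nn_integral_powr_integral_le:
  fixes \<phi> :: "real \<Rightarrow> 'a \<Rightarrow> real"
  assumes st: "s < t" and p: "p \<ge> 1" and K: "K \<ge> 0"
    and m: "\<And>u. u \<in> {s..t} \<Longrightarrow> \<phi> u \<in> borel_measurable M"
    and path: "AE \<omega> in M. continuous_on {s..t} (\<lambda>u. \<phi> u \<omega>) \<and> (\<forall>u\<in>{s..t}. \<phi> u \<omega> \<ge> 0)"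
    and le: "\<And>u. u \<in> {s..t} \<Longrightarrow> (\<integral>\<^sup>+\<omega>. ennreal (\<phi> u \<omega> powr p) \<partial>M) \<le> ennreal K"
  obtains R where "R \<in> borel_measurable M" "\<And>\<omega>. R \<omega> \<ge> 0"
    "AE \<omega> in M. integral {s..t} (\<lambda>u. \<phi> u \<omega>) = R \<omega>"
    "(\<integral>\<^sup>+\<omega>. ennreal (R \<omega> powr p) \<partial>M) \<le> ennreal ((t - s) powr p * K)"
proof -
  define u where "u n i = s + real i * ((t - s) / real (Suc n))" for n i
  have u: "u n i \<in> {s..t}" if "i < Suc n" for n i
  proof -
    have h: "(t - s) / real (Suc n) > 0" "real (Suc n) * ((t - s) / real (Suc n)) = t - s" using st by auto
    have "real i * ((t - s) / real (Suc n)) \<le> real (Suc n) * ((t - s) / real (Suc n))"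
      using that h(1) by (intro mult_right_mono) auto
    hence "real i * ((t - s) / real (Suc n)) \<le> t - s" unfolding h(2) .
    moreover have "0 \<le> real i * ((t - s) / real (Suc n))" using h(1) by (intro mult_nonneg_nonneg) auto
    ultimately show ?thesis unfolding u_def by simp
  qed
  define S where "S n \<omega> = (\<Sum>i<Suc n. \<phi> (u n i) \<omega>) / real (Suc n)" for n \<omega>
  have Sm [measurable]: "S n \<in> borel_measurable M" for n
    unfolding S_def[abs_def] using m u by (intro borel_measurable_divide borel_measurable_sum) auto
  define A where "A n \<omega> = (\<Sum>i<Suc n. \<phi> (u n i) \<omega> powr p) / real (Suc n)" for n \<omega>
  have "(\<integral>\<^sup>+\<omega>. ennreal (integral {s..t} (\<lambda>u. \<phi> u \<omega>) powr p) \<partial>M) =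
      (\<integral>\<^sup>+\<omega>. liminf (\<lambda>n. ennreal (((t - s) * S n \<omega>) powr p)) \<partial>M)"
  proof (rule nn_integral_cong_AE)
    show "AE \<omega> in M. ennreal (integral {s..t} (\<lambda>u. \<phi> u \<omega>) powr p) = liminf (\<lambda>n. ennreal (((t - s) * S n \<omega>) powr p))"
      using path
    proof eventually_elim
      case (elim \<omega>)
      have "(\<lambda>n. (t - s) * S n \<omega>) \<longlonglongrightarrow> integral {s..t} (\<lambda>u. \<phi> u \<omega>)"
        unfolding S_def u_def using elim st by (intro riemann_sums_tendsto) auto
      moreover have "\<forall>\<^sub>F n in sequentially. 0 \<le> (t - s) * S n \<omega>"
      proof (intro always_eventually allI)
        fix n
        have "\<phi> (u n i) \<omega> \<ge> 0" if "i < Suc n" for i using elim u[OF that] by blast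
        hence "S n \<omega> \<ge> 0" unfolding S_def by (intro divide_nonneg_nonneg sum_nonneg) auto
        thus "0 \<le> (t - s) * S n \<omega>" using st by simp
      qed
      ultimately have "(\<lambda>n. ((t - s) * S n \<omega>) powr p) \<longlonglongrightarrow> integral {s..t} (\<lambda>u. \<phi> u \<omega>) powr p"
        using p by (intro tendsto_powr2 tendsto_const) auto
      from lim_imp_Liminf[OF _ tendsto_ennrealI[OF this]] show ?case by simp
    qed
  qed
  also have "\<dots> \<le> liminf (\<lambda>n. \<integral>\<^sup>+\<omega>. ennreal (((t - s) * S n \<omega>) powr p) \<partial>M)"
    by (rule nn_integral_liminf) measurable
  also have "\<dots> \<le> liminf (\<lambda>n. ennreal ((t - s) powr p * K))"
  proof (intro Liminf_mono always_eventually allI)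
    fix n
    have Am: "(\<lambda>\<omega>. ennreal (\<phi> (u n i) \<omega> powr p)) \<in> borel_measurable M" if "i < Suc n" for i
      using m[OF u[OF that]] by measurable
    have "(\<integral>\<^sup>+\<omega>. ennreal (((t - s) * S n \<omega>) powr p) \<partial>M) \<le>
        (\<integral>\<^sup>+\<omega>. (\<Sum>i<Suc n. ennreal ((t - s) powr p / real (Suc n)) * ennreal (\<phi> (u n i) \<omega> powr p)) \<partial>M)"
    proof (rule nn_integral_mono_AE)
      show "AE \<omega> in M. ennreal (((t - s) * S n \<omega>) powr p) \<le> (\<Sum>i<Suc n. ennreal ((t - s) powr p / real (Suc n)) * ennreal (\<phi> (u n i) \<omega> powr p))"
        using path
      proof eventually_elim
        case (elim \<omega>)
        have nn: "\<phi> (u n i) \<omega> \<ge> 0" if "i \<in> {..<Suc n}" for i using elim u[of i n] that by blast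
        hence S0: "S n \<omega> \<ge> 0" unfolding S_def by (intro divide_nonneg_nonneg sum_nonneg) auto
        have "((t - s) * S n \<omega>) powr p = (t - s) powr p * S n \<omega> powr p" using st S0 by (simp add: powr_mult)
        also have "\<dots> \<le> (t - s) powr p * ((\<Sum>i<Suc n. \<phi> (u n i) \<omega> powr p) / real (Suc n))"
        proof -
          have "((\<Sum>i<Suc n. \<phi> (u n i) \<omega>) / real (card {..<Suc n})) powr p \<le> (\<Sum>i<Suc n. \<phi> (u n i) \<omega> powr p) / real (card {..<Suc n})"
            by (rule powr_mean_le[OF _ _ nn p]) auto
          thus ?thesis unfolding S_def card_lessThan by (rule mult_left_mono) simp
        qed
        also have "\<dots> = (\<Sum>i<Suc n. (t - s) powr p / real (Suc n) * \<phi> (u n i) \<omega> powr p)"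
          unfolding sum_distrib_left[symmetric] by simp
        finally have "ennreal (((t - s) * S n \<omega>) powr p) \<le> ennreal (\<Sum>i<Suc n. (t - s) powr p / real (Suc n) * \<phi> (u n i) \<omega> powr p)"
          by (rule ennreal_leI)
        also have "\<dots> = (\<Sum>i<Suc n. ennreal ((t - s) powr p / real (Suc n) * \<phi> (u n i) \<omega> powr p))"
          by (intro sum_ennreal[symmetric]) auto
        also have "\<dots> = (\<Sum>i<Suc n. ennreal ((t - s) powr p / real (Suc n)) * ennreal (\<phi> (u n i) \<omega> powr p))"
          by (intro sum.cong refl ennreal_mult) auto
        finally show ?case .
      qed
    qed
    also have "\<dots> = (\<Sum>i<Suc n. ennreal ((t - s) powr p / real (Suc n)) * (\<integral>\<^sup>+\<omega>. ennreal (\<phi> (u n i) \<omega> powr p) \<partial>M))"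
    proof (subst nn_integral_sum)
      show "(\<Sum>i<Suc n. \<integral>\<^sup>+\<omega>. ennreal ((t - s) powr p / real (Suc n)) * ennreal (\<phi> (u n i) \<omega> powr p) \<partial>M) =
        (\<Sum>i<Suc n. ennreal ((t - s) powr p / real (Suc n)) * (\<integral>\<^sup>+\<omega>. ennreal (\<phi> (u n i) \<omega> powr p) \<partial>M))"
        using Am by (intro sum.cong refl nn_integral_cmult) auto
    qed (use Am in auto)
    also have "\<dots> \<le> (\<Sum>i<Suc n. ennreal ((t - s) powr p / real (Suc n)) * ennreal K)"
      using le u by (intro sum_mono mult_left_mono) auto
    also have "\<dots> = (\<Sum>i<Suc n. ennreal ((t - s) powr p / real (Suc n) * K))"
      using K by (intro sum.cong refl ennreal_mult[symmetric]) auto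
    also have "\<dots> = ennreal (\<Sum>i<Suc n. (t - s) powr p / real (Suc n) * K)"
      using K by (intro sum_ennreal) auto
    also have "(\<Sum>i<Suc n. (t - s) powr p / real (Suc n) * K) = (t - s) powr p * K"
      unfolding sum_constant card_lessThan by simp
    finally show "(\<integral>\<^sup>+\<omega>. ennreal (((t - s) * S n \<omega>) powr p) \<partial>M) \<le> ennreal ((t - s) powr p * K)" .
  qed
  finally have bound: "(\<integral>\<^sup>+\<omega>. ennreal (integral {s..t} (\<lambda>u. \<phi> u \<omega>) powr p) \<partial>M) \<le> ennreal ((t - s) powr p * K)"
    by (simp add: Liminf_const)
  \<comment> \<open>A version of the pathwise integral: as a liminf of measurable Riemann sums it is
    measurable everywhere, and it equals the integral off a null set.\<close>
  define R where "R \<omega> = enn2real (liminf (\<lambda>n. ennreal ((t - s) * S n \<omega>)))" for \<omega>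
  have [measurable]: "R \<in> borel_measurable M" unfolding R_def[abs_def] by measurable
  have R_eq: "AE \<omega> in M. integral {s..t} (\<lambda>u. \<phi> u \<omega>) = R \<omega>"
    using path
  proof eventually_elim
    case (elim \<omega>)
    have "(\<lambda>n. (t - s) * S n \<omega>) \<longlonglongrightarrow> integral {s..t} (\<lambda>u. \<phi> u \<omega>)"
      unfolding S_def u_def using elim st by (intro riemann_sums_tendsto) auto
    from lim_imp_Liminf[OF _ tendsto_ennrealI[OF this]]
    have "liminf (\<lambda>n. ennreal ((t - s) * S n \<omega>)) = ennreal (integral {s..t} (\<lambda>u. \<phi> u \<omega>))" by simp
    moreover have "integral {s..t} (\<lambda>u. \<phi> u \<omega>) \<ge> 0"
      using elim by (intro Henstock_Kurzweil_Integration.integral_nonneg integrable_continuous_real) auto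
    ultimately show ?case by (simp add: R_def)
  qed
  have "(\<integral>\<^sup>+\<omega>. ennreal (R \<omega> powr p) \<partial>M) = (\<integral>\<^sup>+\<omega>. ennreal (integral {s..t} (\<lambda>u. \<phi> u \<omega>) powr p) \<partial>M)"
    by (rule nn_integral_cong_AE) (use R_eq in eventually_elim, simp)
  with bound R_eq show ?thesis by (intro that[of R]) (auto simp: R_def)
qed

section \<open>Increments and the local error\<close>

lemma powr_add_le:
  fixes a b q :: real
  assumes "a \<ge> 0" "b \<ge> 0" "q \<ge> 0"
  shows "(a + b) powr q \<le> 2 powr q * (a powr q + b powr q)"
proof -
  have "(a + b) powr q \<le> (2 * max a b) powr q" using assms by (intro powr_mono2) auto
  also have "\<dots> = 2 powr q * max a b powr q" by (rule powr_mult)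
  also have "max a b powr q \<le> a powr q + b powr q" by (simp add: max_def)
  finally show ?thesis by simp
qed

section \<open>Upper bounds for means of nonnegative random variables\<close>

context prob_space
begin

text \<open>Measurability, sign and bound are carried together, so estimates can be composed with
  the nonnegative integral, and integrability is read off once at the end by
  \<open>mean_le_integrable\<close>.\<close>

definition mean_le :: "('a \<Rightarrow> real) \<Rightarrow> real \<Rightarrow> bool" where
  "mean_le f C \<longleftrightarrow> f \<in> borel_measurable M \<and> (\<forall>\<omega>. f \<omega> \<ge> 0) \<and> C \<ge> 0 \<and> (\<integral>\<^sup>+\<omega>. ennreal (f \<omega>) \<partial>M) \<le> ennreal C"

lemma mean_le_add:
  assumes "mean_le f C" "mean_le g E" shows "mean_le (\<lambda>\<omega>. f \<omega> + g \<omega>) (C + E)"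
proof -
  have [measurable]: "f \<in> borel_measurable M" "g \<in> borel_measurable M" using assms by (auto simp: mean_le_def)
  have "(\<integral>\<^sup>+\<omega>. ennreal (f \<omega> + g \<omega>) \<partial>M) = (\<integral>\<^sup>+\<omega>. ennreal (f \<omega>) + ennreal (g \<omega>) \<partial>M)"
    using assms by (intro nn_integral_cong) (auto simp: mean_le_def)
  also have "\<dots> = (\<integral>\<^sup>+\<omega>. ennreal (f \<omega>) \<partial>M) + (\<integral>\<^sup>+\<omega>. ennreal (g \<omega>) \<partial>M)" by (intro nn_integral_add) measurable
  also have "\<dots> \<le> ennreal C + ennreal E" using assms by (intro add_mono) (auto simp: mean_le_def)
  also have "\<dots> = ennreal (C + E)" using assms by (intro ennreal_plus[symmetric]) (auto simp: mean_le_def)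
  finally show ?thesis using assms by (auto simp: mean_le_def)
qed

lemma mean_le_cmult:
  assumes "mean_le f C" "c \<ge> 0" shows "mean_le (\<lambda>\<omega>. c * f \<omega>) (c * C)"
proof -
  have [measurable]: "f \<in> borel_measurable M" using assms by (auto simp: mean_le_def)
  have "(\<integral>\<^sup>+\<omega>. ennreal (c * f \<omega>) \<partial>M) = (\<integral>\<^sup>+\<omega>. ennreal c * ennreal (f \<omega>) \<partial>M)"
    using assms by (intro nn_integral_cong ennreal_mult) (auto simp: mean_le_def)
  also have "\<dots> = ennreal c * (\<integral>\<^sup>+\<omega>. ennreal (f \<omega>) \<partial>M)" by (intro nn_integral_cmult) measurable
  also have "\<dots> \<le> ennreal c * ennreal C" using assms by (intro mult_left_mono) (auto simp: mean_le_def)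
  also have "\<dots> = ennreal (c * C)" using assms by (intro ennreal_mult[symmetric]) (auto simp: mean_le_def)
  finally show ?thesis using assms by (auto simp: mean_le_def)
qed

lemma mean_le_const: "c \<ge> 0 \<Longrightarrow> mean_le (\<lambda>_. c) c"
  by (simp add: mean_le_def emeasure_space_1)

lemma mean_le_sum:
  assumes "finite A" "\<And>i. i \<in> A \<Longrightarrow> mean_le (f i) (C i)"
  shows "mean_le (\<lambda>\<omega>. \<Sum>i\<in>A. f i \<omega>) (\<Sum>i\<in>A. C i)"
  using assms
proof (induction A rule: finite_induct)
  case empty
  show ?case using mean_le_const[of 0] by simp
next
  case (insert i A)
  thus ?case using mean_le_add[of "f i" "C i" "\<lambda>\<omega>. \<Sum>i\<in>A. f i \<omega>" "\<Sum>i\<in>A. C i"] by simp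
qed

lemma mean_le_mono:
  assumes "mean_le g C" "C \<le> E" "f \<in> borel_measurable M" "\<And>\<omega>. f \<omega> \<ge> 0" "AE \<omega> in M. f \<omega> \<le> g \<omega>"
  shows "mean_le f E"
proof -
  have "(\<integral>\<^sup>+\<omega>. ennreal (f \<omega>) \<partial>M) \<le> (\<integral>\<^sup>+\<omega>. ennreal (g \<omega>) \<partial>M)"
    using assms(5) by (intro nn_integral_mono_AE) (auto simp: ennreal_leI)
  also have "\<dots> \<le> ennreal C" using assms by (simp add: mean_le_def)
  also have "\<dots> \<le> ennreal E" using assms by (simp add: ennreal_leI)
  finally show ?thesis using assms by (auto simp: mean_le_def)
qed

lemma mean_le_integrable:
  assumes "mean_le f C"
  shows "integrable M f" "expectation f \<le> C" "expectation f \<ge> 0"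
proof -
  show i: "integrable M f"
    using assms by (intro integrableI_nonneg) (auto simp: mean_le_def intro: le_less_trans)
  have "ennreal (expectation f) = (\<integral>\<^sup>+\<omega>. ennreal (f \<omega>) \<partial>M)"
    using assms by (intro nn_integral_eq_integral[symmetric] i) (auto simp: mean_le_def)
  hence "ennreal (expectation f) \<le> ennreal C" using assms by (simp add: mean_le_def)
  thus "expectation f \<le> C" using assms by (subst (asm) ennreal_le_iff) (auto simp: mean_le_def)
  show "expectation f \<ge> 0" using assms by (intro Bochner_Integration.integral_nonneg) (auto simp: mean_le_def)
qed

end

section \<open>Size and variation of the singular drift, increments of the solution\<close>

lemma dunkl_drift_measurable [measurable]: "dunkl_drift Rp k \<in> borel_measurable borel"
  unfolding dunkl_drift_def[abs_def] by measurable

lemma norm_dunkl_drift_le: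
  assumes "\<forall>\<alpha>\<in>Rp. k \<alpha> > 0" "x \<in> weyl_chamber Rp"
  shows "norm (dunkl_drift Rp k x) \<le> (\<Sum>\<alpha>\<in>Rp. k \<alpha> * norm \<alpha> * (1 / (\<alpha> \<bullet> x)))"
  unfolding dunkl_drift_def
proof (rule sum_norm_le)
  fix \<alpha> assume "\<alpha> \<in> Rp"
  hence "k \<alpha> > 0" "\<alpha> \<bullet> x > 0" using assms by (auto simp: weyl_chamber_def)
  thus "norm ((k \<alpha> / (\<alpha> \<bullet> x)) *\<^sub>R \<alpha>) \<le> k \<alpha> * norm \<alpha> * (1 / (\<alpha> \<bullet> x))" by simp
qed

text \<open>A difference of reciprocals is the increment times two inverse distances to the wall:
  the triple product to which the splitting into moments of order \<open>3 * p\<close> is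
  applied.\<close>

lemma norm_dunkl_drift_diff_le:
  assumes "\<forall>\<alpha>\<in>Rp. k \<alpha> > 0" "x \<in> weyl_chamber Rp" "y \<in> weyl_chamber Rp"
  shows "norm (dunkl_drift Rp k x - dunkl_drift Rp k y) \<le>
    (\<Sum>\<alpha>\<in>Rp. k \<alpha> * (norm \<alpha>)\<^sup>2 * (norm (x - y) * (1 / (\<alpha> \<bullet> x)) * (1 / (\<alpha> \<bullet> y))))"
  unfolding dunkl_drift_def sum_subtractf[symmetric]
proof (rule sum_norm_le)
  fix \<alpha> assume "\<alpha> \<in> Rp"
  hence p: "k \<alpha> > 0" "\<alpha> \<bullet> x > 0" "\<alpha> \<bullet> y > 0" using assms by (auto simp: weyl_chamber_def)
  have "k \<alpha> / (\<alpha> \<bullet> x) - k \<alpha> / (\<alpha> \<bullet> y) = k \<alpha> * ((\<alpha> \<bullet> (y - x)) * (1 / (\<alpha> \<bullet> x)) * (1 / (\<alpha> \<bullet> y)))"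
    using p by (simp add: field_simps inner_diff_right)
  hence "norm ((k \<alpha> / (\<alpha> \<bullet> x)) *\<^sub>R \<alpha> - (k \<alpha> / (\<alpha> \<bullet> y)) *\<^sub>R \<alpha>) =
      k \<alpha> * (\<bar>\<alpha> \<bullet> (y - x)\<bar> * (1 / (\<alpha> \<bullet> x)) * (1 / (\<alpha> \<bullet> y))) * norm \<alpha>"
    unfolding scaleR_left_diff_distrib[symmetric] norm_scaleR using p by (simp add: abs_mult)
  also have "\<dots> \<le> k \<alpha> * ((norm \<alpha> * norm (x - y)) * (1 / (\<alpha> \<bullet> x)) * (1 / (\<alpha> \<bullet> y))) * norm \<alpha>"
    using p Cauchy_Schwarz_ineq2[of \<alpha> "y - x"]
    by (intro mult_right_mono mult_left_mono) (auto simp: norm_minus_commute)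
  finally show "norm ((k \<alpha> / (\<alpha> \<bullet> x)) *\<^sub>R \<alpha> - (k \<alpha> / (\<alpha> \<bullet> y)) *\<^sub>R \<alpha>) \<le>
      k \<alpha> * (norm \<alpha>)\<^sup>2 * (norm (x - y) * (1 / (\<alpha> \<bullet> x)) * (1 / (\<alpha> \<bullet> y)))"
    by (simp add: power2_eq_square mult_ac)
qed

context dunkl_setup
begin

text \<open>For the increment divided by the square root of the time step, a real power is at most 1
  plus an even integer power, so Gaussian moments suffice; undoing the normalisation gives the
  factor \<open>(t - s) powr (q / 2)\<close>.\<close>

lemma B_increment_powr_moment:
  assumes q: "q \<ge> 0"
  obtains C where "C \<ge> 0"
    "\<And>s t. \<lbrakk>0 \<le> s; s < t; t \<le> T\<rbrakk> \<Longrightarrow> mean_le (\<lambda>\<omega>. norm (B t \<omega> - B s \<omega>) powr q) (C * (t - s) powr (q / 2))"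
proof -
  define N where "N = nat \<lceil>q\<rceil>"
  obtain C where C: "C \<ge> 0"
    "\<And>s t. \<lbrakk>0 \<le> s; s < t; t \<le> T\<rbrakk> \<Longrightarrow> integrable M (\<lambda>\<omega>. norm (B t \<omega> - B s \<omega>) ^ (2 * N))"
    "\<And>s t. \<lbrakk>0 \<le> s; s < t; t \<le> T\<rbrakk> \<Longrightarrow>
      expectation (\<lambda>\<omega>. norm (B t \<omega> - B s \<omega>) ^ (2 * N)) \<le> C * (t - s) ^ N"
    by (rule B_increment_moment[of N]) blast
  show ?thesis
  proof
    show "1 + C \<ge> 0" using C(1) by simp
    fix s t assume st: "0 \<le> s" "s < t" "t \<le> T"
    define h where "h = t - s"
    have h: "h > 0" using st by (simp add: h_def)
    have [measurable]: "B t \<in> borel_measurable M" "B s \<in> borel_measurable M" using st by (auto intro: B_measurable)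
    have m: "mean_le (\<lambda>\<omega>. norm (B t \<omega> - B s \<omega>) ^ (2 * N)) (C * h ^ N)"
      unfolding mean_le_def using C h st nn_integral_eq_integral[OF C(2)[OF st]]
      by (auto simp: h_def ennreal_leI)
    have "mean_le (\<lambda>\<omega>. h powr (q / 2) * (1 + 1 / h ^ N * norm (B t \<omega> - B s \<omega>) ^ (2 * N))) (h powr (q / 2) * (1 + 1 / h ^ N * (C * h ^ N)))"
      using h by (intro mean_le_cmult mean_le_add mean_le_const m) auto
    thus "mean_le (\<lambda>\<omega>. norm (B t \<omega> - B s \<omega>) powr q) ((1 + C) * (t - s) powr (q / 2))"
    proof (rule mean_le_mono)
      show "h powr (q / 2) * (1 + 1 / h ^ N * (C * h ^ N)) \<le> (1 + C) * (t - s) powr (q / 2)"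
        using h by (simp add: h_def[symmetric] mult.commute)
      show "AE \<omega> in M. norm (B t \<omega> - B s \<omega>) powr q \<le> h powr (q / 2) * (1 + 1 / h ^ N * norm (B t \<omega> - B s \<omega>) ^ (2 * N))"
      proof (rule AE_I2)
        fix \<omega>
        define y where "y = norm (B t \<omega> - B s \<omega>) / sqrt h"
        have y: "y \<ge> 0" using h by (simp add: y_def)
        have "y powr q \<le> 1 + y ^ (2 * N)"
        proof (cases "y \<le> 1")
          case True
          have "y powr q \<le> 1 powr q" using True y q by (intro powr_mono2) auto
          thus ?thesis using y by (simp add: add_increasing2)
        next
          case False
          have "q \<le> real (2 * N)" using q unfolding N_def by (simp; linarith)
          hence "y powr q \<le> y powr real (2 * N)" using False by (intro powr_mono) auto
          also have "\<dots> = y ^ (2 * N)" using False by (intro powr_realpow) auto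
          finally show ?thesis by simp
        qed
        moreover have "y ^ (2 * N) = 1 / h ^ N * norm (B t \<omega> - B s \<omega>) ^ (2 * N)"
          using h by (simp add: y_def power_divide power_mult)
        moreover have "norm (B t \<omega> - B s \<omega>) powr q = h powr (q / 2) * y powr q"
        proof -
          have "norm (B t \<omega> - B s \<omega>) = h powr (1 / 2) * y" using h by (simp add: y_def powr_half_sqrt)
          thus ?thesis by (simp add: powr_mult powr_powr)
        qed
        ultimately show "norm (B t \<omega> - B s \<omega>) powr q \<le> h powr (q / 2) * (1 + 1 / h ^ N * norm (B t \<omega> - B s \<omega>) ^ (2 * N))"
          by (simp add: mult_left_mono)
      qed
    qed auto
  qed
qed

lemma inverse_root_mean_le:
  assumes \<nu>2: "\<nu> > 2" and q: "0 < q" "q \<le> \<nu>"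
  obtains C where "C \<ge> 0"
    "\<And>t \<alpha>. \<lbrakk>t \<in> {0..T}; \<alpha> \<in> Rp\<rbrakk> \<Longrightarrow> mean_le (\<lambda>\<omega>. (1 / (\<alpha> \<bullet> X t \<omega>)) powr q) C"
proof -
  obtain C where C: "C \<ge> 0"
    "\<And>t \<alpha>. \<lbrakk>t \<in> {0..T}; \<alpha> \<in> Rp\<rbrakk> \<Longrightarrow> (\<integral>\<^sup>+\<omega>. ennreal ((\<alpha> \<bullet> X t \<omega>) powr (- q)) \<partial>M) \<le> ennreal C"
    by (rule inverse_root_moment[OF assms]) blast
  show ?thesis
  proof (rule that[OF C(1)])
    fix t \<alpha> assume t: "t \<in> {0..T}" and \<alpha>: "\<alpha> \<in> Rp"
    note [measurable] = X_measurable[OF t]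
    have "mean_le (\<lambda>\<omega>. (\<alpha> \<bullet> X t \<omega>) powr (- q)) C"
      unfolding mean_le_def using C(1) C(2)[OF t \<alpha>] by simp
    thus "mean_le (\<lambda>\<omega>. (1 / (\<alpha> \<bullet> X t \<omega>)) powr q) C"
    proof (rule mean_le_mono)
      show "AE \<omega> in M. (1 / (\<alpha> \<bullet> X t \<omega>)) powr q \<le> (\<alpha> \<bullet> X t \<omega>) powr (- q)"
        using AE_X_W[OF t]
      proof eventually_elim
        case (elim \<omega>)
        hence "\<alpha> \<bullet> X t \<omega> > 0" using \<alpha> by (simp add: weyl_chamber_def)
        thus ?case by (simp add: powr_divide powr_minus_divide)
      qed
    qed auto
  qed
qed

lemma drift_powr_moment:
  assumes \<nu>2: "\<nu> > 2" and q: "1 \<le> q" "q \<le> \<nu>" and K: "K \<ge> 0"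
  obtains C where "C \<ge> 0"
    "\<And>t. t \<in> {0..T} \<Longrightarrow> mean_le (\<lambda>\<omega>. (norm (D (X t \<omega>)) + K) powr q) C"
proof -
  have q0: "0 < q" using q by simp
  obtain C where C: "C \<ge> 0"
    "\<And>t \<alpha>. \<lbrakk>t \<in> {0..T}; \<alpha> \<in> Rp\<rbrakk> \<Longrightarrow> mean_le (\<lambda>\<omega>. (1 / (\<alpha> \<bullet> X t \<omega>)) powr q) C"
    by (rule inverse_root_mean_le[OF \<nu>2 q0 q(2)]) blast
  let ?C = "2 powr q * (real (card Rp) powr (q - 1) * (\<Sum>\<alpha>\<in>Rp. (k \<alpha> * norm \<alpha>) powr q * C) + K powr q)"
  show ?thesis
  proof
    show "?C \<ge> 0" using C(1) by (intro mult_nonneg_nonneg add_nonneg_nonneg sum_nonneg) auto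
    fix t assume t: "t \<in> {0..T}"
    note [measurable] = X_measurable[OF t]
    have "mean_le (\<lambda>\<omega>. 2 powr q * (real (card Rp) powr (q - 1) * (\<Sum>\<alpha>\<in>Rp. (k \<alpha> * norm \<alpha>) powr q * (1 / (\<alpha> \<bullet> X t \<omega>)) powr q) + K powr q)) ?C"
      by (intro mean_le_cmult mean_le_add mean_le_const mean_le_sum fin C(2) t) auto
    thus "mean_le (\<lambda>\<omega>. (norm (D (X t \<omega>)) + K) powr q) ?C"
    proof (rule mean_le_mono)
      show "AE \<omega> in M. (norm (D (X t \<omega>)) + K) powr q \<le> 2 powr q * (real (card Rp) powr (q - 1) * (\<Sum>\<alpha>\<in>Rp. (k \<alpha> * norm \<alpha>) powr q * (1 / (\<alpha> \<bullet> X t \<omega>)) powr q) + K powr q)"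
        using AE_X_W[OF t]
      proof eventually_elim
        case (elim \<omega>)
        have nn: "k \<alpha> * norm \<alpha> * (1 / (\<alpha> \<bullet> X t \<omega>)) \<ge> 0" if "\<alpha> \<in> Rp" for \<alpha>
          using elim k_pos that by (auto simp: weyl_chamber_def less_imp_le)
        have "norm (D (X t \<omega>)) powr q \<le> (\<Sum>\<alpha>\<in>Rp. k \<alpha> * norm \<alpha> * (1 / (\<alpha> \<bullet> X t \<omega>))) powr q"
          using q0 by (intro powr_mono2 norm_dunkl_drift_le[OF k_pos elim]) auto
        also have "\<dots> \<le> real (card Rp) powr (q - 1) * (\<Sum>\<alpha>\<in>Rp. (k \<alpha> * norm \<alpha> * (1 / (\<alpha> \<bullet> X t \<omega>))) powr q)"
          by (rule powr_sum_le[OF fin nn q(1)])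
        finally have "norm (D (X t \<omega>)) powr q \<le> real (card Rp) powr (q - 1) * (\<Sum>\<alpha>\<in>Rp. (k \<alpha> * norm \<alpha>) powr q * (1 / (\<alpha> \<bullet> X t \<omega>)) powr q)"
          by (simp only: powr_mult)
        hence "2 powr q * (norm (D (X t \<omega>)) powr q + K powr q) \<le> 2 powr q * (real (card Rp) powr (q - 1) * (\<Sum>\<alpha>\<in>Rp. (k \<alpha> * norm \<alpha>) powr q * (1 / (\<alpha> \<bullet> X t \<omega>)) powr q) + K powr q)"
          by (intro mult_left_mono add_right_mono) auto
        moreover have "(norm (D (X t \<omega>)) + K) powr q \<le> 2 powr q * (norm (D (X t \<omega>)) powr q + K powr q)"
          using K q0 by (intro powr_add_le) auto
        ultimately show ?case by linarith
      qed
    qed auto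
  qed
qed

text \<open>The noise has the order \<open>(t - s) powr (q / 2)\<close>. The drift integral has the
  order \<open>(t - s) powr q\<close> by \<open>nn_integral_powr_integral_le\<close>, which on a
  bounded time interval is no worse; it is there that inverse moments of order \<open>q\<close> are
  used.\<close>

lemma X_increment_moment:
  assumes \<nu>2: "\<nu> > 2" and q: "1 \<le> q" "q \<le> \<nu>"
  obtains C where "C \<ge> 0"
    "\<And>s t. \<lbrakk>0 \<le> s; s \<le> t; t \<le> T\<rbrakk> \<Longrightarrow> mean_le (\<lambda>\<omega>. norm (X t \<omega> - X s \<omega>) powr q) (C * (t - s) powr (q / 2))"
proof -
  obtain C1 where C1: "C1 \<ge> 0"
    "\<And>s t. \<lbrakk>0 \<le> s; s < t; t \<le> T\<rbrakk> \<Longrightarrow> mean_le (\<lambda>\<omega>. norm (B t \<omega> - B s \<omega>) powr q) (C1 * (t - s) powr (q / 2))"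
    using q by (rule_tac B_increment_powr_moment[of q]) auto
  obtain C2 where C2: "C2 \<ge> 0"
    "\<And>t. t \<in> {0..T} \<Longrightarrow> mean_le (\<lambda>\<omega>. (norm (D (X t \<omega>)) + \<bar>Kb\<bar>) powr q) C2"
    by (rule drift_powr_moment[OF \<nu>2 q abs_ge_zero]) blast
  obtain V where V: "AE \<omega> in M. controlled V \<omega>" by (rule controlled_moments[of 0]) blast
  show ?thesis
  proof
    show "2 powr q * (C1 + T powr (q / 2) * C2) \<ge> 0" using C1(1) C2(1) by simp
    fix s t assume st: "0 \<le> s" "s \<le> t" "t \<le> T"
    have [measurable]: "X t \<in> borel_measurable M" "X s \<in> borel_measurable M" using st by (auto intro: X_measurable)
    show "mean_le (\<lambda>\<omega>. norm (X t \<omega> - X s \<omega>) powr q) (2 powr q * (C1 + T powr (q / 2) * C2) * (t - s) powr (q / 2))"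
    proof (cases "s = t")
      case True
      thus ?thesis using q mean_le_const[of 0] by simp
    next
      case False
      hence lt: "s < t" using st by simp
      have sub: "{s..t} \<subseteq> {0..T}" using st by auto
      have "\<exists>R. R \<in> borel_measurable M \<and> (\<forall>\<omega>. R \<omega> \<ge> 0) \<and>
        (AE \<omega> in M. integral {s..t} (\<lambda>u. norm (D (X u \<omega>)) + \<bar>Kb\<bar>) = R \<omega>) \<and>
        (\<integral>\<^sup>+\<omega>. ennreal (R \<omega> powr q) \<partial>M) \<le> ennreal ((t - s) powr q * C2)"
      proof (rule nn_integral_powr_integral_le[OF lt q(1) C2(1), of "\<lambda>u \<omega>. norm (D (X u \<omega>)) + \<bar>Kb\<bar>" M])
        show "(\<lambda>\<omega>. norm (D (X u \<omega>)) + \<bar>Kb\<bar>) \<in> borel_measurable M" if "u \<in> {s..t}" for u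
        proof -
          have [measurable]: "X u \<in> borel_measurable M" using that sub by (intro X_measurable) auto
          show ?thesis by measurable
        qed
        show "AE \<omega> in M. continuous_on {s..t} (\<lambda>u. norm (D (X u \<omega>)) + \<bar>Kb\<bar>) \<and> (\<forall>u\<in>{s..t}. 0 \<le> norm (D (X u \<omega>)) + \<bar>Kb\<bar>)"
          using V
        proof eventually_elim
          case (elim \<omega>)
          have "continuous_on {s..t} (\<lambda>u. D (X u \<omega>))"
            by (rule continuous_on_dunkl_drift[OF continuous_on_subset[OF controlledD(1)[OF elim] sub]]) (use controlledD(2)[OF elim] sub in auto)
          thus ?case by (intro conjI continuous_intros) auto
        qed
        show "(\<integral>\<^sup>+\<omega>. ennreal ((norm (D (X u \<omega>)) + \<bar>Kb\<bar>) powr q) \<partial>M) \<le> ennreal C2" if "u \<in> {s..t}" for u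
          using C2(2)[of u] that sub by (auto simp: mean_le_def)
      qed blast
      then obtain R where R: "R \<in> borel_measurable M" "\<And>\<omega>. R \<omega> \<ge> 0"
        "AE \<omega> in M. integral {s..t} (\<lambda>u. norm (D (X u \<omega>)) + \<bar>Kb\<bar>) = R \<omega>"
        "(\<integral>\<^sup>+\<omega>. ennreal (R \<omega> powr q) \<partial>M) \<le> ennreal ((t - s) powr q * C2)" by blast
      have mR: "mean_le (\<lambda>\<omega>. R \<omega> powr q) ((t - s) powr q * C2)"
        unfolding mean_le_def using R C2(1) by auto
      have "mean_le (\<lambda>\<omega>. 2 powr q * (norm (B t \<omega> - B s \<omega>) powr q + R \<omega> powr q)) (2 powr q * (C1 * (t - s) powr (q / 2) + (t - s) powr q * C2))"
        by (intro mean_le_cmult mean_le_add C1(2) mR st lt) auto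
      thus ?thesis
      proof (rule mean_le_mono)
        have "(t - s) powr q = (t - s) powr (q / 2) * (t - s) powr (q / 2)" by (simp add: powr_add[symmetric])
        also have "\<dots> \<le> T powr (q / 2) * (t - s) powr (q / 2)"
          using st q by (intro mult_right_mono powr_mono2) auto
        finally have "(t - s) powr q * C2 \<le> T powr (q / 2) * (t - s) powr (q / 2) * C2"
          using C2(1) by (rule mult_right_mono)
        hence "2 powr q * (C1 * (t - s) powr (q / 2) + (t - s) powr q * C2) \<le>
            2 powr q * (C1 * (t - s) powr (q / 2) + T powr (q / 2) * (t - s) powr (q / 2) * C2)"
          by (intro mult_left_mono add_left_mono) auto
        also have "\<dots> = 2 powr q * (C1 + T powr (q / 2) * C2) * (t - s) powr (q / 2)"
          by (simp add: algebra_simps)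
        finally show "2 powr q * (C1 * (t - s) powr (q / 2) + (t - s) powr q * C2) \<le> 2 powr q * (C1 + T powr (q / 2) * C2) * (t - s) powr (q / 2)" .
        show "AE \<omega> in M. norm (X t \<omega> - X s \<omega>) powr q \<le> 2 powr q * (norm (B t \<omega> - B s \<omega>) powr q + R \<omega> powr q)"
          using V R(3)
        proof eventually_elim
          case (elim \<omega>)
          note G = controlledD[OF elim(1)]
          have Dc: "continuous_on {s..t} (\<lambda>u. D (X u \<omega>))"
            by (rule continuous_on_dunkl_drift[OF continuous_on_subset[OF G(1) sub]]) (use G(2) sub in auto)
          have "norm (integral {s..t} (speed \<omega>)) \<le> integral {s..t} (\<lambda>u. norm (D (X u \<omega>)) + \<bar>Kb\<bar>)"
          proof (rule integral_norm_bound_integral)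
            show "speed \<omega> integrable_on {s..t}"
              by (rule integrable_continuous_real[OF continuous_on_subset[OF G(5) sub]])
            show "(\<lambda>u. norm (D (X u \<omega>)) + \<bar>Kb\<bar>) integrable_on {s..t}"
              by (intro integrable_continuous_real continuous_intros Dc)
            fix u assume "u \<in> {s..t}"
            hence u: "u \<in> {0..T}" using sub by auto
            show "norm (speed \<omega> u) \<le> norm (D (X u \<omega>)) + \<bar>Kb\<bar>"
              using norm_triangle_ineq[of "D (X u \<omega>)" "b u (X u \<omega>)"] b_bound[OF u G(2)[OF u]] by linarith
          qed
          hence "norm (X t \<omega> - X s \<omega>) \<le> norm (B t \<omega> - B s \<omega>) + R \<omega>"
            using controlled_increment(1)[OF elim(1) st] elim(2) norm_triangle_ineq[of "B t \<omega> - B s \<omega>" "integral {s..t} (speed \<omega>)"]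
            by simp
          hence "norm (X t \<omega> - X s \<omega>) powr q \<le> (norm (B t \<omega> - B s \<omega>) + R \<omega>) powr q"
            using q by (intro powr_mono2) auto
          also have "\<dots> \<le> 2 powr q * (norm (B t \<omega> - B s \<omega>) powr q + R \<omega> powr q)"
            using q R(2) by (intro powr_add_le) auto
          finally show ?case .
        qed
      qed auto
    qed
  qed
qed

text \<open>The quantity bounds the difference between the drift at time \<open>s\<close> and the
  drift as one step freezes it: the singular part is taken at the right end \<open>v\<close>, and
  \<open>b\<close> at the left end \<open>u\<close>. Increments are divided by the square root of
  the step, so that all three factors have uniformly bounded moments and the rate appears as one
  prefactor.\<close>

lemma residual_moment:
  assumes \<nu>2: "\<nu> > 2" and p: "p \<ge> 1" "3 * p \<le> \<nu>" and L: "L \<ge> 0"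
  obtains C where "C \<ge> 0"
    "\<And>u v s. \<lbrakk>0 \<le> u; u < v; v \<le> T; s \<in> {u..v}\<rbrakk> \<Longrightarrow>
      mean_le (\<lambda>\<omega>. (norm (D (X s \<omega>) - D (X v \<omega>)) + L * (sqrt (v - u) + norm (X s \<omega> - X u \<omega>))) powr p)
        (C * (v - u) powr (p / 2))"
proof -
  define q where "q = 3 * p"
  have q: "0 < q" "1 \<le> q" "q \<le> \<nu>" using p by (auto simp: q_def)
  obtain CI where CI: "CI \<ge> 0"
    "\<And>t \<alpha>. \<lbrakk>t \<in> {0..T}; \<alpha> \<in> Rp\<rbrakk> \<Longrightarrow> mean_le (\<lambda>\<omega>. (1 / (\<alpha> \<bullet> X t \<omega>)) powr q) CI"
    by (rule inverse_root_mean_le[OF \<nu>2 q(1,3)]) blast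
  obtain CX where CX: "CX \<ge> 0"
    "\<And>s t. \<lbrakk>0 \<le> s; s \<le> t; t \<le> T\<rbrakk> \<Longrightarrow> mean_le (\<lambda>\<omega>. norm (X t \<omega> - X s \<omega>) powr q) (CX * (t - s) powr (q / 2))"
    by (rule X_increment_moment[OF \<nu>2 q(2,3)]) blast
  define c where "c \<alpha> = k \<alpha> * (norm \<alpha>)\<^sup>2" for \<alpha>
  have c0: "c \<alpha> \<ge> 0" if "\<alpha> \<in> Rp" for \<alpha> using k_pos that by (simp add: c_def less_imp_le)
  define C where "C = 2 powr p * (real (card Rp) powr (p - 1) * (\<Sum>\<alpha>\<in>Rp. c \<alpha> powr p * (CX + CI + CI)) + L powr p * (2 powr p * (2 + CX)))"
  show ?thesis
  proof
    show "C \<ge> 0" unfolding C_def using CI(1) CX(1)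
      by (intro mult_nonneg_nonneg add_nonneg_nonneg sum_nonneg) auto
    fix u v s assume uv: "0 \<le> u" "u < v" "v \<le> T" and s: "s \<in> {u..v}"
    define h where "h = v - u"
    have h: "h > 0" using uv by (simp add: h_def)
    have t: "u \<in> {0..T}" "v \<in> {0..T}" "s \<in> {0..T}" using uv s by auto
    note [measurable] = X_measurable[OF t(1)] X_measurable[OF t(2)] X_measurable[OF t(3)]
    define y where "y a b' \<omega> = norm (X a \<omega> - X b' \<omega>) / sqrt h" for a b' \<omega>
    have y0: "y a b' \<omega> \<ge> 0" for a b' \<omega> using h by (simp add: y_def)
    have y_mean: "mean_le (\<lambda>\<omega>. y a b' \<omega> powr q) CX" if ab: "u \<le> b'" "b' \<le> a" "a \<le> v" for a b'
    proof -
      have [measurable]: "X a \<in> borel_measurable M" "X b' \<in> borel_measurable M"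
        using ab uv by (auto intro!: X_measurable)
      have "y a b' \<omega> powr q = 1 / h powr (q / 2) * norm (X a \<omega> - X b' \<omega>) powr q" for \<omega>
        using h by (simp add: y_def powr_divide powr_powr powr_half_sqrt[symmetric])
      moreover have "mean_le (\<lambda>\<omega>. 1 / h powr (q / 2) * norm (X a \<omega> - X b' \<omega>) powr q) (1 / h powr (q / 2) * (CX * (a - b') powr (q / 2)))"
        using ab uv by (intro mean_le_cmult CX(2)) auto
      moreover have "1 / h powr (q / 2) * (CX * (a - b') powr (q / 2)) \<le> CX"
      proof -
        have "(a - b') powr (q / 2) \<le> h powr (q / 2)" using ab q by (intro powr_mono2) (auto simp: h_def)
        hence "CX * (a - b') powr (q / 2) \<le> CX * h powr (q / 2)" using CX(1) by (rule mult_left_mono)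
        thus ?thesis using h by (simp add: divide_le_eq)
      qed
      ultimately show ?thesis by (intro mean_le_mono[where f="\<lambda>\<omega>. y a b' \<omega> powr q"]) (auto simp: y_def)
    qed
    define G where "G \<omega> = 2 powr p * (real (card Rp) powr (p - 1) *
        (\<Sum>\<alpha>\<in>Rp. c \<alpha> powr p * (y v s \<omega> powr q + (1 / (\<alpha> \<bullet> X s \<omega>)) powr q + (1 / (\<alpha> \<bullet> X v \<omega>)) powr q))
        + L powr p * (2 powr p * (2 + y s u \<omega> powr q)))" for \<omega>
    have "mean_le (\<lambda>\<omega>. h powr (p / 2) * G \<omega>) (h powr (p / 2) * C)"
      unfolding G_def C_def using s t
      by (intro mean_le_cmult mean_le_add mean_le_const mean_le_sum fin CI(2) y_mean) auto
    thus "mean_le (\<lambda>\<omega>. (norm (D (X s \<omega>) - D (X v \<omega>)) + L * (sqrt (v - u) + norm (X s \<omega> - X u \<omega>))) powr p) (C * (v - u) powr (p / 2))"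
    proof (rule mean_le_mono)
      show "h powr (p / 2) * C \<le> C * (v - u) powr (p / 2)" by (simp add: h_def)
      show "AE \<omega> in M. (norm (D (X s \<omega>) - D (X v \<omega>)) + L * (sqrt (v - u) + norm (X s \<omega> - X u \<omega>))) powr p \<le> h powr (p / 2) * G \<omega>"
        using AE_X_W[OF t(2)] AE_X_W[OF t(3)]
      proof eventually_elim
        case (elim \<omega>)
        define A A' where "A \<alpha> = 1 / (\<alpha> \<bullet> X s \<omega>)" and "A' \<alpha> = 1 / (\<alpha> \<bullet> X v \<omega>)" for \<alpha>
        have A0: "A \<alpha> \<ge> 0" "A' \<alpha> \<ge> 0" if "\<alpha> \<in> Rp" for \<alpha>
          using elim that by (auto simp: A_def A'_def weyl_chamber_def less_imp_le)
        define y1 y2 where "y1 = y v s \<omega>" and "y2 = y s u \<omega>"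
        have yy: "y1 \<ge> 0" "y2 \<ge> 0" using y0 by (auto simp: y1_def y2_def)
        have n1: "norm (X s \<omega> - X v \<omega>) = sqrt h * y1" and n2: "norm (X s \<omega> - X u \<omega>) = sqrt h * y2"
          using h by (auto simp: y1_def y2_def y_def norm_minus_commute)
        define S where "S = (\<Sum>\<alpha>\<in>Rp. c \<alpha> * (y1 * A \<alpha> * A' \<alpha>))"
        have S0: "S \<ge> 0" unfolding S_def using c0 A0 yy by (intro sum_nonneg mult_nonneg_nonneg) auto
        have "norm (D (X s \<omega>) - D (X v \<omega>)) \<le> (\<Sum>\<alpha>\<in>Rp. c \<alpha> * (norm (X s \<omega> - X v \<omega>) * A \<alpha> * A' \<alpha>))"
          unfolding c_def A_def A'_def by (rule norm_dunkl_drift_diff_le[OF k_pos elim(2,1)])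
        also have "\<dots> = sqrt h * S" unfolding n1 S_def sum_distrib_left by (intro sum.cong refl) simp
        finally have "norm (D (X s \<omega>) - D (X v \<omega>)) + L * (sqrt (v - u) + norm (X s \<omega> - X u \<omega>)) \<le> sqrt h * (S + L * (1 + y2))"
          unfolding n2 h_def[symmetric] by (simp add: algebra_simps)
        hence "(norm (D (X s \<omega>) - D (X v \<omega>)) + L * (sqrt (v - u) + norm (X s \<omega> - X u \<omega>))) powr p \<le> (sqrt h * (S + L * (1 + y2))) powr p"
          using p L uv by (intro powr_mono2) auto
        also have "\<dots> = h powr (p / 2) * (S + L * (1 + y2)) powr p"
          using h by (simp add: powr_mult powr_half_sqrt[symmetric] powr_powr)
        also have "\<dots> \<le> h powr (p / 2) * G \<omega>"
        proof (rule mult_left_mono)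
          have "(S + L * (1 + y2)) powr p \<le> 2 powr p * (S powr p + (L * (1 + y2)) powr p)"
            using S0 L yy p by (intro powr_add_le) auto
          also have "\<dots> \<le> G \<omega>" unfolding G_def A_def[symmetric] A'_def[symmetric] y1_def[symmetric] y2_def[symmetric]
          proof (intro mult_left_mono add_mono)
            have "S powr p \<le> real (card Rp) powr (p - 1) * (\<Sum>\<alpha>\<in>Rp. (c \<alpha> * (y1 * A \<alpha> * A' \<alpha>)) powr p)"
              unfolding S_def using c0 A0 yy p by (intro powr_sum_le fin mult_nonneg_nonneg) auto
            also have "\<dots> \<le> real (card Rp) powr (p - 1) * (\<Sum>\<alpha>\<in>Rp. c \<alpha> powr p * (y1 powr q + A \<alpha> powr q + A' \<alpha> powr q))"
            proof (intro mult_left_mono sum_mono)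
              fix \<alpha> assume a: "\<alpha> \<in> Rp"
              have "(c \<alpha> * (y1 * A \<alpha> * A' \<alpha>)) powr p = c \<alpha> powr p * (y1 * A \<alpha> * A' \<alpha>) powr p" by (rule powr_mult)
              also have "\<dots> \<le> c \<alpha> powr p * (y1 powr q + A \<alpha> powr q + A' \<alpha> powr q)"
                unfolding q_def using A0[OF a] yy p by (intro mult_left_mono powr_prod3_le) auto
              finally show "(c \<alpha> * (y1 * A \<alpha> * A' \<alpha>)) powr p \<le> c \<alpha> powr p * (y1 powr q + A \<alpha> powr q + A' \<alpha> powr q)" .
            qed auto
            finally show "S powr p \<le> real (card Rp) powr (p - 1) * (\<Sum>\<alpha>\<in>Rp. c \<alpha> powr p * (y1 powr q + A \<alpha> powr q + A' \<alpha> powr q))" .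
            have "y2 powr p \<le> 1 + y2 powr q"
            proof (cases "y2 \<le> 1")
              case True
              have "y2 powr p \<le> 1 powr p" using True yy p by (intro powr_mono2) auto
              thus ?thesis by (simp add: add_increasing2)
            next
              case False
              have "y2 powr p \<le> y2 powr q" using False p by (intro powr_mono) (auto simp: q_def)
              thus ?thesis by simp
            qed
            hence "2 powr p * (1 powr p + y2 powr p) \<le> 2 powr p * (2 + y2 powr q)"
              by (intro mult_left_mono) auto
            moreover have "(1 + y2) powr p \<le> 2 powr p * (1 powr p + y2 powr p)"
              using yy p by (intro powr_add_le) auto
            ultimately have "(1 + y2) powr p \<le> 2 powr p * (2 + y2 powr q)" by linarith
            hence "L powr p * (1 + y2) powr p \<le> L powr p * (2 powr p * (2 + y2 powr q))" by (rule mult_left_mono) simp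
            thus "(L * (1 + y2)) powr p \<le> L powr p * (2 powr p * (2 + y2 powr q))" by (simp only: powr_mult)
          qed simp
          finally show "(S + L * (1 + y2)) powr p \<le> G \<omega>" .
        qed simp
        finally show ?case .
      qed
    qed auto
  qed
qed

text \<open>The error at each grid point is at most \<open>exp (L * T)\<close> times the sum of all
  local errors, so the supremum costs nothing. By the power mean inequality, \<open>n\<close> local
  errors of order \<open>h * sqrt h\<close> contribute
  \<open>n powr p * h powr p * h powr (p / 2)\<close>, and \<open>n * h = T\<close> leaves exactly
  the rate.\<close>

lemma scheme_error:
  assumes \<nu>2: "\<nu> > 2" and p: "p \<ge> 1" "3 * p \<le> \<nu>"
  obtains C where "C \<ge> 0"
    "\<And>n. n \<ge> 1 \<Longrightarrow> mean_le (\<lambda>\<omega>. SUP l\<in>{1..n}.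
      norm (X (real l * T / real n) \<omega> - semi_implicit_EM Rp k b T n x0 (\<lambda>t. B t \<omega>) l) powr p)
      (C * real n powr (- (p / 2)))"
proof -
  obtain L where L: "L > 0"
    "\<And>s t x y. \<lbrakk>s \<in> {0..T}; t \<in> {0..T}; x \<in> W; y \<in> W\<rbrakk> \<Longrightarrow>
       norm (b t x - b s y) \<le> L * (sqrt \<bar>t - s\<bar> + norm (x - y))"
    by (rule b_modulus) blast
  have L0: "L \<ge> 0" using L(1) by simp
  obtain C where C: "C \<ge> 0"
    "\<And>u v s. \<lbrakk>0 \<le> u; u < v; v \<le> T; s \<in> {u..v}\<rbrakk> \<Longrightarrow>
      mean_le (\<lambda>\<omega>. (norm (D (X s \<omega>) - D (X v \<omega>)) + L * (sqrt (v - u) + norm (X s \<omega> - X u \<omega>))) powr p)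
        (C * (v - u) powr (p / 2))"
    by (rule residual_moment[OF \<nu>2 p L0]) blast
  obtain V where V: "AE \<omega> in M. controlled V \<omega>" by (rule controlled_moments[of 0]) blast
  have bc: "continuous_on W (b t)" if t: "t \<in> {0..T}" for t
  proof -
    have "L-lipschitz_on W (b t)"
      using L(2)[OF t t] L0 by (intro lipschitz_onI) (auto simp: dist_norm)
    thus ?thesis by (rule lipschitz_on_continuous_on)
  qed
  define C' where "C' = exp (L * T) powr p * (T powr p * C * T powr (p / 2))"
  show ?thesis
  proof
    show "C' \<ge> 0" unfolding C'_def using C(1) by (intro mult_nonneg_nonneg) auto
    fix n :: nat assume n: "n \<ge> 1"
    define h where "h = T / real n"
    define \<tau> where "\<tau> l = real l * T / real n" for l
    define Y where "Y l \<omega> = semi_implicit_EM Rp k b T n x0 (\<lambda>t. B t \<omega>) l" for l \<omega>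
    have h: "h > 0" "real n * h = T" using n T_pos by (auto simp: h_def)
    have \<tau>_diff: "\<tau> (Suc l) - \<tau> l = h" for l by (simp add: \<tau>_def h_def diff_divide_distrib[symmetric] algebra_simps)
    have \<tau>_lt: "\<tau> l < \<tau> (Suc l)" for l using \<tau>_diff[of l] h(1) by linarith
    have \<tau>_in: "\<tau> l \<in> {0..T}" if "l \<le> n" for l
    proof -
      have "real l * T \<le> real n * T" using that T_pos by (intro mult_right_mono) auto
      thus ?thesis using n T_pos by (simp add: \<tau>_def divide_le_eq mult.commute)
    qed
    define \<phi> where "\<phi> l u \<omega> = norm (D (X u \<omega>) - D (X (\<tau> (Suc l)) \<omega>)) + L * (sqrt h + norm (X u \<omega> - X (\<tau> l) \<omega>))" for l u \<omega>
    have \<phi>0: "\<phi> l u \<omega> \<ge> 0" for l u \<omega> using L0 h by (simp add: \<phi>_def)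
    have \<phi>_cont: "continuous_on {\<tau> l..\<tau> (Suc l)} (\<lambda>u. \<phi> l u \<omega>)" if g: "controlled V \<omega>" and l: "l < n" for l \<omega>
    proof -
      have sub: "{\<tau> l..\<tau> (Suc l)} \<subseteq> {0..T}" using \<tau>_in[of l] \<tau>_in[of "Suc l"] l by auto
      note c = continuous_on_subset[OF controlledD(1)[OF g] sub]
      have "continuous_on {\<tau> l..\<tau> (Suc l)} (\<lambda>u. D (X u \<omega>))"
        by (rule continuous_on_dunkl_drift[OF c]) (use controlledD(2)[OF g] sub in auto)
      thus ?thesis unfolding \<phi>_def by (intro continuous_intros c)
    qed
    \<comment> \<open>Measurable representatives \<open>R l\<close> of the local error integrals are
      chosen; they agree with the pathwise integrals off a null set.\<close>
    have "\<forall>l\<in>{..<n}. \<exists>R. R \<in> borel_measurable M \<and> (\<forall>\<omega>. R \<omega> \<ge> 0) \<and>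
      (AE \<omega> in M. integral {\<tau> l..\<tau> (Suc l)} (\<lambda>u. \<phi> l u \<omega>) = R \<omega>) \<and>
      (\<integral>\<^sup>+\<omega>. ennreal (R \<omega> powr p) \<partial>M) \<le> ennreal (h powr p * (C * h powr (p / 2)))"
    proof
      fix l assume "l \<in> {..<n}"
      hence l: "l < n" by simp
      have tl: "\<tau> l \<in> {0..T}" "\<tau> (Suc l) \<in> {0..T}" using \<tau>_in[of l] \<tau>_in[of "Suc l"] l by auto
      note [measurable] = X_measurable[OF tl(1)] X_measurable[OF tl(2)]
      have K: "C * h powr (p / 2) \<ge> 0" using C(1) by simp
      show "\<exists>R. R \<in> borel_measurable M \<and> (\<forall>\<omega>. R \<omega> \<ge> 0) \<and>
        (AE \<omega> in M. integral {\<tau> l..\<tau> (Suc l)} (\<lambda>u. \<phi> l u \<omega>) = R \<omega>) \<and>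
        (\<integral>\<^sup>+\<omega>. ennreal (R \<omega> powr p) \<partial>M) \<le> ennreal (h powr p * (C * h powr (p / 2)))"
      proof (rule nn_integral_powr_integral_le[OF \<tau>_lt p(1) K, of l "\<phi> l" M])
        show "\<phi> l u \<in> borel_measurable M" if "u \<in> {\<tau> l..\<tau> (Suc l)}" for u
        proof -
          have [measurable]: "X u \<in> borel_measurable M" using that tl by (intro X_measurable) auto
          show ?thesis unfolding \<phi>_def[abs_def] by measurable
        qed
        show "AE \<omega> in M. continuous_on {\<tau> l..\<tau> (Suc l)} (\<lambda>u. \<phi> l u \<omega>) \<and> (\<forall>u\<in>{\<tau> l..\<tau> (Suc l)}. 0 \<le> \<phi> l u \<omega>)"
          using V by eventually_elim (use \<phi>_cont[OF _ l] \<phi>0 in auto)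
        show "(\<integral>\<^sup>+\<omega>. ennreal (\<phi> l u \<omega> powr p) \<partial>M) \<le> ennreal (C * h powr (p / 2))" if "u \<in> {\<tau> l..\<tau> (Suc l)}" for u
        proof -
          have "mean_le (\<lambda>\<omega>. \<phi> l u \<omega> powr p) (C * h powr (p / 2))"
            using C(2)[OF _ \<tau>_lt _ that] tl unfolding \<phi>_def \<tau>_diff by simp
          thus ?thesis by (simp add: mean_le_def)
        qed
      qed (unfold \<tau>_diff, blast)
    qed
    from bchoice[OF this] obtain R where RR: "\<forall>l\<in>{..<n}. R l \<in> borel_measurable M \<and> (\<forall>\<omega>. R l \<omega> \<ge> 0) \<and>
      (AE \<omega> in M. integral {\<tau> l..\<tau> (Suc l)} (\<lambda>u. \<phi> l u \<omega>) = R l \<omega>) \<and>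
      (\<integral>\<^sup>+\<omega>. ennreal (R l \<omega> powr p) \<partial>M) \<le> ennreal (h powr p * (C * h powr (p / 2)))" by (elim exE) (rule that)
    have R: "R l \<in> borel_measurable M" "\<And>\<omega>. R l \<omega> \<ge> 0"
      "AE \<omega> in M. integral {\<tau> l..\<tau> (Suc l)} (\<lambda>u. \<phi> l u \<omega>) = R l \<omega>"
      "(\<integral>\<^sup>+\<omega>. ennreal (R l \<omega> powr p) \<partial>M) \<le> ennreal (h powr p * (C * h powr (p / 2)))" if "l < n" for l
      using bspec[OF RR, of l] that by auto
    have R_AE: "AE \<omega> in M. \<forall>l\<in>{..<n}. integral {\<tau> l..\<tau> (Suc l)} (\<lambda>u. \<phi> l u \<omega>) = R l \<omega>"
      using R(3) by (intro AE_finite_allI) auto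
    have err: "norm (X (\<tau> l) \<omega> - Y l \<omega>) \<le> exp (L * T) * (\<Sum>j<n. R j \<omega>)"
      if g: "controlled V \<omega>" and Req: "\<forall>l\<in>{..<n}. integral {\<tau> l..\<tau> (Suc l)} (\<lambda>u. \<phi> l u \<omega>) = R l \<omega>"
        and X0: "X 0 \<omega> = x0" and l: "l \<le> n" for l \<omega>
    proof -
      note G = controlledD[OF g]
      define e where "e l = norm (X (\<tau> l) \<omega> - Y l \<omega>)" for l
      have YW: "Y l \<omega> \<in> W" for l unfolding Y_def by (rule semi_implicit_EM_in_chamber[OF fin k_pos x0 T_pos n])
      have step: "e (Suc j) \<le> (1 + L * h) * e j + \<bar>R j \<omega>\<bar>" if j: "j < n" for j
      proof -
        have tj: "\<tau> j \<in> {0..T}" "\<tau> (Suc j) \<in> {0..T}" using \<tau>_in[of j] \<tau>_in[of "Suc j"] j by auto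
        have sub: "{\<tau> j..\<tau> (Suc j)} \<subseteq> {0..T}" using tj by auto
        have le: "0 \<le> \<tau> j" "\<tau> j \<le> \<tau> (Suc j)" "\<tau> (Suc j) \<le> T" using tj \<tau>_lt[of j] by auto
        \<comment> \<open>The drift as the scheme freezes it, evaluated along the exact solution:
          singular part at the new time, \<open>b\<close> at the old one. Then \<open>I\<close> is
          the consistency error of the step.\<close>
        define c where "c = D (X (\<tau> (Suc j)) \<omega>) + b (\<tau> j) (X (\<tau> j) \<omega>)"
        define I where "I = integral {\<tau> j..\<tau> (Suc j)} (\<lambda>u. speed \<omega> u - c)"
        have ci: "continuous_on {\<tau> j..\<tau> (Suc j)} (speed \<omega>)" by (rule continuous_on_subset[OF G(5) sub])
        have "I = integral {\<tau> j..\<tau> (Suc j)} (speed \<omega>) - h *\<^sub>R c"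
          unfolding I_def using integrable_continuous_real[OF ci] le(2) \<tau>_diff[of j]
          by (subst Henstock_Kurzweil_Integration.integral_diff) auto
        hence X_eq: "X (\<tau> (Suc j)) \<omega> = X (\<tau> j) \<omega> + (B (\<tau> (Suc j)) \<omega> - B (\<tau> j) \<omega>) + h *\<^sub>R c + I"
          using controlled_increment(1)[OF g le] by (simp add: algebra_simps)
        have I_le: "norm I \<le> R j \<omega>"
        proof -
          have "norm I \<le> integral {\<tau> j..\<tau> (Suc j)} (\<lambda>u. \<phi> j u \<omega>)"
            unfolding I_def
          proof (rule integral_norm_bound_integral)
            show "(\<lambda>u. speed \<omega> u - c) integrable_on {\<tau> j..\<tau> (Suc j)}"
              by (intro integrable_diff integrable_continuous_real[OF ci] integrable_const_ivl)
            show "(\<lambda>u. \<phi> j u \<omega>) integrable_on {\<tau> j..\<tau> (Suc j)}"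
              by (rule integrable_continuous_real[OF \<phi>_cont[OF g j]])
            fix u assume u: "u \<in> {\<tau> j..\<tau> (Suc j)}"
            hence uT: "u \<in> {0..T}" using sub by auto
            have "norm (b u (X u \<omega>) - b (\<tau> j) (X (\<tau> j) \<omega>)) \<le> L * (sqrt \<bar>u - \<tau> j\<bar> + norm (X u \<omega> - X (\<tau> j) \<omega>))"
              by (rule L(2)[OF tj(1) uT G(2)[OF uT] G(2)[OF tj(1)]])
            also have "\<dots> \<le> L * (sqrt h + norm (X u \<omega> - X (\<tau> j) \<omega>))"
              using u \<tau>_diff[of j] L0 by (intro mult_left_mono add_right_mono real_sqrt_le_mono) auto
            finally have b_le: "norm (b u (X u \<omega>) - b (\<tau> j) (X (\<tau> j) \<omega>)) \<le> L * (sqrt h + norm (X u \<omega> - X (\<tau> j) \<omega>))" .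
            have eq: "speed \<omega> u - c = (D (X u \<omega>) - D (X (\<tau> (Suc j)) \<omega>)) + (b u (X u \<omega>) - b (\<tau> j) (X (\<tau> j) \<omega>))"
              by (simp add: c_def)
            show "norm (speed \<omega> u - c) \<le> \<phi> j u \<omega>"
              unfolding eq \<phi>_def by (rule order_trans[OF norm_triangle_ineq add_left_mono[OF b_le]])
          qed
          thus ?thesis using Req j by auto
        qed
        have Y_eq: "Y (Suc j) \<omega> = (Y j \<omega> + (B (\<tau> (Suc j)) \<omega> - B (\<tau> j) \<omega>) + h *\<^sub>R b (\<tau> j) (Y j \<omega>)) + h *\<^sub>R D (Y (Suc j) \<omega>)"
          unfolding Y_def semi_implicit_EM_Suc h_def[symmetric] \<tau>_def[symmetric]
          by (rule dunkl_resolvent(2)[OF fin k_pos x0 h(1)])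
        \<comment> \<open>Everything in the difference of the two recursions except the implicit
          drift. The noise has cancelled because both are driven by the same path.\<close>
        define w where "w = (X (\<tau> j) \<omega> - Y j \<omega>) + h *\<^sub>R (b (\<tau> j) (X (\<tau> j) \<omega>) - b (\<tau> j) (Y j \<omega>)) + I"
        have "X (\<tau> (Suc j)) \<omega> - Y (Suc j) \<omega> =
            (X (\<tau> j) \<omega> + (B (\<tau> (Suc j)) \<omega> - B (\<tau> j) \<omega>) + h *\<^sub>R c + I) -
            ((Y j \<omega> + (B (\<tau> (Suc j)) \<omega> - B (\<tau> j) \<omega>) + h *\<^sub>R b (\<tau> j) (Y j \<omega>)) + h *\<^sub>R D (Y (Suc j) \<omega>))"
          by (rule arg_cong2[where f="(-)", OF X_eq Y_eq])
        also have "\<dots> = w + h *\<^sub>R (D (X (\<tau> (Suc j)) \<omega>) - D (Y (Suc j) \<omega>))"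
          by (simp add: w_def c_def algebra_simps)
        finally have "norm (X (\<tau> (Suc j)) \<omega> - Y (Suc j) \<omega>) \<le> norm w"
          using k_pos h(1) by (intro dunkl_implicit_step_le[OF _ G(2)[OF tj(2)] YW]) (auto simp: less_imp_le)
        also have "\<dots> \<le> norm (X (\<tau> j) \<omega> - Y j \<omega>) + norm (h *\<^sub>R (b (\<tau> j) (X (\<tau> j) \<omega>) - b (\<tau> j) (Y j \<omega>))) + norm I"
          unfolding w_def by (intro norm_triangle_le add_right_mono norm_triangle_ineq)
        also have "norm (h *\<^sub>R (b (\<tau> j) (X (\<tau> j) \<omega>) - b (\<tau> j) (Y j \<omega>))) \<le> h * (L * norm (X (\<tau> j) \<omega> - Y j \<omega>))"
          using L(2)[OF tj(1) tj(1) G(2)[OF tj(1)] YW[of j]] h(1) by (simp add: mult_left_mono)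
        finally show ?thesis using I_le R(2)[OF j, of \<omega>] unfolding e_def by (simp add: algebra_simps)
      qed
      \<comment> \<open>The absolute values are there because \<open>discrete_gronwall\<close> asks
        for nonnegativity at every index, while \<open>R j\<close> is known to be nonnegative only
        for \<open>j < n\<close>.\<close>
      have "e l \<le> exp (L * h * real n) * (\<Sum>j<n. \<bar>R j \<omega>\<bar>)"
      proof (rule discrete_gronwall[where e = e and r = "\<lambda>j. \<bar>R j \<omega>\<bar>", OF _ L0 _ _ step l])
        show "e 0 = 0" using X0 by (simp add: e_def \<tau>_def Y_def)
      qed (use h in auto)
      also have "(\<Sum>j<n. \<bar>R j \<omega>\<bar>) = (\<Sum>j<n. R j \<omega>)" using R(2) by (intro sum.cong) auto
      also have "L * h * real n = L * T" using h(2) by (simp add: mult.assoc mult.commute)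
      finally show ?thesis by (simp add: e_def)
    qed
    have "mean_le (\<lambda>\<omega>. exp (L * T) powr p * (real n powr (p - 1) * (\<Sum>j<n. R j \<omega> powr p)))
        (exp (L * T) powr p * (real n powr (p - 1) * (\<Sum>j<n. h powr p * (C * h powr (p / 2)))))"
      using R C(1) by (intro mean_le_cmult mean_le_sum) (auto simp: mean_le_def)
    hence "mean_le (\<lambda>\<omega>. SUP l\<in>{1..n}. norm (X (\<tau> l) \<omega> - Y l \<omega>) powr p) (C' * real n powr (- (p / 2)))"
    proof (rule mean_le_mono)
      have "real n powr (p - 1) * (\<Sum>j<n. h powr p * (C * h powr (p / 2))) = (real n powr (p - 1) * real n) * h powr p * (C * h powr (p / 2))"
        by simp
      also have "real n powr (p - 1) * real n = real n powr p" using n by (simp add: powr_diff)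
      also have "real n powr p * h powr p = T powr p" unfolding powr_mult[symmetric] h(2) ..
      finally have eq: "real n powr (p - 1) * (\<Sum>j<n. h powr p * (C * h powr (p / 2))) = T powr p * (C * h powr (p / 2))" .
      have hp: "h powr (p / 2) = T powr (p / 2) * real n powr (- (p / 2))"
        by (simp add: h_def powr_divide powr_minus_divide)
      show "exp (L * T) powr p * (real n powr (p - 1) * (\<Sum>j<n. h powr p * (C * h powr (p / 2)))) \<le> C' * real n powr (- (p / 2))"
        unfolding eq unfolding hp C'_def by (simp only: mult.assoc order_refl)
      have ne: "{1..n} \<noteq> {}" using n by simp
      \<comment> \<open>Over a finite nonempty index set the supremum is a maximum, which yields its
        measurability.\<close>
      have Max: "(SUP l\<in>{1..n}. f l) = Max (f ` {1..n})" for f :: "nat \<Rightarrow> real" using ne by (intro cSup_eq_Max) auto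
      have Ym: "Y l \<in> borel_measurable M" if "l \<le> n" for l
        unfolding Y_def[abs_def] by (rule semi_implicit_EM_measurable[OF fin k_pos x0 T_pos n B_measurable bc that])
      show "(\<lambda>\<omega>. SUP l\<in>{1..n}. norm (X (\<tau> l) \<omega> - Y l \<omega>) powr p) \<in> borel_measurable M"
        unfolding Max
      proof (rule borel_measurable_Max)
        fix l assume "l \<in> {1..n}"
        hence l: "l \<le> n" by simp
        note [measurable] = Ym[OF l] X_measurable[OF \<tau>_in[OF l]]
        show "(\<lambda>\<omega>. norm (X (\<tau> l) \<omega> - Y l \<omega>) powr p) \<in> borel_measurable M" by measurable
      qed simp
      show "0 \<le> (SUP l\<in>{1..n}. norm (X (\<tau> l) \<omega> - Y l \<omega>) powr p)" for \<omega>
        unfolding Max using n by (intro order_trans[OF _ Max_ge[of _ "norm (X (\<tau> 1) \<omega> - Y 1 \<omega>) powr p"]]) auto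
      show "AE \<omega> in M. (SUP l\<in>{1..n}. norm (X (\<tau> l) \<omega> - Y l \<omega>) powr p) \<le> exp (L * T) powr p * (real n powr (p - 1) * (\<Sum>j<n. R j \<omega> powr p))"
        using V R_AE AE_X0
      proof eventually_elim
        case (elim \<omega>)
        show ?case
        proof (rule cSUP_least[OF ne])
          fix l assume "l \<in> {1..n}"
          hence l: "l \<le> n" by simp
          have "norm (X (\<tau> l) \<omega> - Y l \<omega>) powr p \<le> (exp (L * T) * (\<Sum>j<n. R j \<omega>)) powr p"
            using p by (intro powr_mono2 err[OF elim l]) auto
          also have "\<dots> = exp (L * T) powr p * (\<Sum>j<n. R j \<omega>) powr p" by (rule powr_mult)
          also have "\<dots> \<le> exp (L * T) powr p * (real (card {..<n}) powr (p - 1) * (\<Sum>j<n. R j \<omega> powr p))"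
            using R(2) p by (intro mult_left_mono powr_sum_le) auto
          finally show "norm (X (\<tau> l) \<omega> - Y l \<omega>) powr p \<le> exp (L * T) powr p * (real n powr (p - 1) * (\<Sum>j<n. R j \<omega> powr p))"
            by simp
        qed
      qed
    qed
    thus "mean_le (\<lambda>\<omega>. SUP l\<in>{1..n}. norm (X (real l * T / real n) \<omega> - semi_implicit_EM Rp k b T n x0 (\<lambda>t. B t \<omega>) l) powr p)
      (C' * real n powr (- (p / 2)))" unfolding \<tau>_def Y_def .
  qed
qed

end

theorem theorem4p2:
  fixes R Rp :: "(real ^ 'd) set"
    and k :: "real ^ 'd \<Rightarrow> real"
    and T p :: real
    and M :: "'a measure"
    and F :: "real \<Rightarrow> 'a measure"
    and B X :: "real \<Rightarrow> 'a \<Rightarrow> real ^ 'd"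
    and b :: "real \<Rightarrow> real ^ 'd \<Rightarrow> real ^ 'd"
    and x0 :: "real ^ 'd"
  assumes "root_system R"
    and "positive_root_system R Rp"
    and "Rp \<noteq> {}"
    and "multiplicity_function R k"
    and "(MIN \<alpha>\<in>Rp. mult_index k \<alpha>) \<ge> 3"
    and "T > 0"
    and "usual_filtration M F T"
    and "brownian_motion M F T B"
    and "bounded {b t x | t x. t \<in> {0..T} \<and> x \<in> weyl_chamber Rp}"
    and "lipschitz_holder_drift (weyl_chamber Rp) T b"
    and "x0 \<in> weyl_chamber Rp"
    and "radial_dunkl_process M F T B Rp k b x0 X"
    and "p \<ge> 1"
    and "p < (MIN \<alpha>\<in>Rp. mult_index k \<alpha>) / 3 \<or>
         (\<forall>t\<in>{0..T}. \<forall>x\<in>weyl_chamber Rp. b t x = 0) \<and>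
         p = (MIN \<alpha>\<in>Rp. mult_index k \<alpha>) / 3"
  shows "\<exists>C>0. \<forall>n::nat\<ge>1.
    integrable M (\<lambda>\<omega>. SUP l\<in>{1..n}.
      norm (X (real l * T / real n) \<omega>
        - semi_implicit_EM Rp k b T n x0 (\<lambda>t. B t \<omega>) l) powr p) \<and>
    (prob_space.expectation M (\<lambda>\<omega>. SUP l\<in>{1..n}.
      norm (X (real l * T / real n) \<omega>
        - semi_implicit_EM Rp k b T n x0 (\<lambda>t. B t \<omega>) l) powr p)) powr (1 / p)
      \<le> C / sqrt (real n)"
proof -
  define \<nu> where "\<nu> = (MIN \<alpha>\<in>Rp. mult_index k \<alpha>)"
  have fin: "finite Rp" using positive_rootsD[OF assms(1,2)] by blast
  obtain Kb where Kb: "\<And>t x. \<lbrakk>t \<in> {0..T}; x \<in> weyl_chamber Rp\<rbrakk> \<Longrightarrow> norm (b t x) \<le> Kb"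
    using assms(9) unfolding bounded_iff by blast
  have "\<nu> \<le> mult_index k \<alpha>" if "\<alpha> \<in> Rp" for \<alpha> unfolding \<nu>_def using fin that by (intro Min_le) auto
  hence k_ge: "\<forall>\<alpha>\<in>Rp. k \<alpha> \<ge> \<nu> + 1 / 2" by (force simp: mult_index_def)
  have \<nu>3: "\<nu> \<ge> 3" using assms(5) by (simp add: \<nu>_def)
  have "prob_space M" using assms(7) by (simp add: usual_filtration_def)
  then interpret dunkl_setup M F T B R Rp k b x0 X \<nu> Kb
    unfolding dunkl_setup_def brownian_setup_def brownian_setup_axioms_def dunkl_setup_axioms_def
    using assms(1,2,4,6-8,10-12) k_ge \<nu>3 Kb by auto
  \<comment> \<open>Both alternatives of the last hypothesis give \<open>3 * p \<le> \<nu>\<close>,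
    the range in which the inverse moments are available.\<close>
  have p: "p \<ge> 1" "3 * p \<le> \<nu>" using assms(13,14) by (auto simp: \<nu>_def)
  have \<nu>2: "\<nu> > 2" using \<nu>3 by simp
  obtain C where C: "C \<ge> 0"
    "\<And>n. n \<ge> 1 \<Longrightarrow> mean_le (\<lambda>\<omega>. SUP l\<in>{1..n}.
      norm (X (real l * T / real n) \<omega> - semi_implicit_EM Rp k b T n x0 (\<lambda>t. B t \<omega>) l) powr p)
      (C * real n powr (- (p / 2)))"
    by (rule scheme_error[OF \<nu>2 p]) blast
  show ?thesis
  \<comment> \<open>The added 1 makes the constant positive also when \<open>C\<close> is 0.\<close>
  proof (intro exI[of _ "C powr (1 / p) + 1"] conjI allI impI)
    show "C powr (1 / p) + 1 > 0" by (simp add: add_nonneg_pos)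
    fix n :: nat assume n: "n \<ge> 1"
    let ?f = "\<lambda>\<omega>. SUP l\<in>{1..n}. norm (X (real l * T / real n) \<omega> - semi_implicit_EM Rp k b T n x0 (\<lambda>t. B t \<omega>) l) powr p"
    note I = mean_le_integrable[OF C(2)[OF n]]
    show "integrable M ?f" by (rule I(1))
    have "expectation ?f powr (1 / p) \<le> (C * real n powr (- (p / 2))) powr (1 / p)"
      using p I(2,3) by (intro powr_mono2) auto
    also have "\<dots> = C powr (1 / p) * real n powr (- (1 / 2))"
      using p by (simp add: powr_mult powr_powr)
    also have "real n powr (- (1 / 2)) = 1 / sqrt (real n)"
      by (simp add: powr_minus_divide powr_half_sqrt)
    also have "C powr (1 / p) * (1 / sqrt (real n)) \<le> (C powr (1 / p) + 1) / sqrt (real n)"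
      by (simp add: divide_right_mono)
    finally show "expectation ?f powr (1 / p) \<le> (C powr (1 / p) + 1) / sqrt (real n)" .
  qed
qed

end
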